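(* Let $n \ge 2$ with $n \neq 6$, and let $X$ be an (unlabelled) character table of the alternating group $A_n$. Then there is a unique way to assign non-self-conjugate partitions of $n$ (taken up to conjugation $\lambda \leftrightarrow \lambda'$) to rows of $X$ and partitions of $n$ not having odd distinct parts to columns of $X$ so that $X_{\lambda\nu} = \chi^\lambda(\nu)$ for all such $\lambda$ and $\nu$; and the labels of the split characters and split conjugacy classes are uniquely determined up to signs. Precisely: if $(\alpha,\beta)$ and $(\alpha',\beta')$ are two labellings of $X$ (in the sense defined in the context), then for every row $i$ the labels $\alpha(i)$ and $\alpha'(i)$ are equal, or are $\lambda^+$ and $\lambda^-$ in some order for some self-conjugate partition $\lambda$; and for every column $j$ the labels $\beta(j)$ and $\beta'(j)$ are equal, or are $\nu^+$ and $\nu^-$ in some order for some partition $\nu$ with odd distinct parts.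
   Context: For a partition $\lambda$ of $n$, $\chi^\lambda$ denotes the ordinary irreducible character of $S_n$ canonically labelled by $\lambda$, and $\lambda'$ is the conjugate partition. Characters of $A_n$: the restriction of $\chi^\lambda$ to $A_n$ is reducible if and only if $\lambda=\lambda'$, in which case it is a sum of two distinct irreducible characters of $A_n$ (the split characters), labelled $\lambda^+$ and $\lambda^-$ in an arbitrarily chosen way. If $\lambda\neq\lambda'$, then $\chi^\lambda$ and $\chi^{\lambda'}$ have the same irreducible restriction to $A_n$, again denoted $\chi^\lambda$, so that $\lambda$ and $\lambda'$ are regarded as the same label. Classes of $A_n$: the $S_n$-class of even permutations of cycle type $\nu$ splits into two $A_n$-classes if and only if $\nu$ has odd distinct parts (all parts odd and pairwise different); the two classes (split classes) are labelled $\nu^+$ and $\nu^-$ in an arbitrarily chosen way. Otherwise it is a single $A_n$-class, labelled $\nu$. Only cycle types $\nu$ of even permutations occur. The arbitrary sign choices are fixed once and for all. An (unlabelled) character table of $A_n$ is a square complex matrix whose rows and columns are indexed by the irreducible characters and the conjugacy classes of $A_n$ respectively, each in some unspecified order, with entries the character values. A labelling of $X$ is a pair $(\alpha,\beta)$, where $\alpha$ is a bijection from the rows of $X$ to the set of labels of irreducible characters of $A_n$ and $\beta$ is a bijection from the columns of $X$ to the set of labels of conjugacy classes of $A_n$, such that every entry $X_{ij}$ equals the value of the character labelled $\alpha(i)$ on the class labelled $\beta(j)$. *)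

theory Defs
  imports
    "HOL-Algebra.Sym_Groups"
    "HOL-Algebra.Group_Action"
    "HOL-Combinatorics.Orbits"
    "Jordan_Normal_Form.VS_Connect"
begin

section \<open>Complex characters of finite groups\<close>

definition trace_mat :: "complex mat \<Rightarrow> complex" where
  "trace_mat A = (\<Sum>i<dim_row A. A $$ (i, i))"

definition representation ::
    "('a, 'm) monoid_scheme \<Rightarrow> nat \<Rightarrow> ('a \<Rightarrow> complex mat) \<Rightarrow> bool" where
  "representation G d \<rho> \<longleftrightarrow> \<rho> \<in> hom G (units_of (ring_mat TYPE(complex) d ()))"

definition irreducible_representation ::
    "('a, 'm) monoid_scheme \<Rightarrow> nat \<Rightarrow> ('a \<Rightarrow> complex mat) \<Rightarrow> bool" where
  "irreducible_representation G d \<rho> \<longleftrightarrow>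
     representation G d \<rho> \<and> d > 0 \<and>
     (\<forall>W. VectorSpace.subspace class_ring W (module_vec TYPE(complex) d) \<longrightarrow>
          (\<forall>g\<in>carrier G. \<forall>w\<in>W. \<rho> g *\<^sub>v w \<in> W) \<longrightarrow>
          W = {0\<^sub>v d} \<or> W = carrier_vec d)"

text \<open>Characters are extensional functions (\<open>undefined\<close> outside the carrier), so that
  equality of characters is equality of functions.\<close>

definition irr_chars :: "('a, 'm) monoid_scheme \<Rightarrow> ('a \<Rightarrow> complex) set" where
  "irr_chars G =
     {(\<lambda>g\<in>carrier G. trace_mat (\<rho> g)) | d \<rho>. irreducible_representation G d \<rho>}"

definition conj_classes :: "('a, 'm) monoid_scheme \<Rightarrow> 'a set set" where
  "conj_classes G = orbits G (carrier G) (\<lambda>x g. x \<otimes>\<^bsub>G\<^esub> g \<otimes>\<^bsub>G\<^esub> inv\<^bsub>G\<^esub> x)"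

definition character_table :: "('a, 'm) monoid_scheme \<Rightarrow> complex mat \<Rightarrow> bool" where
  "character_table G X \<longleftrightarrow> square_mat X \<and>
     (\<exists>r c. bij_betw r {..<dim_row X} (irr_chars G) \<and>
            bij_betw c {..<dim_col X} (conj_classes G) \<and>
            (\<forall>i<dim_row X. \<forall>j<dim_col X. \<forall>g\<in>c j. X $$ (i, j) = r i g))"

definition char_inner ::
    "('a, 'm) monoid_scheme \<Rightarrow> ('a \<Rightarrow> complex) \<Rightarrow> ('a \<Rightarrow> complex) \<Rightarrow> complex" where
  "char_inner G \<phi> \<psi> = (\<Sum>g\<in>carrier G. \<phi> g * cnj (\<psi> g)) / of_nat (Coset.order G)"

definition induced_char ::
    "('a, 'm) monoid_scheme \<Rightarrow> 'a set \<Rightarrow> ('a \<Rightarrow> complex) \<Rightarrow> 'a \<Rightarrow> complex" where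
  "induced_char G H \<phi> g =
     (\<Sum>x \<in> {x \<in> carrier G. inv\<^bsub>G\<^esub> x \<otimes>\<^bsub>G\<^esub> g \<otimes>\<^bsub>G\<^esub> x \<in> H}.
        \<phi> (inv\<^bsub>G\<^esub> x \<otimes>\<^bsub>G\<^esub> g \<otimes>\<^bsub>G\<^esub> x)) / of_nat (card H)"

section \<open>Partitions and the characters of the symmetric group\<close>

text \<open>A partition of \<open>n\<close> is the multiset of its (positive) parts.\<close>

definition partitions_of :: "nat \<Rightarrow> nat multiset set" where
  "partitions_of n = {p. 0 \<notin># p \<and> sum_mset p = n}"

definition conj_partition :: "nat multiset \<Rightarrow> nat multiset" where
  "conj_partition p =
     {#k \<in># image_mset (\<lambda>i. size {#a \<in># p. i \<le> a#}) (mset_set {1..sum_mset p}). k > 0#}"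

text \<open>The \<open>i\<close>-th block of the standard Young subgroup: \<open>{1..n}\<close> is cut into consecutive
  intervals whose lengths are the parts in decreasing order.\<close>

definition young_block :: "nat multiset \<Rightarrow> nat \<Rightarrow> nat set" where
  "young_block p i =
     (let ps = rev (sorted_list_of_multiset p)
      in {sum_list (take i ps) <.. sum_list (take (Suc i) ps)})"

definition young_subgroup :: "nat \<Rightarrow> nat multiset \<Rightarrow> (nat \<Rightarrow> nat) set" where
  "young_subgroup n p =
     {\<sigma> \<in> carrier (sym_group n). \<forall>i<size p. \<sigma> ` young_block p i = young_block p i}"

text \<open>The canonical labelling, as in James and Kerber, \<^emph>\<open>The Representation Theory of the
  Symmetric Group\<close>, Section 2.1: the character labelled by a partition \<open>p\<close> is the unique common
  irreducible constituent of the trivial character of the Young subgroup of \<open>p\<close> and the sign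
  character of the Young subgroup of the conjugate partition, both induced to \<open>S\<^sub>n\<close>. In
  particular \<open>{#n#}\<close> labels the trivial character.\<close>

definition sym_char :: "nat \<Rightarrow> nat multiset \<Rightarrow> (nat \<Rightarrow> nat) \<Rightarrow> complex" where
  "sym_char n p = (THE \<chi>. \<chi> \<in> irr_chars (sym_group n) \<and>
     char_inner (sym_group n) \<chi>
       (induced_char (sym_group n) (young_subgroup n p) (\<lambda>_. 1)) \<noteq> 0 \<and>
     char_inner (sym_group n) \<chi>
       (induced_char (sym_group n) (young_subgroup n (conj_partition p))
          (\<lambda>\<sigma>. of_int (sign \<sigma>))) \<noteq> 0)"

definition sym_char_alt :: "nat \<Rightarrow> nat multiset \<Rightarrow> (nat \<Rightarrow> nat) \<Rightarrow> complex" where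
  "sym_char_alt n p = restrict (sym_char n p) (carrier (alt_group n))"

text \<open>Fixed points count as cycles of length 1, so the cycle type is a partition of \<open>n\<close>.\<close>

definition cycle_type :: "nat \<Rightarrow> (nat \<Rightarrow> nat) \<Rightarrow> nat multiset" where
  "cycle_type n \<sigma> = image_mset card (mset_set (Orbits.orbit \<sigma> ` {1..n}))"

definition even_perms_of_type :: "nat \<Rightarrow> nat multiset \<Rightarrow> (nat \<Rightarrow> nat) set" where
  "even_perms_of_type n v = {\<sigma> \<in> carrier (alt_group n). cycle_type n \<sigma> = v}"

definition odd_distinct :: "nat multiset \<Rightarrow> bool" where
  "odd_distinct v \<longleftrightarrow> (\<forall>k\<in>#v. odd k \<and> count v k = 1)"

section \<open>Labels for the characters and classes of the alternating group\<close>

datatype pm = Plus | Minus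

text \<open>A non-split character is labelled by the unordered pair \<open>{p, p'}\<close> of a partition and its
  conjugate.\<close>

datatype char_label =
    Nonsplit_Char "nat multiset set"
  | Split_Char "nat multiset" pm

datatype class_label =
    Nonsplit_Class "nat multiset"
  | Split_Class "nat multiset" pm

definition char_labels :: "nat \<Rightarrow> char_label set" where
  "char_labels n =
     {Nonsplit_Char {p, conj_partition p} | p. p \<in> partitions_of n \<and> conj_partition p \<noteq> p} \<union>
     {Split_Char p s | p s. p \<in> partitions_of n \<and> conj_partition p = p}"

definition class_labels :: "nat \<Rightarrow> class_label set" where
  "class_labels n =
     {Nonsplit_Class v | v. v \<in> partitions_of n \<and> \<not> odd_distinct v \<and> even_perms_of_type n v \<noteq> {}} \<union>
     {Split_Class v s | v s. v \<in> partitions_of n \<and> odd_distinct v}"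

text \<open>The arbitrary sign choices are parameters: \<open>sc p s\<close> is the split character labelled by
  \<open>p\<close> with sign \<open>s\<close>, and \<open>cc v s\<close> is the split class labelled by \<open>v\<close> with sign \<open>s\<close>.\<close>

definition split_char_choice ::
    "nat \<Rightarrow> (nat multiset \<Rightarrow> pm \<Rightarrow> (nat \<Rightarrow> nat) \<Rightarrow> complex) \<Rightarrow> bool" where
  "split_char_choice n sc \<longleftrightarrow>
     (\<forall>p\<in>partitions_of n. conj_partition p = p \<longrightarrow>
        sc p Plus \<in> irr_chars (alt_group n) \<and> sc p Minus \<in> irr_chars (alt_group n) \<and>
        sc p Plus \<noteq> sc p Minus \<and>
        (\<forall>g\<in>carrier (alt_group n). sym_char_alt n p g = sc p Plus g + sc p Minus g))"

definition split_class_choice ::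
    "nat \<Rightarrow> (nat multiset \<Rightarrow> pm \<Rightarrow> (nat \<Rightarrow> nat) set) \<Rightarrow> bool" where
  "split_class_choice n cc \<longleftrightarrow>
     (\<forall>v\<in>partitions_of n. odd_distinct v \<longrightarrow>
        cc v Plus \<in> conj_classes (alt_group n) \<and> cc v Minus \<in> conj_classes (alt_group n) \<and>
        cc v Plus \<noteq> cc v Minus \<and>
        even_perms_of_type n v = cc v Plus \<union> cc v Minus)"

text \<open>A non-split label \<open>{p, p'}\<close> has two descriptions of the same character, as the restriction
  of the character of \<open>p\<close> or of \<open>p'\<close>; both are collected, so that a labelling below has to agree
  with each of them.\<close>

fun chars_labelled ::
    "nat \<Rightarrow> (nat multiset \<Rightarrow> pm \<Rightarrow> (nat \<Rightarrow> nat) \<Rightarrow> complex) \<Rightarrow> char_label \<Rightarrow>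
     ((nat \<Rightarrow> nat) \<Rightarrow> complex) set" where
  "chars_labelled n sc (Nonsplit_Char P) = sym_char_alt n ` P"
| "chars_labelled n sc (Split_Char p s) = {sc p s}"

fun class_labelled ::
    "nat \<Rightarrow> (nat multiset \<Rightarrow> pm \<Rightarrow> (nat \<Rightarrow> nat) set) \<Rightarrow> class_label \<Rightarrow> (nat \<Rightarrow> nat) set" where
  "class_labelled n cc (Nonsplit_Class v) = even_perms_of_type n v"
| "class_labelled n cc (Split_Class v s) = cc v s"

definition labelling ::
    "nat \<Rightarrow> (nat multiset \<Rightarrow> pm \<Rightarrow> (nat \<Rightarrow> nat) \<Rightarrow> complex) \<Rightarrow>
     (nat multiset \<Rightarrow> pm \<Rightarrow> (nat \<Rightarrow> nat) set) \<Rightarrow> complex mat \<Rightarrow>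
     (nat \<Rightarrow> char_label) \<Rightarrow> (nat \<Rightarrow> class_label) \<Rightarrow> bool" where
  "labelling n sc cc X \<alpha> \<beta> \<longleftrightarrow>
     bij_betw \<alpha> {..<dim_row X} (char_labels n) \<and>
     bij_betw \<beta> {..<dim_col X} (class_labels n) \<and>
     (\<forall>i<dim_row X. \<forall>j<dim_col X.
        \<forall>\<chi>\<in>chars_labelled n sc (\<alpha> i). \<forall>g\<in>class_labelled n cc (\<beta> j). X $$ (i, j) = \<chi> g)"

end

theory Submission
  imports Defs "Jordan_Normal_Form.Schur_Decomposition" "Jordan_Normal_Form.Spectral_Radius"
    "HOL-Algebra.Multiplicative_Group"
begin

text \<open>Mackey's formula and the dominance order show that the trivial character of the Young subgroup
  of \<open>p\<close> and the sign character of the Young subgroup of \<open>p'\<close>, both induced to \<open>S\<^sub>n\<close>, share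
  exactly one irreducible constituent; restricting to \<open>A\<^sub>n\<close> and counting classes yields a
  labelling.

  Two labellings give a correspondence \<open>g \<sim> h\<close> between the classes of \<open>A\<^sub>n\<close> under which
  the irreducible characters take the same values up to a permutation of the characters. It
  preserves class sizes and the structure constants of the class algebra. Let \<open>\<chi>(g)\<close> be the
  number of fixed points of \<open>g\<close> minus 1. If a 3-cycle corresponds to an element that moves \<open>m\<close>
  points, then restricting the partner of \<open>\<chi>\<close> to a subgroup of order 3 shows that 3 divides
  \<open>m\<close>, and a subgroup of order 2 rules out involutions. If \<open>m \<ge> 6\<close>, so that \<open>n \<ge> 7\<close> as \<open>n
  \<noteq> 6\<close>, the centralizer of such an element is too small; so 3-cycles correspond to 3-cycles.
  The partner of \<open>\<chi>\<close> then has degree \<open>n - 1\<close> and the value \<open>n - 4\<close> at 3-cycles, and is afforded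
  by a representation in which every 3-cycle fixes a subspace of codimension 2. Hence
  \<open>A\<^sub>n\<^sub>-\<^sub>1\<close> fixes a nonzero vector, so the partner is \<open>\<chi>\<close> itself, and
  \<open>\<sim>\<close> preserves numbers of fixed points. Since a product \<open>t g\<close> with a 3-cycle \<open>t\<close> has 3 or 2
  more fixed points than \<open>g\<close> just when \<open>t\<close> removes a 3-cycle of \<open>g\<close> or shortens a longer cycle by 2,
  the structure constants determine the number of cycles of each length inductively. So \<open>\<sim>\<close>
  preserves cycle types, on which the non-split characters and the sums \<open>\<lambda>\<^sup>+ +
  \<lambda>\<^sup>-\<close> of split ones depend.\<close>

section \<open>Linear algebra\<close>

text \<open>A correspondence of tables need not come from an automorphism of the group, so only
  quantities expressible by character values can be transferred; the integrality of multiplicities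
  in restrictions to small subgroups supplies the congruences. The case n = 6 is a genuine
  exception: an outer automorphism of A_6 exchanges the 3-cycles with the products of two disjoint
  3-cycles, both classes having 40 elements, and the size comparison fails exactly there. The
  partner of \<open>\<chi>\<close> is recognized without a classification of characters of small
  degree, but the linear algebra has no slack: in dimension n - 1 at most n - 2 linear conditions
  may be spent on A_(n-1). For odd n - 1 the group A_3 costs two conditions and every further
  3-cycle costs two for two new points, which is just enough. For even n - 1 a start from A_4,
  generated by two 3-cycles, would cost four conditions, one too many; comparing the fixed spaces of
  the Klein four-group and of A_4 lowers this to three.\<close>

lemma subspace_vec_iff:
  "VectorSpace.subspace class_ring W (module_vec TYPE(complex) d) \<longleftrightarrow>
     W \<subseteq> carrier_vec d \<and> 0\<^sub>v d \<in> W \<and> (\<forall>v\<in>W. \<forall>w\<in>W. v + w \<in> W) \<and> (\<forall>c. \<forall>v\<in>W. c \<cdot>\<^sub>v v \<in> W)"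
proof -
  have "vectorspace class_ring (module_vec TYPE(complex) d)"
    by (rule vec_vs)
  moreover have "Module.module class_ring (module_vec TYPE(complex) d)"
    by (rule vec_module)
  ultimately show ?thesis
    unfolding VectorSpace.subspace_def submodule_def
    by (auto simp: module_vec_simps class_ring_simps)
qed

text \<open>Padding with zero rows gives a square matrix whose last row vanishes; it is singular,
  and each of its kernel vectors is one of \<open>A\<close>.\<close>

lemma wide_matrix_kernel:
  fixes A :: "complex mat"
  assumes A: "A \<in> carrier_mat r d" and rd: "r < d"
  shows "\<exists>v\<in>carrier_vec d. v \<noteq> 0\<^sub>v d \<and> A *\<^sub>v v = 0\<^sub>v r"
proof -
  define B where "B = mat d d (\<lambda>(i, j). if i < r then A $$ (i, j) else 0)"
  have B: "B \<in> carrier_mat d d" by (simp add: B_def)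
  have "B\<^sup>T *\<^sub>v unit_vec d (d - 1) = 0\<^sub>v d"
    using rd B by (intro eq_vecI) (auto simp: B_def)
  moreover have "unit_vec d (d - 1) \<noteq> (0\<^sub>v d :: complex vec)"
    using rd by (metis One_nat_def diff_less index_unit_vec(2) index_zero_vec(1) less_nat_zero_code neq0_conv zero_less_Suc zero_neq_one)
  ultimately have "det B\<^sup>T = 0"
    using B by (subst det_0_iff_vec_prod_zero[of _ d]) (auto intro!: exI[of _ "unit_vec d (d - 1)"])
  then have "det B = 0"
    using det_transpose[OF B] by simp
  then obtain v where v: "v \<in> carrier_vec d" "v \<noteq> 0\<^sub>v d" "B *\<^sub>v v = 0\<^sub>v d"
    using det_0_iff_vec_prod_zero[OF B] by auto
  have "A *\<^sub>v v = 0\<^sub>v r"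
  proof (rule eq_vecI)
    fix i assume "i < dim_vec (0\<^sub>v r :: complex vec)"
    then have i: "i < r" by simp
    have "row A i = row B i" using i rd A by (intro eq_vecI) (auto simp: B_def row_def)
    then have "(A *\<^sub>v v) $ i = (B *\<^sub>v v) $ i" using i rd A by (auto simp: B_def)
    also have "\<dots> = 0" using v(3) i rd by simp
    finally show "(A *\<^sub>v v) $ i = 0\<^sub>v r $ i" using i by simp
  qed (use A in auto)
  with v show ?thesis by blast
qed

lemma trace_mat_comm:
  assumes "A \<in> carrier_mat n m" "B \<in> carrier_mat m n"
  shows "trace_mat (A * B) = trace_mat (B * A)"
proof -
  have "trace_mat (A * B) = (\<Sum>i<n. \<Sum>k<m. A $$ (i, k) * B $$ (k, i))"
    using assms by (auto simp: trace_mat_def scalar_prod_def atLeast0LessThan intro!: sum.cong)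
  also have "\<dots> = (\<Sum>k<m. \<Sum>i<n. B $$ (k, i) * A $$ (i, k))"
    by (subst sum.swap) (simp add: mult.commute)
  also have "\<dots> = trace_mat (B * A)"
    using assms by (auto simp: trace_mat_def scalar_prod_def atLeast0LessThan intro!: sum.cong)
  finally show ?thesis .
qed

lemma trace_mat_add:
  assumes "A \<in> carrier_mat n n" "B \<in> carrier_mat n n"
  shows "trace_mat (A + B) = trace_mat A + trace_mat B"
  using assms by (auto simp: trace_mat_def sum.distrib)

lemma trace_mat_one [simp]: "trace_mat (1\<^sub>m n) = of_nat n"
  by (simp add: trace_mat_def)

lemma trace_mat_smult:
  assumes "A \<in> carrier_mat n n"
  shows "trace_mat (c \<cdot>\<^sub>m A) = c * trace_mat A"
  using assms by (auto simp: trace_mat_def sum_distrib_left)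

lemma trace_mat_minus:
  assumes "A \<in> carrier_mat n n" "B \<in> carrier_mat n n"
  shows "trace_mat (A - B) = trace_mat A - trace_mat B"
  using assms by (auto simp: trace_mat_def sum_subtractf)

lemma left_inverse_dim_le:
  fixes C :: "complex mat"
  assumes "C \<in> carrier_mat d k" "U \<in> carrier_mat k d" "U * C = 1\<^sub>m k"
  shows "k \<le> d"
proof (rule ccontr)
  assume "\<not> k \<le> d"
  then obtain v where v: "v \<in> carrier_vec k" "v \<noteq> 0\<^sub>v k" "C *\<^sub>v v = 0\<^sub>v d"
    using wide_matrix_kernel[of C d k] assms(1) by auto
  have "v = (U * C) *\<^sub>v v" using assms(3) v by simp
  also have "\<dots> = U *\<^sub>v (C *\<^sub>v v)" using assms v by (intro assoc_mult_mat_vec) auto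
  also have "\<dots> = 0\<^sub>v k" using v assms by (auto intro!: eq_vecI)
  finally show False using v by simp
qed

text \<open>A subspace is the image of a matrix with a left inverse. Among all pairs \<open>(C, U)\<close> with
  \<open>U C = 1\<close> and the columns of \<open>C\<close> in \<open>W\<close>, one with the most columns spans \<open>W\<close>.\<close>

lemma subspace_split:
  assumes W: "VectorSpace.subspace class_ring W (module_vec TYPE(complex) d)"
  obtains k C U where "C \<in> carrier_mat d k" "U \<in> carrier_mat k d" "U * C = 1\<^sub>m k"
    "W = {C *\<^sub>v v | v. v \<in> carrier_vec k}"
proof -
  have W1: "W \<subseteq> carrier_vec d" and W0: "0\<^sub>v d \<in> W"
    and Wa: "\<And>v w. v \<in> W \<Longrightarrow> w \<in> W \<Longrightarrow> v + w \<in> W"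
    and Ws: "\<And>c v. v \<in> W \<Longrightarrow> c \<cdot>\<^sub>v v \<in> W"
    using W by (auto simp: subspace_vec_iff)
  define P where "P k \<longleftrightarrow> (\<exists>C U. C \<in> carrier_mat d k \<and> U \<in> carrier_mat k d \<and> U * C = 1\<^sub>m k
     \<and> {C *\<^sub>v v | v. v \<in> carrier_vec k} \<subseteq> W)" for k
  have P0: "P 0"
  proof -
    have "{(0\<^sub>m d 0 :: complex mat) *\<^sub>v v | v. v \<in> carrier_vec 0} \<subseteq> W"
    proof safe
      fix v :: "complex vec" assume "v \<in> carrier_vec 0"
      then have "(0\<^sub>m d 0 :: complex mat) *\<^sub>v v = 0\<^sub>v d" by (intro eq_vecI) (auto simp: scalar_prod_def)
      then show "(0\<^sub>m d 0 :: complex mat) *\<^sub>v v \<in> W" using W0 by simp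
    qed
    then show ?thesis unfolding P_def
      by (intro exI[of _ "0\<^sub>m d 0"] exI[of _ "0\<^sub>m 0 d"]) auto
  qed
  have bound: "k \<le> d" if "P k" for k
    using that unfolding P_def by (auto dest: left_inverse_dim_le)
  obtain k where k: "P k" and kmax: "\<not> P (Suc k)"
    using P0 bound by (metis Suc_n_not_le_n nat_induct)
  then obtain C U where C: "C \<in> carrier_mat d k" and U: "U \<in> carrier_mat k d"
    and UC: "U * C = 1\<^sub>m k" and sub: "{C *\<^sub>v v | v. v \<in> carrier_vec k} \<subseteq> W"
    unfolding P_def by auto
  have "w \<in> {C *\<^sub>v v | v. v \<in> carrier_vec k}" if w: "w \<in> W" for w
  proof (rule ccontr)
    assume out: "\<not> ?thesis"
    have wd: "w \<in> carrier_vec d" using w W1 by auto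
    \<comment> \<open>The component of \<open>w\<close> in the kernel of \<open>U\<close>; it is
      nonzero because \<open>w\<close> is outside the image of \<open>C\<close>, and it becomes the
      additional column.\<close>
    define y where "y = w - C *\<^sub>v (U *\<^sub>v w)"
    have CUw: "C *\<^sub>v (U *\<^sub>v w) \<in> W"
      using sub mult_mat_vec_carrier[OF U wd] by blast
    have yd: "y \<in> carrier_vec d" using wd C U by (auto simp: y_def)
    have "y = w + (-1) \<cdot>\<^sub>v (C *\<^sub>v (U *\<^sub>v w))"
      using wd C U by (intro eq_vecI) (auto simp: y_def)
    then have yW: "y \<in> W" using Wa[OF w Ws[OF CUw]] by simp
    have "y \<noteq> 0\<^sub>v d"
    proof
      assume "y = 0\<^sub>v d"
      then have "w = C *\<^sub>v (U *\<^sub>v w)"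
        using wd C U by (intro eq_vecI) (auto simp: y_def vec_eq_iff)
      then show False using out U wd by auto
    qed
    then obtain i where i: "i < d" "y $ i \<noteq> 0" using yd by (metis carrier_vecD eq_vecI index_zero_vec)
    have Uy: "U *\<^sub>v y = 0\<^sub>v k"
    proof -
      have "U *\<^sub>v y = U *\<^sub>v w - U *\<^sub>v (C *\<^sub>v (U *\<^sub>v w))"
        unfolding y_def using wd C U by (intro mult_minus_distrib_mat_vec) auto
      also have "U *\<^sub>v (C *\<^sub>v (U *\<^sub>v w)) = (U * C) *\<^sub>v (U *\<^sub>v w)"
        using wd C U by (intro assoc_mult_mat_vec[symmetric, of _ k d _ k]) auto
      also have "U *\<^sub>v w - \<dots> = 0\<^sub>v k" using UC U wd by auto
      finally show ?thesis .
    qed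
    \<comment> \<open>The additional row of the left inverse: row \<open>i\<close> of
      \<open>1 - C * U\<close>, which vanishes on the columns of \<open>C\<close> and takes the
      value \<open>y $ i\<close> on \<open>y\<close> because \<open>U\<close> kills
      \<open>y\<close>; division by the nonzero \<open>y $ i\<close> normalizes it.\<close>
    define u where "u j = ((if j = i then 1 else 0) - (\<Sum>l<k. C $$ (i, l) * U $$ (l, j))) / y $ i" for j
    define C' where "C' = mat d (Suc k) (\<lambda>(r, c). if c < k then C $$ (r, c) else y $ r)"
    define U' where "U' = mat (Suc k) d (\<lambda>(r, c). if r < k then U $$ (r, c) else u c)"
    have UCe: "(\<Sum>j<d. U $$ (r, j) * C $$ (j, c)) = (if r = c then 1 else 0)" if "r < k" "c < k" for r c
    proof -
      have "(U * C) $$ (r, c) = (\<Sum>j<d. U $$ (r, j) * C $$ (j, c))"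
        using that U C by (simp add: scalar_prod_def atLeast0LessThan)
      then show ?thesis using UC that by simp
    qed
    have Uye: "(\<Sum>j<d. U $$ (r, j) * y $ j) = 0" if "r < k" for r
    proof -
      have "(U *\<^sub>v y) $ r = (\<Sum>j<d. U $$ (r, j) * y $ j)"
        using that U yd by (simp add: scalar_prod_def atLeast0LessThan)
      then show ?thesis using Uy that by simp
    qed
    have uC: "(\<Sum>j<d. u j * C $$ (j, c)) = 0" if "c < k" for c
    proof -
      have "(\<Sum>j<d. u j * C $$ (j, c)) = (\<Sum>j<d. ((if j = i then C $$ (j, c) else 0)
          - (\<Sum>l<k. C $$ (i, l) * (U $$ (l, j) * C $$ (j, c))))) / y $ i"
        unfolding u_def sum_divide_distrib
        by (intro sum.cong) (auto simp: field_simps sum_distrib_left sum_distrib_right)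
      also have "(\<Sum>j<d. ((if j = i then C $$ (j, c) else 0)
          - (\<Sum>l<k. C $$ (i, l) * (U $$ (l, j) * C $$ (j, c)))))
         = C $$ (i, c) - (\<Sum>l<k. C $$ (i, l) * (\<Sum>j<d. U $$ (l, j) * C $$ (j, c)))"
        using i by (simp add: sum_subtractf sum_distrib_left sum.swap[of _ "{..<k}"])
      also have "(\<Sum>l<k. C $$ (i, l) * (\<Sum>j<d. U $$ (l, j) * C $$ (j, c))) = (\<Sum>l<k. if l = c then C $$ (i, l) else 0)"
        by (intro sum.cong) (auto simp: UCe that)
      also have "\<dots> = C $$ (i, c)" using that by simp
      finally show ?thesis by simp
    qed
    have uy: "(\<Sum>j<d. u j * y $ j) = 1"
    proof -
      have "(\<Sum>j<d. u j * y $ j) = (\<Sum>j<d. ((if j = i then y $ j else 0)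
          - (\<Sum>l<k. C $$ (i, l) * (U $$ (l, j) * y $ j)))) / y $ i"
        unfolding u_def sum_divide_distrib
        by (intro sum.cong) (auto simp: field_simps sum_distrib_left sum_distrib_right)
      also have "(\<Sum>j<d. ((if j = i then y $ j else 0)
          - (\<Sum>l<k. C $$ (i, l) * (U $$ (l, j) * y $ j))))
         = y $ i - (\<Sum>l<k. C $$ (i, l) * (\<Sum>j<d. U $$ (l, j) * y $ j))"
        using i by (simp add: sum_subtractf sum_distrib_left sum.swap[of _ "{..<k}"])
      also have "\<dots> = y $ i" by (simp add: Uye)
      finally show ?thesis using i by simp
    qed
    have C': "C' \<in> carrier_mat d (Suc k)" and U': "U' \<in> carrier_mat (Suc k) d"
      by (auto simp: C'_def U'_def)
    have "U' * C' = 1\<^sub>m (Suc k)"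
    proof (rule eq_matI)
      fix r c assume "r < dim_row (1\<^sub>m (Suc k) :: complex mat)" "c < dim_col (1\<^sub>m (Suc k) :: complex mat)"
      then have rc: "r < Suc k" "c < Suc k" by auto
      have "(U' * C') $$ (r, c) = (\<Sum>j<d. U' $$ (r, j) * C' $$ (j, c))"
        using rc U' C' by (simp add: scalar_prod_def atLeast0LessThan)
      also have "\<dots> = (if r = c then 1 else 0)"
        using rc by (cases "r < k"; cases "c < k") (auto simp: U'_def C'_def UCe Uye uC uy less_Suc_eq)
      finally show "(U' * C') $$ (r, c) = 1\<^sub>m (Suc k) $$ (r, c)" using rc by simp
    qed (use U' C' in auto)
    moreover have "C' *\<^sub>v v \<in> W" if v: "v \<in> carrier_vec (Suc k)" for v
    proof -
      have "C' *\<^sub>v v = C *\<^sub>v vec k (\<lambda>j. v $ j) + v $ k \<cdot>\<^sub>v y"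
        using C v yd by (intro eq_vecI) (auto simp: C'_def scalar_prod_def)
      moreover have "C *\<^sub>v vec k (\<lambda>j. v $ j) \<in> W" using sub vec_carrier by blast
      ultimately show ?thesis using Wa[OF _ Ws[OF yW]] by simp
    qed
    ultimately have "P (Suc k)" unfolding P_def using C' U' by blast
    then show False using kmax by simp
  qed
  then have "W = {C *\<^sub>v v | v. v \<in> carrier_vec k}" using sub by blast
  then show ?thesis using that C U UC by blast
qed

lemma left_inverse_inject:
  fixes C :: "complex mat"
  assumes "C \<in> carrier_mat d k" "U \<in> carrier_mat k d" "U * C = 1\<^sub>m k"
    "A \<in> carrier_mat k n" "B \<in> carrier_mat k n" "C * A = C * B"
  shows "A = B"
proof -
  have "A = (U * C) * A" using assms by simp
  also have "\<dots> = U * (C * A)" using assms by (intro assoc_mult_mat) auto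
  also have "\<dots> = U * (C * B)" using assms by simp
  also have "\<dots> = (U * C) * B" using assms by (intro assoc_mult_mat[symmetric]) auto
  also have "\<dots> = B" using assms by simp
  finally show ?thesis .
qed

lemma image_factor:
  fixes C :: "complex mat"
  assumes C: "C \<in> carrier_mat d k" and A: "A \<in> carrier_mat d n"
    and im: "\<And>v. v \<in> carrier_vec n \<Longrightarrow> A *\<^sub>v v \<in> {C *\<^sub>v w | w. w \<in> carrier_vec k}"
  obtains X where "X \<in> carrier_mat k n" "A = C * X"
proof -
  have "\<exists>w. w \<in> carrier_vec k \<and> A *\<^sub>v unit_vec n j = C *\<^sub>v w" for j
    using im[of "unit_vec n j"] by auto
  then obtain w where w: "\<And>j. w j \<in> carrier_vec k" "\<And>j. A *\<^sub>v unit_vec n j = C *\<^sub>v w j" by metis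
  define X where "X = mat k n (\<lambda>(i, j). w j $ i)"
  have "A = C * X"
  proof (rule eq_matI)
    fix i j assume "i < dim_row (C * X)" "j < dim_col (C * X)"
    then have ij: "i < d" "j < n" using C by (auto simp: X_def)
    have "A $$ (i, j) = (A *\<^sub>v unit_vec n j) $ i" using ij A by simp
    also have "\<dots> = (C *\<^sub>v w j) $ i" using w by simp
    also have "\<dots> = (C * X) $$ (i, j)" using ij C w(1)[of j]
      by (auto simp: X_def scalar_prod_def)
    finally show "A $$ (i, j) = (C * X) $$ (i, j)" .
  qed (use A C in \<open>auto simp: X_def\<close>)
  then show ?thesis using that[of X] by (auto simp: X_def)
qed

text \<open>\<open>Q\<close> is the identity on its image, so \<open>Q * C = C\<close>; writing
  \<open>Q = C * X\<close> and cancelling \<open>C\<close> gives \<open>X * C = 1\<close>. Cyclicity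
  of the trace turns the trace into the rank \<open>k\<close>, and so dimensions of fixed spaces can
  be read off from character sums.\<close>

lemma idempotent_factor:
  fixes Q :: "complex mat"
  assumes Q: "Q \<in> carrier_mat d d" and QQ: "Q * Q = Q"
  obtains k C U where "C \<in> carrier_mat d k" "U \<in> carrier_mat k d" "U * C = 1\<^sub>m k" "Q = C * U"
    "trace_mat Q = of_nat k"
proof -
  define W where "W = {Q *\<^sub>v v | v. v \<in> carrier_vec d}"
  have "VectorSpace.subspace class_ring W (module_vec TYPE(complex) d)"
    unfolding subspace_vec_iff W_def
  proof (safe, goal_cases)
    case (1 x v) then show ?case using Q by auto
  next
    case 2
    then show ?case using Q by (intro exI[of _ "0\<^sub>v d"]) (auto intro!: eq_vecI)
  next
    case (3 v w va vaa)
    then show ?case using Q by (intro exI[of _ "va + vaa"]) (auto simp: mult_add_distrib_mat_vec)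
  next
    case (4 c v va)
    then show ?case using Q by (intro exI[of _ "c \<cdot>\<^sub>v va"]) (auto simp: mult_mat_vec)
  qed
  then obtain k C U where C: "C \<in> carrier_mat d k" and U: "U \<in> carrier_mat k d"
    and UC: "U * C = 1\<^sub>m k" and im: "W = {C *\<^sub>v v | v. v \<in> carrier_vec k}"
    by (rule subspace_split)
  obtain X where X: "X \<in> carrier_mat k d" and QX: "Q = C * X"
    by (rule image_factor[OF C Q]) (use im W_def in blast)
  obtain Y where Y: "Y \<in> carrier_mat d k" and CY: "C = Q * Y"
    by (rule image_factor[OF Q C]) (use im W_def in blast)
  have "Q * C = Q * (Q * Y)" using CY by simp
  also have "\<dots> = (Q * Q) * Y" using Q Y by (intro assoc_mult_mat[symmetric]) auto
  also have "\<dots> = C" using QQ CY by simp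
  finally have QC: "Q * C = C" .
  have "C * (X * C) = C * 1\<^sub>m k"
    using QC C X unfolding QX by (simp add: assoc_mult_mat[of _ d k _ d])
  then have XC: "X * C = 1\<^sub>m k"
    using left_inverse_inject[OF C U UC, of "X * C" k "1\<^sub>m k"] X C by auto
  have "trace_mat Q = of_nat k"
    unfolding QX using trace_mat_comm[OF C X] XC by simp
  then show ?thesis using that[OF C X XC QX] by blast
qed

section \<open>Characters of a finite group\<close>

lemma upper_triangular_pow_diag:
  fixes B :: "complex mat"
  assumes B: "B \<in> carrier_mat d d" "upper_triangular B"
  shows "upper_triangular (B ^\<^sub>m k) \<and> (\<forall>i<d. (B ^\<^sub>m k) $$ (i, i) = (B $$ (i, i)) ^ k)"
proof (induction k)
  case 0
  show ?case using B by (auto simp: upper_triangular_def)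
next
  case (Suc k)
  let ?A = "B ^\<^sub>m k"
  have A: "?A \<in> carrier_mat d d" using B by simp
  have Az: "?A $$ (i, j) = 0" if "j < i" "i < d" for i j
    using Suc that A by (auto simp: upper_triangular_def)
  have Bz: "B $$ (i, j) = 0" if "j < i" "i < d" for i j
    using B that by (auto simp: upper_triangular_def)
  have e: "(?A * B) $$ (i, j) = (\<Sum>l<d. ?A $$ (i, l) * B $$ (l, j))" if "i < d" "j < d" for i j
    using A B that by (auto simp: scalar_prod_def atLeast0LessThan)
  have "(?A * B) $$ (i, j) = 0" if "j < i" "i < d" for i j
  proof -
    have "?A $$ (i, l) * B $$ (l, j) = 0" if "l < d" for l
      using Az[of l i] Bz[of j l] that \<open>j < i\<close> \<open>i < d\<close> by (cases "l < i") auto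
    then have "(\<Sum>l<d. ?A $$ (i, l) * B $$ (l, j)) = 0" by (intro sum.neutral) auto
    then show ?thesis using e[of i j] that by simp
  qed
  moreover have "(?A * B) $$ (i, i) = (B $$ (i, i)) ^ Suc k" if "i < d" for i
  proof -
    have "?A $$ (i, l) * B $$ (l, i) = (if l = i then (B $$ (i, i)) ^ Suc k else 0)" if "l < d" for l
      using Az[of l i] Bz[of i l] that \<open>i < d\<close> Suc by (cases l i rule: linorder_cases) auto
    then have "(\<Sum>l<d. ?A $$ (i, l) * B $$ (l, i)) = (\<Sum>l<d. if l = i then (B $$ (i, i)) ^ Suc k else 0)"
      by (intro sum.cong) auto
    then show ?thesis using e[of i i] that by simp
  qed
  ultimately show ?case using A B by (auto simp: upper_triangular_def)
qed

lemma trace_mat_similar: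
  assumes A: "A \<in> carrier_mat d d" and sim: "similar_mat_wit A B P Q"
  shows "trace_mat A = trace_mat B"
proof -
  note s = similar_mat_witD2[OF A sim]
  have "trace_mat A = trace_mat (P * (B * Q))" using s by (simp add: assoc_mult_mat[of P d d B d Q d])
  also have "\<dots> = trace_mat ((B * Q) * P)" using s by (intro trace_mat_comm[of _ d d]) auto
  also have "(B * Q) * P = B * (Q * P)" using s by (intro assoc_mult_mat[of _ d d _ d _ d]) auto
  also have "\<dots> = B" using s by simp
  finally show ?thesis .
qed

text \<open>A triangular form suffices: its diagonal entries are roots of unity, whose power
  \<open>m\<close> is both their inverse and their conjugate, and the trace sees only the
  diagonal.\<close>

lemma trace_finite_order:
  fixes A :: "complex mat"
  assumes A: "A \<in> carrier_mat d d" and ord: "A ^\<^sub>m Suc m = 1\<^sub>m d"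
  shows "trace_mat (A ^\<^sub>m m) = cnj (trace_mat A)"
proof -
  obtain as where "char_poly A = (\<Prod>a\<leftarrow>as. [:- a, 1:])" using char_poly_factorized[OF A] by auto
  then obtain B where B: "B \<in> carrier_mat d d" "upper_triangular B" "similar_mat A B"
    using schur_decomposition_exists[OF A] by blast
  then obtain P Q where sim: "similar_mat_wit A B P Q" unfolding similar_mat_def by auto
  note pow = upper_triangular_pow_diag[OF B(1,2)]
  have "similar_mat_wit (1\<^sub>m d) (B ^\<^sub>m Suc m) P Q"
    using similar_mat_wit_pow[OF sim, of "Suc m"] ord by simp
  then have "similar_mat_wit (B ^\<^sub>m Suc m) (1\<^sub>m d) Q P" by (rule similar_mat_wit_sym)
  have "B ^\<^sub>m Suc m \<in> carrier_mat d d" using B by (intro pow_carrier_mat)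
  from similar_mat_witD2[OF this \<open>similar_mat_wit (B ^\<^sub>m Suc m) (1\<^sub>m d) Q P\<close>] have "B ^\<^sub>m Suc m = Q * P" "Q * P = 1\<^sub>m d" by auto
  then have B1: "B ^\<^sub>m Suc m = 1\<^sub>m d" by simp
  have root: "(B $$ (i, i)) ^ m = cnj (B $$ (i, i))" if i: "i < d" for i
  proof -
    have one: "(B $$ (i, i)) ^ Suc m = 1" using pow[of "Suc m"] B1 i by auto
    then have "norm (B $$ (i, i)) ^ Suc m = 1" by (metis norm_one norm_power)
    then have "norm (B $$ (i, i)) = 1"
      using power_eq_imp_eq_base[of "norm (B $$ (i, i))" "Suc m" 1] by simp
    then have "B $$ (i, i) * cnj (B $$ (i, i)) = 1"
      by (simp add: complex_norm_square[symmetric])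
    moreover have "B $$ (i, i) * (B $$ (i, i)) ^ m = 1" using one by simp
    moreover have "B $$ (i, i) \<noteq> 0" using one by auto
    ultimately show ?thesis by (metis mult_left_cancel)
  qed
  have "trace_mat (A ^\<^sub>m m) = trace_mat (B ^\<^sub>m m)"
    using A by (intro trace_mat_similar[OF _ similar_mat_wit_pow[OF sim]]) auto
  also have "\<dots> = (\<Sum>i<d. cnj (B $$ (i, i)))" using B pow[of m] root by (auto simp: trace_mat_def)
  also have "\<dots> = cnj (trace_mat B)" using B by (auto simp: trace_mat_def)
  also have "trace_mat B = trace_mat A" using trace_mat_similar[OF A sim] by simp
  finally show ?thesis .
qed

lemma mat_unit_vec_index:
  "A \<in> carrier_mat n m \<Longrightarrow> i < n \<Longrightarrow> j < m \<Longrightarrow> (A *\<^sub>v unit_vec m j) $ i = (A :: complex mat) $$ (i, j)"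
  by simp

section \<open>Representations, decomposition of their traces, and Schur's lemma\<close>

locale finite_grp = group G for G (structure) +
  assumes finite_carrier [simp]: "finite (carrier G)"
begin

lemma order_pos: "Coset.order G > 0"
  using finite_carrier order_gt_0_iff_finite by blast

lemma inv_cancel_left:
  assumes "x \<in> carrier G" "y \<in> carrier G"
  shows "inv x \<otimes> (x \<otimes> y) = y" "x \<otimes> (inv x \<otimes> y) = y"
  using assms by (metis inv_closed l_inv l_one m_assoc, metis inv_closed l_one m_assoc r_inv)

lemma sum_translate_left:
  assumes "h \<in> carrier G"
  shows "(\<Sum>g\<in>carrier G. F (h \<otimes> g)) = (\<Sum>g\<in>carrier G. F g)"
proof (rule sum.reindex_bij_betw)
  show "bij_betw (\<lambda>g. h \<otimes> g) (carrier G) (carrier G)"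
    using assms by (intro bij_betw_byWitness[where f' = "\<lambda>g. inv h \<otimes> g"]) (auto simp: inv_cancel_left)
qed

lemma sum_conjugate:
  assumes "h \<in> carrier G"
  shows "(\<Sum>g\<in>carrier G. F (h \<otimes> g \<otimes> inv h)) = (\<Sum>g\<in>carrier G. F g)"
proof (rule sum.reindex_bij_betw)
  show "bij_betw (\<lambda>g. h \<otimes> g \<otimes> inv h) (carrier G) (carrier G)"
    using assms by (intro bij_betw_byWitness[where f' = "\<lambda>g. inv h \<otimes> g \<otimes> h"])
      (auto simp: m_assoc inv_cancel_left)
qed

lemma sum_inverse: "(\<Sum>g\<in>carrier G. F (inv g)) = (\<Sum>g\<in>carrier G. F g)"
  by (intro sum.reindex_bij_betw bij_betw_byWitness[where f' = "\<lambda>g. inv g"]) auto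

text \<open>Replaces homomorphisms into the unit group of the matrix ring by multiplicative
  matrix-valued functions; invertibility is automatic, since \<open>\<rho> (inv g)\<close> inverts
  \<open>\<rho> g\<close>.\<close>

lemma representation_iff:
  "representation G d \<rho> \<longleftrightarrow>
     (\<forall>g\<in>carrier G. \<rho> g \<in> carrier_mat d d) \<and>
     (\<forall>g\<in>carrier G. \<forall>h\<in>carrier G. \<rho> (g \<otimes> h) = \<rho> g * \<rho> h) \<and> \<rho> \<one> = 1\<^sub>m d"
  (is "_ \<longleftrightarrow> ?R")
proof
  let ?M = "ring_mat TYPE(complex) d ()"
  have "monoid ?M" using ring_mat[of d "()"] ring.is_monoid by blast
  then have U: "group (units_of ?M)" by (rule monoid.units_group)
  {
    assume r: "representation G d \<rho>"
    then have "\<rho> \<one> = 1\<^sub>m d"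
      using hom_one[OF _ group_axioms U] by (auto simp: representation_def units_of_one ring_mat_simps)
    moreover have "\<rho> g \<in> carrier_mat d d" if "g \<in> carrier G" for g
      using r that unfolding representation_def hom_def
      by (auto simp: units_of_carrier Units_def ring_mat_simps)
    ultimately show ?R
      using r unfolding representation_def hom_def by (auto simp: units_of_mult ring_mat_simps)
  }
  assume R: ?R
  have "\<rho> g \<in> Units ?M" if g: "g \<in> carrier G" for g
  proof -
    have "\<rho> (inv g) * \<rho> g = 1\<^sub>m d" "\<rho> g * \<rho> (inv g) = 1\<^sub>m d"
      using R g by (metis inv_closed l_inv, metis inv_closed r_inv)
    then show ?thesis using R g by (auto simp: Units_def ring_mat_simps intro!: bexI[of _ "\<rho> (inv g)"])
  qed
  then show "representation G d \<rho>"
    using R unfolding representation_def hom_def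
    by (auto simp: units_of_carrier units_of_mult ring_mat_simps)
qed

lemma representationD:
  assumes "representation G d \<rho>"
  shows "\<And>g. g \<in> carrier G \<Longrightarrow> \<rho> g \<in> carrier_mat d d"
    "\<And>g h. g \<in> carrier G \<Longrightarrow> h \<in> carrier G \<Longrightarrow> \<rho> (g \<otimes> h) = \<rho> g * \<rho> h"
    "\<rho> \<one> = 1\<^sub>m d"
  using assms unfolding representation_iff by auto

lemma rep_pow:
  assumes r: "representation G d \<rho>" and g: "g \<in> carrier G"
  shows "\<rho> (g [^] (k::nat)) = \<rho> g ^\<^sub>m k"
proof (induction k)
  case 0 then show ?case using representationD[OF r] g by auto
next
  case (Suc k) then show ?case using representationD[OF r] g by auto
qed

text \<open>With \<open>m + 1\<close> the group order, \<open>inv g\<close> is the power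
  \<open>g [^] m\<close>, which reduces the claim to \<open>trace_finite_order\<close>.\<close>

lemma rep_trace_inv:
  assumes r: "representation G d \<rho>" and g: "g \<in> carrier G"
  shows "trace_mat (\<rho> (inv g)) = cnj (trace_mat (\<rho> g))"
proof -
  obtain m where m: "Coset.order G = Suc m" using order_pos by (cases "Coset.order G") auto
  have one: "g [^] Suc m = \<one>" using pow_order_eq_1[OF g] m by simp
  then have "g [^] m \<otimes> g = \<one>" by simp
  then have "inv g = g [^] m" using g by (metis inv_equality nat_pow_closed)
  moreover have "\<rho> g ^\<^sub>m Suc m = 1\<^sub>m d"
    using one rep_pow[OF r g, of "Suc m"] representationD(3)[OF r] by metis
  ultimately show ?thesis
    using trace_finite_order[OF representationD(1)[OF r g]] rep_pow[OF r g] by metis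
qed

lemma rep_trace_conj:
  assumes r: "representation G d \<rho>" and g: "g \<in> carrier G" "h \<in> carrier G"
  shows "trace_mat (\<rho> (h \<otimes> g \<otimes> inv h)) = trace_mat (\<rho> g)"
proof -
  note R = representationD[OF r]
  have "trace_mat (\<rho> (h \<otimes> g \<otimes> inv h)) = trace_mat (\<rho> (h \<otimes> g) * \<rho> (inv h))" using R g by simp
  also have "\<dots> = trace_mat (\<rho> (inv h) * \<rho> (h \<otimes> g))"
    using R(1) g by (intro trace_mat_comm[of _ d d]) auto
  also have "\<dots> = trace_mat (\<rho> (inv h \<otimes> (h \<otimes> g)))" using R g by simp
  also have "inv h \<otimes> (h \<otimes> g) = g" using g by (simp add: m_assoc[symmetric])
  finally show ?thesis .
qed

lemma irr_charE:
  assumes "\<chi> \<in> irr_chars G"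
  obtains d \<rho> where "irreducible_representation G d \<rho>" "representation G d \<rho>" "d > 0"
    "\<And>g. g \<in> carrier G \<Longrightarrow> \<chi> g = trace_mat (\<rho> g)"
  using assms unfolding irr_chars_def irreducible_representation_def by force

lemma irr_char_inv: "\<chi> \<in> irr_chars G \<Longrightarrow> g \<in> carrier G \<Longrightarrow> \<chi> (inv g) = cnj (\<chi> g)"
  by (auto elim!: irr_charE simp: rep_trace_inv)

lemma irr_char_conj:
  "\<chi> \<in> irr_chars G \<Longrightarrow> g \<in> carrier G \<Longrightarrow> h \<in> carrier G \<Longrightarrow> \<chi> (h \<otimes> g \<otimes> inv h) = \<chi> g"
  by (auto elim!: irr_charE simp: rep_trace_conj)

lemma irr_char_degree:
  assumes "\<chi> \<in> irr_chars G"
  obtains d where "\<chi> \<one> = of_nat d" "d > 0"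
  using assms by (auto elim!: irr_charE simp: representationD(3))

lemma irr_char_extensional: "\<chi> \<in> irr_chars G \<Longrightarrow> \<chi> \<in> extensional (carrier G)"
  unfolding irr_chars_def by auto

lemma irr_char_eqI:
  assumes "\<chi> \<in> irr_chars G" "\<psi> \<in> irr_chars G" "\<And>g. g \<in> carrier G \<Longrightarrow> \<chi> g = \<psi> g"
  shows "\<chi> = \<psi>"
  using assms irr_char_extensional by (intro extensionalityI[of _ "carrier G"]) auto

text \<open>An invariant subspace puts the representation in block triangular form, so that the character
  is the sum of the characters of the subrepresentation and of the quotient.\<close>

lemma rep_trace_decomp:
  "representation G d \<rho> \<Longrightarrow>
     \<exists>M. set_mset M \<subseteq> irr_chars G \<and> (\<forall>g\<in>carrier G. trace_mat (\<rho> g) = (\<Sum>\<chi>\<in>#M. \<chi> g))"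
proof (induction d arbitrary: \<rho> rule: less_induct)
  case (less d)
  note r = less.prems
  note R = representationD[OF r]
  consider "d = 0" | "irreducible_representation G d \<rho>"
    | "d > 0" "\<not> irreducible_representation G d \<rho>" by blast
  then show ?case
  proof cases
    case 1
    then have "trace_mat (\<rho> g) = 0" if "g \<in> carrier G" for g
      using R(1)[OF that] by (simp add: trace_mat_def)
    then show ?thesis by (intro exI[of _ "{#}"]) auto
  next
    case 2
    then have "restrict (\<lambda>g. trace_mat (\<rho> g)) (carrier G) \<in> irr_chars G"
      unfolding irr_chars_def by blast
    then show ?thesis
      by (intro exI[of _ "{# restrict (\<lambda>g. trace_mat (\<rho> g)) (carrier G) #}"]) auto
  next
    case 3
    then obtain W where W: "VectorSpace.subspace class_ring W (module_vec TYPE(complex) d)"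
      and inv: "\<And>g w. g \<in> carrier G \<Longrightarrow> w \<in> W \<Longrightarrow> \<rho> g *\<^sub>v w \<in> W"
      and W0: "W \<noteq> {0\<^sub>v d}" and W1: "W \<noteq> carrier_vec d"
      using r unfolding irreducible_representation_def by blast
    obtain k C U where C: "C \<in> carrier_mat d k" and U: "U \<in> carrier_mat k d" and UC: "U * C = 1\<^sub>m k"
      and im: "W = {C *\<^sub>v v | v. v \<in> carrier_vec k}" by (rule subspace_split[OF W])
    \<comment> \<open>\<open>C * U\<close> projects onto \<open>W\<close> and \<open>Q\<close> onto
      a complement that need not be invariant. In the factorization \<open>Q = D * V\<close> the
      columns of \<open>D\<close> span this complement, and \<open>V\<close> is the passage to the
      quotient by \<open>W\<close>, as \<open>V * C = 0\<close>.\<close>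
    define Q where "Q = 1\<^sub>m d - C * U"
    have CU: "C * U \<in> carrier_mat d d" using C U by simp
    have Qc: "Q \<in> carrier_mat d d" using CU by (simp add: Q_def minus_carrier_mat)
    have QC: "Q * C = 0\<^sub>m d k"
    proof -
      have "Q * C = 1\<^sub>m d * C - C * U * C" unfolding Q_def using C CU by (intro minus_mult_distrib_mat) auto
      also have "C * U * C = C * (U * C)" using C U by (intro assoc_mult_mat) auto
      finally show ?thesis using UC C by simp
    qed
    have "Q * Q = Q * 1\<^sub>m d - Q * (C * U)"
      unfolding Q_def[unfolded Q_def] using Qc CU
      by (subst (2) Q_def, intro mult_minus_distrib_mat) auto
    also have "Q * (C * U) = Q * C * U" using Qc C U by (intro assoc_mult_mat[symmetric]) auto
    also have "\<dots> = 0\<^sub>m d d" using QC U by simp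
    finally have QQ: "Q * Q = Q" using Qc by (intro eq_matI) auto
    obtain l D V where D: "D \<in> carrier_mat d l" and V: "V \<in> carrier_mat l d" and VD: "V * D = 1\<^sub>m l"
      and QDV: "Q = D * V" and tr: "trace_mat Q = of_nat l" by (rule idempotent_factor[OF Qc QQ])
    have "D * (V * C) = D * V * C" using D V C by (intro assoc_mult_mat[symmetric])
    then have DVC: "D * (V * C) = D * 0\<^sub>m l k" using QC D unfolding QDV[symmetric] by simp
    have VC: "V * C = 0\<^sub>m l k"
      by (rule left_inverse_inject[OF D V VD mult_carrier_mat[OF V C] zero_carrier_mat DVC])
    have split: "1\<^sub>m d = C * U + D * V"
      unfolding QDV[symmetric] Q_def using CU by (intro eq_matI) auto
    have "trace_mat Q = of_nat d - trace_mat (C * U)"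
      unfolding Q_def using CU by (subst trace_mat_minus[of _ d]) auto
    also have "trace_mat (C * U) = of_nat k" using trace_mat_comm[OF C U] UC by simp
    finally have "of_nat l + of_nat k = (of_nat d :: complex)" using tr by (simp add: algebra_simps)
    then have lk: "l + k = d" using of_nat_eq_iff[where 'a = complex, of "l + k" d] by simp
    have k0: "k \<noteq> 0"
    proof
      assume k: "k = 0"
      have "C *\<^sub>v v = 0\<^sub>v d" if "v \<in> carrier_vec k" for v
        using that C k by (intro eq_vecI) (auto simp: scalar_prod_def)
      then have "W \<subseteq> {0\<^sub>v d}" using im by auto
      then show False using W W0 unfolding subspace_vec_iff by auto
    qed
    have l0: "l \<noteq> 0"
    proof
      assume l: "l = 0"
      then have "D * V = 0\<^sub>m d d" using D V by (intro eq_matI) (auto simp: scalar_prod_def)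
      then have CU1: "C * U = 1\<^sub>m d" using split CU by simp
      have "w \<in> W" if w: "w \<in> carrier_vec d" for w
      proof -
        have "C *\<^sub>v (U *\<^sub>v w) = C * U *\<^sub>v w" using C U w by (intro assoc_mult_mat_vec[symmetric]) auto
        then have "w = C *\<^sub>v (U *\<^sub>v w)" using CU1 w by simp
        then show ?thesis using im mult_mat_vec_carrier[OF U w] by blast
      qed
      then show False using W W1 unfolding subspace_vec_iff by auto
    qed
    \<comment> \<open>\<open>\<rho>1\<close> is the action on \<open>W\<close> in the basis
      \<open>C\<close>, and \<open>\<rho>2\<close> the action on the quotient in the basis induced
      by \<open>D\<close>.\<close>
    define \<rho>1 where "\<rho>1 g = U * (\<rho> g * C)" for g
    define \<rho>2 where "\<rho>2 g = V * (\<rho> g * D)" for g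
    have inv1: "\<rho> g * C = C * \<rho>1 g" if g: "g \<in> carrier G" for g
    proof -
      obtain X where X: "X \<in> carrier_mat k k" and RX: "\<rho> g * C = C * X"
      proof (rule image_factor[OF C, of "\<rho> g * C" k])
        show "\<rho> g * C \<in> carrier_mat d k" using R(1)[OF g] C by simp
        fix v :: "complex vec" assume v: "v \<in> carrier_vec k"
        have "(\<rho> g * C) *\<^sub>v v = \<rho> g *\<^sub>v (C *\<^sub>v v)" using R(1)[OF g] C v by (intro assoc_mult_mat_vec) auto
        also have "\<dots> \<in> W" using inv[OF g] im v by blast
        finally show "(\<rho> g * C) *\<^sub>v v \<in> {C *\<^sub>v w | w. w \<in> carrier_vec k}" using im by simp
      qed
      have "\<rho>1 g = U * C * X" unfolding \<rho>1_def RX using U C X by (intro assoc_mult_mat[symmetric]) auto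
      then show ?thesis using UC X RX by simp
    qed
    have c1: "\<rho>1 g \<in> carrier_mat k k" and c2: "\<rho>2 g \<in> carrier_mat l l" if "g \<in> carrier G" for g
      using R(1)[OF that] C U D V by (auto simp: \<rho>1_def \<rho>2_def)
    have rep1: "representation G k \<rho>1"
      unfolding representation_iff
    proof (intro conjI ballI)
      fix g h assume g: "g \<in> carrier G" and h: "h \<in> carrier G"
      have "\<rho>1 (g \<otimes> h) = U * (\<rho> g * (\<rho> h * C))"
        unfolding \<rho>1_def R(2)[OF g h] using R(1)[OF g] R(1)[OF h] C by (simp add: assoc_mult_mat[of _ d d _ d _ k])
      also have "\<dots> = U * (\<rho> g * C * \<rho>1 h)"
        unfolding inv1[OF h] using R(1)[OF g] C c1[OF h] by (simp add: assoc_mult_mat[of _ d d _ k _ k])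
      also have "\<dots> = \<rho>1 g * \<rho>1 h"
        unfolding \<rho>1_def[of g] using R(1)[OF g] C U c1[OF h]
        by (intro assoc_mult_mat[symmetric, of _ k d _ k _ k]) auto
      finally show "\<rho>1 (g \<otimes> h) = \<rho>1 g * \<rho>1 h" .
    qed (use c1 R(3) C UC in \<open>auto simp: \<rho>1_def\<close>)
    have rep2: "representation G l \<rho>2"
      unfolding representation_iff
    proof (intro conjI ballI)
      fix g h assume g: "g \<in> carrier G" and h: "h \<in> carrier G"
      note cg = R(1)[OF g] and ch = R(1)[OF h]
      have VRC: "V * (\<rho> g * C) = 0\<^sub>m l k"
      proof -
        have "V * (\<rho> g * C) = V * C * \<rho>1 g"
          unfolding inv1[OF g] using V C c1[OF g] by (intro assoc_mult_mat[symmetric]) auto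
        then show ?thesis using VC c1[OF g] by simp
      qed
      have hD: "\<rho> h * D \<in> carrier_mat d l" using ch D by simp
      have Vg: "V * \<rho> g \<in> carrier_mat l d" using V cg by simp
      have "\<rho>2 (g \<otimes> h) = V * (\<rho> g * (\<rho> h * D))"
        unfolding \<rho>2_def R(2)[OF g h] using cg ch D by (simp add: assoc_mult_mat[of _ d d _ d _ l])
      also have "\<dots> = V * \<rho> g * (\<rho> h * D)"
        using V cg hD by (intro assoc_mult_mat[symmetric]) auto
      \<comment> \<open>The identity is inserted as \<open>C * U + D * V\<close> between the two
        factors; the part through \<open>C\<close> dies because
        \<open>V * (\<rho> g * C) = V * C * \<rho>1 g = 0\<close>.\<close>
      also have "\<dots> = V * \<rho> g * (C * U + D * V) * (\<rho> h * D)"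
        by (simp only: split[symmetric] right_mult_one_mat[OF Vg])
      also have "V * \<rho> g * (C * U + D * V) = V * \<rho> g * (C * U) + V * \<rho> g * (D * V)"
        using Vg CU D V by (intro mult_add_distrib_mat) auto
      also have "V * \<rho> g * (C * U) = V * (\<rho> g * C) * U"
        by (simp only: assoc_mult_mat[OF V cg CU] assoc_mult_mat[OF cg C U]
            assoc_mult_mat[OF V mult_carrier_mat[OF cg C] U])
      also have "V * \<rho> g * (D * V) = \<rho>2 g * V"
        unfolding \<rho>2_def
        by (simp only: assoc_mult_mat[OF V cg mult_carrier_mat[OF D V]] assoc_mult_mat[OF cg D V]
            assoc_mult_mat[OF V mult_carrier_mat[OF cg D] V])
      also have "V * (\<rho> g * C) * U + \<rho>2 g * V = \<rho>2 g * V"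
        unfolding VRC using U V c2[OF g] by simp
      also have "\<rho>2 g * V * (\<rho> h * D) = \<rho>2 g * \<rho>2 h"
        unfolding \<rho>2_def[of h] using c2[OF g] V hD by (intro assoc_mult_mat) auto
      finally show "\<rho>2 (g \<otimes> h) = \<rho>2 g * \<rho>2 h" .
    qed (use c2 R(3) D VD in \<open>auto simp: \<rho>2_def\<close>)
    have tr: "trace_mat (\<rho> g) = trace_mat (\<rho>1 g) + trace_mat (\<rho>2 g)" if g: "g \<in> carrier G" for g
    proof -
      note cg = R(1)[OF g]
      have "\<rho> g = \<rho> g * (C * U + D * V)" using cg by (simp add: split[symmetric])
      also have "\<dots> = \<rho> g * (C * U) + \<rho> g * (D * V)" using cg CU D V by (intro mult_add_distrib_mat) auto
      also have "\<rho> g * (C * U) = \<rho> g * C * U" using cg C U by (intro assoc_mult_mat[symmetric]) auto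
      also have "\<rho> g * (D * V) = \<rho> g * D * V" using cg D V by (intro assoc_mult_mat[symmetric]) auto
      finally have "trace_mat (\<rho> g) = trace_mat (\<rho> g * C * U) + trace_mat (\<rho> g * D * V)"
        using trace_mat_add[of "\<rho> g * C * U" d "\<rho> g * D * V"] cg C U D V by simp
      also have "trace_mat (\<rho> g * C * U) = trace_mat (\<rho>1 g)"
        unfolding \<rho>1_def using cg C U by (intro trace_mat_comm[of _ d k]) auto
      also have "trace_mat (\<rho> g * D * V) = trace_mat (\<rho>2 g)"
        unfolding \<rho>2_def using cg D V by (intro trace_mat_comm[of _ d l]) auto
      finally show ?thesis .
    qed
    obtain M1 M2 where "set_mset M1 \<subseteq> irr_chars G" "\<forall>g\<in>carrier G. trace_mat (\<rho>1 g) = (\<Sum>\<chi>\<in>#M1. \<chi> g)"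
      "set_mset M2 \<subseteq> irr_chars G" "\<forall>g\<in>carrier G. trace_mat (\<rho>2 g) = (\<Sum>\<chi>\<in>#M2. \<chi> g)"
      using less.IH[OF _ rep1] less.IH[OF _ rep2] lk k0 l0 by fastforce
    then show ?thesis using tr by (intro exI[of _ "M1 + M2"]) auto
  qed
qed

text \<open>The kernel of \<open>M\<close> is invariant under \<open>\<rho>'\<close> and its image
  under \<open>\<rho>\<close>; irreducibility makes them zero and everything. Surjectivity yields
  \<open>N\<close> with \<open>M * N = 1\<close>, and since \<open>M\<close> kills the columns of
  \<open>N * M - 1\<close>, the trivial kernel yields the other equation.\<close>

lemma schur_intertwiner:
  assumes irr: "irreducible_representation G d \<rho>" and irr': "irreducible_representation G d' \<rho>'"
    and M: "M \<in> carrier_mat d d'" and int: "\<And>g. g \<in> carrier G \<Longrightarrow> \<rho> g * M = M * \<rho>' g"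
    and M0: "M \<noteq> 0\<^sub>m d d'"
  obtains N where "N \<in> carrier_mat d' d" "M * N = 1\<^sub>m d" "N * M = 1\<^sub>m d'"
proof -
  have r: "representation G d \<rho>" and r': "representation G d' \<rho>'"
    using irr irr' unfolding irreducible_representation_def by auto
  note R = representationD[OF r] and R' = representationD[OF r']
  define K where "K = {v \<in> carrier_vec d'. M *\<^sub>v v = 0\<^sub>v d}"
  define I where "I = {M *\<^sub>v v | v. v \<in> carrier_vec d'}"
  have intv: "\<rho> g *\<^sub>v (M *\<^sub>v v) = M *\<^sub>v (\<rho>' g *\<^sub>v v)" if "g \<in> carrier G" "v \<in> carrier_vec d'" for g v
  proof -
    have "\<rho> g *\<^sub>v (M *\<^sub>v v) = (\<rho> g * M) *\<^sub>v v" using R(1)[OF that(1)] M that by (intro assoc_mult_mat_vec[symmetric]) auto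
    also have "\<dots> = M *\<^sub>v (\<rho>' g *\<^sub>v v)" unfolding int[OF that(1)]
      using R'(1)[OF that(1)] M that by (intro assoc_mult_mat_vec) auto
    finally show ?thesis .
  qed
  have nz: "\<exists>v\<in>carrier_vec d'. M *\<^sub>v v \<noteq> 0\<^sub>v d"
  proof (rule ccontr)
    assume "\<not> ?thesis"
    then have z: "M *\<^sub>v v = 0\<^sub>v d" if "v \<in> carrier_vec d'" for v using that by blast
    have "M = 0\<^sub>m d d'"
    proof (rule eq_matI)
      fix i j assume "i < dim_row (0\<^sub>m d d' :: complex mat)" "j < dim_col (0\<^sub>m d d' :: complex mat)"
      then have ij: "i < d" "j < d'" by auto
      have "M $$ (i, j) = (M *\<^sub>v unit_vec d' j) $ i" using ij M by simp
      then show "M $$ (i, j) = 0\<^sub>m d d' $$ (i, j)" using z[of "unit_vec d' j"] ij by simp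
    qed (use M in auto)
    then show False using M0 by simp
  qed
  have Kinv: "\<rho>' g *\<^sub>v w \<in> K" if "g \<in> carrier G" "w \<in> K" for g w
  proof -
    have "M *\<^sub>v (\<rho>' g *\<^sub>v w) = \<rho> g *\<^sub>v 0\<^sub>v d" using intv[of g w] that by (simp add: K_def)
    also have "\<dots> = 0\<^sub>v d" using R(1)[OF that(1)] by (intro eq_vecI) auto
    finally show ?thesis using that R'(1)[OF that(1)] by (auto simp: K_def)
  qed
  have "VectorSpace.subspace class_ring K (module_vec TYPE(complex) d')"
    unfolding subspace_vec_iff K_def using M
    by (auto simp: mult_add_distrib_mat_vec[of _ d d'] mult_mat_vec[of _ d d'] intro!: eq_vecI)
  then have "K = {0\<^sub>v d'} \<or> K = carrier_vec d'"
    using irr' Kinv unfolding irreducible_representation_def by blast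
  then have K: "K = {0\<^sub>v d'}" using nz unfolding K_def by blast
  have Iinv: "\<rho> g *\<^sub>v w \<in> I" if g: "g \<in> carrier G" and w: "w \<in> I" for g w
  proof -
    obtain v where v: "v \<in> carrier_vec d'" "w = M *\<^sub>v v" using w I_def by blast
    then have "\<rho> g *\<^sub>v w = M *\<^sub>v (\<rho>' g *\<^sub>v v)" using intv g by simp
    moreover have "\<rho>' g *\<^sub>v v \<in> carrier_vec d'" using R'(1)[OF g] v by auto
    ultimately show ?thesis unfolding I_def by blast
  qed
  have "VectorSpace.subspace class_ring I (module_vec TYPE(complex) d)"
    unfolding subspace_vec_iff I_def
  proof (safe, goal_cases)
    case (1 x v) then show ?case using M by auto
  next
    case 2
    then show ?case using M by (intro exI[of _ "0\<^sub>v d'"]) (auto intro!: eq_vecI)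
  next
    case (3 v w va vaa)
    then show ?case using M by (intro exI[of _ "va + vaa"]) (auto simp: mult_add_distrib_mat_vec[of _ d d'])
  next
    case (4 c v va)
    then show ?case using M by (intro exI[of _ "c \<cdot>\<^sub>v va"]) (auto simp: mult_mat_vec[of _ d d'])
  qed
  then have "I = {0\<^sub>v d} \<or> I = carrier_vec d"
    using irr Iinv unfolding irreducible_representation_def by blast
  then have I: "I = carrier_vec d" using nz unfolding I_def by blast
  obtain N where N: "N \<in> carrier_mat d' d" and MN: "1\<^sub>m d = M * N"
  proof (rule image_factor[OF M, of "1\<^sub>m d" d])
    fix v :: "complex vec" assume "v \<in> carrier_vec d"
    then show "1\<^sub>m d *\<^sub>v v \<in> {M *\<^sub>v w | w. w \<in> carrier_vec d'}" using I I_def by simp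
  qed auto
  have "N * M = 1\<^sub>m d'"
  proof (rule eq_matI)
    fix i j assume "i < dim_row (1\<^sub>m d' :: complex mat)" "j < dim_col (1\<^sub>m d' :: complex mat)"
    then have ij: "i < d'" "j < d'" by auto
    let ?e = "unit_vec d' j :: complex vec"
    have NMe: "(N * M) *\<^sub>v ?e \<in> carrier_vec d'" using N M by (metis mult_carrier_mat mult_mat_vec_carrier unit_vec_carrier)
    have "M *\<^sub>v ((N * M) *\<^sub>v ?e) = (M * (N * M)) *\<^sub>v ?e" using M N by (intro assoc_mult_mat_vec[symmetric]) auto
    also have "M * (N * M) = M * N * M" using M N by (intro assoc_mult_mat[symmetric]) auto
    also have "\<dots> = M" using MN[symmetric] M by simp
    finally have "M *\<^sub>v ((N * M) *\<^sub>v ?e - ?e) = 0\<^sub>v d"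
      using M N NMe by (subst mult_minus_distrib_mat_vec[of _ d d']) (auto intro!: eq_vecI)
    then have "(N * M) *\<^sub>v ?e - ?e \<in> K" using NMe by (auto simp: K_def)
    then have e: "(N * M) *\<^sub>v ?e - ?e = 0\<^sub>v d'" using K by simp
    have "(N * M) $$ (i, j) = ((N * M) *\<^sub>v ?e) $ i"
      using ij M N by (intro mat_unit_vec_index[symmetric]) auto
    also have "\<dots> = ((N * M) *\<^sub>v ?e - ?e) $ i + ?e $ i" using ij NMe by simp
    also have "\<dots> = 1\<^sub>m d' $$ (i, j)" unfolding e using ij by simp
    finally show "(N * M) $$ (i, j) = 1\<^sub>m d' $$ (i, j)" .
  qed (use M N in auto)
  then show ?thesis using that[OF N MN[symmetric]] by blast
qed

text \<open>A nonzero intertwiner is invertible and would conjugate \<open>\<rho>'\<close> into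
  \<open>\<rho>\<close>, making the traces equal. The hypothesis speaks of traces because
  orthogonality starts from distinct characters.\<close>

lemma schur_zero:
  assumes irr: "irreducible_representation G d \<rho>" and irr': "irreducible_representation G d' \<rho>'"
    and M: "M \<in> carrier_mat d d'" and int: "\<And>g. g \<in> carrier G \<Longrightarrow> \<rho> g * M = M * \<rho>' g"
    and neq: "\<exists>g\<in>carrier G. trace_mat (\<rho> g) \<noteq> trace_mat (\<rho>' g)"
  shows "M = 0\<^sub>m d d'"
proof (rule ccontr)
  assume "M \<noteq> 0\<^sub>m d d'"
  from schur_intertwiner[OF irr irr' M int this]
  obtain N where N: "N \<in> carrier_mat d' d" "M * N = 1\<^sub>m d" "N * M = 1\<^sub>m d'" by metis
  have "trace_mat (\<rho> g) = trace_mat (\<rho>' g)" if g: "g \<in> carrier G" for g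
  proof -
    have cg: "\<rho> g \<in> carrier_mat d d" "\<rho>' g \<in> carrier_mat d' d'"
      using irr irr' g representationD(1) unfolding irreducible_representation_def by auto
    have "\<rho> g = \<rho> g * (M * N)" using N cg by simp
    also have "\<dots> = \<rho> g * M * N" using N cg M by (intro assoc_mult_mat[symmetric]) auto
    also have "trace_mat \<dots> = trace_mat (N * (\<rho> g * M))" using N cg M by (intro trace_mat_comm[of _ d d']) auto
    also have "N * (\<rho> g * M) = N * M * \<rho>' g" unfolding int[OF g] using N cg M by (intro assoc_mult_mat[symmetric]) auto
    also have "\<dots> = \<rho>' g" using N cg by simp
    finally show ?thesis .
  qed
  then show False using neq by blast
qed

text \<open>For an eigenvalue \<open>c\<close> of \<open>M\<close>, subtracting \<open>c\<close>
  times the identity leaves an intertwiner that kills an eigenvector; it is not invertible and must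
  vanish.\<close>

lemma schur_scalar:
  assumes irr: "irreducible_representation G d \<rho>" and M: "M \<in> carrier_mat d d"
    and int: "\<And>g. g \<in> carrier G \<Longrightarrow> \<rho> g * M = M * \<rho> g"
  obtains c where "M = c \<cdot>\<^sub>m 1\<^sub>m d"
proof -
  have d: "d > 0" and r: "representation G d \<rho>" using irr unfolding irreducible_representation_def by auto
  note R = representationD[OF r]
  obtain c where "eigenvalue M c" using spectrum_non_empty[OF M d] unfolding spectrum_def by auto
  then obtain v where v: "v \<in> carrier_vec d" "v \<noteq> 0\<^sub>v d" "M *\<^sub>v v = c \<cdot>\<^sub>v v"
    using M unfolding eigenvalue_def eigenvector_def by auto
  define N where "N = M - c \<cdot>\<^sub>m 1\<^sub>m d"
  have Nc: "N \<in> carrier_mat d d" using M by (auto simp: N_def)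
  have "\<rho> g * N = N * \<rho> g" if g: "g \<in> carrier G" for g
  proof -
    have "\<rho> g * N = \<rho> g * M - \<rho> g * (c \<cdot>\<^sub>m 1\<^sub>m d)" unfolding N_def using R(1)[OF g] M by (intro mult_minus_distrib_mat) auto
    also have "\<rho> g * (c \<cdot>\<^sub>m 1\<^sub>m d) = (c \<cdot>\<^sub>m 1\<^sub>m d) * \<rho> g"
      using R(1)[OF g] by (simp add: mult_smult_distrib[of _ d d _ d] mult_smult_assoc_mat[of _ d d _ d])
    also have "\<rho> g * M - (c \<cdot>\<^sub>m 1\<^sub>m d) * \<rho> g = N * \<rho> g"
      unfolding N_def int[OF g] using R(1)[OF g] M by (intro minus_mult_distrib_mat[symmetric]) auto
    finally show ?thesis .
  qed
  note int' = this
  have Nv: "N *\<^sub>v v = 0\<^sub>v d"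
  proof -
    have "N *\<^sub>v v = M *\<^sub>v v - (c \<cdot>\<^sub>m 1\<^sub>m d) *\<^sub>v v" unfolding N_def using M v by (intro minus_mult_distrib_mat_vec) auto
    also have "(c \<cdot>\<^sub>m 1\<^sub>m d) *\<^sub>v v = c \<cdot>\<^sub>v v" using v by (intro eq_vecI) auto
    finally show ?thesis using v by auto
  qed
  have "N = 0\<^sub>m d d"
  proof (rule ccontr)
    assume "N \<noteq> 0\<^sub>m d d"
    from schur_intertwiner[OF irr irr Nc int' this] obtain L where L: "L \<in> carrier_mat d d" "L * N = 1\<^sub>m d" by metis
    have "v = (L * N) *\<^sub>v v" using L v by simp
    also have "\<dots> = L *\<^sub>v (N *\<^sub>v v)" using L Nc v by (intro assoc_mult_mat_vec) auto
    also have "\<dots> = 0\<^sub>v d" unfolding Nv using L by (intro eq_vecI) auto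
    finally show False using v by simp
  qed
  then have "M = c \<cdot>\<^sub>m 1\<^sub>m d" using M unfolding N_def
    by (intro eq_matI) (auto simp: mat_eq_iff)
  then show ?thesis using that by blast
qed

end

section \<open>Orthogonality and completeness\<close>

context finite_grp
begin

text \<open>\<open>M\<close> is, entry by entry, the sum of all
  \<open>\<rho> g * E * \<rho>' (inv g)\<close>, where \<open>E\<close> has a single 1 at position
  \<open>(j, k)\<close>; translating the summation variable by \<open>h\<close> moves
  \<open>h\<close> across.\<close>

lemma average_intertwines:
  assumes r: "representation G d \<rho>" and r': "representation G d' \<rho>'" and j: "j < d" and k: "k < d'"
    and h: "h \<in> carrier G"
  defines "M \<equiv> mat d d' (\<lambda>(i, l). \<Sum>g\<in>carrier G. \<rho> g $$ (i, j) * \<rho>' (inv g) $$ (k, l))"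
  shows "\<rho> h * M = M * \<rho>' h"
proof (rule eq_matI)
  note R = representationD[OF r] and R' = representationD[OF r']
  have M: "M \<in> carrier_mat d d'" by (simp add: M_def)
  show "dim_row (\<rho> h * M) = dim_row (M * \<rho>' h)" "dim_col (\<rho> h * M) = dim_col (M * \<rho>' h)"
    using R(1)[OF h] R'(1)[OF h] M by auto
  fix i l assume "i < dim_row (M * \<rho>' h)" "l < dim_col (M * \<rho>' h)"
  then have il: "i < d" "l < d'" using R'(1)[OF h] M by auto
  have L: "\<rho> (h \<otimes> g) $$ (i, j) = (\<Sum>a<d. \<rho> h $$ (i, a) * \<rho> g $$ (a, j))" if g: "g \<in> carrier G" for g
    using R(1)[OF h] R(1)[OF g] il j
    by (simp add: R(2)[OF h g] scalar_prod_def atLeast0LessThan)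
  have R2: "\<rho>' (inv g \<otimes> h) $$ (k, l) = (\<Sum>a<d'. \<rho>' (inv g) $$ (k, a) * \<rho>' h $$ (a, l))" if g: "g \<in> carrier G" for g
    using R'(1)[OF h] R'(1)[of "inv g"] g il k
    by (simp add: R'(2) h scalar_prod_def atLeast0LessThan)
  have "(\<rho> h * M) $$ (i, l) = (\<Sum>a<d. \<rho> h $$ (i, a) * M $$ (a, l))"
    using R(1)[OF h] M il by (simp add: scalar_prod_def atLeast0LessThan)
  also have "\<dots> = (\<Sum>a<d. \<Sum>g\<in>carrier G. \<rho> h $$ (i, a) * \<rho> g $$ (a, j) * \<rho>' (inv g) $$ (k, l))"
    using il by (intro sum.cong) (simp_all add: M_def sum_distrib_left mult.assoc)
  also have "\<dots> = (\<Sum>g\<in>carrier G. \<rho> (h \<otimes> g) $$ (i, j) * \<rho>' (inv g) $$ (k, l))"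
    by (subst sum.swap, intro sum.cong) (simp_all add: L sum_distrib_right)
  also have "\<dots> = (\<Sum>g\<in>carrier G. \<rho> (h \<otimes> g) $$ (i, j) * \<rho>' (inv (h \<otimes> g) \<otimes> h) $$ (k, l))"
    using h by (intro sum.cong) (simp_all add: inv_mult_group m_assoc)
  also have "\<dots> = (\<Sum>g\<in>carrier G. \<rho> g $$ (i, j) * \<rho>' (inv g \<otimes> h) $$ (k, l))"
    by (rule sum_translate_left[OF h, of "\<lambda>g. \<rho> g $$ (i, j) * \<rho>' (inv g \<otimes> h) $$ (k, l)"])
  also have "\<dots> = (\<Sum>g\<in>carrier G. \<Sum>a<d'. \<rho> g $$ (i, j) * \<rho>' (inv g) $$ (k, a) * \<rho>' h $$ (a, l))"
    by (intro sum.cong) (simp_all add: R2 sum_distrib_left mult.assoc)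
  also have "\<dots> = (\<Sum>a<d'. M $$ (i, a) * \<rho>' h $$ (a, l))"
    using il by (subst sum.swap, intro sum.cong) (simp_all add: M_def sum_distrib_right)
  also have "\<dots> = (M * \<rho>' h) $$ (i, l)"
    using R'(1)[OF h] M il by (simp add: scalar_prod_def atLeast0LessThan)
  finally show "(\<rho> h * M) $$ (i, l) = (M * \<rho>' h) $$ (i, l)" .
qed

lemma char_inner_eq_sum_inv:
  assumes "\<psi> \<in> irr_chars G"
  shows "char_inner G \<phi> \<psi> = (\<Sum>g\<in>carrier G. \<phi> g * \<psi> (inv g)) / of_nat (Coset.order G)"
  unfolding char_inner_def using assms by (auto simp: irr_char_inv intro!: sum.cong arg_cong2[where f = "(/)"])

text \<open>For different characters the averaged elementary matrices vanish by Schur's lemma, and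
  with them all sums of products of diagonal entries; for equal characters they are scalar, and the
  trace determines the scalar.\<close>

theorem irr_chars_orthonormal:
  assumes chi: "\<chi> \<in> irr_chars G" and psi: "\<psi> \<in> irr_chars G"
  shows "char_inner G \<chi> \<psi> = (if \<chi> = \<psi> then 1 else 0)"
proof -
  obtain d \<rho> where irr: "irreducible_representation G d \<rho>" and r: "representation G d \<rho>" and d: "d > 0"
    and c: "\<And>g. g \<in> carrier G \<Longrightarrow> \<chi> g = trace_mat (\<rho> g)" using irr_charE[OF chi] by metis
  note R = representationD[OF r]
  have tr: "\<chi> g = (\<Sum>i<d. \<rho> g $$ (i, i))" if "g \<in> carrier G" for g
    using c[OF that] R(1)[OF that] by (simp add: trace_mat_def)
  show ?thesis
  proof (cases "\<chi> = \<psi>")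
    case False
    obtain d' \<rho>' where irr': "irreducible_representation G d' \<rho>'" and r': "representation G d' \<rho>'"
      and c': "\<And>g. g \<in> carrier G \<Longrightarrow> \<psi> g = trace_mat (\<rho>' g)" using irr_charE[OF psi] by metis
    note R' = representationD[OF r']
    have tr': "\<psi> g = (\<Sum>i<d'. \<rho>' g $$ (i, i))" if "g \<in> carrier G" for g
      using c'[OF that] R'(1)[OF that] by (simp add: trace_mat_def)
    have neq: "\<exists>g\<in>carrier G. trace_mat (\<rho> g) \<noteq> trace_mat (\<rho>' g)"
      using False irr_char_eqI[OF chi psi] c c' by metis
    have z: "(\<Sum>g\<in>carrier G. \<rho> g $$ (i, i) * \<rho>' (inv g) $$ (k, k)) = 0" if i: "i < d" and k: "k < d'" for i k
    proof -
      let ?M = "mat d d' (\<lambda>(a, l). \<Sum>g\<in>carrier G. \<rho> g $$ (a, i) * \<rho>' (inv g) $$ (k, l))"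
      have "?M = 0\<^sub>m d d'"
        using schur_zero[OF irr irr' _ average_intertwines[OF r r' i k] neq] by simp
      then have "?M $$ (i, k) = 0" using i k by simp
      then show ?thesis using i k by simp
    qed
    have "(\<Sum>g\<in>carrier G. \<chi> g * \<psi> (inv g))
       = (\<Sum>g\<in>carrier G. \<Sum>i<d. \<Sum>k<d'. \<rho> g $$ (i, i) * \<rho>' (inv g) $$ (k, k))"
      by (intro sum.cong) (simp_all add: tr tr' sum_product)
    also have "\<dots> = (\<Sum>i<d. \<Sum>k<d'. \<Sum>g\<in>carrier G. \<rho> g $$ (i, i) * \<rho>' (inv g) $$ (k, k))"
      by (subst sum.swap, intro sum.cong refl, rule sum.swap)
    also have "\<dots> = 0" using z by simp
    finally show ?thesis using False by (simp add: char_inner_eq_sum_inv[OF psi])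
  next
    case True
    have z: "(\<Sum>g\<in>carrier G. \<rho> g $$ (i, i) * \<rho> (inv g) $$ (k, k))
       = (if i = k then of_nat (Coset.order G) / of_nat d else 0)" if i: "i < d" and k: "k < d" for i k
    proof -
      define M where "M = mat d d (\<lambda>(a, l). \<Sum>g\<in>carrier G. \<rho> g $$ (a, i) * \<rho> (inv g) $$ (k, l))"
      have Mc: "M \<in> carrier_mat d d" by (simp add: M_def)
      have "\<rho> h * M = M * \<rho> h" if "h \<in> carrier G" for h
        unfolding M_def by (rule average_intertwines[OF r r i k that])
      from schur_scalar[OF irr Mc this] obtain c where c: "M = c \<cdot>\<^sub>m 1\<^sub>m d" by metis
      \<comment> \<open>In the trace the sum over \<open>a\<close> recombines to
        \<open>\<rho> (inv g) * \<rho> g = 1\<close>, whose entry \<open>(k, i)\<close> is counted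
        once for each group element.\<close>
      have "c * of_nat d = trace_mat M" unfolding c by (simp add: trace_mat_smult[of _ d])
      also have "\<dots> = (\<Sum>a<d. \<Sum>g\<in>carrier G. \<rho> (inv g) $$ (k, a) * \<rho> g $$ (a, i))"
        by (simp add: trace_mat_def M_def mult.commute)
      also have "\<dots> = (\<Sum>g\<in>carrier G. (\<rho> (inv g) * \<rho> g) $$ (k, i))"
      proof (subst sum.swap, intro sum.cong refl)
        fix g assume g: "g \<in> carrier G"
        show "(\<Sum>a<d. \<rho> (inv g) $$ (k, a) * \<rho> g $$ (a, i)) = (\<rho> (inv g) * \<rho> g) $$ (k, i)"
          using R(1)[OF g] R(1)[of "inv g"] g i k by (simp add: scalar_prod_def atLeast0LessThan)
      qed
      also have "\<dots> = (\<Sum>g\<in>carrier G. if k = i then 1 else 0)"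
        using i k R(2)[symmetric] R(3) by (intro sum.cong) auto
      also have "\<dots> = (if k = i then of_nat (Coset.order G) else 0)" by (simp add: Coset.order_def)
      finally have "c = (if k = i then of_nat (Coset.order G) / of_nat d else 0)"
        using d by (auto simp: field_simps)
      moreover have "(\<Sum>g\<in>carrier G. \<rho> g $$ (i, i) * \<rho> (inv g) $$ (k, k)) = M $$ (i, k)"
        using i k by (simp add: M_def)
      ultimately show ?thesis using c i k by auto
    qed
    have "(\<Sum>g\<in>carrier G. \<chi> g * \<chi> (inv g))
       = (\<Sum>g\<in>carrier G. \<Sum>i<d. \<Sum>k<d. \<rho> g $$ (i, i) * \<rho> (inv g) $$ (k, k))"
      by (intro sum.cong) (simp_all add: tr sum_product)
    also have "\<dots> = (\<Sum>i<d. \<Sum>k<d. \<Sum>g\<in>carrier G. \<rho> g $$ (i, i) * \<rho> (inv g) $$ (k, k))"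
      by (subst sum.swap, intro sum.cong refl, rule sum.swap)
    also have "\<dots> = (\<Sum>i<d. \<Sum>k<d. if i = k then of_nat (Coset.order G) / of_nat d else 0)"
      using z by (intro sum.cong) auto
    also have "\<dots> = of_nat (Coset.order G)" using d by simp
    finally show ?thesis using True order_pos by (simp add: char_inner_eq_sum_inv[OF psi])
  qed
qed

definition class_function :: "('a \<Rightarrow> complex) \<Rightarrow> bool" where
  "class_function f \<longleftrightarrow> (\<forall>g\<in>carrier G. \<forall>h\<in>carrier G. f (h \<otimes> g \<otimes> inv h) = f g)"

lemma class_function_irr_char: "\<chi> \<in> irr_chars G \<Longrightarrow> class_function \<chi>"
  unfolding class_function_def by (auto simp: irr_char_conj)

text \<open>A class function acts on an irreducible representation as a scalar.\<close>

lemma class_function_convolution: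
  assumes chi: "\<chi> \<in> irr_chars G" and f: "class_function f" and x: "x \<in> carrier G"
  shows "(\<Sum>g\<in>carrier G. f g * \<chi> (g \<otimes> x)) = (\<Sum>g\<in>carrier G. f g * \<chi> g) * \<chi> x / \<chi> \<one>"
proof -
  obtain d \<rho> where irr: "irreducible_representation G d \<rho>" and r: "representation G d \<rho>" and d: "d > 0"
    and c: "\<And>g. g \<in> carrier G \<Longrightarrow> \<chi> g = trace_mat (\<rho> g)" using irr_charE[OF chi] by metis
  note R = representationD[OF r]
  have tr: "\<chi> g = (\<Sum>i<d. \<rho> g $$ (i, i))" if "g \<in> carrier G" for g
    using c[OF that] R(1)[OF that] by (simp add: trace_mat_def)
  define M where "M = mat d d (\<lambda>(i, j). \<Sum>g\<in>carrier G. f g * \<rho> g $$ (i, j))"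
  have M: "M \<in> carrier_mat d d" by (simp add: M_def)
  have mult: "\<rho> (g \<otimes> h) $$ (i, j) = (\<Sum>a<d. \<rho> g $$ (i, a) * \<rho> h $$ (a, j))"
    if "g \<in> carrier G" "h \<in> carrier G" "i < d" "j < d" for g h i j
    using R(1)[of g] R(1)[of h] that by (simp add: R(2) scalar_prod_def atLeast0LessThan)
  have "\<rho> h * M = M * \<rho> h" if h: "h \<in> carrier G" for h
  proof (rule eq_matI)
    show "dim_row (\<rho> h * M) = dim_row (M * \<rho> h)" "dim_col (\<rho> h * M) = dim_col (M * \<rho> h)"
      using R(1)[OF h] M by auto
    fix i j assume "i < dim_row (M * \<rho> h)" "j < dim_col (M * \<rho> h)"
    then have ij: "i < d" "j < d" using R(1)[OF h] M by auto
    have "(\<rho> h * M) $$ (i, j) = (\<Sum>a<d. \<Sum>g\<in>carrier G. f g * (\<rho> h $$ (i, a) * \<rho> g $$ (a, j)))"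
      using R(1)[OF h] M ij by (simp add: scalar_prod_def atLeast0LessThan M_def sum_distrib_left mult_ac)
    also have "\<dots> = (\<Sum>g\<in>carrier G. f g * \<rho> (h \<otimes> g) $$ (i, j))"
      using h ij by (subst sum.swap, intro sum.cong) (simp_all add: mult sum_distrib_left)
    also have "\<dots> = (\<Sum>g\<in>carrier G. f (h \<otimes> g \<otimes> inv h) * \<rho> ((h \<otimes> g \<otimes> inv h) \<otimes> h) $$ (i, j))"
      using h f by (intro sum.cong) (simp_all add: m_assoc class_function_def)
    also have "\<dots> = (\<Sum>g\<in>carrier G. f g * \<rho> (g \<otimes> h) $$ (i, j))"
      by (rule sum_conjugate[OF h, of "\<lambda>g. f g * \<rho> (g \<otimes> h) $$ (i, j)"])
    also have "\<dots> = (\<Sum>g\<in>carrier G. \<Sum>a<d. f g * (\<rho> g $$ (i, a) * \<rho> h $$ (a, j)))"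
      using h ij by (intro sum.cong) (simp_all add: mult sum_distrib_left)
    also have "\<dots> = (M * \<rho> h) $$ (i, j)"
      using R(1)[OF h] M ij
      by (subst sum.swap) (simp add: scalar_prod_def atLeast0LessThan M_def sum_distrib_left mult_ac)
    finally show "(\<rho> h * M) $$ (i, j) = (M * \<rho> h) $$ (i, j)" .
  qed
  from schur_scalar[OF irr M this] obtain s where s: "M = s \<cdot>\<^sub>m 1\<^sub>m d" by metis
  have tot: "(\<Sum>g\<in>carrier G. f g * \<chi> g) = s * of_nat d"
  proof -
    have "(\<Sum>g\<in>carrier G. f g * \<chi> g) = (\<Sum>g\<in>carrier G. \<Sum>i<d. f g * \<rho> g $$ (i, i))"
      by (intro sum.cong) (simp_all add: tr sum_distrib_left)
    also have "\<dots> = trace_mat M" by (subst sum.swap) (simp add: trace_mat_def M_def)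
    also have "\<dots> = s * of_nat d" unfolding s by (simp add: trace_mat_smult[of _ d])
    finally show ?thesis .
  qed
  have "(\<Sum>g\<in>carrier G. f g * \<chi> (g \<otimes> x))
     = (\<Sum>g\<in>carrier G. \<Sum>i<d. \<Sum>a<d. f g * \<rho> g $$ (i, a) * \<rho> x $$ (a, i))"
    using x by (intro sum.cong) (simp_all add: tr mult sum_distrib_left mult.assoc)
  also have "\<dots> = (\<Sum>i<d. \<Sum>a<d. M $$ (i, a) * \<rho> x $$ (a, i))"
    by (subst sum.swap, intro sum.cong refl, subst sum.swap, intro sum.cong) (simp_all add: M_def sum_distrib_right)
  also have "\<dots> = (\<Sum>i<d. \<Sum>a<d. if i = a then s * \<rho> x $$ (i, i) else 0)"
    unfolding s by (intro sum.cong) auto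
  also have "\<dots> = s * \<chi> x" using x by (simp add: tr sum_distrib_left)
  finally show ?thesis using tot d R(3) c[OF one_closed] by simp
qed

lemma permutation_representation:
  assumes X: "finite X" and closed: "\<And>g x. g \<in> carrier G \<Longrightarrow> x \<in> X \<Longrightarrow> act g x \<in> X"
    and mult: "\<And>g h x. g \<in> carrier G \<Longrightarrow> h \<in> carrier G \<Longrightarrow> x \<in> X \<Longrightarrow> act (g \<otimes> h) x = act g (act h x)"
    and one: "\<And>x. x \<in> X \<Longrightarrow> act \<one> x = x"
  obtains d \<rho> where "representation G d \<rho>"
    "\<And>g. g \<in> carrier G \<Longrightarrow> trace_mat (\<rho> g) = of_nat (card {x \<in> X. act g x = x})"
proof -
  define d where "d = card X"
  obtain e where e: "bij_betw e {..<d} X"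
    using ex_bij_betw_nat_finite[OF X] unfolding d_def atLeast0LessThan by auto
  have eX: "e i \<in> X" if "i < d" for i using e that by (auto simp: bij_betw_def)
  have einj: "e i = e j \<longleftrightarrow> i = j" if "i < d" "j < d" for i j
    using e that by (auto simp: bij_betw_def inj_on_def)
  define \<rho> where "\<rho> g = mat d d (\<lambda>(i, j). if act g (e j) = e i then 1 else 0 :: complex)" for g
  have "representation G d \<rho>"
    unfolding representation_iff
  proof (intro conjI ballI)
    fix g h assume g: "g \<in> carrier G" and h: "h \<in> carrier G"
    show "\<rho> (g \<otimes> h) = \<rho> g * \<rho> h"
    proof (rule eq_matI)
      fix i j assume "i < dim_row (\<rho> g * \<rho> h)" "j < dim_col (\<rho> g * \<rho> h)"
      then have ij: "i < d" "j < d" by (auto simp: \<rho>_def)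
      obtain l where l: "l < d" "act h (e j) = e l"
        using closed[OF h eX[OF ij(2)]] e unfolding bij_betw_def by blast
      have "(\<rho> g * \<rho> h) $$ (i, j) = (\<Sum>a<d. (if act g (e a) = e i then 1 else 0) * (if l = a then 1 else 0))"
        using ij l by (auto simp: \<rho>_def scalar_prod_def atLeast0LessThan einj intro!: sum.cong)
      also have "\<dots> = (if act g (e l) = e i then 1 else 0)"
        using l(1) by (simp add: if_distrib[of "times _"] cong: if_cong)
      also have "\<dots> = \<rho> (g \<otimes> h) $$ (i, j)" using ij mult[OF g h eX[OF ij(2)]] l(2) by (simp add: \<rho>_def)
      finally show "\<rho> (g \<otimes> h) $$ (i, j) = (\<rho> g * \<rho> h) $$ (i, j)" by simp
    qed (auto simp: \<rho>_def)
  next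
    show "\<rho> \<one> = 1\<^sub>m d" by (rule eq_matI) (auto simp: \<rho>_def one eX einj)
  qed (auto simp: \<rho>_def)
  moreover have "trace_mat (\<rho> g) = of_nat (card {x \<in> X. act g x = x})" if "g \<in> carrier G" for g
  proof -
    have "trace_mat (\<rho> g) = of_nat (card {i \<in> {..<d}. act g (e i) = e i})"
      by (simp add: trace_mat_def \<rho>_def sum.If_cases Int_def)
    also have "card {i \<in> {..<d}. act g (e i) = e i} = card {x \<in> X. act g x = x}"
      using e by (intro bij_betw_same_card[of e] bij_betw_imageI) (auto simp: bij_betw_def inj_on_def)
    finally show ?thesis .
  qed
  ultimately show ?thesis using that by blast
qed

text \<open>Every irreducible \<open>\<chi>\<close> occurs: in its inner product with the regular
  character only the identity contributes, and \<open>\<chi> \<one>\<close> is not zero. The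
  multiplicities stay implicit in the multiset.\<close>

lemma regular_character:
  obtains M where "set_mset M = irr_chars G"
    "\<And>g. g \<in> carrier G \<Longrightarrow> (\<Sum>\<chi>\<in>#M. \<chi> g) = (if g = \<one> then of_nat (Coset.order G) else 0)"
proof -
  obtain d \<rho> where r: "representation G d \<rho>"
    and t: "\<And>g. g \<in> carrier G \<Longrightarrow> trace_mat (\<rho> g) = of_nat (card {x \<in> carrier G. g \<otimes> x = x})"
    by (rule permutation_representation[of "carrier G" "\<lambda>g x. g \<otimes> x"]) (auto simp: m_assoc)
  obtain M where M: "set_mset M \<subseteq> irr_chars G" "\<forall>g\<in>carrier G. trace_mat (\<rho> g) = (\<Sum>\<chi>\<in>#M. \<chi> g)"
    using rep_trace_decomp[OF r] by blast
  have val: "(\<Sum>\<chi>\<in>#M. \<chi> g) = (if g = \<one> then of_nat (Coset.order G) else 0)" if g: "g \<in> carrier G" for g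
  proof -
    have "{x \<in> carrier G. g \<otimes> x = x} = (if g = \<one> then carrier G else {})"
      using g by (auto simp: r_cancel_one')
    then show ?thesis using M(2) t[OF g] g by (auto simp: Coset.order_def)
  qed
  have "\<chi> \<in># M" if chi: "\<chi> \<in> irr_chars G" for \<chi>
  proof (rule ccontr)
    assume n: "\<chi> \<notin># M"
    have "(\<Sum>g\<in>carrier G. (\<Sum>\<psi>\<in>#N. \<psi> g) * \<chi> (inv g)) = 0"
      if "set_mset N \<subseteq> irr_chars G" "\<chi> \<notin># N" for N
      using that
    proof (induction N)
      case (add \<psi> N)
      then have "\<psi> \<in> irr_chars G" "\<psi> \<noteq> \<chi>" by auto
      then have "(\<Sum>g\<in>carrier G. \<psi> g * \<chi> (inv g)) = 0"
        using irr_chars_orthonormal[of \<psi> \<chi>] chi order_pos by (simp add: char_inner_eq_sum_inv)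
      then show ?case using add by (simp add: distrib_right sum.distrib)
    qed simp
    from this[OF M(1) n] have "(\<Sum>g\<in>carrier G. (\<Sum>\<psi>\<in>#M. \<psi> g) * \<chi> (inv g)) = 0" .
    moreover have "(\<Sum>g\<in>carrier G. (\<Sum>\<psi>\<in>#M. \<psi> g) * \<chi> (inv g))
       = (\<Sum>g\<in>carrier G. if g = \<one> then of_nat (Coset.order G) * \<chi> \<one> else 0)"
      by (intro sum.cong refl) (auto simp: val)
    ultimately have "of_nat (Coset.order G) * \<chi> \<one> = 0" by simp
    moreover obtain d where "\<chi> \<one> = of_nat d" "d > 0" by (rule irr_char_degree[OF chi])
    ultimately show False using order_pos by simp
  qed
  then have "set_mset M = irr_chars G" using M(1) by blast
  from that[OF this val] show ?thesis .
qed

lemma finite_irr_chars [simp]: "finite (irr_chars G)"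
proof -
  obtain M where "set_mset M = irr_chars G" by (rule regular_character) (rule that)
  then show ?thesis by (metis finite_set_mset)
qed

text \<open>Convolution with \<open>f'\<close> annihilates every irreducible character and hence the
  regular one; but convolution with the regular character returns a nonzero multiple of
  \<open>f x\<close>.\<close>

theorem class_function_complete:
  assumes f: "class_function f" and orth: "\<And>\<chi>. \<chi> \<in> irr_chars G \<Longrightarrow> char_inner G f \<chi> = 0"
    and x: "x \<in> carrier G"
  shows "f x = 0"
proof -
  \<comment> \<open>Inversion absorbs the complex conjugation in \<open>char_inner\<close>, as
    \<open>\<chi> (inv g) = cnj (\<chi> g)\<close>.\<close>
  define f' where "f' g = f (inv g)" for g
  have "inv (h \<otimes> g \<otimes> inv h) = h \<otimes> inv g \<otimes> inv h" if "g \<in> carrier G" "h \<in> carrier G" for g h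
    using that by (simp add: inv_mult_group m_assoc)
  then have f': "class_function f'"
    using f unfolding class_function_def f'_def by simp
  obtain M where M: "set_mset M = irr_chars G"
    and val: "\<And>g. g \<in> carrier G \<Longrightarrow> (\<Sum>\<chi>\<in>#M. \<chi> g) = (if g = \<one> then of_nat (Coset.order G) else 0)"
    by (rule regular_character) (rule that)
  have z: "(\<Sum>g\<in>carrier G. f' g * \<chi> (g \<otimes> x)) = 0" if chi: "\<chi> \<in> irr_chars G" for \<chi>
  proof -
    have "(\<Sum>g\<in>carrier G. f' g * \<chi> g) = (\<Sum>g\<in>carrier G. f g * \<chi> (inv g))"
      using sum_inverse[of "\<lambda>g. f g * \<chi> (inv g)"] by (simp add: f'_def cong: sum.cong)
    also have "\<dots> = 0" using orth[OF chi] order_pos by (simp add: char_inner_eq_sum_inv[OF chi])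
    finally show ?thesis using class_function_convolution[OF chi f' x] by simp
  qed
  have "(\<Sum>g\<in>carrier G. f' g * (\<Sum>\<chi>\<in>#N. \<chi> (g \<otimes> x))) = 0" if "set_mset N \<subseteq> irr_chars G" for N
    using that by (induction N) (auto simp: distrib_left sum.distrib z)
  from this[of M] have z: "(\<Sum>g\<in>carrier G. f' g * (\<Sum>\<chi>\<in>#M. \<chi> (g \<otimes> x))) = 0" using M by simp
  have "g \<otimes> x = \<one> \<longleftrightarrow> g = inv x" if "g \<in> carrier G" for g
    using that x by (metis inv_equality l_inv)
  then have "(\<Sum>g\<in>carrier G. f' g * (\<Sum>\<chi>\<in>#M. \<chi> (g \<otimes> x)))
      = (\<Sum>g\<in>carrier G. f' g * (if g = inv x then of_nat (Coset.order G) else 0))"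
    using x by (intro sum.cong refl) (simp add: val)
  with z have "(\<Sum>g\<in>carrier G. f' g * (if g = inv x then of_nat (Coset.order G) else 0)) = 0" by simp
  then have "f' (inv x) * of_nat (Coset.order G) = 0" using x
    by (simp add: if_distrib[of "times _"] cong: if_cong)
  then show ?thesis using order_pos x by (simp add: f'_def)
qed

lemma char_inner_add: "char_inner G (\<lambda>g. f g + h g) \<chi> = char_inner G f \<chi> + char_inner G h \<chi>"
  by (simp add: char_inner_def distrib_right sum.distrib add_divide_distrib)

lemma char_inner_diff: "char_inner G (\<lambda>g. f g - h g) \<chi> = char_inner G f \<chi> - char_inner G h \<chi>"
  by (simp add: char_inner_def left_diff_distrib sum_subtractf diff_divide_distrib)

lemma char_inner_sum:
  "char_inner G (\<lambda>g. \<Sum>i\<in>I. a i * f i g) \<chi> = (\<Sum>i\<in>I. a i * char_inner G (f i) \<chi>)"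
proof -
  have "(\<Sum>g\<in>carrier G. (\<Sum>i\<in>I. a i * f i g) * cnj (\<chi> g))
      = (\<Sum>g\<in>carrier G. \<Sum>i\<in>I. a i * (f i g * cnj (\<chi> g)))"
    by (simp add: sum_distrib_right mult.assoc)
  also have "\<dots> = (\<Sum>i\<in>I. a i * (\<Sum>g\<in>carrier G. f i g * cnj (\<chi> g)))"
    by (subst sum.swap) (simp add: sum_distrib_left)
  finally show ?thesis by (simp only: char_inner_def times_divide_eq_right sum_divide_distrib[symmetric])
qed

lemma char_inner_cong:
  "(\<And>g. g \<in> carrier G \<Longrightarrow> f g = f' g) \<Longrightarrow> (\<And>g. g \<in> carrier G \<Longrightarrow> h g = h' g) \<Longrightarrow>
    char_inner G f h = char_inner G f' h'"
  unfolding char_inner_def by (intro arg_cong2[where f = "(/)"] sum.cong refl) simp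

lemma char_inner_commute: "char_inner G f h = cnj (char_inner G h f)"
  unfolding char_inner_def by (simp add: mult.commute[of "f _"])

theorem class_function_expansion:
  assumes f: "class_function f" and x: "x \<in> carrier G"
  shows "f x = (\<Sum>\<chi>\<in>irr_chars G. char_inner G f \<chi> * \<chi> x)"
proof -
  let ?h = "\<lambda>g. f g - (\<Sum>\<chi>\<in>irr_chars G. char_inner G f \<chi> * \<chi> g)"
  have "class_function ?h"
    using f unfolding class_function_def by (auto simp: irr_char_conj cong: sum.cong)
  moreover have "char_inner G ?h \<chi> = 0" if "\<chi> \<in> irr_chars G" for \<chi>
    using that by (simp add: char_inner_diff char_inner_sum irr_chars_orthonormal if_distrib[of "times _"] cong: if_cong sum.cong)
  ultimately have "?h x = 0" using x by (rule class_function_complete)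
  then show ?thesis by simp
qed

corollary parseval:
  assumes f: "class_function f"
  shows "char_inner G f h = (\<Sum>\<chi>\<in>irr_chars G. char_inner G f \<chi> * char_inner G \<chi> h)"
proof -
  have "char_inner G f h = char_inner G (\<lambda>g. \<Sum>\<chi>\<in>irr_chars G. char_inner G f \<chi> * \<chi> g) h"
    using class_function_expansion[OF f] by (intro char_inner_cong) auto
  then show ?thesis by (simp only: char_inner_sum)
qed

subsection \<open>Conjugacy classes\<close>

definition conj_class :: "'a \<Rightarrow> 'a set" where
  "conj_class g = {h \<otimes> g \<otimes> inv h | h. h \<in> carrier G}"

lemma conj_classes_eq: "conj_classes G = conj_class ` carrier G"
  unfolding conj_classes_def orbits_def Group_Action.orbit_def conj_class_def
  by (simp only: Setcompr_eq_image)

lemma conj_class_self: "g \<in> carrier G \<Longrightarrow> g \<in> conj_class g"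
  unfolding conj_class_def by (auto intro!: exI[of _ \<one>])

lemma conj_class_closed: "g \<in> carrier G \<Longrightarrow> conj_class g \<subseteq> carrier G"
  unfolding conj_class_def by auto

lemma finite_conj_class: "g \<in> carrier G \<Longrightarrow> finite (conj_class g)"
  by (rule finite_subset[OF conj_class_closed]) auto

lemma card_conj_class_pos: "g \<in> carrier G \<Longrightarrow> card (conj_class g) > 0"
  using conj_class_self[of g] finite_conj_class[of g] by (auto simp: card_gt_0_iff)

lemma conj_class_sym:
  assumes g: "g \<in> carrier G" and h: "h \<in> conj_class g"
  shows "g \<in> conj_class h"
proof -
  obtain a where a: "a \<in> carrier G" "h = a \<otimes> g \<otimes> inv a" using h unfolding conj_class_def by blast
  then have "g = inv a \<otimes> h \<otimes> inv (inv a)" using g by (simp add: m_assoc inv_cancel_left)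
  then show ?thesis using a(1) unfolding conj_class_def by blast
qed

lemma conj_class_trans: "g \<in> carrier G \<Longrightarrow> h \<in> conj_class g \<Longrightarrow> k \<in> conj_class h \<Longrightarrow> k \<in> conj_class g"
proof -
  assume g: "g \<in> carrier G" and "h \<in> conj_class g" "k \<in> conj_class h"
  then obtain a b where ab: "a \<in> carrier G" "b \<in> carrier G" "k = b \<otimes> (a \<otimes> g \<otimes> inv a) \<otimes> inv b"
    unfolding conj_class_def by auto
  then have "k = (b \<otimes> a) \<otimes> g \<otimes> inv (b \<otimes> a)" using g by (simp add: m_assoc inv_mult_group)
  then show ?thesis using ab unfolding conj_class_def by blast
qed

lemma conj_class_eq: "g \<in> carrier G \<Longrightarrow> h \<in> conj_class g \<Longrightarrow> conj_class h = conj_class g"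
  using conj_class_trans[of g h] conj_class_trans[of h g] conj_class_sym[of g h] conj_class_closed[of g] by blast

lemma conj_class_conj:
  assumes "g \<in> carrier G" "h \<in> carrier G" "x \<in> carrier G"
  shows "h \<otimes> x \<otimes> inv h \<in> conj_class g \<longleftrightarrow> x \<in> conj_class g"
proof -
  have "h \<otimes> x \<otimes> inv h \<in> conj_class x" using assms unfolding conj_class_def by blast
  then show ?thesis
    using conj_class_trans[of g x "h \<otimes> x \<otimes> inv h"] conj_class_trans[of g "h \<otimes> x \<otimes> inv h" x]
      conj_class_sym[of x "h \<otimes> x \<otimes> inv h"] assms by blast
qed

lemma conj_classes_eq_class: "K \<in> conj_classes G \<Longrightarrow> g \<in> K \<Longrightarrow> g \<in> carrier G \<and> K = conj_class g"
  unfolding conj_classes_eq using conj_class_eq[of _ g] conj_class_closed by auto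

lemma irr_char_class: "\<chi> \<in> irr_chars G \<Longrightarrow> g \<in> carrier G \<Longrightarrow> h \<in> conj_class g \<Longrightarrow> \<chi> h = \<chi> g"
  unfolding conj_class_def by (auto simp: irr_char_conj)

lemma char_inner_indicator:
  assumes chi: "\<chi> \<in> irr_chars G" and g: "g \<in> carrier G"
  shows "char_inner G (\<lambda>x. if x \<in> conj_class g then 1 else 0) \<chi>
    = of_nat (card (conj_class g)) * cnj (\<chi> g) / of_nat (Coset.order G)"
proof -
  have "(\<Sum>x\<in>carrier G. (if x \<in> conj_class g then 1 else 0) * cnj (\<chi> x)) = (\<Sum>x\<in>conj_class g. cnj (\<chi> x))"
    using conj_class_closed[OF g]
    by (simp add: if_distrib[of "\<lambda>x. x * _"] sum.If_cases Int_absorb1 cong: if_cong)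
  also have "\<dots> = of_nat (card (conj_class g)) * cnj (\<chi> g)"
    using irr_char_class[OF chi g] by (simp cong: sum.cong)
  finally show ?thesis by (simp add: char_inner_def)
qed

lemma class_function_indicator:
  "g \<in> carrier G \<Longrightarrow> class_function (\<lambda>x. if x \<in> conj_class g then 1 else 0)"
  unfolding class_function_def by (auto simp: conj_class_conj)

lemma indicator_expansion:
  assumes g: "g \<in> carrier G" and x: "x \<in> carrier G"
  shows "(if x \<in> conj_class g then 1 else 0) =
    (\<Sum>\<chi>\<in>irr_chars G. of_nat (card (conj_class g)) * cnj (\<chi> g) / of_nat (Coset.order G) * \<chi> x)"
  using class_function_expansion[OF class_function_indicator[OF g] x] char_inner_indicator[OF _ g]
  by (simp cong: sum.cong)

text \<open>This is the expansion of the indicator function of the class of \<open>g\<close>, whose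
  coefficients are the conjugate values at \<open>g\<close> up to a common factor.\<close>

theorem column_orthogonality:
  assumes g: "g \<in> carrier G" and x: "x \<in> carrier G"
  shows "(\<Sum>\<chi>\<in>irr_chars G. \<chi> x * cnj (\<chi> g)) =
    (if x \<in> conj_class g then of_nat (Coset.order G) / of_nat (card (conj_class g)) else 0)"
proof -
  have "(if x \<in> conj_class g then 1 else 0) =
    (\<Sum>\<chi>\<in>irr_chars G. of_nat (card (conj_class g)) * cnj (\<chi> g) / of_nat (Coset.order G) * \<chi> x)"
    by (rule indicator_expansion[OF g x])
  also have "\<dots> = of_nat (card (conj_class g)) / of_nat (Coset.order G) * (\<Sum>\<chi>\<in>irr_chars G. \<chi> x * cnj (\<chi> g))"
    by (simp add: sum_distrib_left mult_ac)
  finally have "(\<Sum>\<chi>\<in>irr_chars G. \<chi> x * cnj (\<chi> g)) =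
    (if x \<in> conj_class g then 1 else 0) * of_nat (Coset.order G) / of_nat (card (conj_class g))"
    using order_pos card_conj_class_pos[OF g] by (simp add: field_simps)
  then show ?thesis by simp
qed

text \<open>The norms of all irreducible characters are summed in two orders: each row contributes
  1, and each class \<open>K\<close> contributes \<open>card K\<close> terms
  \<open>1 / card K\<close>.\<close>

theorem card_irr_chars: "card (irr_chars G) = card (conj_classes G)"
proof -
  have "of_nat (card (irr_chars G)) = (\<Sum>\<chi>\<in>irr_chars G. char_inner G \<chi> \<chi>)"
    by (simp add: irr_chars_orthonormal)
  also have "\<dots> = (\<Sum>g\<in>carrier G. \<Sum>\<chi>\<in>irr_chars G. \<chi> g * cnj (\<chi> g)) / of_nat (Coset.order G)"
    by (simp add: char_inner_def sum_divide_distrib sum.swap[of _ "irr_chars G"])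
  also have "\<dots> = (\<Sum>g\<in>carrier G. 1 / of_nat (card (conj_class g)))"
    using order_pos by (simp add: column_orthogonality conj_class_self sum_divide_distrib)
  also have "\<dots> = (\<Sum>K\<in>conj_classes G. \<Sum>g\<in>{g \<in> carrier G. conj_class g = K}. 1 / of_nat (card (conj_class g)))"
    by (intro sum.group[symmetric]) (auto simp: conj_classes_eq)
  also have "\<dots> = (\<Sum>K\<in>conj_classes G. 1)"
  proof (intro sum.cong refl)
    fix K assume K: "K \<in> conj_classes G"
    then have e: "{g \<in> carrier G. conj_class g = K} = K"
      using conj_classes_eq_class conj_class_self by blast
    have "(\<Sum>g\<in>{g \<in> carrier G. conj_class g = K}. 1 / of_nat (card (conj_class g))) = (\<Sum>g\<in>K. 1 / of_nat (card K) :: complex)"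
      by (intro sum.cong) (use e in auto)
    also have "\<dots> = 1"
    proof -
      have "card K \<noteq> 0" using K card_conj_class_pos by (auto simp: conj_classes_eq)
      then show ?thesis by simp
    qed
    finally show "(\<Sum>g\<in>{g \<in> carrier G. conj_class g = K}. 1 / of_nat (card (conj_class g))) = (1::complex)" .
  qed
  finally show ?thesis by (simp add: of_nat_eq_iff)
qed

text \<open>The sum over the class of \<open>k\<close> acts on the representation of
  \<open>\<chi>\<close> as the scalar \<open>card (conj_class k) * \<chi> k / \<chi> \<one>\<close>;
  expanding the indicator of the class of \<open>d\<close> then expresses the structure constants of
  the class algebra through the table.\<close>

theorem class_algebra_constant:
  assumes k: "k \<in> carrier G" and d: "d \<in> carrier G" and x: "x \<in> carrier G"
  shows "of_nat (card {y \<in> conj_class k. y \<otimes> x \<in> conj_class d}) =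
    (\<Sum>\<chi>\<in>irr_chars G. of_nat (card (conj_class d)) * cnj (\<chi> d) / of_nat (Coset.order G) *
       (of_nat (card (conj_class k)) * \<chi> k * \<chi> x / \<chi> \<one>))"
proof -
  have act: "(\<Sum>y\<in>conj_class k. \<chi> (y \<otimes> x)) = of_nat (card (conj_class k)) * \<chi> k * \<chi> x / \<chi> \<one>"
    if chi: "\<chi> \<in> irr_chars G" for \<chi>
  proof -
    let ?f = "\<lambda>y. if y \<in> conj_class k then 1 else 0 :: complex"
    have e: "(\<Sum>y\<in>carrier G. ?f y * F y) = (\<Sum>y\<in>conj_class k. F y)" for F
      using conj_class_closed[OF k]
      by (simp add: if_distrib[of "\<lambda>x. x * _"] sum.If_cases Int_absorb1 cong: if_cong)
    have "(\<Sum>y\<in>conj_class k. \<chi> y) = of_nat (card (conj_class k)) * \<chi> k"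
      using irr_char_class[OF chi k] by (simp cong: sum.cong)
    then show ?thesis
      using class_function_convolution[OF chi class_function_indicator[OF k] x] by (simp add: e)
  qed
  have "of_nat (card {y \<in> conj_class k. y \<otimes> x \<in> conj_class d})
     = (\<Sum>y\<in>conj_class k. if y \<otimes> x \<in> conj_class d then 1 else 0 :: complex)"
    using finite_conj_class[OF k] by (simp add: sum.If_cases Int_def)
  also have "\<dots> = (\<Sum>y\<in>conj_class k. \<Sum>\<chi>\<in>irr_chars G.
     of_nat (card (conj_class d)) * cnj (\<chi> d) / of_nat (Coset.order G) * \<chi> (y \<otimes> x))"
    using conj_class_closed[OF k] x by (intro sum.cong refl indicator_expansion[OF d]) auto
  also have "\<dots> = (\<Sum>\<chi>\<in>irr_chars G. of_nat (card (conj_class d)) * cnj (\<chi> d) / of_nat (Coset.order G) *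
       (\<Sum>y\<in>conj_class k. \<chi> (y \<otimes> x)))"
    by (subst sum.swap) (simp add: sum_distrib_left)
  finally show ?thesis by (simp add: act cong: sum.cong)
qed

subsection \<open>Characters of arbitrary representations\<close>

lemma char_inner_mset:
  assumes "set_mset M \<subseteq> irr_chars G" "\<chi> \<in> irr_chars G"
  shows "char_inner G (\<lambda>g. \<Sum>\<psi>\<in>#M. \<psi> g) \<chi> = of_nat (count M \<chi>)"
  using assms
proof (induction M)
  case empty then show ?case by (simp add: char_inner_def)
next
  case (add \<psi> M)
  then show ?case by (simp add: char_inner_add irr_chars_orthonormal)
qed

lemma rep_multiplicity:
  assumes r: "representation G d \<rho>" and chi: "\<chi> \<in> irr_chars G"
  shows "char_inner G (\<lambda>g. trace_mat (\<rho> g)) \<chi> \<in> \<nat>"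
proof -
  obtain M where M: "set_mset M \<subseteq> irr_chars G" "\<forall>g\<in>carrier G. trace_mat (\<rho> g) = (\<Sum>\<chi>\<in>#M. \<chi> g)"
    using rep_trace_decomp[OF r] by blast
  then have "char_inner G (\<lambda>g. trace_mat (\<rho> g)) \<chi> = char_inner G (\<lambda>g. \<Sum>\<psi>\<in>#M. \<psi> g) \<chi>"
    by (intro char_inner_cong) auto
  then show ?thesis using char_inner_mset[OF M(1) chi] by simp
qed

lemma class_function_rep: "representation G d \<rho> \<Longrightarrow> class_function (\<lambda>g. trace_mat (\<rho> g))"
  unfolding class_function_def by (auto simp: rep_trace_conj)

text \<open>The coefficients are natural numbers whose squares sum to 1, so exactly one of them is
  1. The statement is about class functions because it also serves for a permutation character minus
  1, which comes without a representation.\<close>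

lemma norm_1_class_function:
  assumes f: "class_function f" and nat: "\<And>\<chi>. \<chi> \<in> irr_chars G \<Longrightarrow> char_inner G f \<chi> \<in> \<nat>"
    and n: "char_inner G f f = 1"
  shows "restrict f (carrier G) \<in> irr_chars G"
proof -
  have "\<exists>m::nat. char_inner G f \<chi> = of_nat m" if "\<chi> \<in> irr_chars G" for \<chi>
    using nat[OF that] by (auto elim: Nats_cases)
  then obtain m :: "('a \<Rightarrow> complex) \<Rightarrow> nat" where m: "\<And>\<chi>. \<chi> \<in> irr_chars G \<Longrightarrow> char_inner G f \<chi> = of_nat (m \<chi>)"
    by metis
  have "char_inner G f f = (\<Sum>\<chi>\<in>irr_chars G. char_inner G f \<chi> * char_inner G \<chi> f)"
    by (rule parseval[OF f])
  also have "\<dots> = (\<Sum>\<chi>\<in>irr_chars G. of_nat (m \<chi>) * of_nat (m \<chi>))"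
    by (intro sum.cong refl, subst (2) char_inner_commute) (simp add: m)
  finally have "of_nat (\<Sum>\<chi>\<in>irr_chars G. m \<chi> * m \<chi>) = (of_nat 1 :: complex)" using n by simp
  then have "(\<Sum>\<chi>\<in>irr_chars G. m \<chi> * m \<chi>) = 1" by (simp only: of_nat_eq_iff)
  then obtain \<chi> where chi: "\<chi> \<in> irr_chars G" and "m \<chi> * m \<chi> = 1"
    and "\<forall>\<psi>\<in>irr_chars G. \<chi> \<noteq> \<psi> \<longrightarrow> m \<psi> * m \<psi> = 0"
    unfolding sum_eq_1_iff[OF finite_irr_chars] by blast
  then have m1: "m \<chi> = 1" and m0: "\<And>\<psi>. \<psi> \<in> irr_chars G \<Longrightarrow> \<psi> \<noteq> \<chi> \<Longrightarrow> m \<psi> = 0" by auto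
  have "f g = \<chi> g" if g: "g \<in> carrier G" for g
  proof -
    have "f g = (\<Sum>\<psi>\<in>irr_chars G. of_nat (m \<psi>) * \<psi> g)"
      using class_function_expansion[OF f g] m by (simp cong: sum.cong)
    also have "\<dots> = (\<Sum>\<psi>\<in>irr_chars G. if \<psi> = \<chi> then \<chi> g else 0)"
      using m0 m1 by (intro sum.cong) auto
    finally show ?thesis using chi by simp
  qed
  then have "restrict f (carrier G) = \<chi>"
    using irr_char_extensional[OF chi] by (intro extensionalityI[of _ "carrier G"]) auto
  then show ?thesis using chi by simp
qed

lemma norm_1_irreducible:
  assumes r: "representation G d \<rho>" and n: "char_inner G (\<lambda>g. trace_mat (\<rho> g)) (\<lambda>g. trace_mat (\<rho> g)) = 1"
  shows "restrict (\<lambda>g. trace_mat (\<rho> g)) (carrier G) \<in> irr_chars G"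
  using norm_1_class_function[OF class_function_rep[OF r] rep_multiplicity[OF r] n] .

lemma linear_character:
  assumes one: "\<epsilon> \<one> = 1" and mult: "\<And>g h. g \<in> carrier G \<Longrightarrow> h \<in> carrier G \<Longrightarrow> \<epsilon> (g \<otimes> h) = \<epsilon> g * \<epsilon> h"
  shows "restrict \<epsilon> (carrier G) \<in> irr_chars G"
proof -
  define \<rho> where "\<rho> g = mat 1 1 (\<lambda>_. \<epsilon> g)" for g
  have r: "representation G 1 \<rho>"
    unfolding representation_iff
    by (auto simp: \<rho>_def one mult scalar_prod_def intro!: eq_matI)
  have t: "trace_mat (\<rho> g) = \<epsilon> g" for g by (simp add: trace_mat_def \<rho>_def)
  have c: "\<epsilon> g * cnj (\<epsilon> g) = 1" if g: "g \<in> carrier G" for g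
    using rep_trace_inv[OF r g] mult[of g "inv g"] g one by (simp add: t)
  have "char_inner G (\<lambda>g. trace_mat (\<rho> g)) (\<lambda>g. trace_mat (\<rho> g)) = 1"
    using order_pos one_closed by (auto simp: t char_inner_def c Coset.order_def cong: sum.cong)
  from norm_1_irreducible[OF r this] show ?thesis by (simp add: t)
qed

lemma representation_twist:
  assumes r: "representation G d \<rho>" and one: "\<epsilon> \<one> = 1"
    and mult: "\<And>g h. g \<in> carrier G \<Longrightarrow> h \<in> carrier G \<Longrightarrow> \<epsilon> (g \<otimes> h) = \<epsilon> g * \<epsilon> h"
  shows "representation G d (\<lambda>g. \<epsilon> g \<cdot>\<^sub>m \<rho> g)"
proof -
  note R = representationD[OF r]
  show ?thesis
    unfolding representation_iff
  proof (intro conjI ballI)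
    fix g h assume g: "g \<in> carrier G" and h: "h \<in> carrier G"
    show "\<epsilon> (g \<otimes> h) \<cdot>\<^sub>m \<rho> (g \<otimes> h) = \<epsilon> g \<cdot>\<^sub>m \<rho> g * (\<epsilon> h \<cdot>\<^sub>m \<rho> h)"
      using R(1)[OF g] R(1)[OF h]
      by (intro eq_matI) (auto simp: R(2)[OF g h] mult[OF g h] scalar_prod_def sum_distrib_left mult_ac)
  qed (use R one in \<open>auto intro!: eq_matI\<close>)
qed

end

section \<open>Cycle types\<close>

text \<open>Bijections between corresponding fibres are glued together. This matches cycles of equal
  length, and points of a row or column with the cells of a diagram.\<close>

lemma ex_bij_betw_fibres:
  assumes A: "finite A" and B: "finite B"
    and card: "\<And>k. card {a \<in> A. f a = k} = card {b \<in> B. g b = k}"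
  shows "\<exists>\<theta>. bij_betw \<theta> A B \<and> (\<forall>a\<in>A. g (\<theta> a) = f a)"
proof -
  have "\<exists>h. bij_betw h {a \<in> A. f a = k} {b \<in> B. g b = k}" for k
    using A B card[of k] by (intro finite_same_card_bij) auto
  then obtain h where h: "\<And>k. bij_betw (h k) {a \<in> A. f a = k} {b \<in> B. g b = k}" by metis
  define \<theta> where "\<theta> a = h (f a) a" for a
  have val: "\<theta> a \<in> B \<and> g (\<theta> a) = f a" if "a \<in> A" for a
    using bij_betwE[OF h[of "f a"]] that unfolding \<theta>_def by auto
  have "inj_on \<theta> A"
  proof (rule inj_onI)
    fix a b assume ab: "a \<in> A" "b \<in> A" "\<theta> a = \<theta> b"
    then have "f a = f b" using val by metis
    then show "a = b" using ab bij_betw_imp_inj_on[OF h[of "f b"]] unfolding \<theta>_def inj_on_def by auto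
  qed
  moreover have "B \<subseteq> \<theta> ` A"
  proof
    fix b assume "b \<in> B"
    then have "b \<in> h (g b) ` {a \<in> A. f a = g b}" using bij_betw_imp_surj_on[OF h[of "g b"]] by auto
    then obtain a where a: "a \<in> A" "f a = g b" "b = h (g b) a" by auto
    then have "b = \<theta> a" by (simp add: \<theta>_def)
    then show "b \<in> \<theta> ` A" using a by blast
  qed
  ultimately have "bij_betw \<theta> A B" using val by (intro bij_betw_imageI) auto
  then show ?thesis using val by blast
qed

lemma permutation_if_permutes: "\<sigma> permutes {1..n::nat} \<Longrightarrow> permutation \<sigma>"
  using permutation_permutes by blast

lemma orbit_eq_support:
  assumes "permutation \<sigma>"
  shows "Orbits.orbit \<sigma> x = set (support \<sigma> x)"
  unfolding support_set[OF assms] orbit_altdef_permutation[OF assms] by auto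

lemma card_orbit:
  assumes "permutation \<sigma>"
  shows "card (Orbits.orbit \<sigma> x) = least_power \<sigma> x"
  unfolding orbit_eq_support[OF assms] using distinct_card[OF cycle_of_permutation[OF assms, of x]] by simp

lemma orbit_eq_iff:
  assumes "permutation \<sigma>"
  shows "Orbits.orbit \<sigma> x = Orbits.orbit \<sigma> y \<longleftrightarrow> x \<in> Orbits.orbit \<sigma> y"
  using assms permutation_self_in_orbit[OF assms]
  by (metis cyclic_on_orbit' orbit_cyclic_eq3)

lemma least_power_orbit:
  assumes "permutation \<sigma>" "x \<in> Orbits.orbit \<sigma> y"
  shows "least_power \<sigma> x = least_power \<sigma> y"
  using assms orbit_eq_iff[OF assms(1)] card_orbit[OF assms(1)] by metis

lemma least_power_pos: "permutation \<sigma> \<Longrightarrow> least_power \<sigma> x > 0"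
  by (rule least_power_of_permutation(2))

lemma funpow_eq_iff:
  assumes p: "permutation p"
  shows "(p ^^ i) a = (p ^^ j) a \<longleftrightarrow> i mod least_power p a = j mod least_power p a"
proof -
  have inj: "inj p" using permutation_bijective[OF p] bij_is_inj by blast
  have le: "(p ^^ i) a = (p ^^ j) a \<longleftrightarrow> i mod least_power p a = j mod least_power p a" if "i \<le> j" for i j
  proof -
    have "(p ^^ i) a = (p ^^ j) a \<longleftrightarrow> (p ^^ (j - i)) a = a"
    proof
      assume "(p ^^ (j - i)) a = a"
      then have "(p ^^ i) ((p ^^ (j - i)) a) = (p ^^ i) a" by simp
      then show "(p ^^ i) a = (p ^^ j) a" using that by (metis add_diff_inverse_nat comp_apply funpow_add not_less)
    qed (use funpow_diff[OF inj that] in auto)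
    also have "\<dots> \<longleftrightarrow> least_power p a dvd (j - i)" by (rule least_power_dvd[OF p, symmetric])
    also have "\<dots> \<longleftrightarrow> i mod least_power p a = j mod least_power p a"
      using that by (metis mod_eq_dvd_iff_nat)
    finally show ?thesis .
  qed
  show ?thesis using le[of i j] le[of j i] by (cases "i \<le> j") auto
qed

text \<open>Counts the points on cycles of length \<open>k\<close>, that is, \<open>k\<close> times
  the number of such cycles; no representative has to be chosen for a cycle.\<close>

definition cycle_count :: "nat \<Rightarrow> (nat \<Rightarrow> nat) \<Rightarrow> nat \<Rightarrow> nat" where
  "cycle_count n \<sigma> k = card {x \<in> {1..n}. least_power \<sigma> x = k}"

lemma count_image_mset_set:
  assumes "finite A"
  shows "count (image_mset f (mset_set A)) k = card {a \<in> A. f a = k}"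
proof -
  have "count (image_mset f (mset_set A)) k = (\<Sum>a\<in>f -` {k} \<inter> A. count (mset_set A) a)"
    using assms by (simp add: count_image_mset)
  also have "\<dots> = (\<Sum>a\<in>f -` {k} \<inter> A. 1)" using assms by (intro sum.cong) auto
  also have "f -` {k} \<inter> A = {a \<in> A. f a = k}" by auto
  finally show ?thesis by simp
qed

lemma count_cycle_type:
  "count (cycle_type n \<sigma>) k = card {S \<in> Orbits.orbit \<sigma> ` {1..n}. card S = k}"
  unfolding cycle_type_def by (rule count_image_mset_set) simp

lemma mult_count_cycle_type:
  assumes s: "\<sigma> permutes {1..n}"
  shows "k * count (cycle_type n \<sigma>) k = cycle_count n \<sigma> k"
proof -
  note p = permutation_if_permutes[OF s]
  let ?C = "{S \<in> Orbits.orbit \<sigma> ` {1..n}. card S = k}"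
  have un: "\<Union>?C = {x \<in> {1..n}. least_power \<sigma> x = k}"
  proof (intro equalityI subsetI)
    fix x assume "x \<in> \<Union>?C"
    then obtain y where y: "y \<in> {1..n}" "card (Orbits.orbit \<sigma> y) = k" "x \<in> Orbits.orbit \<sigma> y" by auto
    then show "x \<in> {x \<in> {1..n}. least_power \<sigma> x = k}"
      using permutes_orbit_subset[OF s y(1)] least_power_orbit[OF p y(3)] card_orbit[OF p] by auto
  next
    fix x assume "x \<in> {x \<in> {1..n}. least_power \<sigma> x = k}"
    then show "x \<in> \<Union>?C" using permutation_self_in_orbit[OF p, of x] card_orbit[OF p, of x] by auto
  qed
  have "card (\<Union>?C) = (\<Sum>S\<in>?C. card S)"
  proof (rule card_Union_disjoint)
    show "pairwise disjnt ?C"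
      unfolding pairwise_def disjnt_def using orbit_eq_iff[OF p] by blast
    show "finite S" if "S \<in> ?C" for S
      using that permutation_self_in_orbit[OF p] by (auto intro: finite_orbit)
  qed
  also have "\<dots> = k * card ?C" by simp
  finally show ?thesis unfolding cycle_count_def count_cycle_type un by simp
qed

lemma zero_not_in_cycle_type:
  assumes s: "\<sigma> permutes {1..n}"
  shows "count (cycle_type n \<sigma>) 0 = 0"
proof -
  note p = permutation_if_permutes[OF s]
  have "{S \<in> Orbits.orbit \<sigma> ` {1..n}. card S = 0} = {}"
    using card_orbit[OF p] least_power_pos[OF p] by auto
  then show ?thesis unfolding count_cycle_type by simp
qed

lemma cycle_type_eq_iff:
  assumes s: "\<sigma> permutes {1..n}" and t: "\<tau> permutes {1..n}"
  shows "cycle_type n \<sigma> = cycle_type n \<tau> \<longleftrightarrow> (\<forall>k. cycle_count n \<sigma> k = cycle_count n \<tau> k)"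
proof
  assume c: "\<forall>k. cycle_count n \<sigma> k = cycle_count n \<tau> k"
  show "cycle_type n \<sigma> = cycle_type n \<tau>"
  proof (rule multiset_eqI)
    fix k
    have "k * count (cycle_type n \<sigma>) k = k * count (cycle_type n \<tau>) k"
      using c mult_count_cycle_type[OF s, of k] mult_count_cycle_type[OF t, of k] by simp
    then show "count (cycle_type n \<sigma>) k = count (cycle_type n \<tau>) k"
      using zero_not_in_cycle_type[OF s] zero_not_in_cycle_type[OF t] by (cases "k = 0") auto
  qed
qed (simp add: mult_count_cycle_type[OF s, symmetric] mult_count_cycle_type[OF t, symmetric])

lemma cycle_type_partition:
  assumes s: "\<sigma> permutes {1..n}"
  shows "cycle_type n \<sigma> \<in> partitions_of n"
proof -
  note p = permutation_if_permutes[OF s]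
  let ?C = "Orbits.orbit \<sigma> ` {1..n}"
  have "sum_mset (cycle_type n \<sigma>) = (\<Sum>S\<in>?C. card S)"
    unfolding cycle_type_def by (simp add: sum_unfold_sum_mset)
  also have "\<dots> = card (\<Union>?C)"
  proof (rule card_Union_disjoint[symmetric])
    show "pairwise disjnt ?C"
      unfolding pairwise_def disjnt_def using orbit_eq_iff[OF p] by blast
    show "finite S" if "S \<in> ?C" for S
      using that permutation_self_in_orbit[OF p] by (auto intro: finite_orbit)
  qed
  also have "\<Union>?C = {1..n}"
    using permutes_orbit_subset[OF s] permutation_self_in_orbit[OF p] by blast
  finally show ?thesis using zero_not_in_cycle_type[OF s]
    by (auto simp: partitions_of_def not_in_iff)
qed

lemma funpow_conj:
  assumes "\<And>x. \<pi> (\<sigma> x) = \<tau> (\<pi> x)"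
  shows "\<pi> ((\<sigma> ^^ k) x) = (\<tau> ^^ k) (\<pi> x)"
  by (induction k) (simp_all add: assms)

lemma least_power_conj:
  assumes "inj \<pi>" "\<And>x. \<pi> (\<sigma> x) = \<tau> (\<pi> x)"
  shows "least_power \<tau> (\<pi> x) = least_power \<sigma> x"
  unfolding least_power_def using assms by (simp add: funpow_conj[of \<pi> \<sigma> \<tau>, OF assms(2), symmetric] inj_eq)

lemma cycle_type_conj:
  assumes s: "\<sigma> permutes {1..n}" and t: "\<tau> permutes {1..n}" and p: "\<pi> permutes {1..n}"
    and c: "\<And>x. \<pi> (\<sigma> x) = \<tau> (\<pi> x)"
  shows "cycle_type n \<sigma> = cycle_type n \<tau>"
  unfolding cycle_type_eq_iff[OF s t]
proof
  fix k
  note inj = permutes_inj[OF p]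
  have "\<pi> ` {x \<in> {1..n}. least_power \<sigma> x = k} = {x \<in> {1..n}. least_power \<tau> x = k}"
  proof (intro equalityI subsetI)
    fix y assume y: "y \<in> {x \<in> {1..n}. least_power \<tau> x = k}"
    obtain x where x: "y = \<pi> x" using permutes_surj[OF p] by (metis surjD)
    then have "x \<in> {1..n}" using y permutes_in_image[OF p] by auto
    then show "y \<in> \<pi> ` {x \<in> {1..n}. least_power \<sigma> x = k}"
      using y x least_power_conj[of \<pi> \<sigma> \<tau>, OF inj c] by auto
  next
    fix y assume "y \<in> \<pi> ` {x \<in> {1..n}. least_power \<sigma> x = k}"
    then show "y \<in> {x \<in> {1..n}. least_power \<tau> x = k}"
      using permutes_in_image[OF p] least_power_conj[of \<pi> \<sigma> \<tau>, OF inj c] by auto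
  qed
  then show "cycle_count n \<sigma> k = cycle_count n \<tau> k"
    unfolding cycle_count_def using card_image[OF inj_on_subset[OF inj subset_UNIV]] by metis
qed

text \<open>A length-preserving bijection \<open>F\<close> of the cycles is combined with base
  points \<open>r\<close> and \<open>q\<close> on corresponding cycles; the conjugating permutation
  sends each \<open>(\<sigma> ^^ i) r\<close> to \<open>(\<tau> ^^ i) q\<close>.\<close>

lemma cycle_type_imp_conj:
  assumes s: "\<sigma> permutes {1..n}" and t: "\<tau> permutes {1..n}" and ct: "cycle_type n \<sigma> = cycle_type n \<tau>"
  obtains \<pi> where "\<pi> permutes {1..n}" "\<And>x. \<pi> (\<sigma> x) = \<tau> (\<pi> x)"
proof -
  note ps = permutation_if_permutes[OF s] and pt = permutation_if_permutes[OF t]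
  have "card {S \<in> Orbits.orbit \<sigma> ` {1..n}. card S = k} = card {S \<in> Orbits.orbit \<tau> ` {1..n}. card S = k}" for k
    using ct count_cycle_type count_cycle_type by metis
  then obtain F where F: "bij_betw F (Orbits.orbit \<sigma> ` {1..n}) (Orbits.orbit \<tau> ` {1..n})"
    and Fc: "\<And>S. S \<in> Orbits.orbit \<sigma> ` {1..n} \<Longrightarrow> card (F S) = card S"
    using ex_bij_betw_fibres[of "Orbits.orbit \<sigma> ` {1..n}" "Orbits.orbit \<tau> ` {1..n}" card card] by auto
  define r where "r x = (SOME y. y \<in> Orbits.orbit \<sigma> x)" for x
  define q where "q x = (SOME y. y \<in> F (Orbits.orbit \<sigma> x))" for x
  define i where "i x = (SOME i. (\<sigma> ^^ i) (r x) = x)" for x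
  define \<pi> where "\<pi> x = (if x \<in> {1..n} then (\<tau> ^^ i x) (q x) else x)" for x
  have r: "r x \<in> Orbits.orbit \<sigma> x" for x
    unfolding r_def using permutation_self_in_orbit[OF ps] by (rule someI)
  have i: "(\<sigma> ^^ i x) (r x) = x" for x
  proof -
    have "x \<in> Orbits.orbit \<sigma> (r x)" using r[of x] by (metis orbit_eq_iff ps permutation_self_in_orbit)
    then obtain j where "x = (\<sigma> ^^ j) (r x)" unfolding orbit_altdef_permutation[OF ps] by auto
    then have "(\<sigma> ^^ j) (r x) = x" by simp
    then show ?thesis unfolding i_def by (rule someI)
  qed
  have q: "q x \<in> F (Orbits.orbit \<sigma> x) \<and> F (Orbits.orbit \<sigma> x) = Orbits.orbit \<tau> (q x) \<and> q x \<in> {1..n}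
      \<and> least_power \<tau> (q x) = least_power \<sigma> (r x)" if x: "x \<in> {1..n}" for x
  proof -
    have "F (Orbits.orbit \<sigma> x) \<in> Orbits.orbit \<tau> ` {1..n}" using bij_betwE[OF F] x by blast
    then obtain y where y: "y \<in> {1..n}" "F (Orbits.orbit \<sigma> x) = Orbits.orbit \<tau> y" by blast
    then have "y \<in> F (Orbits.orbit \<sigma> x)" using permutation_self_in_orbit[OF pt] by simp
    then have q: "q x \<in> F (Orbits.orbit \<sigma> x)" unfolding q_def by (rule someI)
    then have e: "F (Orbits.orbit \<sigma> x) = Orbits.orbit \<tau> (q x)" using y(2) orbit_eq_iff[OF pt, of "q x" y] by simp
    have "card (F (Orbits.orbit \<sigma> x)) = least_power \<sigma> x" using Fc[of "Orbits.orbit \<sigma> x"] x card_orbit[OF ps] by simp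
    then have "least_power \<tau> (q x) = least_power \<sigma> (r x)"
      unfolding e using card_orbit[OF pt] least_power_orbit[OF ps r] by metis
    then show ?thesis using q e y permutes_orbit_subset[OF t y(1)] by auto
  qed
  have same: "r y = r x \<and> q y = q x" if "Orbits.orbit \<sigma> y = Orbits.orbit \<sigma> x" for x y
    unfolding r_def q_def that by simp
  \<comment> \<open>The exponent is determined only modulo the cycle length; the lengths at
    \<open>r x\<close> and \<open>q x\<close> agree, so every admissible exponent gives the same
    value.\<close>
  have pi: "\<pi> x = (\<tau> ^^ j) (q x)" if x: "x \<in> {1..n}" and j: "(\<sigma> ^^ j) (r x) = x" for x j
  proof -
    have "(\<sigma> ^^ i x) (r x) = (\<sigma> ^^ j) (r x)" using i j by simp
    then have "i x mod least_power \<sigma> (r x) = j mod least_power \<sigma> (r x)" unfolding funpow_eq_iff[OF ps] .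
    then have "(\<tau> ^^ i x) (q x) = (\<tau> ^^ j) (q x)" unfolding funpow_eq_iff[OF pt] using q[OF x] by simp
    then show ?thesis unfolding \<pi>_def using x by simp
  qed
  have comm: "\<pi> (\<sigma> x) = \<tau> (\<pi> x)" for x
  proof (cases "x \<in> {1..n}")
    case True
    then have sx: "\<sigma> x \<in> {1..n}" using permutes_in_image[OF s] by blast
    have o: "Orbits.orbit \<sigma> (\<sigma> x) = Orbits.orbit \<sigma> x" using permutation_orbit_step[OF ps] .
    have "(\<sigma> ^^ Suc (i x)) (r (\<sigma> x)) = \<sigma> x" using same[OF o] i[of x] by simp
    from pi[OF sx this] show ?thesis using same[OF o] True by (simp add: \<pi>_def)
  next
    case False
    then have "\<pi> x = x" unfolding \<pi>_def by (rule if_not_P)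
    then show ?thesis using permutes_not_in[OF s False] permutes_not_in[OF t False] by simp
  qed
  have into: "\<pi> x \<in> {1..n}" if x: "x \<in> {1..n}" for x
    using q[OF x] x permutes_in_image[OF permutes_funpow[OF t], of "i x" "q x"] by (auto simp: \<pi>_def)
  have "inj_on \<pi> {1..n}"
  proof (rule inj_onI)
    fix x y assume x: "x \<in> {1..n}" and y: "y \<in> {1..n}" and e: "\<pi> x = \<pi> y"
    have "\<pi> x \<in> Orbits.orbit \<tau> (q x)" "\<pi> y \<in> Orbits.orbit \<tau> (q y)"
      using x y unfolding \<pi>_def orbit_altdef_permutation[OF pt] by auto
    then have "Orbits.orbit \<tau> (q x) = Orbits.orbit \<tau> (q y)" using e orbit_eq_iff[OF pt] by metis
    then have "F (Orbits.orbit \<sigma> x) = F (Orbits.orbit \<sigma> y)" using q[OF x] q[OF y] by simp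
    then have o: "Orbits.orbit \<sigma> x = Orbits.orbit \<sigma> y"
      using bij_betw_imp_inj_on[OF F] x y unfolding inj_on_def by blast
    then have "(\<tau> ^^ i x) (q x) = (\<tau> ^^ i y) (q x)" using e x y same[OF o] by (simp add: \<pi>_def)
    then have "i x mod least_power \<sigma> (r x) = i y mod least_power \<sigma> (r x)"
      unfolding funpow_eq_iff[OF pt] using q[OF x] by simp
    then have "(\<sigma> ^^ i x) (r x) = (\<sigma> ^^ i y) (r x)" unfolding funpow_eq_iff[OF ps] .
    moreover have "r y = r x" using same[OF o] by simp
    ultimately show "x = y" by (metis i)
  qed
  moreover have "\<pi> ` {1..n} \<subseteq> {1..n}" using into by blast
  ultimately have "bij_betw \<pi> {1..n} {1..n}"
    unfolding bij_betw_def by (simp only: endo_inj_surj finite_atLeastAtMost simp_thms)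
  then have "\<pi> permutes {1..n}" by (rule bij_imp_permutes) (unfold \<pi>_def, rule if_not_P)
  then show ?thesis using comm by (rule that)
qed

text \<open>Along the enumeration \<open>f\<close> of \<open>m\<close> points, \<open>w\<close> is
  the shift by one and \<open>\<sigma>\<close> the shift by \<open>e\<close>, so they commute, and
  the even length makes \<open>w\<close> odd. The step \<open>e\<close> covers a single cycle (1)
  and two interleaved cycles (2).\<close>

lemma cyclic_enumeration_commutes:
  fixes f :: "nat \<Rightarrow> nat"
  assumes s: "\<sigma> permutes {1..n}" and m: "even m" "m > 0" and inj: "inj_on f {..<m}"
    and per: "\<And>j. f (j + m) = f j" and sub: "\<And>j. f j \<in> {1..n}" and step: "\<And>j. \<sigma> (f j) = f (j + e)"
  obtains w where "w permutes {1..n}" "\<not> evenperm w" "w \<circ> \<sigma> = \<sigma> \<circ> w"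
proof -
  define cs where "cs = map f [0..<m]"
  define w where "w = cycle_of_list cs"
  have dist: "cycle cs" using inj by (simp add: cs_def distinct_map atLeast0LessThan)
  have fmod: "f (j mod m) = f j" for j
  proof -
    have "f (j mod m + i * m) = f (j mod m)" for i
      by (induction i) (simp_all add: per add.assoc[symmetric] add.commute[of m])
    from this[of "j div m"] show ?thesis by simp
  qed
  have wstep: "w (f j) = f (Suc j)" for j
  proof -
    have "map w cs = rotate1 cs" using cyclic_rotation[OF dist, of 1] by (simp add: w_def)
    then have "map w cs ! (j mod m) = rotate1 cs ! (j mod m)" by simp
    then have "w (f (j mod m)) = f (Suc (j mod m) mod m)" using m by (simp add: cs_def nth_rotate1)
    then show ?thesis using fmod[of j] fmod[of "Suc j"] by (simp add: mod_Suc_eq)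
  qed
  have setcs: "set cs = range f"
  proof -
    have "f j \<in> f ` {..<m}" for j using fmod[of j] m by (metis imageI lessThan_iff mod_less_divisor)
    then show ?thesis unfolding cs_def by (auto simp: atLeast0LessThan)
  qed
  have "w permutes set cs" unfolding w_def by (rule cycle_permutes)
  moreover have "set cs \<subseteq> {1..n}" unfolding setcs by (intro image_subsetI sub)
  ultimately have w: "w permutes {1..n}" by (rule permutes_subset)
  have "swapidseq_ext (set cs) (length cs - 1) w" unfolding w_def by (rule swapidseq_ext_of_cycles[OF dist])
  then have "evenperm w \<longleftrightarrow> even (length cs - 1)" by (rule evenperm_unique[OF swapidseq_ext_imp_swapidseq refl])
  then have odd: "\<not> evenperm w" using m by (simp add: cs_def)
  have "w (\<sigma> x) = \<sigma> (w x)" for x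
  proof (cases "x \<in> set cs")
    case True
    then obtain j where "x = f j" using setcs by auto
    then show ?thesis by (simp add: step wstep)
  next
    case False
    have "\<sigma> ` set cs \<subseteq> set cs" using setcs step by auto
    then have "\<sigma> ` set cs = set cs" using permutes_inj[OF s]
      by (intro endo_inj_surj) (auto intro: inj_on_subset)
    then have "\<sigma> x \<notin> set cs" using False permutes_inj[OF s] by (metis imageE injD)
    then show ?thesis using False id_outside_supp[of _ cs] by (simp add: w_def)
  qed
  then show ?thesis using that[OF w odd] by (simp add: fun_eq_iff)
qed

text \<open>If the parts are not odd and distinct, there is a cycle of even length, itself an odd
  permutation, or there are two cycles of equal odd length, which can be interleaved to one cycle of
  even length whose square agrees with \<open>\<sigma>\<close> on its points.\<close>

lemma odd_centralizer:
  assumes s: "\<sigma> permutes {1..n}" and nod: "\<not> odd_distinct (cycle_type n \<sigma>)"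
  obtains w where "w permutes {1..n}" "\<not> evenperm w" "w \<circ> \<sigma> = \<sigma> \<circ> w"
proof -
  note p = permutation_if_permutes[OF s]
  obtain k where k: "k \<in># cycle_type n \<sigma>" "even k \<or> count (cycle_type n \<sigma>) k \<noteq> 1"
    using nod unfolding odd_distinct_def by auto
  let ?C = "{S \<in> Orbits.orbit \<sigma> ` {1..n}. card S = k}"
  have "card ?C > 0" using k(1) unfolding count_cycle_type[symmetric] by simp
  then obtain x where x: "x \<in> {1..n}" "least_power \<sigma> x = k"
    using card_orbit[OF p] by (auto simp: card_gt_0_iff)
  have kpos: "k > 0" using x least_power_pos[OF p] by blast
  have in_n: "(\<sigma> ^^ i) z \<in> {1..n}" if "z \<in> {1..n}" for i z
    using permutes_in_image[OF permutes_funpow[OF s]] that by blast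
  have lpk: "(\<sigma> ^^ (i + k)) z = (\<sigma> ^^ i) z" if "least_power \<sigma> z = k" for i z
    unfolding funpow_eq_iff[OF p] using that by simp
  show ?thesis
  proof (cases "even k")
    case True
    show ?thesis
    proof (rule cyclic_enumeration_commutes[OF s True kpos, of "\<lambda>j. (\<sigma> ^^ j) x" 1])
      show "inj_on (\<lambda>j. (\<sigma> ^^ j) x) {..<k}" using x by (auto simp: inj_on_def funpow_eq_iff[OF p])
    qed (use x in_n lpk that in auto)
  next
    case False
    then have "card ?C \<noteq> 1" "card ?C \<noteq> 0"
      using k(2) \<open>card ?C > 0\<close> unfolding count_cycle_type[symmetric] by auto
    then have "?C \<noteq> {Orbits.orbit \<sigma> x}" by force
    moreover have "Orbits.orbit \<sigma> x \<in> ?C" using x card_orbit[OF p] by simp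
    ultimately obtain S where "S \<in> ?C" "S \<noteq> Orbits.orbit \<sigma> x" by blast
    then obtain y where y: "y \<in> {1..n}" "card (Orbits.orbit \<sigma> y) = k" "Orbits.orbit \<sigma> y \<noteq> Orbits.orbit \<sigma> x"
      by blast
    then have y2: "least_power \<sigma> y = k" using card_orbit[OF p] by simp
    \<comment> \<open>Alternates between the cycles of \<open>x\<close> and \<open>y\<close>, so
      that \<open>\<sigma>\<close> advances the enumeration by 2.\<close>
    define f where "f j = (if even j then (\<sigma> ^^ (j div 2)) x else (\<sigma> ^^ (j div 2)) y)" for j
    have ne: "(\<sigma> ^^ i) x \<noteq> (\<sigma> ^^ j) y" for i j
    proof
      assume e: "(\<sigma> ^^ i) x = (\<sigma> ^^ j) y"
      have "(\<sigma> ^^ i) x \<in> Orbits.orbit \<sigma> x" "(\<sigma> ^^ j) y \<in> Orbits.orbit \<sigma> y"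
        unfolding orbit_altdef_permutation[OF p] by auto
      then show False using e y(3) orbit_eq_iff[OF p] by metis
    qed
    show ?thesis
    proof (rule cyclic_enumeration_commutes[OF s _ _, of "2 * k" f 2])
      show "inj_on f {..<2 * k}"
      proof (rule inj_onI)
        fix a b assume ab: "a \<in> {..<2 * k}" "b \<in> {..<2 * k}" "f a = f b"
        then have par: "even a \<longleftrightarrow> even b" using ne ne[symmetric] by (auto simp: f_def split: if_splits)
        have "a div 2 mod k = b div 2 mod k"
          using ab par x y2 by (auto simp: f_def funpow_eq_iff[OF p] split: if_splits)
        then have "a div 2 = b div 2" using ab by (simp add: less_mult_imp_div_less mult.commute)
        then show "a = b" using par by (metis even_two_times_div_two odd_two_times_div_two_succ)
      qed
      show "f (j + 2 * k) = f j" for j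
        using lpk[OF x(2)] lpk[OF y2] by (auto simp: f_def add.commute[of k])
      show "\<sigma> (f j) = f (j + 2)" for j by (auto simp: f_def)
      show "f j \<in> {1..n}" for j using in_n[OF x(1)] in_n[OF y(1)] by (auto simp: f_def)
    qed (use kpos that in auto)
  qed
qed

section \<open>Partitions, diagrams and Young subgroups\<close>

text \<open>The value 0 beyond the last part allows partial sums of partitions with different
  numbers of parts to be compared.\<close>

definition part :: "nat multiset \<Rightarrow> nat \<Rightarrow> nat" where
  "part p i = (if i < size p then rev (sorted_list_of_multiset p) ! i else 0)"

lemma size_sorted_list_of_multiset [simp]: "length (sorted_list_of_multiset p) = size p"
  by (metis mset_sorted_list_of_multiset size_mset)

lemma map_part: "map (part p) [0..<size p] = rev (sorted_list_of_multiset p)"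
  by (rule nth_equalityI) (auto simp: part_def)

lemma mset_map_part: "mset (map (part p) [0..<size p]) = p"
  unfolding map_part by simp

lemma part_antimono: "i \<le> j \<Longrightarrow> part p j \<le> part p i"
  unfolding part_def using sorted_sorted_list_of_multiset[of p]
  by (auto simp: sorted_rev_nth_mono)

lemma part_of_map:
  assumes f: "\<And>i j. i \<le> j \<Longrightarrow> f j \<le> f i" and p: "p = mset (map f [0..<m])"
  shows "part p i = (if i < m then f i else (0::nat))"
proof -
  have "sorted (rev (map f [0..<m]))"
    unfolding sorted_iff_nth_mono by (auto simp: rev_nth intro!: f)
  moreover have "mset (rev (map f [0..<m])) = p" using p by simp
  ultimately have "sorted_list_of_multiset p = rev (map f [0..<m])"
    by (metis sort_key_id_if_sorted list.map_ident sorted_list_of_multiset_mset sorted_sort_id)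
  then show ?thesis using p by (simp add: part_def)
qed

lemma part_pos: "p \<in> partitions_of n \<Longrightarrow> i < size p \<Longrightarrow> part p i > 0"
proof -
  assume p: "p \<in> partitions_of n" and i: "i < size p"
  have "part p i \<in># mset (map (part p) [0..<size p])" using i by simp
  then have "part p i \<in># p" by (simp only: mset_map_part)
  then show "part p i > 0" using p unfolding partitions_of_def by (cases "part p i") auto
qed

lemma part_pos_iff: "p \<in> partitions_of n \<Longrightarrow> part p i > 0 \<longleftrightarrow> i < size p"
  using part_pos[of p n i] by (auto simp: part_def)

lemma sum_part: "p \<in> partitions_of n \<Longrightarrow> (\<Sum>i<size p. part p i) = n"
proof -
  assume "p \<in> partitions_of n"
  then have "n = sum_mset (mset (map (part p) [0..<size p]))"
    by (simp only: mset_map_part partitions_of_def mem_Collect_eq)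
  also have "\<dots> = (\<Sum>i<size p. part p i)"
    by (simp only: sum_mset_sum_list interv_sum_list_conv_sum_set_nat atLeast0LessThan set_upt)
  finally show ?thesis ..
qed

lemma size_le: "p \<in> partitions_of n \<Longrightarrow> size p \<le> n"
proof -
  assume p: "p \<in> partitions_of n"
  have "(\<Sum>i<size p. 1) \<le> (\<Sum>i<size p. part p i)"
    using part_pos[OF p] by (intro sum_mono) (auto simp: Suc_le_eq)
  then show ?thesis using sum_part[OF p] by simp
qed

lemma part_zero: "p \<in> partitions_of n \<Longrightarrow> i \<ge> n \<Longrightarrow> part p i = 0"
  using size_le[of p n] by (simp add: part_def)

lemma partition_eqI:
  assumes p: "p \<in> partitions_of n" and q: "q \<in> partitions_of n" and eq: "\<And>i. part p i = part q i"
  shows "p = q"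
proof -
  have "i < size p \<longleftrightarrow> i < size q" for i
    using part_pos_iff[OF p, of i] part_pos_iff[OF q, of i] eq by simp
  then have "size p = size q" by (metis linorder_neq_iff)
  moreover have "part p = part q" using eq by (rule ext)
  ultimately show ?thesis using mset_map_part[of p] mset_map_part[of q] by metis
qed

lemma down_set_eq_lessThan_card:
  assumes "finite A" "\<And>i j. j \<in> A \<Longrightarrow> i \<le> j \<Longrightarrow> i \<in> A"
  shows "A = {..<card A}"
proof -
  define m where "m = (LEAST i. i \<notin> A)"
  have ex: "\<exists>i. i \<notin> A" using assms(1) ex_new_if_finite infinite_UNIV_nat by blast
  have "A = {..<m}"
  proof (intro equalityI subsetI)
    fix i assume i: "i \<in> A"
    show "i \<in> {..<m}"
    proof (rule ccontr)
      assume "i \<notin> {..<m}"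
      then have "m \<le> i" by simp
      then have "m \<in> A" using assms(2)[OF i] by blast
      moreover have "m \<notin> A" unfolding m_def using ex by (rule LeastI_ex)
      ultimately show False by blast
    qed
  next
    fix i assume "i \<in> {..<m}"
    then show "i \<in> A" using not_less_Least unfolding m_def by blast
  qed
  then show ?thesis by simp
qed

text \<open>The length of column \<open>j\<close> of the diagram, with columns counted from 0;
  \<open>conj_partition\<close> counts them from 1.\<close>

definition leg :: "nat multiset \<Rightarrow> nat \<Rightarrow> nat" where
  "leg p j = card {i. j < part p i}"

lemma finite_part_greater: "finite {i. j < part p i}"
  by (rule finite_subset[of _ "{..<size p}"]) (auto simp: part_def split: if_splits)

text \<open>Since parts decrease, each column is an initial segment of the rows. Both sides say that
  the cell \<open>(i, j)\<close> lies in the diagram, so conjugation is the reflection of the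
  diagram.\<close>

lemma less_leg_iff: "i < leg p j \<longleftrightarrow> j < part p i"
proof -
  have "{i. j < part p i} = {..<card {i. j < part p i}}"
    by (rule down_set_eq_lessThan_card[OF finite_part_greater]) (auto dest: part_antimono[of _ _ p])
  then have "i \<in> {i. j < part p i} \<longleftrightarrow> i \<in> {..<leg p j}" unfolding leg_def by simp
  then show ?thesis by simp
qed

lemma leg_antimono: "i \<le> j \<Longrightarrow> leg p j \<le> leg p i"
  unfolding leg_def by (rule card_mono[OF finite_part_greater]) auto

lemma leg_eq_size_filter: "leg p j = size {#a \<in># p. Suc j \<le> a#}"
proof -
  have "size {#a \<in># p. Suc j \<le> a#} = size {#a \<in># mset (map (part p) [0..<size p]). Suc j \<le> a#}"
    by (simp only: mset_map_part)
  also have "\<dots> = length (filter (\<lambda>i. Suc j \<le> part p i) [0..<size p])"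
    by (simp only: mset_filter[symmetric] size_mset length_filter_map comp_def)
  also have "\<dots> = card (set (filter (\<lambda>i. Suc j \<le> part p i) [0..<size p]))"
    by (rule distinct_card[symmetric]) simp
  also have "set (filter (\<lambda>i. Suc j \<le> part p i) [0..<size p]) = {i. j < part p i}"
    by (auto simp: part_def split: if_splits)
  finally show ?thesis by (simp add: leg_def)
qed

lemma leg_zero: "p \<in> partitions_of n \<Longrightarrow> n \<le> j \<Longrightarrow> leg p j = 0"
proof -
  assume p: "p \<in> partitions_of n" and j: "n \<le> j"
  have "part p i \<le> n" for i
  proof (cases "i < size p")
    case True
    then have "part p i \<le> (\<Sum>i<size p. part p i)" by (intro member_le_sum) auto
    then show ?thesis using sum_part[OF p] by simp
  qed (simp add: part_def)
  then have "{i. j < part p i} = {}" using j by (auto simp: not_less intro: order.trans)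
  then show ?thesis by (simp add: leg_def)
qed

lemma conj_partition_eq:
  assumes p: "p \<in> partitions_of n"
  shows "conj_partition p = mset (map (leg p) [0..<card {j. 0 < leg p j}])"
    and "finite {j. 0 < leg p j}" and "card {j. 0 < leg p j} \<le> n"
proof -
  have sub: "{j. 0 < leg p j} \<subseteq> {..<n}"
  proof
    fix j assume "j \<in> {j. 0 < leg p j}"
    then show "j \<in> {..<n}" using leg_zero[OF p, of j] by (cases "n \<le> j") auto
  qed
  then show fin: "finite {j. 0 < leg p j}" by (rule finite_subset) simp
  have "card {j. 0 < leg p j} \<le> card {..<n}" using sub by (rule card_mono[rotated]) simp
  then show "card {j. 0 < leg p j} \<le> n" by simp
  define m where "m = card {j. 0 < leg p j}"
  have "{j. 0 < leg p j} = {..<m}" unfolding m_def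
    by (rule down_set_eq_lessThan_card[OF fin]) (auto dest: leg_antimono[of _ _ p])
  then have m: "0 < leg p j \<longleftrightarrow> j < m" for j by blast
  have mn: "m \<le> n" unfolding m_def by fact
  have "sum_mset p = n" using p by (simp add: partitions_of_def)
  then have "image_mset (\<lambda>i. size {#a \<in># p. i \<le> a#}) (mset_set {1..sum_mset p})
      = image_mset (\<lambda>i. size {#a \<in># p. i \<le> a#}) (image_mset Suc (mset_set {0..<n}))"
    by (subst image_mset_mset_set) (auto simp: image_Suc_atLeastLessThan atLeastLessThanSuc_atLeastAtMost)
  also have "\<dots> = image_mset (leg p) (mset_set {0..<n})"
    by (simp add: image_mset.compositionality comp_def leg_eq_size_filter[symmetric])
  also have "\<dots> = mset (map (leg p) [0..<n])" by simp
  finally have "conj_partition p = filter_mset (\<lambda>k. k > 0) (mset (map (leg p) [0..<n]))"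
    unfolding conj_partition_def by simp
  also have "\<dots> = mset (map (leg p) (filter (\<lambda>j. 0 < leg p j) [0..<n]))"
    by (simp only: mset_filter[symmetric] filter_map comp_def)
  also have "filter (\<lambda>j. 0 < leg p j) [0..<n] = [0..<m]"
  proof -
    have "[0..<n] = [0..<m] @ [m..<n]" using mn upt_add_eq_append[of 0 m "n - m"] by simp
    then show ?thesis by (simp add: m filter_id_conv)
  qed
  finally show "conj_partition p = mset (map (leg p) [0..<card {j. 0 < leg p j}])" by (simp add: m_def)
qed

lemma part_conj_partition:
  assumes p: "p \<in> partitions_of n"
  shows "part (conj_partition p) j = leg p j"
proof -
  note c = conj_partition_eq[OF p]
  have "{j. 0 < leg p j} = {..<card {j. 0 < leg p j}}"
    by (rule down_set_eq_lessThan_card[OF c(2)]) (auto dest: leg_antimono[of _ _ p])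
  then have "0 < leg p j \<longleftrightarrow> j < card {j. 0 < leg p j}" by blast
  then show ?thesis using part_of_map[OF leg_antimono c(1), of j] by auto
qed

lemma conj_partition_in:
  assumes p: "p \<in> partitions_of n"
  shows "conj_partition p \<in> partitions_of n"
proof -
  note c = conj_partition_eq[OF p]
  define m where "m = card {j. 0 < leg p j}"
  have down: "{j. 0 < leg p j} = {..<m}" unfolding m_def
    by (rule down_set_eq_lessThan_card[OF c(2)]) (auto dest: leg_antimono[of _ _ p])
  have "0 \<notin># conj_partition p" by (simp add: conj_partition_def)
  moreover have "sum_mset (conj_partition p) = n"
  proof -
    have "sum_mset (conj_partition p) = (\<Sum>j<m. leg p j)"
      unfolding c(1) m_def[symmetric]
      by (simp only: sum_mset_sum_list interv_sum_list_conv_sum_set_nat atLeast0LessThan set_upt)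
    also have "\<dots> = (\<Sum>j<n. leg p j)"
    proof (rule sum.mono_neutral_left)
      show "{..<m} \<subseteq> {..<n}" using c(3) by (simp add: m_def)
      show "\<forall>j\<in>{..<n} - {..<m}. leg p j = 0"
      proof
        fix j assume "j \<in> {..<n} - {..<m}"
        then have "j \<notin> {j. 0 < leg p j}" unfolding down by simp
        then show "leg p j = 0" by simp
      qed
    qed simp
    also have "\<dots> = (\<Sum>j<n. \<Sum>i<size p. if j < part p i then 1 else 0)"
    proof (intro sum.cong refl)
      fix j
      have "{i. j < part p i} = {i \<in> {..<size p}. j < part p i}" by (auto simp: part_def split: if_splits)
      then show "leg p j = (\<Sum>i<size p. if j < part p i then 1 else 0)"
        by (simp add: leg_def sum.If_cases Int_def)
    qed
    also have "\<dots> = (\<Sum>i<size p. \<Sum>j<n. if j < part p i then 1 else 0)" by (rule sum.swap)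
    also have "\<dots> = (\<Sum>i<size p. part p i)"
    proof (intro sum.cong refl)
      fix i assume i: "i \<in> {..<size p}"
      then have "part p i \<le> (\<Sum>i<size p. part p i)" by (intro member_le_sum) auto
      then have "{j \<in> {..<n}. j < part p i} = {..<part p i}" using sum_part[OF p] by auto
      then show "(\<Sum>j<n. if j < part p i then 1 else 0) = part p i" by (simp add: sum.If_cases Int_def)
    qed
    finally show ?thesis using sum_part[OF p] by simp
  qed
  ultimately show ?thesis by (simp add: partitions_of_def)
qed

lemma less_part_conj_iff:
  "p \<in> partitions_of n \<Longrightarrow> i < part (conj_partition p) j \<longleftrightarrow> j < part p i"
  by (simp add: part_conj_partition less_leg_iff)

lemma conj_partition_conj:
  assumes p: "p \<in> partitions_of n"
  shows "conj_partition (conj_partition p) = p"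
proof (rule partition_eqI[OF conj_partition_in[OF conj_partition_in[OF p]] p])
  fix i
  have "j < part (conj_partition (conj_partition p)) i \<longleftrightarrow> j < part p i" for j
    using less_part_conj_iff[OF conj_partition_in[OF p]] less_part_conj_iff[OF p] by simp
  then show "part (conj_partition (conj_partition p)) i = part p i" by (metis linorder_neq_iff)
qed

text \<open>The row of \<open>x\<close> when the cells of the diagram are numbered row by row. Such
  a labelling of points takes the place of the blocks in \<open>young_subgroup\<close>.\<close>

definition young_row :: "nat multiset \<Rightarrow> nat \<Rightarrow> nat" where
  "young_row p x = (LEAST i. x \<le> (\<Sum>l<Suc i. part p l))"

lemma sum_list_take_part:
  "i \<le> size p \<Longrightarrow> sum_list (take i (rev (sorted_list_of_multiset p))) = (\<Sum>l<i. part p l)"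
  unfolding map_part[symmetric]
  by (simp add: take_map take_upt min_def interv_sum_list_conv_sum_set_nat atLeast0LessThan)

lemma young_block_eq: "i < size p \<Longrightarrow> young_block p i = {(\<Sum>l<i. part p l)<..(\<Sum>l<Suc i. part p l)}"
  unfolding young_block_def Let_def by (simp only: sum_list_take_part Suc_leI less_imp_le)

lemma young_row_eq_iff:
  assumes "x > 0"
  shows "young_row p x = i \<and> x \<le> (\<Sum>l<Suc i. part p l) \<longleftrightarrow> (\<Sum>l<i. part p l) < x \<and> x \<le> (\<Sum>l<Suc i. part p l)"
proof safe
  assume x: "x \<le> (\<Sum>l<Suc (young_row p x). part p l)" "i = young_row p x"
  show "(\<Sum>l<young_row p x. part p l) < x"
  proof (cases "young_row p x")
    case (Suc j)
    then have "j < (LEAST i. x \<le> (\<Sum>l<Suc i. part p l))" by (simp add: young_row_def)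
    then have "\<not> x \<le> (\<Sum>l<Suc j. part p l)" by (rule not_less_Least)
    then show ?thesis using Suc by simp
  qed (use assms in simp)
next
  assume x: "(\<Sum>l<i. part p l) < x" "x \<le> (\<Sum>l<Suc i. part p l)"
  show "young_row p x = i"
    unfolding young_row_def
  proof (rule Least_equality)
    fix j assume j: "x \<le> (\<Sum>l<Suc j. part p l)"
    show "i \<le> j"
    proof (rule ccontr)
      assume "\<not> i \<le> j"
      then have "(\<Sum>l<Suc j. part p l) \<le> (\<Sum>l<i. part p l)" by (intro sum_mono2) auto
      then show False using j x by simp
    qed
  qed (rule x)
qed

lemma young_row_less_size:
  assumes p: "p \<in> partitions_of n" and x: "x \<in> {1..n}"
  shows "young_row p x < size p" "x \<le> (\<Sum>l<Suc (young_row p x). part p l)"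
proof -
  have "size p > 0" using sum_part[OF p] x by (cases "size p") auto
  then have "x \<le> (\<Sum>l<Suc (size p - 1). part p l)" using sum_part[OF p] x by simp
  then have "young_row p x \<le> size p - 1" "x \<le> (\<Sum>l<Suc (young_row p x). part p l)"
    unfolding young_row_def by (rule Least_le, rule LeastI)
  then show "young_row p x < size p" "x \<le> (\<Sum>l<Suc (young_row p x). part p l)" using \<open>size p > 0\<close> by auto
qed

lemma young_block_row:
  assumes p: "p \<in> partitions_of n" and i: "i < size p"
  shows "young_block p i = {x \<in> {1..n}. young_row p x = i}"
proof (intro equalityI subsetI)
  fix x assume "x \<in> young_block p i"
  then have x: "(\<Sum>l<i. part p l) < x \<and> x \<le> (\<Sum>l<Suc i. part p l)" using young_block_eq[OF i] by simp
  then have "x > 0" by simp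
  moreover have "(\<Sum>l<Suc i. part p l) \<le> (\<Sum>l<size p. part p l)" using i by (intro sum_mono2) auto
  then have "x \<le> n" using x sum_part[OF p] by linarith
  ultimately show "x \<in> {x \<in> {1..n}. young_row p x = i}" using young_row_eq_iff[of x p i] x by auto
next
  fix x assume x: "x \<in> {x \<in> {1..n}. young_row p x = i}"
  then have "young_row p x = i \<and> x \<le> (\<Sum>l<Suc i. part p l)" "x > 0" using young_row_less_size(2)[OF p, of x] by auto
  then show "x \<in> young_block p i" using young_row_eq_iff[of x p i] young_block_eq[OF i] by simp
qed

lemma card_young_row:
  assumes p: "p \<in> partitions_of n"
  shows "card {x \<in> {1..n}. young_row p x = i} = part p i"
proof (cases "i < size p")
  case True
  have "card (young_block p i) = part p i" unfolding young_block_eq[OF True] by simp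
  then show ?thesis unfolding young_block_row[OF p True] .
next
  case False
  then have "{x \<in> {1..n}. young_row p x = i} = {}" using young_row_less_size(1)[OF p] by auto
  then show ?thesis using False by (simp add: part_def)
qed

text \<open>The labels are arbitrary so that pairs of labels can be used: stabilizing a pair means
  lying in the intersection of one Young subgroup with a conjugate of another.\<close>

definition fibre_stabilizer :: "nat \<Rightarrow> (nat \<Rightarrow> 'b) \<Rightarrow> (nat \<Rightarrow> nat) set" where
  "fibre_stabilizer n u = {\<sigma>. \<sigma> permutes {1..n} \<and> (\<forall>x\<in>{1..n}. u (\<sigma> x) = u x)}"

lemma young_subgroup_eq:
  assumes p: "p \<in> partitions_of n"
  shows "young_subgroup n p = fibre_stabilizer n (young_row p)"
proof (intro equalityI subsetI)
  fix \<sigma> assume "\<sigma> \<in> young_subgroup n p"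
  then have s: "\<sigma> permutes {1..n}" and b: "\<And>i. i < size p \<Longrightarrow> \<sigma> ` young_block p i = young_block p i"
    by (auto simp: young_subgroup_def sym_group_carrier)
  have "young_row p (\<sigma> x) = young_row p x" if x: "x \<in> {1..n}" for x
  proof -
    note r = young_row_less_size(1)[OF p x]
    have "x \<in> young_block p (young_row p x)" using young_block_row[OF p r] x by simp
    then have "\<sigma> x \<in> young_block p (young_row p x)" using b[OF r] by blast
    then show ?thesis using young_block_row[OF p r] by simp
  qed
  then show "\<sigma> \<in> fibre_stabilizer n (young_row p)" using s by (simp add: fibre_stabilizer_def)
next
  fix \<sigma> assume "\<sigma> \<in> fibre_stabilizer n (young_row p)"
  then have s: "\<sigma> permutes {1..n}" and r: "\<And>x. x \<in> {1..n} \<Longrightarrow> young_row p (\<sigma> x) = young_row p x"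
    by (auto simp: fibre_stabilizer_def)
  have "\<sigma> ` young_block p i = young_block p i" if i: "i < size p" for i
  proof (rule endo_inj_surj)
    show "\<sigma> ` young_block p i \<subseteq> young_block p i"
      unfolding young_block_row[OF p i] using r permutes_in_image[OF s] by auto
    show "inj_on \<sigma> (young_block p i)" using permutes_inj[OF s] by (rule inj_on_subset) simp
    show "finite (young_block p i)" unfolding young_block_row[OF p i] by simp
  qed
  then show "\<sigma> \<in> young_subgroup n p" using s by (simp add: young_subgroup_def sym_group_carrier)
qed

lemma fibre_stabilizer_inj:
  assumes "inj_on u {1..n}"
  shows "fibre_stabilizer n u = {id}"
proof (intro equalityI subsetI)
  fix \<sigma> assume "\<sigma> \<in> fibre_stabilizer n u"
  then have s: "\<sigma> permutes {1..n}" and r: "\<And>x. x \<in> {1..n} \<Longrightarrow> u (\<sigma> x) = u x"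
    by (auto simp: fibre_stabilizer_def)
  have "\<sigma> x = x" for x
  proof (cases "x \<in> {1..n}")
    case True
    then show ?thesis using r[OF True] permutes_in_image[OF s, of x] assms unfolding inj_on_def by blast
  qed (rule permutes_not_in[OF s])
  then show "\<sigma> \<in> {id}" by auto
qed (simp add: fibre_stabilizer_def permutes_id)

lemma finite_fibre_stabilizer [simp]: "finite (fibre_stabilizer n u)"
  by (rule finite_subset[of _ "{\<sigma>. \<sigma> permutes {1..n}}"]) (auto simp: fibre_stabilizer_def finite_permutations)

text \<open>Composition with a transposition in the stabilizer cancels the signs in pairs.\<close>

lemma sum_sign_fibre_stabilizer:
  "(\<Sum>\<sigma>\<in>fibre_stabilizer n u. of_int (sign \<sigma>)) = (if inj_on u {1..n} then 1 else 0 :: complex)"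
proof (cases "inj_on u {1..n}")
  case True
  then show ?thesis by (simp add: fibre_stabilizer_inj)
next
  case False
  then obtain a b where ab: "a \<in> {1..n}" "b \<in> {1..n}" "u a = u b" "a \<noteq> b" unfolding inj_on_def by blast
  let ?t = "transpose a b"
  have t: "?t permutes {1..n}" using ab by (intro permutes_swap_id) auto
  have ut: "u (?t x) = u x" for x using ab by (simp add: transpose_def)
  have mem: "?t \<circ> \<sigma> \<in> fibre_stabilizer n u" if "\<sigma> \<in> fibre_stabilizer n u" for \<sigma>
    using that t ut by (auto simp: fibre_stabilizer_def intro: permutes_compose)
  have inv: "?t \<circ> (?t \<circ> \<sigma>) = \<sigma>" for \<sigma> :: "nat \<Rightarrow> nat" by (simp add: fun_eq_iff)
  have "(\<Sum>\<sigma>\<in>fibre_stabilizer n u. of_int (sign \<sigma>) :: complex)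
      = (\<Sum>\<sigma>\<in>fibre_stabilizer n u. of_int (sign (?t \<circ> \<sigma>)))"
    by (rule sum.reindex_bij_witness[of _ "\<lambda>\<sigma>. ?t \<circ> \<sigma>" "\<lambda>\<sigma>. ?t \<circ> \<sigma>"]) (auto simp: mem inv)
  also have "\<dots> = (\<Sum>\<sigma>\<in>fibre_stabilizer n u. - of_int (sign \<sigma>))"
  proof (intro sum.cong refl)
    fix \<sigma> assume "\<sigma> \<in> fibre_stabilizer n u"
    then have "permutation \<sigma>" by (auto simp: fibre_stabilizer_def intro: permutation_if_permutes)
    then show "of_int (sign (?t \<circ> \<sigma>)) = (- of_int (sign \<sigma>) :: complex)"
      using ab by (simp add: sign_compose permutation_swap_id sign_swap_id)
  qed
  finally have "(\<Sum>\<sigma>\<in>fibre_stabilizer n u. of_int (sign \<sigma>) :: complex) = 0" by (simp add: sum_negf)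
  then show ?thesis using False by simp
qed

text \<open>If \<open>(a, b)\<close> is injective and has the row lengths of \<open>p\<close> and the column lengths of \<open>q'\<close>,
  then each column contains at most \<open>min k q'\<^sub>j\<close> points of the first \<open>k\<close> rows.\<close>

lemma column_bound:
  assumes q: "q \<in> partitions_of n"
    and b: "\<And>j. card {z \<in> {1..n}. b z = j} = part (conj_partition q) j"
    and inj: "inj_on (\<lambda>z. (a z, b z :: nat)) {1..n}"
  shows "card {z \<in> {1..n}. a z < k \<and> b z = j} \<le> card {i \<in> {..<k}. j < part q i}"
proof -
  have "card {z \<in> {1..n}. a z < k \<and> b z = j} \<le> card {..<k}"
  proof (rule card_inj_on_le[of a])
    show "inj_on a {z \<in> {1..n}. a z < k \<and> b z = j}"
    proof (rule inj_onI)
      fix x y assume x: "x \<in> {z \<in> {1..n}. a z < k \<and> b z = j}"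
        and y: "y \<in> {z \<in> {1..n}. a z < k \<and> b z = j}" and e: "a x = a y"
      show "x = y" by (rule inj_onD[OF inj]) (use x y e in simp_all)
    qed
  qed auto
  moreover have "card {z \<in> {1..n}. a z < k \<and> b z = j} \<le> card {z \<in> {1..n}. b z = j}"
    by (intro card_mono) auto
  moreover have "{i \<in> {..<k}. j < part q i} = {..<min k (part (conj_partition q) j)}"
    using less_part_conj_iff[OF q] by auto
  ultimately show ?thesis using b by simp
qed

lemma sum_card_columns:
  assumes q: "q \<in> partitions_of n"
  shows "(\<Sum>j<n. card {i \<in> {..<k}. j < part q i}) = (\<Sum>i<k. part q i)"
proof -
  have "(\<Sum>j<n. card {i \<in> {..<k}. j < part q i}) = (\<Sum>j<n. \<Sum>i<k. if j < part q i then 1 else 0)"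
    by (simp add: sum.If_cases Int_def)
  also have "\<dots> = (\<Sum>i<k. \<Sum>j<n. if j < part q i then 1 else 0)" by (rule sum.swap)
  also have "\<dots> = (\<Sum>i<k. part q i)"
  proof (intro sum.cong refl)
    fix i
    have "i < leg q n \<longleftrightarrow> n < part q i" by (rule less_leg_iff)
    then have "part q i \<le> n" using leg_zero[OF q, of n] by simp
    then have "{j \<in> {..<n}. j < part q i} = {..<part q i}" by auto
    then show "(\<Sum>j<n. if j < part q i then 1 else 0) = part q i" by (simp add: sum.If_cases Int_def)
  qed
  finally show ?thesis .
qed

lemma sum_card_rows:
  assumes p: "p \<in> partitions_of n" and q: "q \<in> partitions_of n"
    and a: "\<And>i. card {z \<in> {1..n}. a z = i} = part p i"
    and b: "\<And>j. card {z \<in> {1..n}. b z = j} = part (conj_partition q) j"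
  shows "(\<Sum>j<n. card {z \<in> {1..n}. a z < k \<and> b z = j}) = (\<Sum>i<k. part p i)"
proof -
  have bn: "b z < n" if z: "z \<in> {1..n}" for z
  proof (rule ccontr)
    assume "\<not> b z < n"
    then have "part (conj_partition q) (b z) = 0"
      using part_zero[OF conj_partition_in[OF q]] by simp
    then have "{y \<in> {1..n}. b y = b z} = {}" using b[of "b z"] by simp
    then show False using z by blast
  qed
  have "(\<Sum>j<n. card {z \<in> {1..n}. a z < k \<and> b z = j}) = card {z \<in> {1..n}. a z < k}"
  proof -
    have "card {z \<in> {1..n}. a z < k} = (\<Sum>j<n. card {z \<in> {z \<in> {1..n}. a z < k}. b z = j})"
      unfolding card_eq_sum using bn by (intro sum.group[symmetric]) auto
    moreover have "{z \<in> {z \<in> {1..n}. a z < k}. b z = j} = {z \<in> {1..n}. a z < k \<and> b z = j}" for j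
      by auto
    ultimately show ?thesis by simp
  qed
  also have "\<dots> = (\<Sum>i<k. card {z \<in> {z \<in> {1..n}. a z < k}. a z = i})"
    unfolding card_eq_sum by (intro sum.group[symmetric]) auto
  also have "\<dots> = (\<Sum>i<k. part p i)"
  proof (intro sum.cong refl)
    fix i assume "i \<in> {..<k}"
    then have "{z \<in> {z \<in> {1..n}. a z < k}. a z = i} = {z \<in> {1..n}. a z = i}" by auto
    then show "card {z \<in> {z \<in> {1..n}. a z < k}. a z = i} = part p i" using a[of i] by simp
  qed
  finally show ?thesis .
qed

lemma dominance:
  assumes p: "p \<in> partitions_of n" and q: "q \<in> partitions_of n"
    and a: "\<And>i. card {z \<in> {1..n}. a z = i} = part p i"
    and b: "\<And>j. card {z \<in> {1..n}. b z = j} = part (conj_partition q) j"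
    and inj: "inj_on (\<lambda>z. (a z, b z :: nat)) {1..n}"
  shows "(\<Sum>i<k. part p i) \<le> (\<Sum>i<k. part q i)"
  unfolding sum_card_rows[OF p q a b, symmetric] sum_card_columns[OF q, symmetric]
  by (intro sum_mono column_bound[OF q b inj])

lemma partition_eq_of_sums:
  assumes p: "p \<in> partitions_of n" and q: "q \<in> partitions_of n"
    and eq: "\<And>k. (\<Sum>i<k. part p i) = (\<Sum>i<k. part q i)"
  shows "p = q"
proof (rule partition_eqI[OF p q])
  fix i
  show "part p i = part q i" using eq[of i] eq[of "Suc i"] by simp
qed

text \<open>For \<open>q = p\<close> all these bounds are attained, so \<open>(a, b)\<close> is a bijection onto the diagram.\<close>

lemma diagram_bij:
  assumes p: "p \<in> partitions_of n"
    and a: "\<And>i. card {z \<in> {1..n}. a z = i} = part p i"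
    and b: "\<And>j. card {z \<in> {1..n}. b z = j} = part (conj_partition p) j"
    and inj: "inj_on (\<lambda>z. (a z, b z :: nat)) {1..n}"
  shows "(\<lambda>z. (a z, b z)) ` {1..n} = {(i, j). j < part p i}"
proof -
  \<comment> \<open>The bounds of \<open>column_bound\<close> add up to the true total, so none of
    them can be strict.\<close>
  have attained: "card {z \<in> {1..n}. a z < k \<and> b z = j} = card {i \<in> {..<k}. j < part p i}" if j: "j < n" for k j
  proof (rule ccontr)
    assume ne: "\<not> ?thesis"
    have "(\<Sum>j<n. card {z \<in> {1..n}. a z < k \<and> b z = j}) < (\<Sum>j<n. card {i \<in> {..<k}. j < part p i})"
      using column_bound[OF p b inj, of k] ne j
      by (intro sum_strict_mono_ex1) (auto intro!: bexI[of _ j] simp: order.strict_iff_order)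
    then show False using sum_card_rows[OF p p a b] sum_card_columns[OF p] by simp
  qed
  \<comment> \<open>The attained bounds for \<open>i\<close> and \<open>Suc i\<close> differ by the
    number of points in the cell \<open>(i, j)\<close>, which is therefore 1 inside the diagram and
    0 outside.\<close>
  have iff: "(\<exists>z\<in>{1..n}. a z = i \<and> b z = j) \<longleftrightarrow> j < part p i" if j: "j < n" for i j
  proof -
    have "{z \<in> {1..n}. a z < Suc i \<and> b z = j} = {z \<in> {1..n}. a z < i \<and> b z = j} \<union> {z \<in> {1..n}. a z = i \<and> b z = j}"
      by auto
    then have A: "card {z \<in> {1..n}. a z < Suc i \<and> b z = j}
        = card {z \<in> {1..n}. a z < i \<and> b z = j} + card {z \<in> {1..n}. a z = i \<and> b z = j}"
      by (simp only:) (rule card_Un_disjoint, auto)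
    have "{l \<in> {..<Suc i}. j < part p l} = {l \<in> {..<i}. j < part p l} \<union> (if j < part p i then {i} else {})"
      by (auto simp: less_Suc_eq)
    then have B: "card {l \<in> {..<Suc i}. j < part p l} = card {l \<in> {..<i}. j < part p l} + (if j < part p i then 1 else 0)"
      by (simp only:) (subst card_Un_disjoint, auto)
    have C: "card {z \<in> {1..n}. a z = i \<and> b z = j} = (if j < part p i then 1 else 0)"
      using A B attained[OF j, of i] attained[OF j, of "Suc i"] by simp
    show ?thesis
    proof
      assume "\<exists>z\<in>{1..n}. a z = i \<and> b z = j"
      then have "card {z \<in> {1..n}. a z = i \<and> b z = j} \<noteq> 0" by (subst card_0_eq) auto
      then show "j < part p i" using C by (auto split: if_splits)
    next
      assume "j < part p i"
      then have "card {z \<in> {1..n}. a z = i \<and> b z = j} \<noteq> 0" using C by simp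
      then have "{z \<in> {1..n}. a z = i \<and> b z = j} \<noteq> {}" by (metis card.empty)
      then show "\<exists>z\<in>{1..n}. a z = i \<and> b z = j" by blast
    qed
  qed
  have bn: "b z < n" if z: "z \<in> {1..n}" for z
  proof (rule ccontr)
    assume "\<not> b z < n"
    then have "part (conj_partition p) (b z) = 0"
      using part_zero[OF conj_partition_in[OF p]] by simp
    then have "{y \<in> {1..n}. b y = b z} = {}" using b[of "b z"] by simp
    then show False using z by blast
  qed
  have pn: "part p i \<le> n" for i
    using less_leg_iff[of i p n] leg_zero[OF p, of n] by simp
  show ?thesis
  proof (intro equalityI subsetI)
    fix w assume "w \<in> (\<lambda>z. (a z, b z)) ` {1..n}"
    then obtain z where z: "z \<in> {1..n}" "w = (a z, b z)" by blast
    then show "w \<in> {(i, j). j < part p i}" using iff[OF bn[OF z(1)], of "a z"] by auto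
  next
    fix w assume "w \<in> {(i, j). j < part p i}"
    then obtain i j where w: "w = (i, j)" "j < part p i" by blast
    then have "j < n" using pn[of i] by linarith
    then obtain z where "z \<in> {1..n}" "a z = i" "b z = j" using iff w by blast
    then show "w \<in> (\<lambda>z. (a z, b z)) ` {1..n}" using w by blast
  qed
qed

section \<open>The characters of the symmetric group\<close>

context finite_grp
begin

lemma class_function_induced: "class_function (induced_char G H \<phi>)"
  unfolding class_function_def
proof (intro ballI)
  fix g h assume g: "g \<in> carrier G" and h: "h \<in> carrier G"
  have "(\<Sum>x\<in>{x \<in> carrier G. inv x \<otimes> (h \<otimes> g \<otimes> inv h) \<otimes> x \<in> H}. \<phi> (inv x \<otimes> (h \<otimes> g \<otimes> inv h) \<otimes> x))
      = (\<Sum>x\<in>{x \<in> carrier G. inv x \<otimes> g \<otimes> x \<in> H}. \<phi> (inv x \<otimes> g \<otimes> x))"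
  proof (rule sum.reindex_bij_witness[of _ "\<lambda>x. h \<otimes> x" "\<lambda>x. inv h \<otimes> x"])
    have e: "inv (inv h \<otimes> x) \<otimes> g \<otimes> (inv h \<otimes> x) = inv x \<otimes> (h \<otimes> g \<otimes> inv h) \<otimes> x" if "x \<in> carrier G" for x
      using that g h by (simp add: m_assoc inv_mult_group)
    have e': "inv (h \<otimes> x) \<otimes> (h \<otimes> g \<otimes> inv h) \<otimes> (h \<otimes> x) = inv x \<otimes> g \<otimes> x" if "x \<in> carrier G" for x
      using that g h by (simp add: m_assoc inv_mult_group inv_cancel_left)
    show "inv h \<otimes> x \<in> {x \<in> carrier G. inv x \<otimes> g \<otimes> x \<in> H}"
      if "x \<in> {x \<in> carrier G. inv x \<otimes> (h \<otimes> g \<otimes> inv h) \<otimes> x \<in> H}" for x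
      using that h by (auto simp: e)
    show "h \<otimes> x \<in> {x \<in> carrier G. inv x \<otimes> (h \<otimes> g \<otimes> inv h) \<otimes> x \<in> H}"
      if "x \<in> {x \<in> carrier G. inv x \<otimes> g \<otimes> x \<in> H}" for x
      using that h by (auto simp: e')
    show "\<phi> (inv (inv h \<otimes> x) \<otimes> g \<otimes> (inv h \<otimes> x)) = \<phi> (inv x \<otimes> (h \<otimes> g \<otimes> inv h) \<otimes> x)"
      if "x \<in> {x \<in> carrier G. inv x \<otimes> (h \<otimes> g \<otimes> inv h) \<otimes> x \<in> H}" for x
      using that by (simp add: e)
  qed (use h in \<open>auto simp: inv_cancel_left\<close>)
  then show "induced_char G H \<phi> (h \<otimes> g \<otimes> inv h) = induced_char G H \<phi> g"
    by (simp add: induced_char_def)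
qed

text \<open>After exchanging the sums, conjugation by \<open>x\<close> turns each inner sum into the
  same sum over \<open>H\<close>, because \<open>f\<close> is a class function; the outer sum over
  \<open>x\<close> then cancels the group order.\<close>

lemma frobenius_reciprocity:
  assumes f: "class_function f" and H: "H \<subseteq> carrier G"
  shows "char_inner G f (induced_char G H \<phi>) = (\<Sum>h\<in>H. f h * cnj (\<phi> h)) / of_nat (card H)"
proof -
  let ?c = "of_nat (card H) :: complex"
  define F where "F x g = (if inv x \<otimes> g \<otimes> x \<in> H then f g * cnj (\<phi> (inv x \<otimes> g \<otimes> x)) / ?c else 0)" for x g
  have "(\<Sum>g\<in>carrier G. f g * cnj (induced_char G H \<phi> g)) = (\<Sum>g\<in>carrier G. \<Sum>x\<in>carrier G. F x g)"
  proof (intro sum.cong refl)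
    fix g
    have "f g * cnj (induced_char G H \<phi> g)
       = (\<Sum>x\<in>{x \<in> carrier G. inv x \<otimes> g \<otimes> x \<in> H}. f g * cnj (\<phi> (inv x \<otimes> g \<otimes> x)) / ?c)"
      by (simp add: induced_char_def sum_distrib_left sum_divide_distrib)
    also have "\<dots> = (\<Sum>x\<in>carrier G. F x g)"
      unfolding F_def by (rule sum.inter_filter) simp
    finally show "f g * cnj (induced_char G H \<phi> g) = (\<Sum>x\<in>carrier G. F x g)" .
  qed
  also have "\<dots> = (\<Sum>x\<in>carrier G. \<Sum>g\<in>carrier G. F x g)" by (rule sum.swap)
  also have "\<dots> = (\<Sum>x\<in>carrier G. (\<Sum>h\<in>H. f h * cnj (\<phi> h)) / ?c)"
  proof (intro sum.cong refl)
    fix x assume x: "x \<in> carrier G"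
    have "(\<Sum>g\<in>carrier G. F x g) = (\<Sum>g\<in>carrier G. F x (x \<otimes> g \<otimes> inv x))"
      by (rule sum_conjugate[OF x, symmetric])
    also have "\<dots> = (\<Sum>g\<in>carrier G. if g \<in> H then f g * cnj (\<phi> g) / ?c else 0)"
    proof (intro sum.cong refl)
      fix g assume g: "g \<in> carrier G"
      have "inv x \<otimes> (x \<otimes> g \<otimes> inv x) \<otimes> x = g" using g x by (simp add: m_assoc inv_cancel_left)
      moreover have "f (x \<otimes> g \<otimes> inv x) = f g" using f g x by (simp add: class_function_def)
      ultimately show "F x (x \<otimes> g \<otimes> inv x) = (if g \<in> H then f g * cnj (\<phi> g) / ?c else 0)"
        by (simp add: F_def)
    qed
    also have "\<dots> = (\<Sum>h\<in>carrier G \<inter> H. f h * cnj (\<phi> h) / ?c)"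
      by (rule sum.inter_restrict[symmetric]) simp
    finally show "(\<Sum>g\<in>carrier G. F x g) = (\<Sum>h\<in>H. f h * cnj (\<phi> h)) / ?c"
      using H by (simp add: Int_absorb1 sum_divide_distrib)
  qed
  finally show ?thesis using order_pos one_closed by (auto simp: char_inner_def Coset.order_def)
qed

text \<open>The multiplicity of the linear character \<open>\<epsilon>\<close> in the restriction to
  \<open>H\<close>. For a subgroup of order 2 or 3 and trivial \<open>\<epsilon>\<close>, its
  integrality becomes a congruence for character values.\<close>

lemma subgroup_multiplicity:
  assumes H: "subgroup H G" and r: "representation G d \<rho>" and one: "\<epsilon> \<one> = 1"
    and mult: "\<And>g h. g \<in> H \<Longrightarrow> h \<in> H \<Longrightarrow> \<epsilon> (g \<otimes> h) = \<epsilon> g * \<epsilon> h"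
  shows "(\<Sum>h\<in>H. trace_mat (\<rho> h) * cnj (\<epsilon> h)) / of_nat (card H) \<in> \<nat>"
proof -
  let ?H = "G\<lparr>carrier := H\<rparr>"
  have sub: "H \<subseteq> carrier G" using subgroup.subset[OF H] .
  interpret K: finite_grp ?H
    by (intro finite_grp.intro finite_grp_axioms.intro subgroup_imp_group[OF H])
      (simp add: finite_subset[OF sub])
  have rH: "representation ?H d \<rho>"
    unfolding K.representation_iff using representationD[OF r] sub by auto
  have lin: "restrict \<epsilon> H \<in> irr_chars ?H"
    using K.linear_character[of \<epsilon>] one mult by simp
  have "char_inner ?H (\<lambda>g. trace_mat (\<rho> g)) (restrict \<epsilon> H) \<in> \<nat>"
    by (rule K.rep_multiplicity[OF rH lin])
  then show ?thesis by (simp add: char_inner_def Coset.order_def)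
qed

end

section \<open>Characters induced from Young subgroups\<close>

lemma finite_grp_sym: "finite_grp (sym_group n)"
  by (intro finite_grp.intro finite_grp_axioms.intro sym_group_is_group)
    (simp add: sym_group_def finite_permutations)

interpretation S: finite_grp "sym_group n" for n by (rule finite_grp_sym)

lemma sym_mult [simp]: "x \<otimes>\<^bsub>sym_group n\<^esub> y = x \<circ> y"
  by (simp add: sym_group_mult)

lemma fibre_stabilizer_subgroup: "subgroup (fibre_stabilizer n u) (sym_group n)"
proof (rule S.subgroupI)
  show "fibre_stabilizer n u \<subseteq> carrier (sym_group n)"
    by (auto simp: fibre_stabilizer_def sym_group_carrier)
  show "fibre_stabilizer n u \<noteq> {}"
    by (auto simp: fibre_stabilizer_def intro!: exI[of _ id] permutes_id)
next
  fix \<sigma> assume "\<sigma> \<in> fibre_stabilizer n u"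
  then have s: "\<sigma> permutes {1..n}" and r: "\<And>x. x \<in> {1..n} \<Longrightarrow> u (\<sigma> x) = u x"
    by (auto simp: fibre_stabilizer_def)
  have "u (inv' \<sigma> x) = u x" if x: "x \<in> {1..n}" for x
    using r[of "inv' \<sigma> x"] permutes_in_image[OF permutes_inv[OF s], of x] x permutes_inverses(1)[OF s] by simp
  then show "inv\<^bsub>sym_group n\<^esub> \<sigma> \<in> fibre_stabilizer n u"
    using s permutes_inv[OF s] by (simp add: fibre_stabilizer_def sym_group_carrier)
next
  fix \<sigma> \<tau> assume s: "\<sigma> \<in> fibre_stabilizer n u" and t: "\<tau> \<in> fibre_stabilizer n u"
  then have "u (\<sigma> (\<tau> x)) = u x" if "x \<in> {1..n}" for x
  proof -
    have "\<tau> x \<in> {1..n}" using t that permutes_in_image[of \<tau> "{1..n}" x] by (simp add: fibre_stabilizer_def)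
    then show ?thesis using s t that by (simp add: fibre_stabilizer_def)
  qed
  then show "\<sigma> \<otimes>\<^bsub>sym_group n\<^esub> \<tau> \<in> fibre_stabilizer n u"
    using s t by (simp add: fibre_stabilizer_def permutes_compose)
qed

lemma card_fibre_stabilizer_pos: "card (fibre_stabilizer n u) > 0"
  using subgroup.one_closed[OF fibre_stabilizer_subgroup[of n u]] finite_fibre_stabilizer[of n u]
  by (auto simp: card_gt_0_iff)

abbreviation young_trivial :: "nat \<Rightarrow> nat multiset \<Rightarrow> (nat \<Rightarrow> nat) \<Rightarrow> complex" where
  "young_trivial n p \<equiv> induced_char (sym_group n) (young_subgroup n p) (\<lambda>_. 1)"

abbreviation young_sign :: "nat \<Rightarrow> nat multiset \<Rightarrow> (nat \<Rightarrow> nat) \<Rightarrow> complex" where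
  "young_sign n p \<equiv> induced_char (sym_group n) (young_subgroup n p) (\<lambda>\<sigma>. of_int (sign \<sigma>))"

lemma young_subgroup_carrier: "young_subgroup n p \<subseteq> carrier (sym_group n)"
  by (auto simp: young_subgroup_def)

lemma char_inner_young_trivial:
  "S.class_function n f \<Longrightarrow>
    char_inner (sym_group n) f (young_trivial n p) = (\<Sum>h\<in>young_subgroup n p. f h) / of_nat (card (young_subgroup n p))"
  using S.frobenius_reciprocity[OF _ young_subgroup_carrier, where \<phi> = "\<lambda>_. 1"] by simp

lemma char_inner_young_sign:
  "S.class_function n f \<Longrightarrow>
    char_inner (sym_group n) f (young_sign n p)
      = (\<Sum>h\<in>young_subgroup n p. f h * of_int (sign h)) / of_nat (card (young_subgroup n p))"
  using S.frobenius_reciprocity[OF _ young_subgroup_carrier, where \<phi> = "\<lambda>\<sigma>. of_int (sign \<sigma>)"] by simp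

lemma sign_mult_sym:
  "g \<in> carrier (sym_group n) \<Longrightarrow> h \<in> carrier (sym_group n) \<Longrightarrow> sign (g \<circ> h) = sign g * sign h"
  by (intro sign_compose sym_group_carrier')

lemma young_multiplicities:
  assumes p: "p \<in> partitions_of n" and chi: "\<chi> \<in> irr_chars (sym_group n)"
  shows "char_inner (sym_group n) \<chi> (young_trivial n p) \<in> \<nat>"
    and "char_inner (sym_group n) \<chi> (young_sign n p) \<in> \<nat>"
proof -
  obtain d \<rho> where r: "representation (sym_group n) d \<rho>"
    and t: "\<And>g. g \<in> carrier (sym_group n) \<Longrightarrow> \<chi> g = trace_mat (\<rho> g)"
    using S.irr_charE[OF chi] by metis
  have H: "subgroup (young_subgroup n p) (sym_group n)"
    unfolding young_subgroup_eq[OF p] by (rule fibre_stabilizer_subgroup)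
  have t': "\<chi> h = trace_mat (\<rho> h)" if "h \<in> young_subgroup n p" for h
    using that young_subgroup_carrier t by blast
  note cf = S.class_function_irr_char[OF chi]
  show "char_inner (sym_group n) \<chi> (young_trivial n p) \<in> \<nat>"
    using S.subgroup_multiplicity[OF H r, of "\<lambda>_. 1"] t'
    by (simp add: char_inner_young_trivial[OF cf] cong: sum.cong)
  have "sign (g \<circ> h) = sign g * sign h" if "g \<in> young_subgroup n p" "h \<in> young_subgroup n p" for g h
    using that young_subgroup_carrier sign_mult_sym by blast
  then show "char_inner (sym_group n) \<chi> (young_sign n p) \<in> \<nat>"
    using S.subgroup_multiplicity[OF H r, of "\<lambda>\<sigma>. of_int (sign \<sigma>)"] t'
    by (simp add: char_inner_young_sign[OF cf] sym_group_one cong: sum.cong)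
qed

text \<open>The \<open>x\<close> for which the conjugate by \<open>x\<close> of the Young subgroup
  of \<open>p\<close> meets that of \<open>q\<close> trivially: two points with the same pair of
  labels would give a transposition in the intersection.\<close>

definition young_pairs :: "nat \<Rightarrow> nat multiset \<Rightarrow> nat multiset \<Rightarrow> (nat \<Rightarrow> nat) set" where
  "young_pairs n p q = {x. x permutes {1..n} \<and> inj_on (\<lambda>z. (young_row p (inv' x z), young_row q z)) {1..n}}"

lemma finite_young_pairs [simp]: "finite (young_pairs n p q)"
  by (rule finite_subset[of _ "{\<sigma>. \<sigma> permutes {1..n}}"]) (auto simp: young_pairs_def finite_permutations)

text \<open>Mackey's formula without double coset representatives: a sum over all \<open>x\<close>
  of the sign sums over the intersections of Young subgroups, each of which is 1 or 0 according to
  whether the intersection is trivial.\<close>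

lemma char_inner_young:
  assumes p: "p \<in> partitions_of n" and q: "q \<in> partitions_of n"
  shows "char_inner (sym_group n) (young_trivial n p) (young_sign n q)
    = of_nat (card (young_pairs n p q)) / of_nat (card (young_subgroup n p) * card (young_subgroup n q))"
proof -
  let ?H = "young_subgroup n p" and ?K = "young_subgroup n q" and ?S = "carrier (sym_group n)"
  let ?u = "\<lambda>x z. (young_row p (inv' x z), young_row q z)"
  have stab: "{k \<in> ?K. inv\<^bsub>sym_group n\<^esub> x \<otimes>\<^bsub>sym_group n\<^esub> k \<otimes>\<^bsub>sym_group n\<^esub> x \<in> ?H} = fibre_stabilizer n (?u x)"
    if "x \<in> ?S" for x
  proof -
    have x: "x permutes {1..n}" using that by (simp add: sym_group_carrier)
    have "inv' x \<circ> k \<circ> x \<in> ?H \<longleftrightarrow> (\<forall>z\<in>{1..n}. young_row p (inv' x (k z)) = young_row p (inv' x z))"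
      if k: "k permutes {1..n}" for k
    proof -
      have "inv' x \<circ> k \<circ> x permutes {1..n}" using x k permutes_inv[OF x] by (intro permutes_compose)
      then have "inv' x \<circ> k \<circ> x \<in> ?H \<longleftrightarrow> (\<forall>y\<in>{1..n}. young_row p (inv' x (k (x y))) = young_row p y)"
        unfolding young_subgroup_eq[OF p] by (simp add: fibre_stabilizer_def)
      also have "\<dots> \<longleftrightarrow> (\<forall>z\<in>{1..n}. young_row p (inv' x (k z)) = young_row p (inv' x z))"
      proof (intro iffI ballI)
        fix z assume "\<forall>y\<in>{1..n}. young_row p (inv' x (k (x y))) = young_row p y" "z \<in> {1..n}"
        then show "young_row p (inv' x (k z)) = young_row p (inv' x z)"
          using permutes_in_image[OF permutes_inv[OF x], of z] permutes_inverses(1)[OF x, of z] by metis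
      next
        fix y assume "\<forall>z\<in>{1..n}. young_row p (inv' x (k z)) = young_row p (inv' x z)" "y \<in> {1..n}"
        then show "young_row p (inv' x (k (x y))) = young_row p y"
          using permutes_in_image[OF x, of y] permutes_inverses(2)[OF x, of y] by metis
      qed
      finally show ?thesis .
    qed
    then show ?thesis using that unfolding young_subgroup_eq[OF q] fibre_stabilizer_def by auto
  qed
  have "(\<Sum>k\<in>?K. young_trivial n p k * of_int (sign k))
      = (\<Sum>k\<in>?K. \<Sum>x\<in>{x \<in> ?S. inv\<^bsub>sym_group n\<^esub> x \<otimes>\<^bsub>sym_group n\<^esub> k \<otimes>\<^bsub>sym_group n\<^esub> x \<in> ?H}. of_int (sign k) / of_nat (card ?H))"
    by (intro sum.cong refl) (simp add: induced_char_def)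
  also have "\<dots> = (\<Sum>k\<in>?K. \<Sum>x\<in>?S. if inv\<^bsub>sym_group n\<^esub> x \<otimes>\<^bsub>sym_group n\<^esub> k \<otimes>\<^bsub>sym_group n\<^esub> x \<in> ?H then of_int (sign k) / of_nat (card ?H) else 0)"
    by (intro sum.cong refl sum.inter_filter) simp
  also have "\<dots> = (\<Sum>x\<in>?S. \<Sum>k\<in>?K. if inv\<^bsub>sym_group n\<^esub> x \<otimes>\<^bsub>sym_group n\<^esub> k \<otimes>\<^bsub>sym_group n\<^esub> x \<in> ?H then of_int (sign k) / of_nat (card ?H) else 0)"
    by (rule sum.swap)
  also have "\<dots> = (\<Sum>x\<in>?S. \<Sum>k\<in>fibre_stabilizer n (?u x). of_int (sign k) / of_nat (card ?H))"
  proof (rule sum.cong[OF refl])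
    fix x assume x: "x \<in> ?S"
    have "finite ?K" unfolding young_subgroup_eq[OF q] by simp
    then show "(\<Sum>k\<in>?K. if inv\<^bsub>sym_group n\<^esub> x \<otimes>\<^bsub>sym_group n\<^esub> k \<otimes>\<^bsub>sym_group n\<^esub> x \<in> ?H then of_int (sign k) / of_nat (card ?H) else 0)
       = (\<Sum>k\<in>fibre_stabilizer n (?u x). of_int (sign k) / of_nat (card ?H) :: complex)"
      unfolding stab[OF x, symmetric] by (rule sum.inter_filter[symmetric])
  qed
  also have "\<dots> = (\<Sum>x\<in>?S. (if inj_on (?u x) {1..n} then 1 else 0) / of_nat (card ?H))"
    by (simp add: sum_divide_distrib[symmetric] sum_sign_fibre_stabilizer)
  also have "\<dots> = (\<Sum>x\<in>?S. (if inj_on (?u x) {1..n} then 1 else 0)) / of_nat (card ?H)"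
    by (simp add: sum_divide_distrib)
  also have "(\<Sum>x\<in>?S. (if inj_on (?u x) {1..n} then 1 else 0)) = (of_nat (card (young_pairs n p q)) :: complex)"
  proof -
    have "{x \<in> ?S. inj_on (?u x) {1..n}} = young_pairs n p q"
      by (auto simp: young_pairs_def sym_group_carrier)
    then show ?thesis by (simp add: sum.If_cases Int_def)
  qed
  finally show ?thesis
    using char_inner_young_sign[OF S.class_function_induced, of n "young_subgroup n p" "\<lambda>_. 1" q] by simp
qed

lemma card_young_row_inv:
  assumes p: "p \<in> partitions_of n" and x: "x permutes {1..n}"
  shows "card {z \<in> {1..n}. young_row p (inv' x z) = i} = part p i"
proof -
  have "{z \<in> {1..n}. young_row p (inv' x z) = i} = x ` {y \<in> {1..n}. young_row p y = i}"
  proof (intro equalityI subsetI)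
    fix z assume "z \<in> {z \<in> {1..n}. young_row p (inv' x z) = i}"
    then show "z \<in> x ` {y \<in> {1..n}. young_row p y = i}"
      using permutes_in_image[OF permutes_inv[OF x], of z] permutes_inverses(1)[OF x, of z]
      by (intro image_eqI[of _ _ "inv' x z"]) auto
  next
    fix z assume "z \<in> x ` {y \<in> {1..n}. young_row p y = i}"
    then show "z \<in> {z \<in> {1..n}. young_row p (inv' x z) = i}"
      using permutes_in_image[OF x] permutes_inverses(2)[OF x] by auto
  qed
  also have "card \<dots> = card {y \<in> {1..n}. young_row p y = i}"
    using permutes_inj[OF x] by (intro card_image) (rule inj_on_subset, auto)
  finally show ?thesis using card_young_row[OF p] by simp
qed

lemma young_pairs_dominance:
  assumes p: "p \<in> partitions_of n" and q: "q \<in> partitions_of n"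
    and ne: "young_pairs n p (conj_partition q) \<noteq> {}"
  shows "(\<Sum>i<k. part p i) \<le> (\<Sum>i<k. part q i)"
proof -
  obtain x where x: "x permutes {1..n}"
    and inj: "inj_on (\<lambda>z. (young_row p (inv' x z), young_row (conj_partition q) z)) {1..n}"
    using ne unfolding young_pairs_def by auto
  show ?thesis
    by (rule dominance[OF p q card_young_row_inv[OF p x] card_young_row[OF conj_partition_in[OF q]] inj])
qed

text \<open>Two fillings of the diagram \<open>D\<close> are compared: \<open>\<theta>\<close> puts
  points into the rows given by \<open>p\<close>, and \<open>\<theta>'\<close> into the columns
  given by the conjugate. Points filling the same cell correspond under \<open>y\<close>, and a cell
  is determined by its row and its column.\<close>

lemma young_pairs_nonempty:
  assumes p: "p \<in> partitions_of n"
  shows "young_pairs n p (conj_partition p) \<noteq> {}"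
proof -
  let ?q = "conj_partition p"
  define D where "D = {(i, j). j < part p i}"
  have row: "{d \<in> D. fst d = i} = (\<lambda>j. (i, j)) ` {..<part p i}" for i by (auto simp: D_def)
  have col: "{d \<in> D. snd d = j} = (\<lambda>i. (i, j)) ` {..<part ?q j}" for j
    using less_part_conj_iff[OF p] by (auto simp: D_def)
  have "D \<subseteq> {..<n} \<times> {..<n}"
  proof
    fix d assume "d \<in> D"
    then obtain i j where d: "d = (i, j)" "j < part p i" by (auto simp: D_def)
    then have "i < part ?q j" using less_part_conj_iff[OF p] by simp
    then show "d \<in> {..<n} \<times> {..<n}"
      using d part_zero[OF p, of i] part_zero[OF conj_partition_in[OF p], of j]
      by (cases "i < n"; cases "j < n") auto
  qed
  then have fin: "finite D" by (rule finite_subset) simp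
  have "card {x \<in> {1..n}. young_row p x = i} = card {d \<in> D. fst d = i}" for i
    unfolding card_young_row[OF p] row by (subst card_image) (auto simp: inj_on_def)
  then obtain \<theta> where th: "bij_betw \<theta> {1..n} D" "\<forall>x\<in>{1..n}. fst (\<theta> x) = young_row p x"
    using ex_bij_betw_fibres[of "{1..n}" D "young_row p" fst] fin by auto
  have "card {x \<in> {1..n}. young_row ?q x = j} = card {d \<in> D. snd d = j}" for j
    unfolding card_young_row[OF conj_partition_in[OF p]] col by (subst card_image) (auto simp: inj_on_def)
  then obtain \<theta>' where th': "bij_betw \<theta>' {1..n} D" "\<forall>x\<in>{1..n}. snd (\<theta>' x) = young_row ?q x"
    using ex_bij_betw_fibres[of "{1..n}" D "young_row ?q" snd] fin by auto
  define y where "y z = (if z \<in> {1..n} then inv_into {1..n} \<theta> (\<theta>' z) else z)" for z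
  have "bij_betw (\<lambda>z. inv_into {1..n} \<theta> (\<theta>' z)) {1..n} {1..n}"
    using bij_betw_trans[OF th'(1) bij_betw_inv_into[OF th(1)]] by (simp add: comp_def)
  then have "bij_betw y {1..n} {1..n}" by (rule iffD1[OF bij_betw_cong, rotated]) (simp add: y_def)
  then have y: "y permutes {1..n}" by (rule bij_imp_permutes) (unfold y_def, rule if_not_P)
  have "\<theta> (y z) = \<theta>' z" if "z \<in> {1..n}" for z
  proof -
    have "\<theta>' z \<in> \<theta> ` {1..n}" using th(1) th'(1) that unfolding bij_betw_def by blast
    then show ?thesis using that by (simp add: y_def f_inv_into_f)
  qed
  then have pair: "(young_row p (y z), young_row ?q z) = \<theta>' z" if "z \<in> {1..n}" for z
    using that th(2) th'(2) permutes_in_image[OF y, of z] by (metis prod.collapse)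
  \<comment> \<open>\<open>young_pairs\<close> reads the row labels through \<open>inv' x\<close>,
    so the inverse of \<open>y\<close> is the required element.\<close>
  have "inv' (inv' y) = y" using permutes_bij[OF y] by (rule inv_inv_eq)
  moreover have "inj_on (\<lambda>z. (young_row p (y z), young_row ?q z)) {1..n}"
    using bij_betw_imp_inj_on[OF th'(1)] by (simp only: inj_on_cong[OF pair])
  ultimately have "inv' y \<in> young_pairs n p ?q"
    using permutes_inv[OF y] by (simp add: young_pairs_def)
  then show ?thesis by blast
qed

text \<open>The pairs for \<open>p\<close> and \<open>p'\<close> form a single double coset \<open>K x\<^sub>0 H\<close> in which every element has
  a unique expression.\<close>

lemma card_young_pairs_conj:
  assumes p: "p \<in> partitions_of n"
  shows "card (young_pairs n p (conj_partition p)) = card (young_subgroup n p) * card (young_subgroup n (conj_partition p))"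
proof -
  let ?q = "conj_partition p"
  note q = conj_partition_in[OF p]
  let ?H = "fibre_stabilizer n (young_row p)" and ?K = "fibre_stabilizer n (young_row ?q)"
  define u where "u x = (\<lambda>z. (young_row p (inv' x z), young_row ?q z))" for x
  obtain x0 where "x0 \<in> young_pairs n p ?q" using young_pairs_nonempty[OF p] by blast
  then have x0: "x0 permutes {1..n}" and inj0: "inj_on (u x0) {1..n}"
    unfolding young_pairs_def u_def by auto
  have img: "u x ` {1..n} = {(i, j). j < part p i}" if x: "x permutes {1..n}" and inj: "inj_on (u x) {1..n}" for x
    unfolding u_def
    by (rule diagram_bij[OF p card_young_row_inv[OF p x] card_young_row[OF q] inj[unfolded u_def]])
  define F :: "(nat \<Rightarrow> nat) \<times> (nat \<Rightarrow> nat) \<Rightarrow> nat \<Rightarrow> nat" where "F = (\<lambda>(k, h). k \<circ> x0 \<circ> inv' h)"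
  have "bij_betw F (?K \<times> ?H) (young_pairs n p ?q)"
  proof (rule bij_betw_imageI)
    show "inj_on F (?K \<times> ?H)"
    proof (rule inj_onI, clarify)
      fix k h k' h' assume kh: "k \<in> ?K" "h \<in> ?H" "k' \<in> ?K" "h' \<in> ?H" and e: "F (k, h) = F (k', h')"
      have k: "k permutes {1..n}" and h: "h permutes {1..n}" and k': "k' permutes {1..n}" and h': "h' permutes {1..n}"
        using kh by (auto simp: fibre_stabilizer_def)
      have e1: "k (x0 (inv' h z)) = k' (x0 (inv' h' z))" for z
        using fun_cong[OF e, of z] by (simp add: F_def)
      define w where "w = inv' k' \<circ> k"
      have w: "w permutes {1..n}" unfolding w_def using k permutes_inv[OF k'] by (rule permutes_compose)
      have k'K: "inv' k' \<in> ?K"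
        using subgroup.m_inv_closed[OF fibre_stabilizer_subgroup kh(3)] k' by (simp add: sym_group_carrier)
      \<comment> \<open>\<open>w\<close> lies in the second Young subgroup and in the conjugate by
        \<open>x0\<close> of the first, and these meet trivially by the choice of
        \<open>x0\<close>.\<close>
      have "w \<in> fibre_stabilizer n (u x0)"
        unfolding fibre_stabilizer_def
      proof (intro CollectI conjI ballI w)
        fix z assume z: "z \<in> {1..n}"
        have c: "young_row ?q (w z) = young_row ?q z"
          using kh(1) k'K z permutes_in_image[OF k, of z] by (auto simp: fibre_stabilizer_def w_def)
        have "k (x0 (inv' h (h (inv' x0 z)))) = k' (x0 (inv' h' (h (inv' x0 z))))" by (rule e1)
        then have "w z = x0 (inv' h' (h (inv' x0 z)))"
          using permutes_inverses[OF h] permutes_inverses[OF x0] permutes_inverses[OF k'] by (simp add: w_def)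
        then have "inv' x0 (w z) = inv' h' (h (inv' x0 z))"
          using permutes_inverses[OF x0] by simp
        moreover have "inv' h' \<in> ?H"
          using subgroup.m_inv_closed[OF fibre_stabilizer_subgroup kh(4)] h' by (simp add: sym_group_carrier)
        then have "young_row p (inv' h' (h (inv' x0 z))) = young_row p (inv' x0 z)"
          using kh(2) z permutes_in_image[OF permutes_inv[OF x0], of z] permutes_in_image[OF h, of "inv' x0 z"]
          by (auto simp: fibre_stabilizer_def)
        ultimately show "u x0 (w z) = u x0 z" using c by (simp add: u_def)
      qed
      then have wid: "w = id" using fibre_stabilizer_inj[OF inj0] by simp
      have "k z = k' z" for z
        using fun_cong[OF wid, of z] permutes_inverses(1)[OF k', of "k z"] by (simp add: w_def)
      then have kk: "k = k'" by (rule ext)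
      have "inv' h z = inv' h' z" for z
        using e1[of z] permutes_inj[OF k'] permutes_inj[OF x0] unfolding kk by (simp add: inj_eq)
      then have "inv' h = inv' h'" by (rule ext)
      then have "h = h'" by (metis h h' inv_inv_eq permutes_bij)
      with kk show "k = k' \<and> h = h'" by simp
    qed
    show "F ` (?K \<times> ?H) = young_pairs n p ?q"
    proof (intro equalityI subsetI)
      fix x assume "x \<in> F ` (?K \<times> ?H)"
      then obtain k h where kh: "k \<in> ?K" "h \<in> ?H" "x = k \<circ> x0 \<circ> inv' h" unfolding F_def by auto
      have k: "k permutes {1..n}" and h: "h permutes {1..n}" using kh by (auto simp: fibre_stabilizer_def)
      have x: "x permutes {1..n}" unfolding kh(3)
        using k h x0 permutes_inv[OF h] by (intro permutes_compose)
      have kK: "inv' k \<in> ?K"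
        using subgroup.m_inv_closed[OF fibre_stabilizer_subgroup kh(1)] k by (simp add: sym_group_carrier)
      have ux: "u x z = u x0 (inv' k z)" if z: "z \<in> {1..n}" for z
      proof -
        have "x (h (inv' x0 (inv' k z))) = z"
          unfolding kh(3) using permutes_inverses[OF h] permutes_inverses[OF x0] permutes_inverses[OF k] by simp
        then have "inv' x z = h (inv' x0 (inv' k z))" using permutes_inverses(2)[OF x] by metis
        moreover have "inv' x0 (inv' k z) \<in> {1..n}"
          using z permutes_in_image[OF permutes_inv[OF x0]] permutes_in_image[OF permutes_inv[OF k]] by blast
        ultimately show ?thesis using kh(2) kK z by (simp add: u_def fibre_stabilizer_def)
      qed
      have "inj_on (u x) {1..n}"
      proof (rule inj_onI)
        fix y z assume yz: "y \<in> {1..n}" "z \<in> {1..n}" "u x y = u x z"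
        have "inv' k y \<in> {1..n}" "inv' k z \<in> {1..n}"
          using yz permutes_in_image[OF permutes_inv[OF k]] by auto
        then have "inv' k y = inv' k z" using inj0 yz ux unfolding inj_on_def by metis
        then show "y = z" using permutes_inj[OF permutes_inv[OF k]] by (simp add: inj_eq)
      qed
      then show "x \<in> young_pairs n p ?q" using x by (simp add: young_pairs_def u_def)
    next
      fix x assume "x \<in> young_pairs n p ?q"
      then have x: "x permutes {1..n}" and inj: "inj_on (u x) {1..n}"
        unfolding young_pairs_def u_def by auto
      \<comment> \<open>Both \<open>u x\<close> and \<open>u x0\<close> are bijections onto the
        diagram, so \<open>k\<close> can match points through their cells. Agreement of the columns
        puts \<open>k\<close> into the second Young subgroup, and agreement of the rows puts
        \<open>inv' x \<circ> k \<circ> x0\<close> into the first.\<close>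
      define k where "k z = (if z \<in> {1..n} then inv_into {1..n} (u x) (u x0 z) else z)" for z
      have b: "bij_betw (u x) {1..n} {(i, j). j < part p i}" and b0: "bij_betw (u x0) {1..n} {(i, j). j < part p i}"
        using img[OF x inj] img[OF x0 inj0] inj inj0 by (auto simp: bij_betw_def)
      have "bij_betw (\<lambda>z. inv_into {1..n} (u x) (u x0 z)) {1..n} {1..n}"
        using bij_betw_trans[OF b0 bij_betw_inv_into[OF b]] by (simp add: comp_def)
      then have "bij_betw k {1..n} {1..n}" by (rule iffD1[OF bij_betw_cong, rotated]) (simp add: k_def)
      then have k: "k permutes {1..n}" by (rule bij_imp_permutes) (unfold k_def, rule if_not_P)
      have uk: "u x (k z) = u x0 z" if z: "z \<in> {1..n}" for z
      proof -
        have "u x0 z \<in> u x0 ` {1..n}" using z by (rule imageI)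
        then have "u x0 z \<in> u x ` {1..n}" by (simp only: img[OF x inj] img[OF x0 inj0])
        then show ?thesis using z by (simp add: k_def f_inv_into_f)
      qed
      have kK: "k \<in> ?K" using k uk by (auto simp: fibre_stabilizer_def u_def)
      define h where "h = inv' x \<circ> k \<circ> x0"
      have h: "h permutes {1..n}" unfolding h_def using x x0 k permutes_inv[OF x] by (intro permutes_compose)
      have "young_row p (h z) = young_row p z" if z: "z \<in> {1..n}" for z
        using uk[of "x0 z"] permutes_in_image[OF x0, of z] z permutes_inverses[OF x0] by (simp add: u_def h_def)
      then have hH: "h \<in> ?H" using h by (simp add: fibre_stabilizer_def)
      have "x = k \<circ> x0 \<circ> inv' h"
      proof (rule ext)
        fix z
        have "h (inv' h z) = z" using permutes_inverses[OF h] by simp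
        then have "x (h (inv' h z)) = x z" by simp
        then show "x z = (k \<circ> x0 \<circ> inv' h) z" using permutes_inverses[OF x] by (simp add: h_def)
      qed
      then have "x = F (k, h)" by (simp add: F_def)
      then show "x \<in> F ` (?K \<times> ?H)" using kK hH by blast
    qed
  qed
  then have "card (young_pairs n p ?q) = card (?K \<times> ?H)" by (simp add: bij_betw_same_card)
  then show ?thesis by (simp add: young_subgroup_eq[OF p] young_subgroup_eq[OF q] card_cartesian_product)
qed

lemma card_young_subgroup_pos: "p \<in> partitions_of n \<Longrightarrow> card (young_subgroup n p) > 0"
  by (simp add: young_subgroup_eq card_fibre_stabilizer_pos)

definition is_sym_char :: "nat \<Rightarrow> nat multiset \<Rightarrow> ((nat \<Rightarrow> nat) \<Rightarrow> complex) \<Rightarrow> bool" where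
  "is_sym_char n p \<chi> \<longleftrightarrow> \<chi> \<in> irr_chars (sym_group n) \<and>
     char_inner (sym_group n) \<chi> (young_trivial n p) \<noteq> 0 \<and>
     char_inner (sym_group n) \<chi> (young_sign n (conj_partition p)) \<noteq> 0"

lemma char_inner_young_expand:
  assumes p: "p \<in> partitions_of n" and q: "q \<in> partitions_of n"
  obtains s t :: "((nat \<Rightarrow> nat) \<Rightarrow> complex) \<Rightarrow> nat" where
    "\<And>\<chi>. \<chi> \<in> irr_chars (sym_group n) \<Longrightarrow> char_inner (sym_group n) \<chi> (young_trivial n p) = of_nat (s \<chi>)"
    "\<And>\<chi>. \<chi> \<in> irr_chars (sym_group n) \<Longrightarrow> char_inner (sym_group n) \<chi> (young_sign n q) = of_nat (t \<chi>)"
    "char_inner (sym_group n) (young_trivial n p) (young_sign n q) = of_nat (\<Sum>\<chi>\<in>irr_chars (sym_group n). s \<chi> * t \<chi>)"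
proof -
  have "\<exists>m::nat. char_inner (sym_group n) \<chi> (young_trivial n p) = of_nat m" if "\<chi> \<in> irr_chars (sym_group n)" for \<chi>
    using young_multiplicities(1)[OF p that] by (auto elim: Nats_cases)
  then obtain s :: "((nat \<Rightarrow> nat) \<Rightarrow> complex) \<Rightarrow> nat"
    where s: "\<And>\<chi>. \<chi> \<in> irr_chars (sym_group n) \<Longrightarrow> char_inner (sym_group n) \<chi> (young_trivial n p) = of_nat (s \<chi>)"
    by metis
  have "\<exists>m::nat. char_inner (sym_group n) \<chi> (young_sign n q) = of_nat m" if "\<chi> \<in> irr_chars (sym_group n)" for \<chi>
    using young_multiplicities(2)[OF q that] by (auto elim: Nats_cases)
  then obtain t :: "((nat \<Rightarrow> nat) \<Rightarrow> complex) \<Rightarrow> nat"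
    where t: "\<And>\<chi>. \<chi> \<in> irr_chars (sym_group n) \<Longrightarrow> char_inner (sym_group n) \<chi> (young_sign n q) = of_nat (t \<chi>)"
    by metis
  have "char_inner (sym_group n) (young_trivial n p) (young_sign n q)
    = (\<Sum>\<chi>\<in>irr_chars (sym_group n). char_inner (sym_group n) (young_trivial n p) \<chi> * char_inner (sym_group n) \<chi> (young_sign n q))"
    by (rule S.parseval[OF S.class_function_induced])
  also have "\<dots> = (\<Sum>\<chi>\<in>irr_chars (sym_group n). of_nat (s \<chi>) * of_nat (t \<chi>))"
  proof (intro sum.cong refl)
    fix \<chi> assume chi: "\<chi> \<in> irr_chars (sym_group n)"
    have "char_inner (sym_group n) (young_trivial n p) \<chi> = cnj (char_inner (sym_group n) \<chi> (young_trivial n p))"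
      by (rule S.char_inner_commute)
    then show "char_inner (sym_group n) (young_trivial n p) \<chi> * char_inner (sym_group n) \<chi> (young_sign n q) = of_nat (s \<chi>) * of_nat (t \<chi>)"
      by (simp add: s[OF chi] t[OF chi])
  qed
  finally have "char_inner (sym_group n) (young_trivial n p) (young_sign n q) = of_nat (\<Sum>\<chi>\<in>irr_chars (sym_group n). s \<chi> * t \<chi>)"
    by simp
  with s t show ?thesis by (rule that)
qed

text \<open>The inner product of the two induced characters is 1 by the double coset count, and it
  is a sum of products of natural multiplicities; so one product is 1 and all others vanish.\<close>

lemma ex1_is_sym_char:
  assumes p: "p \<in> partitions_of n"
  shows "\<exists>!\<chi>. is_sym_char n p \<chi>"
proof -
  note q = conj_partition_in[OF p]
  obtain s t where
    s: "\<And>\<chi>. \<chi> \<in> irr_chars (sym_group n) \<Longrightarrow> char_inner (sym_group n) \<chi> (young_trivial n p) = of_nat (s \<chi>)" and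
    t: "\<And>\<chi>. \<chi> \<in> irr_chars (sym_group n) \<Longrightarrow> char_inner (sym_group n) \<chi> (young_sign n (conj_partition p)) = of_nat (t \<chi>)" and
    st: "char_inner (sym_group n) (young_trivial n p) (young_sign n (conj_partition p)) = of_nat (\<Sum>\<chi>\<in>irr_chars (sym_group n). s \<chi> * t \<chi>)"
    by (rule char_inner_young_expand[OF p q]) (rule that)
  have "char_inner (sym_group n) (young_trivial n p) (young_sign n (conj_partition p)) = 1"
    unfolding char_inner_young[OF p q] card_young_pairs_conj[OF p]
    using card_young_subgroup_pos[OF p] card_young_subgroup_pos[OF q] by simp
  then have "of_nat (\<Sum>\<chi>\<in>irr_chars (sym_group n). s \<chi> * t \<chi>) = (of_nat 1 :: complex)" using st by simp
  then have "(\<Sum>\<chi>\<in>irr_chars (sym_group n). s \<chi> * t \<chi>) = 1" by (simp only: of_nat_eq_iff)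
  then obtain \<chi> where chi: "\<chi> \<in> irr_chars (sym_group n)" "s \<chi> * t \<chi> = 1"
    and z: "\<forall>\<psi>\<in>irr_chars (sym_group n). \<chi> \<noteq> \<psi> \<longrightarrow> s \<psi> * t \<psi> = 0"
    unfolding sum_eq_1_iff[OF S.finite_irr_chars] by blast
  show ?thesis
  proof (rule ex1I[of _ \<chi>])
    show "is_sym_char n p \<chi>" using chi s t by (auto simp: is_sym_char_def)
    fix \<psi> assume "is_sym_char n p \<psi>"
    then have psi: "\<psi> \<in> irr_chars (sym_group n)" and "s \<psi> \<noteq> 0" "t \<psi> \<noteq> 0"
      using s[of \<psi>] t[of \<psi>] by (auto simp: is_sym_char_def)
    then show "\<psi> = \<chi>" using z by fastforce
  qed
qed

lemma sym_char_is:
  assumes p: "p \<in> partitions_of n"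
  shows "is_sym_char n p (sym_char n p)"
proof -
  have "sym_char n p = (THE \<chi>. is_sym_char n p \<chi>)" by (simp add: sym_char_def is_sym_char_def)
  then show ?thesis using theI'[OF ex1_is_sym_char[OF p]] by simp
qed

lemma sym_char_eqI: "p \<in> partitions_of n \<Longrightarrow> is_sym_char n p \<chi> \<Longrightarrow> sym_char n p = \<chi>"
  using ex1_is_sym_char sym_char_is by blast

lemma sym_char_irr: "p \<in> partitions_of n \<Longrightarrow> sym_char n p \<in> irr_chars (sym_group n)"
  using sym_char_is by (auto simp: is_sym_char_def)

text \<open>An equal character is a constituent both of the trivial character induced for
  \<open>p\<close> and of the sign character induced for the conjugate of \<open>q\<close>. Hence a
  Young pair exists and \<open>q\<close> dominates \<open>p\<close>; by symmetry all partial sums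
  agree.\<close>

lemma sym_char_inj:
  assumes p: "p \<in> partitions_of n" and q: "q \<in> partitions_of n" and eq: "sym_char n p = sym_char n q"
  shows "p = q"
proof -
  have dom: "(\<Sum>i<k. part p i) \<le> (\<Sum>i<k. part q i)"
    if p: "p \<in> partitions_of n" and q: "q \<in> partitions_of n" and eq: "sym_char n p = sym_char n q" for p q k
  proof (rule young_pairs_dominance[OF p q])
    note q' = conj_partition_in[OF q]
    obtain s t where
      s: "\<And>\<chi>. \<chi> \<in> irr_chars (sym_group n) \<Longrightarrow> char_inner (sym_group n) \<chi> (young_trivial n p) = of_nat (s \<chi>)" and
      t: "\<And>\<chi>. \<chi> \<in> irr_chars (sym_group n) \<Longrightarrow> char_inner (sym_group n) \<chi> (young_sign n (conj_partition q)) = of_nat (t \<chi>)" and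
      st: "char_inner (sym_group n) (young_trivial n p) (young_sign n (conj_partition q)) = of_nat (\<Sum>\<chi>\<in>irr_chars (sym_group n). s \<chi> * t \<chi>)"
      by (rule char_inner_young_expand[OF p q']) (rule that)
    let ?c = "sym_char n p"
    have c: "?c \<in> irr_chars (sym_group n)" using sym_char_irr[OF p] .
    have "s ?c \<noteq> 0" using s[OF c] sym_char_is[OF p] by (auto simp: is_sym_char_def)
    moreover have "t ?c \<noteq> 0" using t[OF c] sym_char_is[OF q] unfolding eq by (auto simp: is_sym_char_def)
    moreover have "s ?c * t ?c \<le> (\<Sum>\<chi>\<in>irr_chars (sym_group n). s \<chi> * t \<chi>)" by (rule member_le_sum[OF c]) auto
    ultimately have nz: "(\<Sum>\<chi>\<in>irr_chars (sym_group n). s \<chi> * t \<chi>) \<noteq> 0"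
      by (metis le_zero_eq mult_eq_0_iff)
    have "char_inner (sym_group n) (young_trivial n p) (young_sign n (conj_partition q)) \<noteq> 0"
      unfolding st of_nat_eq_0_iff by (rule nz)
    then show "young_pairs n p (conj_partition q) \<noteq> {}" unfolding char_inner_young[OF p q'] by auto
  qed
  show ?thesis
    by (rule partition_eq_of_sums[OF p q], rule antisym) (rule dom[OF p q eq], rule dom[OF q p eq[symmetric]])
qed

lemma conj_class_sym_iff:
  assumes s: "\<sigma> \<in> carrier (sym_group n)" and t: "\<tau> \<in> carrier (sym_group n)"
  shows "\<tau> \<in> S.conj_class n \<sigma> \<longleftrightarrow> cycle_type n \<sigma> = cycle_type n \<tau>"
proof
  assume "\<tau> \<in> S.conj_class n \<sigma>"
  then obtain \<pi> where pi: "\<pi> permutes {1..n}" "\<tau> = \<pi> \<circ> \<sigma> \<circ> inv' \<pi>"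
    unfolding S.conj_class_def by (auto simp: sym_group_carrier)
  then show "cycle_type n \<sigma> = cycle_type n \<tau>"
    using s t permutes_inverses[OF pi(1)] by (intro cycle_type_conj[OF _ _ pi(1)]) (auto simp: sym_group_carrier)
next
  assume ct: "cycle_type n \<sigma> = cycle_type n \<tau>"
  have s': "\<sigma> permutes {1..n}" and t': "\<tau> permutes {1..n}" using s t by (auto simp: sym_group_carrier)
  obtain \<pi> where pi: "\<pi> permutes {1..n}" "\<And>x. \<pi> (\<sigma> x) = \<tau> (\<pi> x)"
    by (rule cycle_type_imp_conj[OF s' t' ct]) (rule that)
  have "\<tau> = \<pi> \<circ> \<sigma> \<circ> inv' \<pi>" using permutes_inverses[OF pi(1)] by (auto simp: fun_eq_iff pi(2))
  moreover have "\<pi> \<in> carrier (sym_group n)" using pi by (simp add: sym_group_carrier)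
  ultimately show "\<tau> \<in> S.conj_class n \<sigma>" unfolding S.conj_class_def by (auto intro!: exI[of _ \<pi>])
qed

text \<open>Finiteness is inherited from the irreducible characters through the injective
  labelling.\<close>

lemma finite_partitions [simp]: "finite (partitions_of n)"
proof (rule inj_on_finite)
  show "inj_on (sym_char n) (partitions_of n)" by (rule inj_onI) (rule sym_char_inj)
  show "sym_char n ` partitions_of n \<subseteq> irr_chars (sym_group n)" using sym_char_irr by blast
qed simp

text \<open>Injectivity leaves only a count: there are as many irreducible characters as classes,
  and the cycle type embeds the classes into the partitions.\<close>

theorem sym_char_bij: "bij_betw (sym_char n) (partitions_of n) (irr_chars (sym_group n))"
proof -
  have inj: "inj_on (sym_char n) (partitions_of n)" by (rule inj_onI) (rule sym_char_inj)
  have sub: "sym_char n ` partitions_of n \<subseteq> irr_chars (sym_group n)" using sym_char_irr by blast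
  have "card (irr_chars (sym_group n)) = card (conj_classes (sym_group n))" by (rule S.card_irr_chars)
  also have "\<dots> \<le> card (partitions_of n)"
  proof (rule card_inj_on_le[of "\<lambda>K. cycle_type n (SOME \<sigma>. \<sigma> \<in> K)"])
    have some: "(SOME \<sigma>. \<sigma> \<in> K) \<in> K \<and> (SOME \<sigma>. \<sigma> \<in> K) \<in> carrier (sym_group n) \<and> K = S.conj_class n (SOME \<sigma>. \<sigma> \<in> K)"
      if K: "K \<in> conj_classes (sym_group n)" for K
    proof -
      obtain g where "g \<in> carrier (sym_group n)" "K = S.conj_class n g" using K by (auto simp: S.conj_classes_eq)
      then have "g \<in> K" using S.conj_class_self by simp
      then have "(SOME \<sigma>. \<sigma> \<in> K) \<in> K" by (rule someI[of "\<lambda>\<sigma>. \<sigma> \<in> K"])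
      then show ?thesis using S.conj_classes_eq_class[OF K] by blast
    qed
    show "inj_on (\<lambda>K. cycle_type n (SOME \<sigma>. \<sigma> \<in> K)) (conj_classes (sym_group n))"
    proof (rule inj_onI)
      fix K L assume K: "K \<in> conj_classes (sym_group n)" and L: "L \<in> conj_classes (sym_group n)"
        and e: "cycle_type n (SOME \<sigma>. \<sigma> \<in> K) = cycle_type n (SOME \<sigma>. \<sigma> \<in> L)"
      have "(SOME \<sigma>. \<sigma> \<in> L) \<in> S.conj_class n (SOME \<sigma>. \<sigma> \<in> K)"
        using conj_class_sym_iff e some[OF K] some[OF L] by blast
      then have "S.conj_class n (SOME \<sigma>. \<sigma> \<in> L) = S.conj_class n (SOME \<sigma>. \<sigma> \<in> K)"
        using some[OF K] by (intro S.conj_class_eq) auto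
      then show "K = L" using some[OF K] some[OF L] by simp
    qed
    show "(\<lambda>K. cycle_type n (SOME \<sigma>. \<sigma> \<in> K)) ` conj_classes (sym_group n) \<subseteq> partitions_of n"
      using some by (auto intro!: cycle_type_partition simp: sym_group_carrier)
  qed simp
  also have "\<dots> = card (sym_char n ` partitions_of n)" using card_image[OF inj] by simp
  finally have "sym_char n ` partitions_of n = irr_chars (sym_group n)"
    using sub by (intro card_seteq) auto
  then show ?thesis using inj by (simp add: bij_betw_def)
qed

lemma sign_twist:
  assumes chi: "\<chi> \<in> irr_chars (sym_group n)"
  shows "(\<lambda>\<sigma>\<in>carrier (sym_group n). of_int (sign \<sigma>) * \<chi> \<sigma>) \<in> irr_chars (sym_group n)"
proof -
  obtain d \<rho> where r: "representation (sym_group n) d \<rho>"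
    and t: "\<And>g. g \<in> carrier (sym_group n) \<Longrightarrow> \<chi> g = trace_mat (\<rho> g)"
    using S.irr_charE[OF chi] by metis
  let ?\<rho> = "\<lambda>g. of_int (sign g) \<cdot>\<^sub>m \<rho> g"
  have r': "representation (sym_group n) d ?\<rho>"
    by (rule S.representation_twist[OF r]) (auto simp: sym_group_one sign_mult_sym)
  have t': "trace_mat (?\<rho> g) = of_int (sign g) * \<chi> g" if "g \<in> carrier (sym_group n)" for g
    using trace_mat_smult[OF S.representationD(1)[OF r that]] t[OF that] by simp
  have "char_inner (sym_group n) (\<lambda>g. trace_mat (?\<rho> g)) (\<lambda>g. trace_mat (?\<rho> g)) = char_inner (sym_group n) \<chi> \<chi>"
    unfolding char_inner_def
  proof (intro arg_cong2[where f = "(/)"] sum.cong refl)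
    fix g assume g: "g \<in> carrier (sym_group n)"
    have "of_int (sign g) * of_int (sign g) = (1 :: complex)" by (metis of_int_1 of_int_mult sign_idempotent)
    then show "trace_mat (?\<rho> g) * cnj (trace_mat (?\<rho> g)) = \<chi> g * cnj (\<chi> g)"
      unfolding t'[OF g] by (simp add: mult_ac)
  qed
  also have "\<dots> = 1" using S.irr_chars_orthonormal[OF chi chi] by simp
  finally have "restrict (\<lambda>g. trace_mat (?\<rho> g)) (carrier (sym_group n)) \<in> irr_chars (sym_group n)"
    by (rule S.norm_1_irreducible[OF r'])
  moreover have "restrict (\<lambda>g. trace_mat (?\<rho> g)) (carrier (sym_group n))
      = (\<lambda>\<sigma>\<in>carrier (sym_group n). of_int (sign \<sigma>) * \<chi> \<sigma>)"
    by (rule restrict_ext) (rule t')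
  ultimately show ?thesis by simp
qed

text \<open>Multiplication by the sign exchanges the trivial and the sign character of every Young
  subgroup, hence the two multiplicities that define the label.\<close>

theorem sym_char_conj:
  assumes p: "p \<in> partitions_of n"
  shows "sym_char n (conj_partition p) = (\<lambda>\<sigma>\<in>carrier (sym_group n). of_int (sign \<sigma>) * sym_char n p \<sigma>)"
proof (rule sym_char_eqI[OF conj_partition_in[OF p]])
  let ?c = "sym_char n p" and ?t = "\<lambda>\<sigma>\<in>carrier (sym_group n). of_int (sign \<sigma>) * sym_char n p \<sigma>"
  note c = sym_char_irr[OF p]
  note cf = S.class_function_irr_char[OF c] and tf = S.class_function_irr_char[OF sign_twist[OF c]]
  have sq: "of_int (sign g) * of_int (sign g) = (1 :: complex)" for g :: "nat \<Rightarrow> nat"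
    by (metis of_int_1 of_int_mult sign_idempotent)
  have mem: "h \<in> carrier (sym_group n)" if "h \<in> young_subgroup n q" for h q
    using that young_subgroup_carrier by blast
  have 1: "char_inner (sym_group n) ?t (young_trivial n q) = char_inner (sym_group n) ?c (young_sign n q)" for q
    unfolding char_inner_young_trivial[OF tf] char_inner_young_sign[OF cf]
    by (intro arg_cong2[where f = "(/)"] sum.cong refl) (simp add: mem mult.commute)
  have 2: "char_inner (sym_group n) ?t (young_sign n q) = char_inner (sym_group n) ?c (young_trivial n q)" for q
    unfolding char_inner_young_trivial[OF cf] char_inner_young_sign[OF tf]
  proof (intro arg_cong2[where f = "(/)"] sum.cong refl)
    fix h assume "h \<in> young_subgroup n q"
    then show "?t h * of_int (sign h) = ?c h" using sq[of h] by (simp add: mem mult_ac)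
  qed
  show "is_sym_char n (conj_partition p) ?t"
    using sym_char_is[OF p] sign_twist[OF c] by (simp add: is_sym_char_def 1 2 conj_partition_conj[OF p])
qed

section \<open>Characters and classes of the alternating group\<close>

lemma finite_grp_alt: "finite_grp (alt_group n)"
  by (intro finite_grp.intro finite_grp_axioms.intro alt_group_is_group)
    (auto simp: alt_group_def intro: finite_subset[OF _ finite_permutations[of "{1..n}"]])

interpretation A: finite_grp "alt_group n" for n by (rule finite_grp_alt)

lemma alt_mult [simp]: "x \<otimes>\<^bsub>alt_group n\<^esub> y = x \<circ> y"
  by (simp add: alt_group_mult)

lemma alt_subset_sym: "carrier (alt_group n) \<subseteq> carrier (sym_group n)"
  by (auto simp: alt_group_carrier sym_group_carrier)

lemma alt_in_sym: "g \<in> carrier (alt_group n) \<Longrightarrow> g \<in> carrier (sym_group n)"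
  using alt_subset_sym by blast

lemma alt_carrier_eq: "carrier (alt_group n) = {g \<in> carrier (sym_group n). evenperm g}"
  by (auto simp: alt_group_carrier sym_group_carrier)

lemma order_sym_alt: "n \<ge> 2 \<Longrightarrow> Coset.order (sym_group n) = 2 * Coset.order (alt_group n)"
  using alt_group_card_carrier[of n] sym_group_card_carrier[of n] by (simp add: Coset.order_def)

text \<open>\<open>(1 + sign g) / 2\<close> is the indicator function of the even
  permutations.\<close>

lemma sum_alt:
  "(\<Sum>g\<in>carrier (alt_group n). F g) =
    ((\<Sum>g\<in>carrier (sym_group n). F g) + (\<Sum>g\<in>carrier (sym_group n). of_int (sign g) * F g)) / (2 :: complex)"
proof -
  have "(\<Sum>g\<in>carrier (alt_group n). F g) = (\<Sum>g\<in>carrier (sym_group n). if evenperm g then F g else 0)"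
    unfolding alt_carrier_eq by (rule sum.inter_filter) simp
  also have "\<dots> = (\<Sum>g\<in>carrier (sym_group n). (F g + of_int (sign g) * F g) / 2)"
    by (intro sum.cong refl) (simp add: sign_def)
  finally show ?thesis by (simp add: sum_divide_distrib[symmetric] sum.distrib)
qed

lemma sym_char_alt_eq: "g \<in> carrier (alt_group n) \<Longrightarrow> sym_char_alt n p g = sym_char n p g"
  by (simp add: sym_char_alt_def)

lemma sym_char_alt_conj:
  assumes p: "p \<in> partitions_of n"
  shows "sym_char_alt n (conj_partition p) = sym_char_alt n p"
  unfolding sym_char_alt_def sym_char_conj[OF p]
  by (rule restrict_ext) (auto simp: alt_carrier_eq sign_def)

lemma conj_partition_eq_iff:
  "p \<in> partitions_of n \<Longrightarrow> q \<in> partitions_of n \<Longrightarrow> p = conj_partition q \<longleftrightarrow> conj_partition p = q"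
  using conj_partition_conj[of p n] conj_partition_conj[of q n] by auto

text \<open>By \<open>sum_alt\<close> the inner product over A_n is the sum of two over S_n, the
  second twisted by the sign, which conjugates \<open>q\<close>. The value 2 at
  \<open>p = q = conj_partition p\<close> reflects the splitting.\<close>

lemma char_inner_sym_char_alt:
  assumes n: "n \<ge> 2" and p: "p \<in> partitions_of n" and q: "q \<in> partitions_of n"
  shows "char_inner (alt_group n) (sym_char_alt n p) (sym_char_alt n q)
    = (if p = q then 1 else 0) + (if conj_partition p = q then 1 else 0)"
proof -
  let ?S = "carrier (sym_group n)"
  have "(\<Sum>g\<in>carrier (alt_group n). sym_char_alt n p g * cnj (sym_char_alt n q g))
      = (\<Sum>g\<in>carrier (alt_group n). sym_char n p g * cnj (sym_char n q g))"
    by (intro sum.cong refl) (simp add: sym_char_alt_eq)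
  also have "\<dots> = ((\<Sum>g\<in>?S. sym_char n p g * cnj (sym_char n q g))
      + (\<Sum>g\<in>?S. of_int (sign g) * (sym_char n p g * cnj (sym_char n q g)))) / 2"
    by (rule sum_alt)
  also have "(\<Sum>g\<in>?S. of_int (sign g) * (sym_char n p g * cnj (sym_char n q g)))
      = (\<Sum>g\<in>?S. sym_char n p g * cnj (sym_char n (conj_partition q) g))"
    by (intro sum.cong refl) (simp add: sym_char_conj[OF q])
  finally have "char_inner (alt_group n) (sym_char_alt n p) (sym_char_alt n q)
      = char_inner (sym_group n) (sym_char n p) (sym_char n q)
        + char_inner (sym_group n) (sym_char n p) (sym_char n (conj_partition q))"
    using order_sym_alt[OF n] by (simp add: char_inner_def add_divide_distrib)
  also have "char_inner (sym_group n) (sym_char n p) (sym_char n q) = (if p = q then 1 else 0)"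
    using S.irr_chars_orthonormal[OF sym_char_irr[OF p] sym_char_irr[OF q]] sym_char_inj[OF p q] by auto
  also have "char_inner (sym_group n) (sym_char n p) (sym_char n (conj_partition q))
      = (if conj_partition p = q then 1 else 0)"
    using S.irr_chars_orthonormal[OF sym_char_irr[OF p] sym_char_irr[OF conj_partition_in[OF q]]]
      sym_char_inj[OF p conj_partition_in[OF q]] conj_partition_eq_iff[OF p q] by auto
  finally show ?thesis .
qed

lemma representation_alt: "representation (sym_group n) d \<rho> \<Longrightarrow> representation (alt_group n) d \<rho>"
  unfolding A.representation_iff S.representation_iff using alt_subset_sym[of n]
  by (auto simp: sym_group_one alt_group_one)

lemma sym_char_alt_irr:
  assumes n: "n \<ge> 2" and p: "p \<in> partitions_of n" and ns: "conj_partition p \<noteq> p"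
  shows "sym_char_alt n p \<in> irr_chars (alt_group n)"
proof -
  obtain d \<rho> where r: "representation (sym_group n) d \<rho>"
    and t: "\<And>g. g \<in> carrier (sym_group n) \<Longrightarrow> sym_char n p g = trace_mat (\<rho> g)"
    using S.irr_charE[OF sym_char_irr[OF p]] by metis
  have t': "sym_char_alt n p g = trace_mat (\<rho> g)" if "g \<in> carrier (alt_group n)" for g
    using that t[of g] alt_subset_sym by (auto simp: sym_char_alt_eq)
  have "char_inner (alt_group n) (\<lambda>g. trace_mat (\<rho> g)) (\<lambda>g. trace_mat (\<rho> g))
      = char_inner (alt_group n) (sym_char_alt n p) (sym_char_alt n p)"
    by (rule A.char_inner_cong) (simp_all add: t')
  also have "\<dots> = 1" using char_inner_sym_char_alt[OF n p p] ns by simp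
  finally have "restrict (\<lambda>g. trace_mat (\<rho> g)) (carrier (alt_group n)) \<in> irr_chars (alt_group n)"
    by (rule A.norm_1_irreducible[OF representation_alt[OF r]])
  moreover have "restrict (\<lambda>g. trace_mat (\<rho> g)) (carrier (alt_group n)) = sym_char_alt n p"
    unfolding sym_char_alt_def by (rule restrict_ext) (simp add: t alt_in_sym)
  ultimately show ?thesis by simp
qed

lemma alt_conj_class_sub: "A.conj_class n g \<subseteq> S.conj_class n g"
proof
  fix x assume "x \<in> A.conj_class n g"
  then obtain h where h: "h \<in> carrier (alt_group n)" "x = h \<circ> g \<circ> inv' h"
    by (auto simp: A.conj_class_def alt_group_inv_equality)
  then show "x \<in> S.conj_class n g"
    by (auto simp: S.conj_class_def alt_in_sym intro!: exI[of _ h])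
qed

lemma alt_conj_class_cycle_type:
  assumes g: "g \<in> carrier (alt_group n)" and x: "x \<in> A.conj_class n g"
  shows "cycle_type n x = cycle_type n g"
proof -
  have "x \<in> carrier (alt_group n)" using A.conj_class_closed[OF g] x by blast
  then have "x \<in> S.conj_class n g \<longleftrightarrow> cycle_type n g = cycle_type n x"
    by (intro conj_class_sym_iff alt_in_sym g)
  then show ?thesis using alt_conj_class_sub x by auto
qed

lemma nonsplit_class:
  assumes g: "g \<in> carrier (alt_group n)" and nod: "\<not> odd_distinct (cycle_type n g)"
  shows "A.conj_class n g = even_perms_of_type n (cycle_type n g)"
proof (intro equalityI subsetI)
  fix x assume "x \<in> A.conj_class n g"
  then show "x \<in> even_perms_of_type n (cycle_type n g)"
    using alt_conj_class_cycle_type[OF g] A.conj_class_closed[OF g] by (auto simp: even_perms_of_type_def)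
next
  fix x assume "x \<in> even_perms_of_type n (cycle_type n g)"
  then have x: "x \<in> carrier (alt_group n)" "cycle_type n g = cycle_type n x" by (auto simp: even_perms_of_type_def)
  have gp: "g permutes {1..n}" and xp: "x permutes {1..n}" using g x by (auto simp: alt_group_carrier)
  obtain \<pi> where pi: "\<pi> permutes {1..n}" "\<And>z. \<pi> (g z) = x (\<pi> z)"
    by (rule cycle_type_imp_conj[OF gp xp x(2)]) (rule that)
  obtain w where w: "w permutes {1..n}" "\<not> evenperm w" "w \<circ> g = g \<circ> w"
    by (rule odd_centralizer[OF gp nod]) (rule that)
  \<comment> \<open>An odd conjugator is corrected by an odd permutation that commutes with
    \<open>g\<close>.\<close>
  define h where "h = (if evenperm \<pi> then \<pi> else \<pi> \<circ> w)"
  have hp: "h permutes {1..n}" using pi w permutes_compose by (auto simp: h_def)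
  have "evenperm h"
    using w pi evenperm_comp[OF permutation_if_permutes[OF pi(1)] permutation_if_permutes[OF w(1)]]
    by (auto simp: h_def)
  then have hA: "h \<in> carrier (alt_group n)" using hp by (simp add: alt_group_carrier)
  have "h (g z) = x (h z)" for z
    using pi(2) fun_cong[OF w(3), of z] by (auto simp: h_def)
  then have "x = h \<circ> g \<circ> inv' h" using permutes_inverses[OF hp] by (auto simp: fun_eq_iff)
  then show "x \<in> A.conj_class n g"
    using hA by (auto simp: A.conj_class_def alt_group_inv_equality intro!: exI[of _ h])
qed

section \<open>Labels for the characters and classes of A_n, and existence of a labelling\<close>

locale alt_labels =
  fixes n :: nat and sc :: "nat multiset \<Rightarrow> pm \<Rightarrow> (nat \<Rightarrow> nat) \<Rightarrow> complex"
    and cc :: "nat multiset \<Rightarrow> pm \<Rightarrow> (nat \<Rightarrow> nat) set"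
  assumes n2: "n \<ge> 2" and sc: "split_char_choice n sc" and cc: "split_class_choice n cc"
begin

lemma split_char:
  assumes "p \<in> partitions_of n" "conj_partition p = p"
  shows "sc p s \<in> irr_chars (alt_group n)" "sc p Plus \<noteq> sc p Minus"
    "\<And>g. g \<in> carrier (alt_group n) \<Longrightarrow> sym_char_alt n p g = sc p Plus g + sc p Minus g"
  using sc assms unfolding split_char_choice_def by (cases s; blast)+

definition label_char :: "char_label \<Rightarrow> (nat \<Rightarrow> nat) \<Rightarrow> complex" where
  "label_char L = the_elem (chars_labelled n sc L)"

lemma chars_labelled_eq:
  assumes L: "L \<in> char_labels n"
  shows "chars_labelled n sc L = {label_char L}"
proof -
  consider p where "L = Nonsplit_Char {p, conj_partition p}" "p \<in> partitions_of n"
    | p s where "L = Split_Char p s" using L unfolding char_labels_def by blast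
  then show ?thesis
  proof cases
    case 1
    then show ?thesis using sym_char_alt_conj by (simp add: label_char_def)
  next
    case 2
    then show ?thesis by (simp add: label_char_def)
  qed
qed

lemma label_char_nonsplit:
  "p \<in> partitions_of n \<Longrightarrow> label_char (Nonsplit_Char {p, conj_partition p}) = sym_char_alt n p"
  using sym_char_alt_conj by (simp add: label_char_def)

lemma label_char_split: "label_char (Split_Char p s) = sc p s"
  by (simp add: label_char_def)

lemma label_char_irr:
  assumes "L \<in> char_labels n"
  shows "label_char L \<in> irr_chars (alt_group n)"
  using assms unfolding char_labels_def
  by (auto simp: label_char_nonsplit label_char_split split_char sym_char_alt_irr[OF n2])

lemma char_inner_self_conj:
  assumes p: "p \<in> partitions_of n" "conj_partition p = p" and phi: "\<phi> \<in> irr_chars (alt_group n)"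
  shows "char_inner (alt_group n) \<phi> (sym_char_alt n p)
    = (if \<phi> = sc p Plus then 1 else 0) + (if \<phi> = sc p Minus then 1 else 0)"
proof -
  have "char_inner (alt_group n) \<phi> (sym_char_alt n p) = cnj (char_inner (alt_group n) (sym_char_alt n p) \<phi>)"
    by (rule A.char_inner_commute)
  also have "char_inner (alt_group n) (sym_char_alt n p) \<phi>
      = char_inner (alt_group n) (\<lambda>g. sc p Plus g + sc p Minus g) \<phi>"
    by (rule A.char_inner_cong) (simp_all add: split_char(3)[OF p])
  also have "\<dots> = (if \<phi> = sc p Plus then 1 else 0) + (if \<phi> = sc p Minus then 1 else 0)"
    unfolding A.char_inner_add using A.irr_chars_orthonormal[OF split_char(1)[OF p] phi] by auto
  finally show ?thesis by (simp add: if_distrib cong: if_cong)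
qed

lemma char_inner_irr_alt:
  assumes q: "q \<in> partitions_of n" and phi: "\<phi> \<in> irr_chars (alt_group n)"
  obtains m :: nat where "char_inner (alt_group n) \<phi> (sym_char_alt n q) = of_nat m"
proof (cases "conj_partition q = q")
  case True
  show ?thesis
    by (rule that[of "(if \<phi> = sc q Plus then 1 else 0) + (if \<phi> = sc q Minus then 1 else 0)"])
      (simp add: char_inner_self_conj[OF q True phi])
next
  case False
  show ?thesis
    by (rule that[of "if \<phi> = sym_char_alt n q then 1 else 0"])
      (simp add: A.irr_chars_orthonormal[OF phi sym_char_alt_irr[OF n2 q False]])
qed

text \<open>The inner products with restrictions from S_n recover the partition of a label up to
  conjugation, as injectivity of \<open>label_char\<close> requires.\<close>

lemma label_char_inner:
  assumes p: "p \<in> partitions_of n"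
    and Lp: "L = Nonsplit_Char {p, conj_partition p} \<and> conj_partition p \<noteq> p
      \<or> (\<exists>s. L = Split_Char p s) \<and> conj_partition p = p" and q: "q \<in> partitions_of n"
  shows "char_inner (alt_group n) (label_char L) (sym_char_alt n q) \<noteq> 0 \<longleftrightarrow> q = p \<or> q = conj_partition p"
  using Lp
proof
  assume ns: "L = Nonsplit_Char {p, conj_partition p} \<and> conj_partition p \<noteq> p"
  then have "label_char L = sym_char_alt n p" using label_char_nonsplit[OF p] by simp
  then show ?thesis using char_inner_sym_char_alt[OF n2 p q] by auto
next
  assume "(\<exists>s. L = Split_Char p s) \<and> conj_partition p = p"
  then obtain s where s: "L = Split_Char p s" and self: "conj_partition p = p" by blast
  have l: "label_char L = sc p s" using s by (simp add: label_char_split)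
  note irr = split_char(1)[OF p self]
  have "char_inner (alt_group n) (sc p s) (sym_char_alt n p) = 1"
    using char_inner_self_conj[OF p self irr[of s]] split_char(2)[OF p self] by (cases s) auto
  moreover have "char_inner (alt_group n) (sc p s) (sym_char_alt n q) = 0" if "q \<noteq> p"
  proof -
    obtain a :: nat where a: "char_inner (alt_group n) (sc p Plus) (sym_char_alt n q) = of_nat a"
      by (rule char_inner_irr_alt[OF q irr[of Plus]]) (rule that)
    obtain b :: nat where b: "char_inner (alt_group n) (sc p Minus) (sym_char_alt n q) = of_nat b"
      by (rule char_inner_irr_alt[OF q irr[of Minus]]) (rule that)
    \<comment> \<open>The multiplicities of both halves are natural numbers, and they add up to the
      inner product of two different restrictions, which is 0.\<close>
    have "0 = char_inner (alt_group n) (sym_char_alt n p) (sym_char_alt n q)"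
      using char_inner_sym_char_alt[OF n2 p q] that self by simp
    also have "\<dots> = char_inner (alt_group n) (\<lambda>g. sc p Plus g + sc p Minus g) (sym_char_alt n q)"
      by (rule A.char_inner_cong) (simp_all add: split_char(3)[OF p self])
    also have "\<dots> = of_nat (a + b)" unfolding A.char_inner_add a b by simp
    finally have "a + b = 0" by (metis of_nat_eq_0_iff)
    then show ?thesis using a b by (cases s) auto
  qed
  ultimately show ?thesis using l self by auto
qed

lemma char_labels_cases:
  assumes "L \<in> char_labels n"
  obtains p where "p \<in> partitions_of n" "L = Nonsplit_Char {p, conj_partition p} \<and> conj_partition p \<noteq> p
      \<or> (\<exists>s. L = Split_Char p s) \<and> conj_partition p = p"
  using assms unfolding char_labels_def by blast

theorem label_char_bij: "bij_betw label_char (char_labels n) (irr_chars (alt_group n))"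
proof (rule bij_betw_imageI)
  show "inj_on label_char (char_labels n)"
  proof (rule inj_onI)
    fix L M assume L: "L \<in> char_labels n" and M: "M \<in> char_labels n" and eq: "label_char L = label_char M"
    obtain p where p: "p \<in> partitions_of n" and Lp: "L = Nonsplit_Char {p, conj_partition p} \<and> conj_partition p \<noteq> p
      \<or> (\<exists>s. L = Split_Char p s) \<and> conj_partition p = p" by (rule char_labels_cases[OF L])
    obtain q where q: "q \<in> partitions_of n" and Mq: "M = Nonsplit_Char {q, conj_partition q} \<and> conj_partition q \<noteq> q
      \<or> (\<exists>s. M = Split_Char q s) \<and> conj_partition q = q" by (rule char_labels_cases[OF M])
    have pq: "q = p \<or> q = conj_partition p"
      using label_char_inner[OF p Lp q] label_char_inner[OF q Mq q] eq by simp
    show "L = M"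
    proof (cases "conj_partition p = p")
      case True
      then have "q = p" using pq by simp
      then obtain s t where "L = Split_Char p s" "M = Split_Char p t" using Lp Mq True by auto
      then show ?thesis using eq split_char(2)[OF p True] by (cases s; cases t) (auto simp: label_char_split)
    next
      case False
      have "conj_partition q \<noteq> q" using pq False conj_partition_conj[OF p] by auto
      then have "L = Nonsplit_Char {p, conj_partition p}" "M = Nonsplit_Char {q, conj_partition q}"
        using Lp Mq False by auto
      then show ?thesis using pq conj_partition_conj[OF p] by auto
    qed
  qed
  show "label_char ` char_labels n = irr_chars (alt_group n)"
  proof (intro equalityI subsetI)
    fix \<phi> assume "\<phi> \<in> label_char ` char_labels n"
    then show "\<phi> \<in> irr_chars (alt_group n)" using label_char_irr by blast
  next
    fix \<phi> assume phi: "\<phi> \<in> irr_chars (alt_group n)"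
    have "\<exists>p\<in>partitions_of n. char_inner (alt_group n) \<phi> (sym_char_alt n p) \<noteq> 0"
    proof (rule ccontr)
      assume "\<not> ?thesis"
      then have z: "char_inner (alt_group n) \<phi> (sym_char_alt n p) = 0" if "p \<in> partitions_of n" for p
        using that by blast
      \<comment> \<open>By Frobenius reciprocity this induced character is orthogonal to all
        irreducible characters of S_n and hence zero, whereas its value at the identity is a
        positive multiple of the degree of \<open>\<phi>\<close>.\<close>
      let ?f = "induced_char (sym_group n) (carrier (alt_group n)) \<phi>"
      have "char_inner (sym_group n) ?f \<chi> = 0" if chi: "\<chi> \<in> irr_chars (sym_group n)" for \<chi>
      proof -
        obtain p where p: "p \<in> partitions_of n" "\<chi> = sym_char n p"
          using sym_char_bij[of n] chi unfolding bij_betw_def by blast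
        have "char_inner (sym_group n) \<chi> ?f
          = (\<Sum>h\<in>carrier (alt_group n). \<chi> h * cnj (\<phi> h)) / of_nat (card (carrier (alt_group n)))"
          by (rule S.frobenius_reciprocity[OF S.class_function_irr_char[OF chi] alt_subset_sym])
        also have "\<dots> = char_inner (alt_group n) (sym_char_alt n p) \<phi>"
          by (simp add: char_inner_def Coset.order_def p(2) sym_char_alt_eq)
        also have "\<dots> = cnj (char_inner (alt_group n) \<phi> (sym_char_alt n p))" by (rule A.char_inner_commute)
        also have "\<dots> = 0" using z[OF p(1)] by simp
        finally show ?thesis using S.char_inner_commute[of n ?f \<chi>] by simp
      qed
      then have "?f id = 0"
        using S.class_function_complete[OF S.class_function_induced, of n "carrier (alt_group n)" \<phi> id]
        by (simp add: sym_group_carrier permutes_id)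
      moreover have "?f id = of_nat (card (carrier (sym_group n))) * \<phi> id / of_nat (card (carrier (alt_group n)))"
      proof -
        have "inv\<^bsub>sym_group n\<^esub> x \<circ> id \<circ> x = id" if "x \<in> carrier (sym_group n)" for x
          using that permutes_inverses(2)[of x "{1..n}"] by (auto simp: sym_group_carrier fun_eq_iff)
        then have "{x \<in> carrier (sym_group n). inv\<^bsub>sym_group n\<^esub> x \<circ> id \<circ> x \<in> carrier (alt_group n)} = carrier (sym_group n)"
          by (auto simp: alt_group_carrier permutes_id evenperm_id)
        then show ?thesis
          using \<open>\<And>x. x \<in> carrier (sym_group n) \<Longrightarrow> inv\<^bsub>sym_group n\<^esub> x \<circ> id \<circ> x = id\<close>
          by (simp add: induced_char_def del: id_comp comp_id o_id id_o)
      qed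
      moreover obtain d where "\<phi> id = of_nat d" "d > 0"
        using A.irr_char_degree[OF phi] by (auto simp: alt_group_one)
      ultimately show False using S.order_pos[of n] A.order_pos[of n] S.one_closed[of n] A.one_closed[of n]
        by (auto simp: Coset.order_def)
    qed
    then obtain p where p: "p \<in> partitions_of n" and nz: "char_inner (alt_group n) \<phi> (sym_char_alt n p) \<noteq> 0" by blast
    show "\<phi> \<in> label_char ` char_labels n"
    proof (cases "conj_partition p = p")
      case True
      then obtain s where "\<phi> = sc p s" using nz char_inner_self_conj[OF p True phi] by (auto split: if_splits)
      then have "\<phi> = label_char (Split_Char p s)" by (simp add: label_char_split)
      moreover have "Split_Char p s \<in> char_labels n" using p True by (auto simp: char_labels_def)
      ultimately show ?thesis by blast
    next
      case False
      then have "\<phi> = sym_char_alt n p"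
        using nz A.irr_chars_orthonormal[OF phi sym_char_alt_irr[OF n2 p False]] by (auto split: if_splits)
      then have "\<phi> = label_char (Nonsplit_Char {p, conj_partition p})" using label_char_nonsplit[OF p] by simp
      moreover have "Nonsplit_Char {p, conj_partition p} \<in> char_labels n" using p False by (auto simp: char_labels_def)
      ultimately show ?thesis by blast
    qed
  qed
qed

lemma split_class:
  assumes "v \<in> partitions_of n" "odd_distinct v"
  shows "cc v s \<in> conj_classes (alt_group n)" "cc v Plus \<noteq> cc v Minus"
    "even_perms_of_type n v = cc v Plus \<union> cc v Minus"
  using cc assms unfolding split_class_choice_def by (cases s; blast)+

definition label_type :: "class_label \<Rightarrow> nat multiset" where
  "label_type L = (case L of Nonsplit_Class v \<Rightarrow> v | Split_Class v s \<Rightarrow> v)"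

lemma class_labelled_type:
  assumes L: "L \<in> class_labels n"
  shows "class_labelled n cc L \<in> conj_classes (alt_group n)"
    "class_labelled n cc L \<subseteq> even_perms_of_type n (label_type L)"
proof -
  consider v where "L = Nonsplit_Class v" "\<not> odd_distinct v" "even_perms_of_type n v \<noteq> {}"
    | v s where "L = Split_Class v s" "v \<in> partitions_of n" "odd_distinct v"
    using L unfolding class_labels_def by blast
  then have "class_labelled n cc L \<in> conj_classes (alt_group n) \<and>
    class_labelled n cc L \<subseteq> even_perms_of_type n (label_type L)"
  proof cases
    case 1
    then obtain g where g: "g \<in> carrier (alt_group n)" "cycle_type n g = v" by (auto simp: even_perms_of_type_def)
    then have "even_perms_of_type n v = A.conj_class n g" using nonsplit_class[OF g(1)] 1 by simp
    then show ?thesis using 1 g by (simp add: label_type_def A.conj_classes_eq)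
  next
    case 2
    then show ?thesis using split_class[OF 2(2,3)] by (cases s) (auto simp: label_type_def)
  qed
  then show "class_labelled n cc L \<in> conj_classes (alt_group n)"
    "class_labelled n cc L \<subseteq> even_perms_of_type n (label_type L)" by auto
qed

theorem class_labelled_bij: "bij_betw (class_labelled n cc) (class_labels n) (conj_classes (alt_group n))"
proof (rule bij_betw_imageI)
  show "inj_on (class_labelled n cc) (class_labels n)"
  proof (rule inj_onI)
    fix L M assume L: "L \<in> class_labels n" and M: "M \<in> class_labels n"
      and eq: "class_labelled n cc L = class_labelled n cc M"
    obtain g where "g \<in> class_labelled n cc L"
      using class_labelled_type(1)[OF L] A.conj_class_self by (auto simp: A.conj_classes_eq)
    then have "g \<in> even_perms_of_type n (label_type L)" "g \<in> even_perms_of_type n (label_type M)"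
      using class_labelled_type(2)[OF L] class_labelled_type(2)[OF M] eq by auto
    then have t: "label_type L = label_type M" by (simp add: even_perms_of_type_def)
    show "L = M"
    proof (cases "odd_distinct (label_type L)")
      case True
      then obtain v s s' where v: "L = Split_Class v s" "M = Split_Class v s'" "v \<in> partitions_of n" "odd_distinct v"
        using L M t unfolding class_labels_def by (auto simp: label_type_def)
      then show ?thesis using eq split_class(2)[OF v(3,4)] by (cases s; cases s') auto
    next
      case False
      then show ?thesis using L M t unfolding class_labels_def by (auto simp: label_type_def)
    qed
  qed
  show "class_labelled n cc ` class_labels n = conj_classes (alt_group n)"
  proof (intro equalityI subsetI)
    fix K assume "K \<in> class_labelled n cc ` class_labels n"
    then show "K \<in> conj_classes (alt_group n)" using class_labelled_type(1) by blast
  next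
    fix K assume K: "K \<in> conj_classes (alt_group n)"
    then obtain g where g: "g \<in> carrier (alt_group n)" "K = A.conj_class n g" by (auto simp: A.conj_classes_eq)
    let ?v = "cycle_type n g"
    have v: "?v \<in> partitions_of n" using g by (auto simp: alt_group_carrier intro: cycle_type_partition)
    have gt: "g \<in> even_perms_of_type n ?v" using g by (simp add: even_perms_of_type_def)
    show "K \<in> class_labelled n cc ` class_labels n"
    proof (cases "odd_distinct ?v")
      case True
      then obtain s where s: "g \<in> cc ?v s" using split_class(3)[OF v True] gt by blast
      then have "cc ?v s = K" using A.conj_classes_eq_class[OF split_class(1)[OF v True] s] g by simp
      then have "K = class_labelled n cc (Split_Class ?v s)" by simp
      moreover have "Split_Class ?v s \<in> class_labels n" using v True by (auto simp: class_labels_def)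
      ultimately show ?thesis by blast
    next
      case False
      then have "K = class_labelled n cc (Nonsplit_Class ?v)" using nonsplit_class[OF g(1)] g by simp
      moreover have "Nonsplit_Class ?v \<in> class_labels n" using v False gt by (auto simp: class_labels_def)
      ultimately show ?thesis by blast
    qed
  qed
qed

theorem labelling_exists:
  assumes X: "character_table (alt_group n) X"
  shows "\<exists>\<alpha> \<beta>. labelling n sc cc X \<alpha> \<beta>"
proof -
  obtain r c where r: "bij_betw r {..<dim_row X} (irr_chars (alt_group n))"
    and c: "bij_betw c {..<dim_col X} (conj_classes (alt_group n))"
    and X: "\<And>i j g. i < dim_row X \<Longrightarrow> j < dim_col X \<Longrightarrow> g \<in> c j \<Longrightarrow> X $$ (i, j) = r i g"
    using X unfolding character_table_def by blast
  define \<alpha> where "\<alpha> = (\<lambda>i. the_inv_into (char_labels n) label_char (r i))"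
  define \<beta> where "\<beta> = (\<lambda>j. the_inv_into (class_labels n) (class_labelled n cc) (c j))"
  have a: "bij_betw \<alpha> {..<dim_row X} (char_labels n)"
    using bij_betw_trans[OF r bij_betw_the_inv_into[OF label_char_bij]] by (simp add: \<alpha>_def comp_def)
  have b: "bij_betw \<beta> {..<dim_col X} (class_labels n)"
    using bij_betw_trans[OF c bij_betw_the_inv_into[OF class_labelled_bij]] by (simp add: \<beta>_def comp_def)
  have ra: "label_char (\<alpha> i) = r i" if "i < dim_row X" for i
    unfolding \<alpha>_def using that bij_betwE[OF r] by (intro f_the_inv_into_f_bij_betw[OF label_char_bij]) auto
  have cb: "class_labelled n cc (\<beta> j) = c j" if "j < dim_col X" for j
    unfolding \<beta>_def using that bij_betwE[OF c] by (intro f_the_inv_into_f_bij_betw[OF class_labelled_bij]) auto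
  have "labelling n sc cc X \<alpha> \<beta>"
    unfolding labelling_def
  proof (intro conjI a b allI impI ballI)
    fix i j \<chi> g assume i: "i < dim_row X" and j: "j < dim_col X"
      and chi: "\<chi> \<in> chars_labelled n sc (\<alpha> i)" and g: "g \<in> class_labelled n cc (\<beta> j)"
    have "\<alpha> i \<in> char_labels n" using bij_betwE[OF a] i by blast
    then have "\<chi> = r i" using chars_labelled_eq ra[OF i] chi by simp
    moreover have "g \<in> c j" using g cb[OF j] by simp
    ultimately show "X $$ (i, j) = \<chi> g" using X[OF i j] by simp
  qed
  then show ?thesis by blast
qed

end

section \<open>Symmetries of a character table\<close>

text \<open>\<open>r\<close>, \<open>c\<close> and \<open>r'\<close>, \<open>c'\<close> are two
  readings of one table with rows \<open>I\<close> and columns \<open>J\<close>. The assumptions are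
  symmetric, so every result also holds with the readings exchanged (\<open>swap\<close>).\<close>

locale table_symmetry = finite_grp G for G (structure) +
  fixes I :: "'i set" and J :: "'j set"
    and r r' :: "'i \<Rightarrow> 'a \<Rightarrow> complex" and c c' :: "'j \<Rightarrow> 'a set"
  assumes r: "bij_betw r I (irr_chars G)" and r': "bij_betw r' I (irr_chars G)"
    and c: "bij_betw c J (conj_classes G)" and c': "bij_betw c' J (conj_classes G)"
    and table: "\<And>i j g h. i \<in> I \<Longrightarrow> j \<in> J \<Longrightarrow> g \<in> c j \<Longrightarrow> h \<in> c' j \<Longrightarrow> r i g = r' i h"
begin

definition rel :: "'a \<Rightarrow> 'a \<Rightarrow> bool" where
  "rel g h \<longleftrightarrow> (\<exists>j\<in>J. g \<in> c j \<and> h \<in> c' j)"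

lemma swap: "table_symmetry G I J r' r c' c"
  by unfold_locales (simp_all add: r r' c c' table[symmetric])

lemma rel_swap: "table_symmetry.rel J c' c g h \<longleftrightarrow> rel h g"
  unfolding rel_def table_symmetry.rel_def[OF swap] by blast

lemma relE:
  assumes "rel g h"
  obtains j where "j \<in> J" "g \<in> c j" "h \<in> c' j" "c j = conj_class g" "c' j = conj_class h"
    "g \<in> carrier G" "h \<in> carrier G"
proof -
  obtain j where j: "j \<in> J" "g \<in> c j" "h \<in> c' j" using assms unfolding rel_def by blast
  then have "c j \<in> conj_classes G" "c' j \<in> conj_classes G" using bij_betwE[OF c] bij_betwE[OF c'] by auto
  then show ?thesis using that[OF j] conj_classes_eq_class j by blast
qed

lemma rel_carrier: "rel g h \<Longrightarrow> g \<in> carrier G \<and> h \<in> carrier G"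
  by (auto elim: relE)

lemma class_index:
  assumes "g \<in> carrier G"
  obtains j where "j \<in> J" "g \<in> c j" "c j = conj_class g"
proof -
  have "conj_class g \<in> c ` J" using bij_betw_imp_surj_on[OF c] assms by (simp add: conj_classes_eq)
  then show ?thesis using that conj_class_self[OF assms] by auto
qed

lemma rel_total:
  assumes g: "g \<in> carrier G"
  obtains h where "rel g h"
proof -
  obtain j where j: "j \<in> J" "g \<in> c j" using class_index[OF g] by metis
  then have "c' j \<in> conj_classes G" using bij_betwE[OF c'] by blast
  then obtain h where "h \<in> c' j" using conj_class_self by (auto simp: conj_classes_eq)
  then show ?thesis using j that unfolding rel_def by blast
qed

lemma rel_value: "rel g h \<Longrightarrow> i \<in> I \<Longrightarrow> r i g = r' i h"
  unfolding rel_def using table by blast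

lemma finite_I: "finite I" and finite_J: "finite J"
  using bij_betw_finite[OF r] bij_betw_finite[OF c] by (simp_all add: conj_classes_eq)

lemma sum_irr_transfer:
  assumes "\<And>i. i \<in> I \<Longrightarrow> F (r i) = F' (r' i)"
  shows "(\<Sum>\<chi>\<in>irr_chars G. F \<chi>) = (\<Sum>\<chi>\<in>irr_chars G. F' \<chi>)"
proof -
  have "(\<Sum>\<chi>\<in>irr_chars G. F \<chi>) = (\<Sum>i\<in>I. F (r i))" by (rule sum.reindex_bij_betw[OF r, symmetric])
  also have "\<dots> = (\<Sum>i\<in>I. F' (r' i))" using assms by (rule sum.cong[OF refl])
  also have "\<dots> = (\<Sum>\<chi>\<in>irr_chars G. F' \<chi>)" by (rule sum.reindex_bij_betw[OF r'])
  finally show ?thesis .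
qed

lemma rel_card_class:
  assumes "rel g h"
  shows "card (conj_class g) = card (conj_class h)"
proof -
  have g: "g \<in> carrier G" and h: "h \<in> carrier G" using rel_carrier[OF assms] by auto
  have "(\<Sum>\<chi>\<in>irr_chars G. \<chi> g * cnj (\<chi> g)) = (\<Sum>\<chi>\<in>irr_chars G. \<chi> h * cnj (\<chi> h))"
    by (rule sum_irr_transfer) (simp add: rel_value[OF assms])
  then have "(of_nat (Coset.order G) / of_nat (card (conj_class g)) :: complex)
      = of_nat (Coset.order G) / of_nat (card (conj_class h))"
    using column_orthogonality[OF g g] column_orthogonality[OF h h] conj_class_self g h by simp
  then have "(of_nat (card (conj_class g)) :: complex) = of_nat (card (conj_class h))"
    using order_pos card_conj_class_pos[OF g] card_conj_class_pos[OF h] by (simp add: field_simps)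
  then show ?thesis by (simp only: of_nat_eq_iff)
qed

text \<open>The values \<open>r' i h = r i \<one>\<close> and \<open>r' i \<one>\<close> are
  positive natural numbers, so the columns of \<open>h\<close> and of the identity in the second
  reading are not orthogonal, and the two classes coincide.\<close>

lemma rel_one:
  assumes "rel \<one> h"
  shows "h = \<one>"
proof -
  have h: "h \<in> carrier G" using rel_carrier[OF assms] by auto
  have "\<exists>m::nat. m > 0 \<and> r' i h * cnj (r' i \<one>) = of_nat m" if i: "i \<in> I" for i
  proof -
    have "r i \<in> irr_chars G" "r' i \<in> irr_chars G" using i bij_betwE[OF r] bij_betwE[OF r'] by auto
    then obtain d e where "r i \<one> = of_nat d" "d > 0" "r' i \<one> = of_nat e" "e > 0"
      by (metis irr_char_degree)
    then show ?thesis using rel_value[OF assms i] by (intro exI[of _ "d * e"]) simp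
  qed
  then obtain m :: "'i \<Rightarrow> nat" where m: "\<And>i. i \<in> I \<Longrightarrow> m i > 0"
    "\<And>i. i \<in> I \<Longrightarrow> r' i h * cnj (r' i \<one>) = of_nat (m i)" by metis
  have "(\<Sum>\<chi>\<in>irr_chars G. \<chi> h * cnj (\<chi> \<one>)) = (\<Sum>i\<in>I. r' i h * cnj (r' i \<one>))"
    by (rule sum.reindex_bij_betw[OF r', symmetric])
  also have "\<dots> = of_nat (\<Sum>i\<in>I. m i)" using m by simp
  finally have e: "(\<Sum>\<chi>\<in>irr_chars G. \<chi> h * cnj (\<chi> \<one>)) = of_nat (\<Sum>i\<in>I. m i)" .
  have "I \<noteq> {}"
  proof
    assume "I = {}"
    then have "card (conj_classes G) = 0" using r card_irr_chars by (simp add: bij_betw_def)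
    then show False using one_closed by (simp add: conj_classes_eq card_eq_0_iff)
  qed
  then have "(\<Sum>i\<in>I. m i) > 0" using m finite_I by (intro sum_pos) auto
  then have nz: "of_nat (\<Sum>i\<in>I. m i) \<noteq> (0 :: complex)"
    unfolding of_nat_eq_0_iff by (rule gr_implies_not0)
  have "h \<in> conj_class \<one>"
  proof (rule ccontr)
    assume "h \<notin> conj_class \<one>"
    then show False using column_orthogonality[OF one_closed h] nz unfolding e by simp
  qed
  then show ?thesis by (auto simp: conj_class_def)
qed

lemma rel_one_one: "rel \<one> \<one>"
proof -
  obtain h where h: "rel \<one> h" by (rule rel_total[OF one_closed])
  then have "h = \<one>" by (rule rel_one)
  with h show ?thesis by simp
qed

lemma degree_eq: "i \<in> I \<Longrightarrow> r i \<one> = r' i \<one>"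
  using rel_value[OF rel_one_one] .

lemma class_constant_transfer:
  assumes k: "rel k k'" and d: "rel d d'" and x: "rel x x'"
  shows "card {y \<in> conj_class k. y \<otimes> x \<in> conj_class d} = card {y \<in> conj_class k'. y \<otimes> x' \<in> conj_class d'}"
proof -
  note car = rel_carrier[OF k] rel_carrier[OF d] rel_carrier[OF x]
  have "of_nat (card {y \<in> conj_class k. y \<otimes> x \<in> conj_class d}) =
    (\<Sum>\<chi>\<in>irr_chars G. of_nat (card (conj_class d)) * cnj (\<chi> d) / of_nat (Coset.order G) *
       (of_nat (card (conj_class k)) * \<chi> k * \<chi> x / \<chi> \<one>))"
    using car by (intro class_algebra_constant) auto
  also have "\<dots> = (\<Sum>\<chi>\<in>irr_chars G. of_nat (card (conj_class d')) * cnj (\<chi> d') / of_nat (Coset.order G) *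
       (of_nat (card (conj_class k')) * \<chi> k' * \<chi> x' / \<chi> \<one>))"
    by (rule sum_irr_transfer)
      (simp add: rel_value[OF k] rel_value[OF d] rel_value[OF x] degree_eq rel_card_class[OF k] rel_card_class[OF d])
  also have "\<dots> = of_nat (card {y \<in> conj_class k'. y \<otimes> x' \<in> conj_class d'})"
    using car by (intro class_algebra_constant[symmetric]) auto
  finally show ?thesis by (simp only: of_nat_eq_iff)
qed

text \<open>Conditions invariant under \<open>rel\<close> are unions of classes, so the count is a
  sum of structure constants, each of which agrees for the two readings.\<close>

lemma count_transfer:
  assumes T: "\<And>g h. rel g h \<Longrightarrow> P g \<longleftrightarrow> P h" and D: "\<And>g h. rel g h \<Longrightarrow> Q g \<longleftrightarrow> Q h" and x: "rel x x'"
  shows "card {y \<in> carrier G. P y \<and> Q (y \<otimes> x)} = card {y \<in> carrier G. P y \<and> Q (y \<otimes> x')}"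
proof -
  \<comment> \<open>Stated for an arbitrary symmetry, since it is applied to the given readings and
    to the exchanged ones.\<close>
  have split: "card {y \<in> carrier G. P y \<and> Q (y \<otimes> x)}
      = (\<Sum>(j, l)\<in>{j \<in> J. \<forall>g\<in>c j. P g} \<times> {l \<in> J. \<forall>g\<in>c l. Q g}. card {y \<in> c j. y \<otimes> x \<in> c l})"
    if sym: "table_symmetry G I J r r' c c'"
      and T: "\<And>g h. table_symmetry.rel J c c' g h \<Longrightarrow> P g \<longleftrightarrow> P h"
      and D: "\<And>g h. table_symmetry.rel J c c' g h \<Longrightarrow> Q g \<longleftrightarrow> Q h"
      and x: "x \<in> carrier G" for r r' c c' x
  proof -
    interpret t: table_symmetry G I J r r' c c' by (rule sym)
    let ?A = "{j \<in> J. \<forall>g\<in>c j. P g} \<times> {l \<in> J. \<forall>g\<in>c l. Q g}"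
    \<comment> \<open>Elements of one class are related to a common \<open>z\<close> and therefore
      satisfy the same conditions.\<close>
    have const: "P g \<longleftrightarrow> P h" "Q g \<longleftrightarrow> Q h" if gh: "j \<in> J" "g \<in> c j" "h \<in> c j" for g h j
    proof -
      have "c' j \<in> conj_classes G" using bij_betwE[OF t.c'] gh by blast
      then obtain z where "z \<in> c' j" using conj_class_self by (auto simp: conj_classes_eq)
      then have "t.rel g z" "t.rel h z" using gh unfolding t.rel_def by auto
      then show "P g \<longleftrightarrow> P h" "Q g \<longleftrightarrow> Q h" using T D by auto
    qed
    have cj: "c j \<subseteq> carrier G" if "j \<in> J" for j
      using bij_betwE[OF t.c] that conj_class_closed by (fastforce simp: conj_classes_eq)
    have inj: "j = l" if "j \<in> J" "l \<in> J" "g \<in> c j" "g \<in> c l" for j l g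
    proof -
      have "c j \<in> conj_classes G" "c l \<in> conj_classes G" using bij_betwE[OF t.c] that by auto
      then have "c j = c l" using conj_classes_eq_class that by metis
      then show ?thesis using bij_betw_imp_inj_on[OF t.c] that by (auto dest: inj_onD)
    qed
    have eq: "{y \<in> carrier G. P y \<and> Q (y \<otimes> x)} = (\<Union>(j, l)\<in>?A. {y \<in> c j. y \<otimes> x \<in> c l})"
    proof (intro equalityI subsetI)
      fix y assume y: "y \<in> {y \<in> carrier G. P y \<and> Q (y \<otimes> x)}"
      then have "y \<otimes> x \<in> carrier G" using x by simp
      then obtain l where l: "l \<in> J" "y \<otimes> x \<in> c l" by (rule t.class_index) (rule that)
      have "y \<in> carrier G" using y by simp
      then obtain j where j: "j \<in> J" "y \<in> c j" by (rule t.class_index) (rule that)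
      have "P g" if "g \<in> c j" for g using const(1)[OF j(1) that j(2)] y by simp
      moreover have "Q g" if "g \<in> c l" for g using const(2)[OF l(1) that l(2)] y by simp
      ultimately have "(j, l) \<in> ?A" using j(1) l(1) by simp
      then show "y \<in> (\<Union>(j, l)\<in>?A. {y \<in> c j. y \<otimes> x \<in> c l})"
        by (rule UN_I) (simp add: j l)
    next
      fix y assume "y \<in> (\<Union>(j, l)\<in>?A. {y \<in> c j. y \<otimes> x \<in> c l})"
      then show "y \<in> {y \<in> carrier G. P y \<and> Q (y \<otimes> x)}" using cj by auto
    qed
    have "card (\<Union>(j, l)\<in>?A. {y \<in> c j. y \<otimes> x \<in> c l}) = (\<Sum>a\<in>?A. card (case a of (j, l) \<Rightarrow> {y \<in> c j. y \<otimes> x \<in> c l}))"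
    proof (rule card_UN_disjoint)
      show "finite ?A" using t.finite_J by simp
      show "\<forall>a\<in>?A. finite (case a of (j, l) \<Rightarrow> {y \<in> c j. y \<otimes> x \<in> c l})"
        using cj finite_subset[OF _ finite_carrier] by (auto intro!: finite_subset[OF _ finite_carrier])
      show "\<forall>a\<in>?A. \<forall>b\<in>?A. a \<noteq> b \<longrightarrow> (case a of (j, l) \<Rightarrow> {y \<in> c j. y \<otimes> x \<in> c l}) \<inter> (case b of (j, l) \<Rightarrow> {y \<in> c j. y \<otimes> x \<in> c l}) = {}"
        using inj by auto
    qed
    then show ?thesis unfolding eq by (simp add: case_prod_unfold)
  qed
  have x1: "x \<in> carrier G" and x2: "x' \<in> carrier G" using rel_carrier[OF x] by auto
  have 1: "card {y \<in> carrier G. P y \<and> Q (y \<otimes> x)}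
      = (\<Sum>(j, l)\<in>{j \<in> J. \<forall>g\<in>c j. P g} \<times> {l \<in> J. \<forall>g\<in>c l. Q g}. card {y \<in> c j. y \<otimes> x \<in> c l})"
    by (rule split[OF table_symmetry_axioms T D x1])
  have 2: "card {y \<in> carrier G. P y \<and> Q (y \<otimes> x')}
      = (\<Sum>(j, l)\<in>{j \<in> J. \<forall>g\<in>c' j. P g} \<times> {l \<in> J. \<forall>g\<in>c' l. Q g}. card {y \<in> c' j. y \<otimes> x' \<in> c' l})"
    by (rule split[OF swap _ _ x2]) (simp_all add: rel_swap T D)
  have ne: "c j \<noteq> {}" "c' j \<noteq> {}" if "j \<in> J" for j
    using bij_betwE[OF c] bij_betwE[OF c'] that conj_class_self by (fastforce simp: conj_classes_eq)+
  have PP: "(\<forall>g\<in>c j. P g) \<longleftrightarrow> (\<forall>g\<in>c' j. P g)" and QQ: "(\<forall>g\<in>c j. Q g) \<longleftrightarrow> (\<forall>g\<in>c' j. Q g)"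
    if j: "j \<in> J" for j
  proof -
    have "rel g h" if "g \<in> c j" "h \<in> c' j" for g h using that j unfolding rel_def by blast
    then show "(\<forall>g\<in>c j. P g) \<longleftrightarrow> (\<forall>g\<in>c' j. P g)" "(\<forall>g\<in>c j. Q g) \<longleftrightarrow> (\<forall>g\<in>c' j. Q g)"
      using T D ne[OF j] by blast+
  qed
  have each: "card {y \<in> c j. y \<otimes> x \<in> c l} = card {y \<in> c' j. y \<otimes> x' \<in> c' l}" if j: "j \<in> J" and l: "l \<in> J" for j l
  proof -
    obtain g h u v where g: "g \<in> c j" "h \<in> c' j" "u \<in> c l" "v \<in> c' l" using ne[OF j] ne[OF l] by blast
    then have gh: "rel g h" and uv: "rel u v" using j l unfolding rel_def by blast+
    have "c j = conj_class g" "c' j = conj_class h" "c l = conj_class u" "c' l = conj_class v"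
      using g bij_betwE[OF c] bij_betwE[OF c'] j l conj_classes_eq_class by metis+
    then show ?thesis using class_constant_transfer[OF gh uv x] by simp
  qed
  have "(\<Sum>(j, l)\<in>{j \<in> J. \<forall>g\<in>c j. P g} \<times> {l \<in> J. \<forall>g\<in>c l. Q g}. card {y \<in> c j. y \<otimes> x \<in> c l})
    = (\<Sum>(j, l)\<in>{j \<in> J. \<forall>g\<in>c' j. P g} \<times> {l \<in> J. \<forall>g\<in>c' l. Q g}. card {y \<in> c' j. y \<otimes> x' \<in> c' l})"
  proof (rule sum.cong[rotated])
    have "{j \<in> J. \<forall>g\<in>c j. P g} = {j \<in> J. \<forall>g\<in>c' j. P g}"
      by (intro Collect_cong conj_cong refl PP)
    moreover have "{l \<in> J. \<forall>g\<in>c l. Q g} = {l \<in> J. \<forall>g\<in>c' l. Q g}"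
      by (intro Collect_cong conj_cong refl QQ)
    ultimately show "{j \<in> J. \<forall>g\<in>c j. P g} \<times> {l \<in> J. \<forall>g\<in>c l. Q g}
      = {j \<in> J. \<forall>g\<in>c' j. P g} \<times> {l \<in> J. \<forall>g\<in>c' l. Q g}" by simp
  qed (auto simp: each)
  then show ?thesis using 1 2 by simp
qed

end

section \<open>Multiplication by 3-cycles\<close>

text \<open>For distinct points this is the cycle \<open>a\<close> to \<open>b\<close> to
  \<open>c\<close> to \<open>a\<close>.\<close>

definition tri :: "nat \<Rightarrow> nat \<Rightarrow> nat \<Rightarrow> nat \<Rightarrow> nat" where
  "tri a b c = transpose a b \<circ> transpose b c"

lemma tri_apply:
  assumes "a \<noteq> b" "b \<noteq> c" "a \<noteq> c"
  shows "tri a b c a = b" "tri a b c b = c" "tri a b c c = a"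
    "x \<noteq> a \<Longrightarrow> x \<noteq> b \<Longrightarrow> x \<noteq> c \<Longrightarrow> tri a b c x = x"
  using assms by (auto simp: tri_def transpose_def)

lemma tri_rotate:
  assumes "a \<noteq> b" "b \<noteq> c" "a \<noteq> c"
  shows "tri b c a = tri a b c"
  using assms by (auto simp: tri_def transpose_def fun_eq_iff)

definition three_cycle :: "nat \<Rightarrow> (nat \<Rightarrow> nat) \<Rightarrow> bool" where
  "three_cycle n t \<longleftrightarrow> (\<exists>a b c. {a, b, c} \<subseteq> {1..n} \<and> a \<noteq> b \<and> b \<noteq> c \<and> a \<noteq> c \<and> t = tri a b c)"

lemma three_cycle_iff: "three_cycle n t \<longleftrightarrow> t \<in> three_cycles n"
proof
  assume "three_cycle n t"
  then obtain a b c where "{a, b, c} \<subseteq> {1..n}" "a \<noteq> b" "b \<noteq> c" "a \<noteq> c" "t = tri a b c"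
    unfolding three_cycle_def by blast
  then show "t \<in> three_cycles n" by (auto simp: tri_def intro!: exI[of _ "[a, b, c]"])
next
  assume "t \<in> three_cycles n"
  then obtain cs where cs: "t = cycle_of_list cs" "cycle cs" "length cs = 3" "set cs \<subseteq> {1..n}" by auto
  then obtain a b c where "cs = [a, b, c]" using stupid_lemma by blast
  then show "three_cycle n t" using cs unfolding three_cycle_def
    by (intro exI[of _ a] exI[of _ b] exI[of _ c]) (auto simp: tri_def)
qed

lemma three_cycle_carrier: "three_cycle n t \<Longrightarrow> t \<in> carrier (alt_group n)"
  using three_cycles_incl three_cycle_iff by blast

lemma three_cycle_permutes: "three_cycle n t \<Longrightarrow> t permutes {1..n}"
  using three_cycle_carrier by (auto simp: alt_group_carrier)

definition fixes_count :: "nat \<Rightarrow> (nat \<Rightarrow> nat) \<Rightarrow> nat" where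
  "fixes_count n g = card {x \<in> {1..n}. g x = x}"

lemma least_power_eq_1_iff:
  assumes "permutation g"
  shows "least_power g x = 1 \<longleftrightarrow> g x = x"
proof -
  have "least_power g x = 1 \<longleftrightarrow> least_power g x dvd 1" by simp
  also have "\<dots> \<longleftrightarrow> g x = x" using least_power_dvd[OF assms, of x 1] by simp
  finally show ?thesis .
qed

lemma cycle_count_1:
  assumes "g permutes {1..n}"
  shows "cycle_count n g 1 = fixes_count n g"
  unfolding cycle_count_def fixes_count_def least_power_eq_1_iff[OF permutation_if_permutes[OF assms]] ..

lemma card_split_off:
  assumes "finite X" "Y \<subseteq> X" "\<And>z. z \<in> Y \<Longrightarrow> P z \<longleftrightarrow> Q z"
  shows "card {z \<in> X. P z} = card {z \<in> X - Y. P z} + card {z \<in> Y. Q z}"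
proof -
  have "{z \<in> X. P z} = {z \<in> X - Y. P z} \<union> {z \<in> Y. Q z}" using assms by auto
  moreover have "card ({z \<in> X - Y. P z} \<union> {z \<in> Y. Q z}) = card {z \<in> X - Y. P z} + card {z \<in> Y. Q z}"
    using finite_subset[OF assms(2,1)] assms(1) by (intro card_Un_disjoint) auto
  ultimately show ?thesis by simp
qed

text \<open>Only \<open>a, b, c\<close> can change between being fixed by \<open>g\<close> and by \<open>(a b c) g\<close>; a point \<open>y\<close>
  stands here for its preimage under \<open>g\<close>.\<close>

lemma fixes_count_tri:
  assumes g: "g permutes {1..n}" and abc: "{a, b, c} \<subseteq> {1..n}" "a \<noteq> b" "b \<noteq> c" "a \<noteq> c"
  shows "fixes_count n (tri a b c \<circ> g) + card {y \<in> {a, b, c}. g y = y}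
    = fixes_count n g + card {y \<in> {a, b, c}. g (tri a b c y) = y}"
proof -
  let ?t = "tri a b c"
  note t = tri_apply[OF abc(2-4)]
  have tp: "?t permutes {1..n}" using abc by (intro three_cycle_permutes) (auto simp: three_cycle_def)
  have "g ` {x \<in> {1..n}. (?t \<circ> g) x = x} = {y \<in> {1..n}. g (?t y) = y}"
  proof (intro equalityI subsetI)
    fix y assume "y \<in> g ` {x \<in> {1..n}. (?t \<circ> g) x = x}"
    then obtain x where x: "y = g x" "x \<in> {1..n}" "?t (g x) = x" unfolding o_apply by blast
    have "y \<in> {1..n}" unfolding x(1) using x(2) by (simp only: permutes_in_image[OF g])
    moreover have "g (?t y) = y" unfolding x(1) x(3) ..
    ultimately show "y \<in> {y \<in> {1..n}. g (?t y) = y}" by (simp only: mem_Collect_eq)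
  next
    fix y assume "y \<in> {y \<in> {1..n}. g (?t y) = y}"
    then have y: "y \<in> {1..n}" "g (?t y) = y" by (simp_all only: mem_Collect_eq)
    have "?t y \<in> {1..n}" using y(1) by (simp only: permutes_in_image[OF tp])
    moreover have "(?t \<circ> g) (?t y) = ?t y" unfolding o_apply y(2) ..
    ultimately have "?t y \<in> {x \<in> {1..n}. (?t \<circ> g) x = x}" by (simp only: mem_Collect_eq)
    then show "y \<in> g ` {x \<in> {1..n}. (?t \<circ> g) x = x}" using y(2)[symmetric] by (rule rev_image_eqI)
  qed
  then have 1: "fixes_count n (?t \<circ> g) = card {y \<in> {1..n}. g (?t y) = y}"
    unfolding fixes_count_def using card_image[OF permutes_inj_on[OF g], of "{x \<in> {1..n}. (?t \<circ> g) x = x}"]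
    by (simp only:)
  let ?R = "{y \<in> {1..n} - {a, b, c}. g y = y}"
  have "{y \<in> {1..n}. g (?t y) = y} = ?R \<union> {y \<in> {a, b, c}. g (?t y) = y}" using abc(1) t(4) by auto
  then have 2: "card {y \<in> {1..n}. g (?t y) = y} = card ?R + card {y \<in> {a, b, c}. g (?t y) = y}"
    by (simp only:) (rule card_Un_disjoint, auto)
  have "{y \<in> {1..n}. g y = y} = ?R \<union> {y \<in> {a, b, c}. g y = y}" using abc(1) by auto
  then have 3: "card {y \<in> {1..n}. g y = y} = card ?R + card {y \<in> {a, b, c}. g y = y}"
    by (simp only:) (rule card_Un_disjoint, auto)
  show ?thesis using 1 2 3 by (simp add: fixes_count_def)
qed

text \<open>On a cycle of length at least 3 this 3-cycle undoes two steps of \<open>g\<close>: it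
  sends \<open>g x\<close> back to \<open>x\<close> and \<open>g (g x)\<close> back to
  \<open>g x\<close>. After composition with \<open>g\<close> the points \<open>x\<close> and
  \<open>g x\<close> are fixed, and in a cycle of length 3 all three points are.\<close>

definition inv_arc :: "(nat \<Rightarrow> nat) \<Rightarrow> nat \<Rightarrow> nat \<Rightarrow> nat" where
  "inv_arc g x = tri (g (g x)) (g x) x"

lemma arc_distinct:
  assumes p: "permutation g" and l: "least_power g x \<ge> 3"
  shows "g (g x) \<noteq> g x" "g x \<noteq> x" "g (g x) \<noteq> x"
proof -
  have "(g ^^ i) x = (g ^^ j) x \<longleftrightarrow> i = j" if "i < 3" "j < 3" for i j
    using funpow_eq_iff[OF p, of i x j] that l by simp
  from this[of 2 1] this[of 1 0] this[of 2 0] show "g (g x) \<noteq> g x" "g x \<noteq> x" "g (g x) \<noteq> x"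
    by (simp_all add: numeral_2_eq_2)
qed

lemma arc_subset:
  assumes g: "g permutes {1..n}" and x: "x \<in> {1..n}"
  shows "{g (g x), g x, x} \<subseteq> {1..n}"
  using x by (simp only: insert_subset permutes_in_image[OF g] empty_subsetI simp_thms)

lemma inv_arc_three_cycle:
  assumes g: "g permutes {1..n}" and x: "x \<in> {1..n}" and l: "least_power g x \<ge> 3"
  shows "three_cycle n (inv_arc g x)"
  unfolding three_cycle_def inv_arc_def
  using arc_distinct[OF permutation_if_permutes[OF g] l] arc_subset[OF g x] by blast

lemma cube_eq_iff:
  assumes p: "permutation g" and l: "least_power g x \<ge> 3"
  shows "g (g (g x)) = x \<longleftrightarrow> least_power g x = 3"
proof -
  have "g (g (g x)) = x \<longleftrightarrow> (g ^^ 3) x = x" by (simp add: numeral_3_eq_3)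
  also have "\<dots> \<longleftrightarrow> least_power g x dvd 3" using least_power_dvd[OF p] by simp
  also have "\<dots> \<longleftrightarrow> least_power g x = 3" using l by (auto dest: dvd_imp_le)
  finally show ?thesis .
qed

lemma fixes_count_inv_arc:
  assumes g: "g permutes {1..n}" and x: "x \<in> {1..n}" and l: "least_power g x \<ge> 3"
  shows "fixes_count n (inv_arc g x \<circ> g) = fixes_count n g + (if least_power g x = 3 then 3 else 2)"
proof -
  note p = permutation_if_permutes[OF g]
  define b where "b = g x"
  define a where "a = g b"
  have d: "a \<noteq> b" "b \<noteq> x" "a \<noteq> x" using arc_distinct[OF p l] by (simp_all only: a_def b_def not_False_eq_True)
  note t = tri_apply(1-3)[OF d]
  have gx: "g x = b" "g b = a" by (simp_all only: a_def b_def)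
  have ga: "g a = x \<longleftrightarrow> least_power g x = 3" using cube_eq_iff[OF p l] by (simp only: a_def b_def)
  have "g a \<noteq> a" using d(1) permutes_inj[OF g] gx(2) by (metis injD)
  then have e1: "{y \<in> {a, b, x}. g y = y} = {}" using d gx by auto
  have e2: "{y \<in> {a, b, x}. g (tri a b x y) = y} = (if least_power g x = 3 then {a, b, x} else {a, b})"
    using t gx ga d by auto
  have "{a, b, x} \<subseteq> {1..n}" using arc_subset[OF g x] by (simp only: a_def b_def)
  from fixes_count_tri[OF g this d] have "fixes_count n (tri a b x \<circ> g) =
      fixes_count n g + card (if least_power g x = 3 then {a, b, x} else {a, b})"
    unfolding e1 e2 card.empty by (simp only: add_0_right)
  moreover have "inv_arc g x = tri a b x" by (simp only: inv_arc_def a_def b_def)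
  ultimately show ?thesis using d by simp
qed

text \<open>A gain of 2 requires two of the three equations \<open>g b = a\<close>,
  \<open>g c = b\<close>, \<open>g a = c\<close>; rotating \<open>(a, b, c)\<close> makes them the
  first two, and then \<open>x = c\<close>.\<close>

lemma gain_imp_inv_arc:
  assumes g: "g permutes {1..n}" and t: "three_cycle n t" and gain: "fixes_count n (t \<circ> g) \<ge> fixes_count n g + 2"
  obtains x where "x \<in> {1..n}" "least_power g x \<ge> 3" "t = inv_arc g x"
proof -
  note p = permutation_if_permutes[OF g] and result = that
  obtain a b c where abc: "{a, b, c} \<subseteq> {1..n}" "a \<noteq> b" "b \<noteq> c" "a \<noteq> c" and ta: "t = tri a b c"
    using t unfolding three_cycle_def by blast
  note tt = tri_apply[OF abc(2-4)]
  have s: "card {y \<in> {a, b, c}. g (tri a b c y) = y} \<ge> 2 + card {y \<in> {a, b, c}. g y = y}"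
    using fixes_count_tri[OF g abc] gain unfolding ta by linarith
  have main: thesis
    if abc: "{a, b, c} \<subseteq> {1..n}" "a \<noteq> b" "b \<noteq> c" "a \<noteq> c" and ta: "t = tri a b c"
      and e: "g b = a" "g c = b" for a b c
  proof -
    have "least_power g c \<ge> 3"
    proof -
      have "(g ^^ 1) c \<noteq> c" "(g ^^ 2) c \<noteq> c" using e abc by (auto simp: numeral_2_eq_2)
      then have "\<not> least_power g c dvd 1" "\<not> least_power g c dvd 2" unfolding least_power_dvd[OF p] .
      then have "least_power g c \<noteq> 1" "least_power g c \<noteq> 2" by (metis dvd_refl)+
      then show ?thesis using least_power_pos[OF p, of c] by linarith
    qed
    moreover have "t = inv_arc g c" using e ta by (simp add: inv_arc_def)
    ultimately show thesis using abc(1) by (intro result[of c]) auto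
  qed
  have eqs: "g (tri a b c a) = a \<longleftrightarrow> g b = a" "g (tri a b c b) = b \<longleftrightarrow> g c = b" "g (tri a b c c) = c \<longleftrightarrow> g a = c"
    by (simp_all add: tt)
  have "g b = a \<and> g c = b \<or> g c = b \<and> g a = c \<or> g a = c \<and> g b = a"
  proof (rule ccontr)
    assume n: "\<not> ?thesis"
    have "\<exists>z. {y \<in> {a, b, c}. g (tri a b c y) = y} \<subseteq> {z}"
    proof (cases "g b = a")
      case True
      then show ?thesis using n eqs by (intro exI[of _ a]) blast
    next
      case False
      then show ?thesis using n eqs by (cases "g c = b") (intro exI[of _ b], blast, intro exI[of _ c], blast)
    qed
    then obtain z where "{y \<in> {a, b, c}. g (tri a b c y) = y} \<subseteq> {z}" ..
    then have "card {y \<in> {a, b, c}. g (tri a b c y) = y} \<le> card {z}" by (rule card_mono[rotated]) simp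
    then show False using s by simp
  qed
  then show thesis
  proof (elim disjE conjE)
    assume "g b = a" "g c = b"
    then show thesis by (rule main[OF abc ta])
  next
    assume "g c = b" "g a = c"
    then show thesis using main[of b c a] abc ta tri_rotate[OF abc(2-4)] by simp
  next
    assume "g a = c" "g b = a"
    then show thesis using main[of c a b] abc ta tri_rotate[OF abc(2-4)] tri_rotate[of b c a] by simp
  qed
qed

lemma inv_arc_support:
  assumes p: "permutation g" and l: "least_power g x \<ge> 3"
  shows "{y. inv_arc g x y \<noteq> y} = {x, g x, g (g x)}"
  using tri_apply[OF arc_distinct[OF p l]] arc_distinct[OF p l] unfolding inv_arc_def by auto

text \<open>On a cycle of length at least 4, \<open>g (g (g x))\<close> lies outside the support of
  \<open>inv_arc g x\<close>, so the support has a unique starting point.\<close>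

lemma inv_arc_inj:
  assumes p: "permutation g" and x: "least_power g x \<ge> 4" and y: "least_power g y \<ge> 4" and eq: "inv_arc g x = inv_arc g y"
  shows "x = y"
proof -
  have S: "{x, g x, g (g x)} = {y, g y, g (g y)}"
    using inv_arc_support[OF p, of x] inv_arc_support[OF p, of y] x y eq by simp
  have pw: "(g ^^ i) x = (g ^^ j) x \<longleftrightarrow> i mod least_power g x = j mod least_power g x" for i j
    by (rule funpow_eq_iff[OF p])
  have ne: "(g ^^ 3) x \<noteq> (g ^^ i) x" if "i < 3" for i
    using pw[of 3 i] that x by simp
  then have g3: "g (g (g x)) \<notin> {x, g x, g (g x)}"
    using ne[of 0] ne[of 1] ne[of 2] by (simp add: numeral_3_eq_3 numeral_2_eq_2)
  show ?thesis
  proof (rule ccontr)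
    assume "x \<noteq> y"
    then have "y = g x \<or> y = g (g x)" using S by auto
    then have "g (g (g x)) \<in> {y, g y, g (g y)}" by auto
    then show False using g3 S by blast
  qed
qed

lemma inv_arc_eq_iff_3:
  assumes p: "permutation g" and x: "least_power g x = 3" and y: "least_power g y = 3"
  shows "inv_arc g x = inv_arc g y \<longleftrightarrow> y \<in> {x, g x, g (g x)}"
proof
  assume eq: "inv_arc g x = inv_arc g y"
  then show "y \<in> {x, g x, g (g x)}"
    using inv_arc_support[OF p, of x] inv_arc_support[OF p, of y] x y by auto
next
  assume yx: "y \<in> {x, g x, g (g x)}"
  note d = arc_distinct[OF p, of x]
  have c: "g (g (g x)) = x" using cube_eq_iff[OF p, of x] x by simp
  show "inv_arc g x = inv_arc g y"
    using yx d x tri_rotate[of "g (g x)" "g x" x] tri_rotate[of "g x" x "g (g x)"] by (auto simp: inv_arc_def c)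
qed

lemma least_power_step: "permutation g \<Longrightarrow> least_power g (g x) = least_power g x"
  by (rule least_power_orbit) (auto intro: orbit.base)

text \<open>The 3-cycles that gain three fixed points are the inverses of the 3-cycles of
  \<open>g\<close>, and each of them is \<open>inv_arc g x\<close> for exactly the three points
  \<open>x\<close> of its support.\<close>

lemma cycle_count_3:
  assumes g: "g permutes {1..n}"
  shows "cycle_count n g 3 = 3 * card {t. three_cycle n t \<and> fixes_count n (t \<circ> g) = fixes_count n g + 3}"
proof -
  note p = permutation_if_permutes[OF g]
  let ?X = "{x \<in> {1..n}. least_power g x = 3}"
  have im: "{t. three_cycle n t \<and> fixes_count n (t \<circ> g) = fixes_count n g + 3} = inv_arc g ` ?X"
  proof (intro equalityI subsetI)
    fix t assume "t \<in> {t. three_cycle n t \<and> fixes_count n (t \<circ> g) = fixes_count n g + 3}"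
    then have t: "three_cycle n t" "fixes_count n (t \<circ> g) = fixes_count n g + 3" by auto
    then have "fixes_count n (t \<circ> g) \<ge> fixes_count n g + 2" by simp
    then obtain x where x: "x \<in> {1..n}" "least_power g x \<ge> 3" "t = inv_arc g x"
      using gain_imp_inv_arc[OF g t(1)] by metis
    then have "least_power g x = 3" using fixes_count_inv_arc[OF g x(1,2)] t(2) by (auto split: if_splits)
    then show "t \<in> inv_arc g ` ?X" using x by blast
  next
    fix t assume "t \<in> inv_arc g ` ?X"
    then obtain x where x: "x \<in> {1..n}" "least_power g x = 3" "t = inv_arc g x" by blast
    then show "t \<in> {t. three_cycle n t \<and> fixes_count n (t \<circ> g) = fixes_count n g + 3}"
      using inv_arc_three_cycle[OF g x(1)] fixes_count_inv_arc[OF g x(1)] by simp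
  qed
  have fib: "card {y \<in> ?X. inv_arc g y = t} = 3" if t: "t \<in> inv_arc g ` ?X" for t
  proof -
    obtain x where x: "x \<in> {1..n}" "least_power g x = 3" "t = inv_arc g x" using t by blast
    have "{y \<in> ?X. inv_arc g y = t} = {x, g x, g (g x)}"
    proof (intro equalityI subsetI)
      fix y assume "y \<in> {y \<in> ?X. inv_arc g y = t}"
      then show "y \<in> {x, g x, g (g x)}" using inv_arc_eq_iff_3[OF p x(2), of y] x(3) by simp
    next
      fix y assume y: "y \<in> {x, g x, g (g x)}"
      then have "y \<in> {1..n}" using permutes_in_image[OF g] x(1) by auto
      moreover have "least_power g y = 3" using y x(2) least_power_step[OF p] by auto
      ultimately show "y \<in> {y \<in> ?X. inv_arc g y = t}"
        using inv_arc_eq_iff_3[OF p x(2), of y] x(3) y by auto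
    qed
    then show ?thesis using arc_distinct[OF p, of x] x(2) by auto
  qed
  have "card ?X = (\<Sum>t\<in>inv_arc g ` ?X. card {y \<in> ?X. inv_arc g y = t})"
    unfolding card_eq_sum by (rule sum.group[symmetric]) auto
  also have "\<dots> = 3 * card (inv_arc g ` ?X)" using fib by simp
  finally show ?thesis unfolding im cycle_count_def .
qed

lemma gain_2_eq:
  assumes g: "g permutes {1..n}"
  shows "{t. three_cycle n t \<and> fixes_count n (t \<circ> g) = fixes_count n g + 2 \<and> Q t}
    = inv_arc g ` {x \<in> {1..n}. least_power g x \<ge> 4 \<and> Q (inv_arc g x)}"
proof (intro equalityI subsetI)
  fix t assume "t \<in> {t. three_cycle n t \<and> fixes_count n (t \<circ> g) = fixes_count n g + 2 \<and> Q t}"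
  then have t: "three_cycle n t" "fixes_count n (t \<circ> g) = fixes_count n g + 2" "Q t" by auto
  then have "fixes_count n (t \<circ> g) \<ge> fixes_count n g + 2" by simp
  then obtain x where x: "x \<in> {1..n}" "least_power g x \<ge> 3" "t = inv_arc g x"
    using gain_imp_inv_arc[OF g t(1)] by metis
  then have "least_power g x \<noteq> 3" using fixes_count_inv_arc[OF g x(1,2)] t(2) by (auto split: if_splits)
  then show "t \<in> inv_arc g ` {x \<in> {1..n}. least_power g x \<ge> 4 \<and> Q (inv_arc g x)}" using x t(3) by auto
next
  fix t assume "t \<in> inv_arc g ` {x \<in> {1..n}. least_power g x \<ge> 4 \<and> Q (inv_arc g x)}"
  then obtain x where x: "x \<in> {1..n}" "least_power g x \<ge> 4" "t = inv_arc g x" "Q t" by blast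
  then show "t \<in> {t. three_cycle n t \<and> fixes_count n (t \<circ> g) = fixes_count n g + 2 \<and> Q t}"
    using inv_arc_three_cycle[OF g x(1)] fixes_count_inv_arc[OF g x(1)] by simp
qed

lemma card_gain_2:
  assumes g: "g permutes {1..n}"
  shows "card {t. three_cycle n t \<and> fixes_count n (t \<circ> g) = fixes_count n g + 2 \<and> Q t}
    = card {x \<in> {1..n}. least_power g x \<ge> 4 \<and> Q (inv_arc g x)}"
  unfolding gain_2_eq[OF g]
  using inv_arc_inj[OF permutation_if_permutes[OF g]] by (intro card_image inj_onI) auto

lemma least_power_enum:
  assumes m: "m > 0" and inj: "inj_on f {..<m}" and per: "\<And>j. f (j + m) = f j" and step: "\<And>j. h (f j) = f (Suc j)"
  shows "least_power h (f 0) = m"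
proof -
  have pw: "(h ^^ j) (f 0) = f j" for j by (induction j) (simp_all add: step)
  have "f m = f 0" using per[of 0] by simp
  have "m \<le> j" if "(h ^^ j) (f 0) = f 0" "j > 0" for j
  proof (rule ccontr)
    assume "\<not> m \<le> j"
    then have "j = 0" using inj_onD[OF inj, of j 0] that pw by simp
    then show False using that by simp
  qed
  then show ?thesis
    unfolding least_power_def using m pw \<open>f m = f 0\<close> by (intro Least_equality) auto
qed

text \<open>\<open>inv_arc g x \<circ> g\<close> cuts the points \<open>x\<close> and \<open>g x\<close> out of the cycle of \<open>x\<close>.\<close>

lemma least_power_inv_arc:
  assumes g: "g permutes {1..n}" and l: "least_power g x \<ge> 4"
  shows "least_power (inv_arc g x \<circ> g) z =
    (if z \<notin> Orbits.orbit g x then least_power g z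
     else if z = x \<or> z = g x then 1 else least_power g x - 2)"
proof -
  note p = permutation_if_permutes[OF g]
  let ?h = "inv_arc g x \<circ> g" and ?l = "least_power g x"
  have l3: "?l \<ge> 3" using l by simp
  note d = arc_distinct[OF p l3]
  note t = tri_apply[OF d(1,2,3), folded inv_arc_def]
  have p1: "permutation (inv_arc g x)"
    unfolding inv_arc_def tri_def by (intro permutation_compose permutation_swap_id)
  have ph: "permutation ?h" using p1 p by (rule permutation_compose)
  have pw: "(g ^^ i) x = (g ^^ j) x \<longleftrightarrow> i mod ?l = j mod ?l" for i j by (rule funpow_eq_iff[OF p])
  consider "z \<notin> Orbits.orbit g x" | "z = x" | "z = g x" | "z \<in> Orbits.orbit g x" "z \<noteq> x" "z \<noteq> g x" by blast
  then show ?thesis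
  proof cases
    case 1
    have out: "(g ^^ j) z \<notin> Orbits.orbit g x" for j
    proof
      assume a: "(g ^^ j) z \<in> Orbits.orbit g x"
      have "(g ^^ j) z \<in> Orbits.orbit g z" unfolding orbit_altdef_permutation[OF p] by auto
      then show False using a 1 orbit_eq_iff[OF p] permutation_self_in_orbit[OF p] by metis
    qed
    have in_orb: "x \<in> Orbits.orbit g x" "g x \<in> Orbits.orbit g x" "g (g x) \<in> Orbits.orbit g x"
      using permutation_self_in_orbit[OF p] by (auto intro: orbit.intros)
    have "(?h ^^ j) z = (g ^^ j) z" for j
    proof (induction j)
      case (Suc j)
      have "g ((g ^^ j) z) \<notin> Orbits.orbit g x" using out[of "Suc j"] by simp
      then have "inv_arc g x (g ((g ^^ j) z)) = g ((g ^^ j) z)" using in_orb by (intro t(4)) auto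
      then show ?case using Suc by simp
    qed simp
    then show ?thesis using 1 by (simp add: least_power_def)
  next
    case 2
    have "?h x = x" using t by simp
    then show ?thesis using 2 least_power_eq_1_iff[OF ph, of x] permutation_self_in_orbit[OF p] by simp
  next
    case 3
    have "?h (g x) = g x" using t by simp
    then show ?thesis using 3 least_power_eq_1_iff[OF ph, of "g x"] by (auto intro: orbit.base)
  next
    case 4
    \<comment> \<open>Enumerates what remains of the cycle, starting at \<open>g (g x)\<close>; the
      period drops by the two points that become fixed.\<close>
    define f where "f j = (g ^^ (2 + j mod (?l - 2))) x" for j
    have inj: "inj_on f {..<?l - 2}"
    proof (rule inj_onI)
      fix i j assume "i \<in> {..<?l - 2}" "j \<in> {..<?l - 2}" "f i = f j"
      then show "i = j" using pw[of "2 + i" "2 + j"] l by (simp add: f_def)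
    qed
    have step: "?h (f j) = f (Suc j)" for j
    proof -
      let ?i = "j mod (?l - 2)"
      have i: "?i < ?l - 2" using l by simp
      show ?thesis
      proof (cases "Suc ?i = ?l - 2")
        case True
        then have "Suc j mod (?l - 2) = 0" by (simp add: mod_Suc)
        then have fs: "f (Suc j) = g (g x)" by (simp add: f_def numeral_2_eq_2)
        have "3 + ?i = ?l" using True l by linarith
        have "g (f j) = (g ^^ (3 + ?i)) x" by (simp add: f_def numeral_3_eq_3 numeral_2_eq_2)
        then have "g (f j) = x" unfolding \<open>3 + ?i = ?l\<close> using least_power_of_permutation(1)[OF p] by simp
        then show ?thesis using fs t by simp
      next
        case False
        then have "Suc j mod (?l - 2) = Suc ?i" by (simp add: mod_Suc)
        then have fs: "f (Suc j) = g (f j)" by (simp add: f_def)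
        have e: "g (f j) = (g ^^ (3 + ?i)) x" by (simp add: f_def numeral_3_eq_3 numeral_2_eq_2)
        have lt: "3 + ?i < ?l" using False i by linarith
        have "(g ^^ (3 + ?i)) x \<noteq> (g ^^ m) x" if "m < 3" for m
          using pw[of "3 + ?i" m] lt that by simp
        from this[of 0] this[of 1] this[of 2] have "g (f j) \<noteq> x" "g (f j) \<noteq> g x" "g (f j) \<noteq> g (g x)"
          unfolding e by (simp_all add: numeral_2_eq_2)
        then have "inv_arc g x (g (f j)) = g (f j)" by (intro t(4)) auto
        then show ?thesis using fs by simp
      qed
    qed
    have f0: "least_power ?h (f 0) = ?l - 2"
    proof (rule least_power_enum[OF _ inj _ step])
      show "0 < ?l - 2" using l by simp
      show "f (j + (?l - 2)) = f j" for j unfolding f_def mod_add_self2 ..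
    qed
    have pwh: "(?h ^^ j) (f 0) = f j" for j
    proof (induction j)
      case (Suc j)
      have "(?h ^^ Suc j) (f 0) = ?h ((?h ^^ j) (f 0))" by (simp only: funpow.simps(2) o_apply)
      then show ?case unfolding Suc step .
    qed simp
    obtain k where k: "z = (g ^^ k) x" using 4(1) unfolding orbit_altdef_permutation[OF p] by auto
    define m where "m = k mod ?l"
    have zm: "z = (g ^^ m) x" unfolding k m_def using pw by simp
    have "m < ?l" using l by (simp add: m_def)
    moreover have "m \<noteq> 0" using 4(2) zm by (cases m) simp_all
    moreover have "m \<noteq> 1" using 4(3) zm by force
    ultimately have "2 + (m - 2) mod (?l - 2) = m" by simp
    then have "z = f (m - 2)" using zm by (simp only: f_def)
    then have "z \<in> Orbits.orbit ?h (f 0)" using pwh[of "m - 2"] unfolding orbit_altdef_permutation[OF ph]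
      by (metis (mono_tags, lifting) mem_Collect_eq)
    then have "least_power ?h z = least_power ?h (f 0)" by (rule least_power_orbit[OF ph])
    then show ?thesis using f0 4 by simp
  qed
qed

text \<open>Shortening a cycle of length \<open>l\<close> adds \<open>l - 2\<close> points to the
  count for \<open>l - 2\<close> and takes \<open>l\<close> points from the count for
  \<open>l\<close>, so only the case \<open>j = l - 2\<close> gives a gain of \<open>j\<close>. The
  condition \<open>j \<ge> 2\<close> keeps the two new fixed points out.\<close>

lemma cycle_count_inv_arc:
  assumes g: "g permutes {1..n}" and x: "x \<in> {1..n}" and l: "least_power g x \<ge> 4" and j: "j \<ge> 2"
  shows "cycle_count n (inv_arc g x \<circ> g) j = cycle_count n g j + j \<longleftrightarrow> least_power g x = j + 2"
proof -
  note p = permutation_if_permutes[OF g]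
  let ?h = "inv_arc g x \<circ> g" and ?l = "least_power g x" and ?O = "Orbits.orbit g x"
  have O: "?O \<subseteq> {1..n}" using permutes_orbit_subset[OF g x] .
  have finO: "finite ?O" using O by (rule finite_subset) simp
  have l3: "?l \<ge> 3" using l by simp
  note d = arc_distinct[OF p l3]
  have xO: "x \<in> ?O" "g x \<in> ?O" using permutation_self_in_orbit[OF p] by (auto intro: orbit.base)
  let ?R = "{z \<in> {1..n} - ?O. least_power g z = j}"
  have lO: "least_power g z = ?l" if "z \<in> ?O" for z using least_power_orbit[OF p that] .
  have cg: "cycle_count n g j = card ?R + (if ?l = j then ?l else 0)"
  proof -
    have "cycle_count n g j = card ?R + card {z \<in> ?O. ?l = j}"
      unfolding cycle_count_def by (rule card_split_off[OF _ O]) (use lO in auto)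
    also have "card {z \<in> ?O. ?l = j} = (if ?l = j then ?l else 0)" using card_orbit[OF p, of x] by simp
    finally show ?thesis .
  qed
  have ch: "cycle_count n ?h j = card ?R + (if ?l - 2 = j then ?l - 2 else 0)"
  proof -
    have "cycle_count n ?h j = card {z \<in> {1..n} - ?O. least_power ?h z = j} + card {z \<in> ?O - {x, g x}. ?l - 2 = j}"
      unfolding cycle_count_def
    proof (rule trans[OF card_split_off[OF _ O, of _ "\<lambda>z. z \<noteq> x \<and> z \<noteq> g x \<and> ?l - 2 = j"]])
      show "least_power ?h z = j \<longleftrightarrow> z \<noteq> x \<and> z \<noteq> g x \<and> ?l - 2 = j" if "z \<in> ?O" for z
        unfolding least_power_inv_arc[OF g l, of z] using j that by simp
      have "{z \<in> ?O. z \<noteq> x \<and> z \<noteq> g x \<and> ?l - 2 = j} = {z \<in> ?O - {x, g x}. ?l - 2 = j}" by blast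
      then show "card {z \<in> {1..n} - ?O. least_power ?h z = j} + card {z \<in> ?O. z \<noteq> x \<and> z \<noteq> g x \<and> ?l - 2 = j}
          = card {z \<in> {1..n} - ?O. least_power ?h z = j} + card {z \<in> ?O - {x, g x}. ?l - 2 = j}"
        by (simp only:)
    qed simp
    also have "{z \<in> {1..n} - ?O. least_power ?h z = j} = ?R"
    proof (rule Collect_cong)
      show "z \<in> {1..n} - ?O \<and> least_power ?h z = j \<longleftrightarrow> z \<in> {1..n} - ?O \<and> least_power g z = j" for z
        unfolding least_power_inv_arc[OF g l, of z] by simp
    qed
    also have "card (?O - {x, g x}) = ?l - 2"
      using card_orbit[OF p, of x] xO d(2) finO by (subst card_Diff_subset) auto
    then have "card {z \<in> ?O - {x, g x}. ?l - 2 = j} = (if ?l - 2 = j then ?l - 2 else 0)"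
      by (cases "?l - 2 = j") (simp_all only: simp_thms if_True if_False Collect_mem_eq empty_def[symmetric] card.empty refl)
    finally show ?thesis .
  qed
  show ?thesis unfolding cg ch using l j by auto
qed

text \<open>Among the 3-cycles that gain two fixed points, those that create a cycle of length
  \<open>k - 2\<close> belong to the points on cycles of length \<open>k\<close>, one for each
  point. Only the count for the smaller length \<open>k - 2\<close> enters, so an induction is
  possible.\<close>

lemma cycle_count_ge_4:
  assumes g: "g permutes {1..n}" and k: "k \<ge> 4"
  shows "cycle_count n g k = card {t. three_cycle n t \<and> fixes_count n (t \<circ> g) = fixes_count n g + 2 \<and>
    cycle_count n (t \<circ> g) (k - 2) = cycle_count n g (k - 2) + (k - 2)}"
  unfolding card_gain_2[OF g] cycle_count_def[of n g k]
proof (rule arg_cong[of _ _ card])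
  show "{x \<in> {1..n}. least_power g x = k} = {x \<in> {1..n}. least_power g x \<ge> 4 \<and>
    cycle_count n (inv_arc g x \<circ> g) (k - 2) = cycle_count n g (k - 2) + (k - 2)}"
    using cycle_count_inv_arc[OF g, of _ "k - 2"] k by auto
qed

text \<open>Cycles of length 2 cannot be shortened in this way, so their points are counted as a
  complement: the 3-cycles gaining two fixed points correspond to the points on cycles of length at
  least 4.\<close>

lemma cycle_count_2:
  assumes g: "g permutes {1..n}"
  shows "cycle_count n g 2 + cycle_count n g 1 + cycle_count n g 3
    + card {t. three_cycle n t \<and> fixes_count n (t \<circ> g) = fixes_count n g + 2} = n"
proof -
  note p = permutation_if_permutes[OF g]
  let ?A = "\<lambda>k. {x \<in> {1..n}. least_power g x = k}" and ?B = "{x \<in> {1..n}. least_power g x \<ge> 4}"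
  have "{1..n} = ((?A 2 \<union> ?A 1) \<union> ?A 3) \<union> ?B"
  proof (intro equalityI subsetI)
    fix x assume x: "x \<in> {1..n}"
    have "least_power g x > 0" using least_power_pos[OF p] .
    then have "least_power g x = 1 \<or> least_power g x = 2 \<or> least_power g x = 3 \<or> least_power g x \<ge> 4" by linarith
    then show "x \<in> ((?A 2 \<union> ?A 1) \<union> ?A 3) \<union> ?B" using x by blast
  qed auto
  then have "card {1..n} = card (((?A 2 \<union> ?A 1) \<union> ?A 3) \<union> ?B)" by (rule arg_cong)
  also have "\<dots> = card ((?A 2 \<union> ?A 1) \<union> ?A 3) + card ?B" by (rule card_Un_disjoint) auto
  also have "card ((?A 2 \<union> ?A 1) \<union> ?A 3) = card (?A 2 \<union> ?A 1) + card (?A 3)" by (rule card_Un_disjoint) auto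
  also have "card (?A 2 \<union> ?A 1) = card (?A 2) + card (?A 1)" by (rule card_Un_disjoint) auto
  finally show ?thesis using card_gain_2[OF g, of "\<lambda>_. True"] by (simp add: cycle_count_def)
qed

section \<open>Cycle types from structure constants\<close>

locale alt_table = T?: table_symmetry "alt_group n" I J r r' c c'
  for n :: nat and I :: "'i set" and J :: "'j set"
    and r r' :: "'i \<Rightarrow> (nat \<Rightarrow> nat) \<Rightarrow> complex" and c c' :: "'j \<Rightarrow> (nat \<Rightarrow> nat) set"
begin

lemma rel_cycle_type:
  assumes tri: "\<And>g h. rel g h \<Longrightarrow> three_cycle n g \<longleftrightarrow> three_cycle n h"
    and fx: "\<And>g h. rel g h \<Longrightarrow> fixes_count n g = fixes_count n h"
    and gh: "rel g h"
  shows "cycle_type n g = cycle_type n h"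
proof -
  have perm: "g permutes {1..n}" "h permutes {1..n}" if "rel g h" for g h
    using rel_carrier[OF that] by (auto simp: alt_group_carrier)
  have transfer: "card {t. three_cycle n t \<and> Q (t \<circ> g)} = card {t. three_cycle n t \<and> Q (t \<circ> h)}"
    if Q: "\<And>x y. rel x y \<Longrightarrow> Q x \<longleftrightarrow> Q y" and gh: "rel g h" for Q g h
  proof -
    have e: "{t. three_cycle n t \<and> Q (t \<circ> z)} = {t \<in> carrier (alt_group n). three_cycle n t \<and> Q (t \<otimes>\<^bsub>alt_group n\<^esub> z)}" for z
      using three_cycle_carrier by auto
    show ?thesis unfolding e by (rule count_transfer[OF tri Q gh])
  qed
  \<comment> \<open>Quantified over all related pairs, because the induction hypothesis is applied
    to the products \<open>t \<circ> g\<close> as well as to \<open>g\<close>.\<close>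
  have "\<forall>g h. rel g h \<longrightarrow> cycle_count n g k = cycle_count n h k" for k
  proof (induction k rule: less_induct)
    case (less k)
    show ?case
    proof (intro allI impI)
      fix g h assume gh: "rel g h"
      note pg = perm(1)[OF gh] and ph = perm(2)[OF gh]
      have c3: "cycle_count n g 3 = cycle_count n h 3"
        unfolding cycle_count_3[OF pg] cycle_count_3[OF ph] fx[OF gh]
        by (rule arg_cong[of _ _ "times 3"], rule transfer[OF _ gh]) (simp add: fx)
      have c1: "cycle_count n g 1 = cycle_count n h 1"
        unfolding cycle_count_1[OF pg] cycle_count_1[OF ph] by (rule fx[OF gh])
      have c2: "cycle_count n g 2 = cycle_count n h 2"
      proof -
        have "card {t. three_cycle n t \<and> fixes_count n (t \<circ> g) = fixes_count n g + 2}
            = card {t. three_cycle n t \<and> fixes_count n (t \<circ> h) = fixes_count n h + 2}"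
          unfolding fx[OF gh] by (rule transfer[OF _ gh]) (simp add: fx)
        then show ?thesis using cycle_count_2[OF pg] cycle_count_2[OF ph] c1 c3 by linarith
      qed
      have c0: "cycle_count n g 0 = cycle_count n h 0"
        using mult_count_cycle_type[OF pg, of 0] mult_count_cycle_type[OF ph, of 0] by simp
      consider "k = 0" | "k = 1" | "k = 2" | "k = 3" | "k \<ge> 4" by linarith
      then show "cycle_count n g k = cycle_count n h k"
      proof cases
        case 5
        then have "k - 2 < k" by simp
        then have IH: "rel x y \<Longrightarrow> cycle_count n x (k - 2) = cycle_count n y (k - 2)" for x y using less by blast
        show ?thesis
          unfolding cycle_count_ge_4[OF pg 5] cycle_count_ge_4[OF ph 5] fx[OF gh] IH[OF gh]
          by (rule transfer[OF _ gh]) (simp add: fx IH)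
      qed (use c0 c1 c2 c3 in auto)
    qed
  qed
  then show ?thesis unfolding cycle_type_eq_iff[OF perm(1)[OF gh] perm(2)[OF gh]] using gh by blast
qed

end

section \<open>Centralizers and class sizes\<close>

text \<open>The set \<open>S\<close> is arbitrary because the size estimates remove one cycle after
  another.\<close>

definition centralizing_perms :: "'b set \<Rightarrow> ('b \<Rightarrow> 'b) \<Rightarrow> ('b \<Rightarrow> 'b) set" where
  "centralizing_perms S g = {h. h permutes S \<and> (\<forall>x. h (g x) = g (h x))}"

lemma finite_centralizing_perms: "finite S \<Longrightarrow> finite (centralizing_perms S g)"
  by (rule finite_subset[OF _ finite_permutations]) (auto simp: centralizing_perms_def)

lemma centralizing_perms_inv_comp:
  assumes h: "h \<in> centralizing_perms S g" and k: "k \<in> centralizing_perms S g"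
  shows "inv' h \<circ> k \<in> centralizing_perms S g"
proof -
  have hp: "h permutes S" and kp: "k permutes S" using h k by (auto simp: centralizing_perms_def)
  have "inv' h (g x) = g (inv' h x)" for x
  proof -
    have "h (g (inv' h x)) = g (h (inv' h x))" using h by (simp add: centralizing_perms_def)
    then have "h (g (inv' h x)) = g x" using permutes_inverses(1)[OF hp] by simp
    then show ?thesis using permutes_inverses(2)[OF hp] by metis
  qed
  then show ?thesis using k permutes_compose[OF kp permutes_inv[OF hp]] by (simp add: centralizing_perms_def)
qed

text \<open>A permutation commuting with \<open>g\<close> maps \<open>x\<close> into a cycle of the same length, and two of them with
  the same value at \<open>x\<close> differ by one that is trivial on the cycle of \<open>x\<close>.\<close>

lemma card_centralizing_perms_le:
  assumes S: "finite S" and g: "g permutes S" and x: "x \<in> S"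
  shows "card (centralizing_perms S g) \<le> card {y \<in> S. least_power g y = least_power g x} *
    card (centralizing_perms (S - Orbits.orbit g x) (perm_restrict g (S - Orbits.orbit g x)))"
proof -
  let ?O = "Orbits.orbit g x" and ?C = "centralizing_perms S g" and ?Y = "{y \<in> S. least_power g y = least_power g x}"
  let ?g = "perm_restrict g (S - ?O)"
  have p: "permutation g" using g S permutation_permutes by blast
  have into: "h x \<in> ?Y" if "h \<in> ?C" for h
  proof -
    have hp: "h permutes S" and c: "\<And>x. h (g x) = g (h x)" using that by (auto simp: centralizing_perms_def)
    have "least_power g (h x) = least_power g x" by (rule least_power_conj[of h g g, OF permutes_inj[OF hp] c])
    then show ?thesis using permutes_in_image[OF hp] x by simp
  qed
  have fib: "card {h \<in> ?C. h x = y} \<le> card (centralizing_perms (S - ?O) ?g)" for y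
  proof (cases "{h \<in> ?C. h x = y} = {}")
    case False
    then obtain h0 where h0: "h0 \<in> ?C" "h0 x = y" by blast
    then have h0p: "h0 permutes S" by (simp add: centralizing_perms_def)
    show ?thesis
    proof (rule card_inj_on_le[of "\<lambda>h. inv' h0 \<circ> h"])
      show "inj_on (\<lambda>h. inv' h0 \<circ> h) {h \<in> ?C. h x = y}"
      proof (rule inj_onI)
        fix h h' assume e: "inv' h0 \<circ> h = inv' h0 \<circ> h'"
        have "h z = h' z" for z
          using fun_cong[OF e, of z] permutes_inj[OF permutes_inv[OF h0p]] by (simp add: inj_eq)
        then show "h = h'" by (rule ext)
      qed
      show "(\<lambda>h. inv' h0 \<circ> h) ` {h \<in> ?C. h x = y} \<subseteq> centralizing_perms (S - ?O) ?g"
      proof (rule image_subsetI)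
        fix h assume "h \<in> {h \<in> ?C. h x = y}"
        then have h: "h \<in> ?C" "h x = y" by auto
        define k where "k = inv' h0 \<circ> h"
        have "k \<in> ?C" unfolding k_def by (rule centralizing_perms_inv_comp[OF h0(1) h(1)])
        then have kp: "k permutes S" and kc: "\<And>z. k (g z) = g (k z)" by (auto simp: centralizing_perms_def)
        have kx: "k x = x" using h h0 permutes_inverses(2)[OF h0p, of x] by (simp add: k_def)
        have "k ((g ^^ i) x) = (g ^^ i) x" for i by (induction i) (simp_all add: kx kc)
        then have kO: "k z = z" if "z \<in> ?O" for z using that unfolding orbit_altdef_permutation[OF p] by auto
        have kp': "k permutes (S - ?O)" by (rule permutes_superset[OF kp]) (use kO in auto)
        have "k (?g z) = ?g (k z)" for z
        proof (cases "z \<in> S - ?O")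
          case True
          then have "k z \<in> S - ?O" using permutes_in_image[OF kp'] by blast
          then show ?thesis using True kc by (simp add: perm_restrict_def)
        next
          case False
          then show ?thesis using permutes_not_in[OF kp' False] by (simp add: perm_restrict_simps(2))
        qed
        then show "inv' h0 \<circ> h \<in> centralizing_perms (S - ?O) ?g"
          using kp' unfolding k_def by (simp add: centralizing_perms_def)
      qed
      show "finite (centralizing_perms (S - ?O) ?g)" using S by (intro finite_centralizing_perms) simp
    qed
  qed (simp only: card.empty)
  have "card ?C = (\<Sum>y\<in>?Y. card {h \<in> ?C. h x = y})"
    unfolding card_eq_sum using into S finite_centralizing_perms[OF S, of g] by (intro sum.group[symmetric]) auto
  also have "\<dots> \<le> card ?Y * card (centralizing_perms (S - ?O) ?g)"
    using sum_bounded_above[of ?Y "\<lambda>y. card {h \<in> ?C. h x = y}" "card (centralizing_perms (S - ?O) ?g)"] fib by simp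
  finally show ?thesis .
qed

text \<open>For even \<open>m\<close> this is the order of the centralizer, in the symmetric group
  on \<open>m\<close> points, of a product of \<open>m div 2\<close> disjoint
  transpositions.\<close>

fun double_fact :: "nat \<Rightarrow> nat" where
  "double_fact 0 = 1"
| "double_fact (Suc 0) = 1"
| "double_fact (Suc (Suc m)) = Suc (Suc m) * double_fact m"

lemma double_fact_pos: "double_fact m > 0"
  by (induction m rule: double_fact.induct) auto

lemma double_fact_Suc_le: "double_fact m \<le> double_fact (Suc m)"
proof (induction m rule: double_fact.induct)
  case (3 m)
  then show ?case unfolding double_fact.simps(3) by (rule mult_le_mono[rotated]) simp
qed auto

lemma double_fact_mono: "k \<le> m \<Longrightarrow> double_fact k \<le> double_fact m"
  by (rule lift_Suc_mono_le[of double_fact]) (rule double_fact_Suc_le)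

lemma fact_double_fact: "fact (Suc m) = double_fact (Suc m) * double_fact m"
  by (induction m) (auto simp: algebra_simps)

lemma moved_peel:
  assumes S: "finite S" and g: "g permutes S" and x: "x \<in> S" and gx: "g x \<noteq> x"
  shows "perm_restrict g (S - Orbits.orbit g x) permutes (S - Orbits.orbit g x)"
    "{y \<in> S - Orbits.orbit g x. perm_restrict g (S - Orbits.orbit g x) y \<noteq> y} = {y \<in> S. g y \<noteq> y} - Orbits.orbit g x"
    "Orbits.orbit g x \<subseteq> {y \<in> S. g y \<noteq> y}" "card (Orbits.orbit g x) = least_power g x" "least_power g x \<ge> 2"
    "{y \<in> S. least_power g y = least_power g x} \<subseteq> {y \<in> S. g y \<noteq> y}"
proof -
  let ?O = "Orbits.orbit g x"
  have p: "permutation g" using g S permutation_permutes by blast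
  show "perm_restrict g (S - ?O) permutes (S - ?O)"
    using perm_restrict_diff_cyclic[OF g cyclic_on_orbit[OF g S]] .
  show "{y \<in> S - ?O. perm_restrict g (S - ?O) y \<noteq> y} = {y \<in> S. g y \<noteq> y} - ?O"
    by (auto simp: perm_restrict_def)
  show "card ?O = least_power g x" by (rule card_orbit[OF p])
  have ne: "least_power g x \<noteq> 1" using least_power_eq_1_iff[OF p] gx by simp
  then show "least_power g x \<ge> 2" using least_power_pos[OF p, of x] by linarith
  have "g y \<noteq> y" if "least_power g y = least_power g x" for y
    using ne that least_power_eq_1_iff[OF p, of y] by simp
  then show "?O \<subseteq> {y \<in> S. g y \<noteq> y}" "{y \<in> S. least_power g y = least_power g x} \<subseteq> {y \<in> S. g y \<noteq> y}"
    using permutes_orbit_subset[OF g x] least_power_orbit[OF p, of _ x] by auto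
qed

lemma fixed_peel:
  "Orbits.orbit g x \<subseteq> {y \<in> S. g y \<noteq> y} \<Longrightarrow>
    {y \<in> S - Orbits.orbit g x. perm_restrict g (S - Orbits.orbit g x) y = y} = {y \<in> S. g y = y}"
  by (auto simp: perm_restrict_def)

text \<open>One cycle is removed at a time. A point of it has at most as many images as there are
  moved points, and at least two moved points disappear, which is the recursion of
  \<open>double_fact\<close>.\<close>

lemma card_centralizing_perms_bound:
  assumes S: "finite S" and g: "g permutes S"
  shows "card (centralizing_perms S g) \<le> fact (card {y \<in> S. g y = y}) * double_fact (card {y \<in> S. g y \<noteq> y})"
  using assms
proof (induction "card {y \<in> S. g y \<noteq> y}" arbitrary: S g rule: less_induct)
  case less
  show ?case
  proof (cases "{y \<in> S. g y \<noteq> y} = {}")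
    case True
    then have e: "{y \<in> S. g y = y} = S" by auto
    have "card (centralizing_perms S g) \<le> card {h. h permutes S}"
      using less.prems by (intro card_mono finite_permutations) (auto simp: centralizing_perms_def)
    also have "\<dots> = fact (card S)" using less.prems by (intro card_permutations) auto
    finally show ?thesis unfolding True e by simp
  next
    case False
    then obtain x where x: "x \<in> S" "g x \<noteq> x" by auto
    let ?O = "Orbits.orbit g x" and ?M = "{y \<in> S. g y \<noteq> y}" and ?F = "{y \<in> S. g y = y}"
    let ?g = "perm_restrict g (S - ?O)"
    note pe = moved_peel[OF less.prems x]
    have finM: "finite ?M" using less.prems by simp
    have cM: "card (?M - ?O) = card ?M - least_power g x"
      using pe(3,4) finM by (subst card_Diff_subset) (auto intro: finite_subset)
    have leM: "least_power g x \<le> card ?M" using card_mono[OF finM pe(3)] pe(4) by simp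
    have "card (centralizing_perms (S - ?O) ?g)
        \<le> fact (card {y \<in> S - ?O. ?g y = y}) * double_fact (card {y \<in> S - ?O. ?g y \<noteq> y})"
    proof (rule less.hyps)
      show "card {y \<in> S - ?O. ?g y \<noteq> y} < card ?M" unfolding pe(2) cM using pe(5) leM by linarith
    qed (use less.prems pe(1) in auto)
    also have "\<dots> = fact (card ?F) * double_fact (card ?M - least_power g x)"
      unfolding pe(2) cM fixed_peel[OF pe(3)] ..
    also have "\<dots> \<le> fact (card ?F) * double_fact (card ?M - 2)"
      using pe(5) by (intro mult_le_mono double_fact_mono) auto
    finally have 1: "card (centralizing_perms (S - ?O) ?g) \<le> fact (card ?F) * double_fact (card ?M - 2)" .
    have "card (centralizing_perms S g) \<le> card {y \<in> S. least_power g y = least_power g x} * card (centralizing_perms (S - ?O) ?g)"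
      by (rule card_centralizing_perms_le[OF less.prems x(1)])
    also have "\<dots> \<le> card ?M * (fact (card ?F) * double_fact (card ?M - 2))"
      using 1 card_mono[OF finM pe(6)] by (rule mult_le_mono[rotated])
    also have "\<dots> = fact (card ?F) * double_fact (card ?M)"
    proof -
      obtain k where "card ?M = 2 + k" using le_trans[OF pe(5) leM] le_Suc_ex by blast
      then have "card ?M = Suc (Suc k)" by simp
      then show ?thesis by (simp only: double_fact.simps diff_Suc_Suc diff_zero numeral_2_eq_2 mult.left_commute)
    qed
    finally show ?thesis .
  qed
qed

text \<open>Removing a cycle of length at least 3 at the start costs the same factor but takes away
  three moved points. The gain is essential: with \<open>double_fact 6\<close> in place of
  \<open>6 * double_fact 3\<close>, the later comparison would fail for 6 moved points among
  7.\<close>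

lemma card_centralizing_perms_bound_3:
  assumes S: "finite S" and g: "g permutes S" and x: "x \<in> S" "least_power g x \<ge> 3"
  shows "card (centralizing_perms S g) \<le>
    fact (card {y \<in> S. g y = y}) * (card {y \<in> S. g y \<noteq> y} * double_fact (card {y \<in> S. g y \<noteq> y} - 3))"
proof -
  let ?O = "Orbits.orbit g x" and ?M = "{y \<in> S. g y \<noteq> y}" and ?F = "{y \<in> S. g y = y}"
  let ?g = "perm_restrict g (S - ?O)"
  have p: "permutation g" using g S permutation_permutes by blast
  have gx: "g x \<noteq> x" using least_power_eq_1_iff[OF p, of x] x(2) by auto
  note pe = moved_peel[OF S g x(1) gx]
  have finM: "finite ?M" using S by simp
  have cM: "card (?M - ?O) = card ?M - least_power g x"
    using pe(3,4) finM by (subst card_Diff_subset) (auto intro: finite_subset)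
  have "card (centralizing_perms (S - ?O) ?g)
      \<le> fact (card {y \<in> S - ?O. ?g y = y}) * double_fact (card {y \<in> S - ?O. ?g y \<noteq> y})"
    using S pe(1) by (intro card_centralizing_perms_bound) auto
  also have "\<dots> = fact (card ?F) * double_fact (card ?M - least_power g x)"
    unfolding pe(2) cM fixed_peel[OF pe(3)] ..
  also have "\<dots> \<le> fact (card ?F) * double_fact (card ?M - 3)"
    using x(2) by (intro mult_le_mono double_fact_mono) auto
  finally have 1: "card (centralizing_perms (S - ?O) ?g) \<le> fact (card ?F) * double_fact (card ?M - 3)" .
  have "card (centralizing_perms S g) \<le> card {y \<in> S. least_power g y = least_power g x} * card (centralizing_perms (S - ?O) ?g)"
    by (rule card_centralizing_perms_le[OF S g x(1)])
  also have "\<dots> \<le> card ?M * (fact (card ?F) * double_fact (card ?M - 3))"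
    using 1 card_mono[OF finM pe(6)] by (rule mult_le_mono[rotated])
  finally show ?thesis by (simp add: mult_ac)
qed

text \<open>Elements conjugating \<open>g\<close> to the same result differ by one that commutes
  with \<open>g\<close>; the centralizer is taken in the full symmetric group, where cycles can be
  treated separately.\<close>

lemma card_alt_le:
  assumes g: "g \<in> carrier (alt_group n)"
  shows "card (carrier (alt_group n)) \<le> card (A.conj_class n g) * card (centralizing_perms {1..n} g)"
proof -
  let ?A = "carrier (alt_group n)" and ?K = "A.conj_class n g" and ?f = "\<lambda>h. h \<circ> g \<circ> inv' h"
  have inK: "?f h \<in> ?K" if "h \<in> ?A" for h
    using that by (auto simp: A.conj_class_def alt_group_inv_equality intro!: exI[of _ h])
  have fib: "card {h \<in> ?A. ?f h = y} \<le> card (centralizing_perms {1..n} g)" for y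
  proof (cases "{h \<in> ?A. ?f h = y} = {}")
    case False
    then obtain h0 where h0: "h0 \<in> ?A" "?f h0 = y" by blast
    then have h0p: "h0 permutes {1..n}" by (simp add: alt_group_carrier)
    show ?thesis
    proof (rule card_inj_on_le[of "\<lambda>h. inv' h0 \<circ> h"])
      show "inj_on (\<lambda>h. inv' h0 \<circ> h) {h \<in> ?A. ?f h = y}"
      proof (rule inj_onI)
        fix h h' assume e: "inv' h0 \<circ> h = inv' h0 \<circ> h'"
        have "h z = h' z" for z
          using fun_cong[OF e, of z] permutes_inj[OF permutes_inv[OF h0p]] by (simp add: inj_eq)
        then show "h = h'" by (rule ext)
      qed
      show "(\<lambda>h. inv' h0 \<circ> h) ` {h \<in> ?A. ?f h = y} \<subseteq> centralizing_perms {1..n} g"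
      proof (rule image_subsetI)
        fix h assume "h \<in> {h \<in> ?A. ?f h = y}"
        then have h: "h permutes {1..n}" "?f h = ?f h0" using h0 by (auto simp: alt_group_carrier)
        have "inv' h0 (h (g x)) = g (inv' h0 (h x))" for x
        proof -
          have "h (g (inv' h (h x))) = h0 (g (inv' h0 (h x)))" using fun_cong[OF h(2), of "h x"] by simp
          then have "h (g x) = h0 (g (inv' h0 (h x)))" using permutes_inverses(2)[OF h(1)] by simp
          then show ?thesis using permutes_inverses(2)[OF h0p] by simp
        qed
        then show "inv' h0 \<circ> h \<in> centralizing_perms {1..n} g"
          using permutes_compose[OF h(1) permutes_inv[OF h0p]] by (simp add: centralizing_perms_def)
      qed
    qed (intro finite_centralizing_perms, simp)
  qed (simp only: card.empty)
  have "card ?A = (\<Sum>y\<in>?K. card {h \<in> ?A. ?f h = y})"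
    unfolding card_eq_sum using inK A.finite_conj_class[OF g] by (intro sum.group[symmetric]) auto
  also have "\<dots> \<le> card ?K * card (centralizing_perms {1..n} g)"
    using sum_bounded_above[of ?K "\<lambda>y. card {h \<in> ?A. ?f h = y}" "card (centralizing_perms {1..n} g)"] fib by simp
  finally show ?thesis .
qed

lemma three_cycle_conj:
  assumes t: "three_cycle n t" and h: "h permutes {1..n}"
  shows "three_cycle n (h \<circ> t \<circ> inv' h)"
proof -
  obtain cs where cs: "t = cycle_of_list cs" "cycle cs" "length cs = 3" "set cs \<subseteq> {1..n}"
    using t unfolding three_cycle_iff by blast
  have "h \<circ> t \<circ> inv' h = cycle_of_list (map h cs)"
    unfolding cs(1) by (rule conjugation_of_cycle[OF cs(2) permutes_bij[OF h]])
  moreover have "cycle (map h cs)" using cs(2) permutes_inj_on[OF h] by (simp add: distinct_map)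
  moreover have "set (map h cs) \<subseteq> {1..n}" using cs(4) permutes_in_image[OF h] by auto
  ultimately show ?thesis using cs(3) unfolding three_cycle_iff by (auto intro!: exI[of _ "map h cs"])
qed

text \<open>Every 3-cycle arises from at least three ordered triples of distinct points, namely the
  rotations of one.\<close>

lemma card_three_cycles: "3 * card {t. three_cycle n t} \<le> n * (n - 1) * (n - 2)"
proof -
  let ?D = "SIGMA a:{1..n}. SIGMA b:{1..n} - {a}. {1..n} - {a, b}"
  let ?f = "\<lambda>(a, b, c). tri a b c"
  let ?T = "{t. three_cycle n t}"
  have im: "?f ` ?D = ?T"
  proof (intro equalityI subsetI)
    fix t assume "t \<in> ?T"
    then obtain a b c where abc: "{a, b, c} \<subseteq> {1..n}" "a \<noteq> b" "b \<noteq> c" "a \<noteq> c" "t = tri a b c"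
      unfolding three_cycle_def by blast
    then have "(a, b, c) \<in> ?D" "t = ?f (a, b, c)" by auto
    then show "t \<in> ?f ` ?D" by (rule rev_image_eqI)
  next
    fix t assume "t \<in> ?f ` ?D"
    then obtain q where q: "q \<in> ?D" "t = ?f q" by (rule imageE) simp
    obtain a b c where "q = (a, b, c)" by (cases q)
    then have "a \<in> {1..n}" "b \<in> {1..n} - {a}" "c \<in> {1..n} - {a, b}" "t = tri a b c" using q by simp_all
    then have "{a, b, c} \<subseteq> {1..n} \<and> a \<noteq> b \<and> b \<noteq> c \<and> a \<noteq> c \<and> t = tri a b c" by simp
    then show "t \<in> ?T" unfolding three_cycle_def mem_Collect_eq by blast
  qed
  have finD: "finite ?D" by simp
  have finT: "finite ?T" unfolding im[symmetric] by (rule finite_imageI[OF finD])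
  have fib: "3 \<le> card {d \<in> ?D. ?f d = t}" if t: "t \<in> ?T" for t
  proof -
    obtain a b c where abc: "{a, b, c} \<subseteq> {1..n}" "a \<noteq> b" "b \<noteq> c" "a \<noteq> c" "t = tri a b c"
      using t unfolding three_cycle_def by blast
    have "{(a, b, c), (b, c, a), (c, a, b)} \<subseteq> {d \<in> ?D. ?f d = t}"
      using abc tri_rotate[OF abc(2-4)] tri_rotate[of b c a] by auto
    then have "card {(a, b, c), (b, c, a), (c, a, b)} \<le> card {d \<in> ?D. ?f d = t}"
      by (rule card_mono[OF finite_subset[OF Collect_restrict finD]])
    moreover have "card {(a, b, c), (b, c, a), (c, a, b)} = 3" using abc by auto
    ultimately show ?thesis by simp
  qed
  have "3 * card ?T = (\<Sum>t\<in>?T. 3)" by simp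
  also have "\<dots> \<le> (\<Sum>t\<in>?T. card {d \<in> ?D. ?f d = t})" using fib by (intro sum_mono) auto
  also have "\<dots> = card ?D"
    unfolding card_eq_sum by (rule sum.group[OF finD finT]) (simp only: im subset_refl)
  also have "card ?D = (\<Sum>a\<in>{1..n}. card (SIGMA b:{1..n} - {a}. {1..n} - {a, b}))" by (rule card_SigmaI) auto
  also have "\<dots> = (\<Sum>a\<in>{1..n}. (n - 1) * (n - 2))"
  proof (intro sum.cong refl)
    fix a assume a: "a \<in> {1..n}"
    have "card (SIGMA b:{1..n} - {a}. {1..n} - {a, b}) = (\<Sum>b\<in>{1..n} - {a}. card ({1..n} - {a, b}))"
      by (rule card_SigmaI) auto
    also have "\<dots> = (\<Sum>b\<in>{1..n} - {a}. n - 2)"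
    proof (intro sum.cong refl)
      fix b assume "b \<in> {1..n} - {a}"
      then show "card ({1..n} - {a, b}) = n - 2" using a by (subst card_Diff_subset) auto
    qed
    also have "\<dots> = (n - 1) * (n - 2)" using a by (simp add: card_Diff_singleton)
    finally show "card (SIGMA b:{1..n} - {a}. {1..n} - {a, b}) = (n - 1) * (n - 2)" .
  qed
  finally show ?thesis by (simp add: mult.assoc)
qed

lemma double_fact_bound:
  assumes "m \<ge> 9"
  shows "2 * m < 3 * double_fact (m - 4)"
proof -
  obtain k where k: "m = k + 9" using assms by (metis add.commute le_Suc_ex)
  have "m - 4 = Suc (Suc (k + 3))" unfolding k by simp
  then have "double_fact (m - 4) = Suc (Suc (k + 3)) * double_fact (k + 3)" by (simp only: double_fact.simps)
  moreover have "double_fact 3 \<le> double_fact (k + 3)" by (rule double_fact_mono) simp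
  then have "3 \<le> double_fact (k + 3)" by (simp add: numeral_3_eq_3)
  then have "Suc (Suc (k + 3)) * 3 \<le> Suc (Suc (k + 3)) * double_fact (k + 3)" by (rule mult_le_mono2)
  ultimately have "Suc (Suc (k + 3)) * 3 \<le> double_fact (m - 4)" by simp
  then show ?thesis unfolding k by simp
qed

lemma fact_mult_le: "fact d * fact k \<le> (fact (d + k) :: nat)"
  using fact_fact_dvd_fact[of d k] by (intro dvd_imp_le) auto

text \<open>Compares the centralizer bound for \<open>m\<close> moved points with the order of the centralizer of a
  3-cycle.\<close>

lemma centralizer_order_bound:
  assumes mn: "m \<le> n" and n: "n \<ge> 7" and m: "m = 6 \<or> m \<ge> 9"
  shows "2 * (fact (n - m) * (m * double_fact (m - 3))) < 3 * fact (n - 3)"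
proof -
  obtain d where d: "n = m + d" using mn le_Suc_ex by blast
  show ?thesis
  proof (cases "m = 6")
    case True
    \<comment> \<open>The exclusion of 6 enters here: for \<open>n = m = 6\<close> the inequality
      would read 36 < 18.\<close>
    have d1: "d \<ge> 1" using n d True by simp
    have "n - 3 = Suc (Suc (Suc d))" using d True by simp
    then have f: "fact (n - 3) = (d + 3) * ((d + 2) * ((d + 1) * (fact d :: nat)))" by (simp add: algebra_simps)
    have "24 \<le> (d + 3) * ((d + 2) * (d + 1))"
    proof -
      have "4 * (3 * 2) \<le> (d + 3) * ((d + 2) * (d + 1))" using d1 by (intro mult_le_mono) auto
      then show ?thesis by simp
    qed
    then have "24 * fact d \<le> (d + 3) * ((d + 2) * (d + 1)) * fact d" by (rule mult_le_mono1)
    also have "\<dots> = fact (n - 3)" unfolding f by (simp only: mult.assoc)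
    finally have "24 * fact d \<le> (fact (n - 3) :: nat)" .
    then have "2 * (fact d * (6 * 3)) < 3 * (fact (n - 3) :: nat)" using fact_gt_zero[of d, where 'a=nat] by linarith
    moreover have "n - m = d" "double_fact (m - 3) = 3" using d True by (simp_all add: numeral_3_eq_3)
    ultimately show ?thesis unfolding True by simp
  next
    case False
    then have m9: "m \<ge> 9" using m by simp
    have pos: "(fact d :: nat) * double_fact (m - 3) > 0" using double_fact_pos by simp
    \<comment> \<open>The double factorial in the bound cancels against one of these two factors and
      leaves \<open>double_fact_bound\<close>.\<close>
    have f: "fact (m - 3) = double_fact (m - 3) * double_fact (m - 4)"
    proof -
      have e: "m - 3 = Suc (m - 4)" using m9 by simp
      show ?thesis unfolding e by (rule fact_double_fact)
    qed
    have "2 * (fact (n - m) * (m * double_fact (m - 3))) = (fact d * double_fact (m - 3)) * (2 * m)"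
      using d by (simp add: mult_ac)
    also have "\<dots> < (fact d * double_fact (m - 3)) * (3 * double_fact (m - 4))"
      using double_fact_bound[OF m9] pos by (simp only: mult_less_cancel1)
    also have "\<dots> = 3 * (fact d * fact (m - 3))" unfolding f by (simp add: mult_ac)
    also have "\<dots> \<le> 3 * fact (n - 3)"
      using fact_mult_le[of d "m - 3"] d m9 by (simp add: add.commute)
    finally show ?thesis .
  qed
qed

section \<open>Vectors fixed by a subgroup\<close>

context finite_grp
begin

lemma sum_subgroup_translate:
  assumes H: "subgroup H G" and k: "k \<in> H"
  shows "(\<Sum>h\<in>H. F (k \<otimes> h)) = (\<Sum>h\<in>H. F h)" "(\<Sum>h\<in>H. F (h \<otimes> k)) = (\<Sum>h\<in>H. F h)"
proof -
  have c: "\<And>x. x \<in> H \<Longrightarrow> x \<in> carrier G" using subgroup.subset[OF H] by blast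
  note i = subgroup.m_inv_closed[OF H k] and m = subgroup.m_closed[OF H]
  show "(\<Sum>h\<in>H. F (k \<otimes> h)) = (\<Sum>h\<in>H. F h)"
    by (rule sum.reindex_bij_witness[of _ "\<lambda>h. inv k \<otimes> h" "\<lambda>h. k \<otimes> h"])
      (use i m k c in \<open>auto simp: m_assoc[symmetric]\<close>)
  show "(\<Sum>h\<in>H. F (h \<otimes> k)) = (\<Sum>h\<in>H. F h)"
    by (rule sum.reindex_bij_witness[of _ "\<lambda>h. h \<otimes> inv k" "\<lambda>h. h \<otimes> k"])
      (use i m k c in \<open>auto simp: m_assoc\<close>)
qed

text \<open>For a representation \<open>\<rho>\<close> and a subgroup \<open>H\<close>, the
  projection onto the vectors fixed by \<open>H\<close>; its trace is the dimension of the fixed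
  space.\<close>

definition average :: "nat \<Rightarrow> ('a \<Rightarrow> complex mat) \<Rightarrow> 'a set \<Rightarrow> complex mat" where
  "average d \<rho> H = mat d d (\<lambda>(i, j). (\<Sum>h\<in>H. \<rho> h $$ (i, j)) / of_nat (card H))"

lemma average_carrier [simp]: "average d \<rho> H \<in> carrier_mat d d"
  by (simp add: average_def)

context
  fixes d \<rho> assumes r: "representation G d \<rho>"
begin

lemma subgroup_rep_carrier: "subgroup H G \<Longrightarrow> h \<in> H \<Longrightarrow> \<rho> h \<in> carrier_mat d d"
  using representationD(1)[OF r] subgroup.subset by blast

lemma trace_average:
  assumes H: "subgroup H G"
  shows "trace_mat (average d \<rho> H) = (\<Sum>h\<in>H. trace_mat (\<rho> h)) / of_nat (card H)"
proof -
  have "trace_mat (average d \<rho> H) = (\<Sum>i<d. (\<Sum>h\<in>H. \<rho> h $$ (i, i)) / of_nat (card H))"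
    unfolding trace_mat_def by (simp add: average_def)
  also have "\<dots> = (\<Sum>h\<in>H. \<Sum>i<d. \<rho> h $$ (i, i)) / of_nat (card H)"
    unfolding sum_divide_distrib[symmetric] by (subst sum.swap) (rule refl)
  also have "(\<Sum>h\<in>H. \<Sum>i<d. \<rho> h $$ (i, i)) = (\<Sum>h\<in>H. trace_mat (\<rho> h))"
    unfolding trace_mat_def using subgroup_rep_carrier[OF H] by (intro sum.cong refl) auto
  finally show ?thesis .
qed

lemma mult_average_index:
  assumes H: "subgroup H G" and M: "M \<in> carrier_mat d d" and ij: "i < d" "j < d"
  shows "(M * average d \<rho> H) $$ (i, j) = (\<Sum>h\<in>H. (M * \<rho> h) $$ (i, j)) / of_nat (card H)"
    "(average d \<rho> H * M) $$ (i, j) = (\<Sum>h\<in>H. (\<rho> h * M) $$ (i, j)) / of_nat (card H)"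
proof -
  have mm: "(A * B) $$ (i, j) = (\<Sum>l<d. A $$ (i, l) * B $$ (l, j))"
    if "A \<in> carrier_mat d d" "B \<in> carrier_mat d d" for A B :: "complex mat"
    using that ij by (simp add: scalar_prod_def atLeast0LessThan)
  have "(M * average d \<rho> H) $$ (i, j) = (\<Sum>l<d. M $$ (i, l) * ((\<Sum>h\<in>H. \<rho> h $$ (l, j)) / of_nat (card H)))"
    using ij by (simp add: mm M average_def)
  also have "\<dots> = (\<Sum>h\<in>H. \<Sum>l<d. M $$ (i, l) * \<rho> h $$ (l, j)) / of_nat (card H)"
    unfolding times_divide_eq_right sum_distrib_left sum_divide_distrib[symmetric] by (subst sum.swap) (rule refl)
  also have "(\<Sum>h\<in>H. \<Sum>l<d. M $$ (i, l) * \<rho> h $$ (l, j)) = (\<Sum>h\<in>H. (M * \<rho> h) $$ (i, j))"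
    using mm[OF M] subgroup_rep_carrier[OF H] by (intro sum.cong refl) simp
  finally show "(M * average d \<rho> H) $$ (i, j) = (\<Sum>h\<in>H. (M * \<rho> h) $$ (i, j)) / of_nat (card H)" .
  have "(average d \<rho> H * M) $$ (i, j) = (\<Sum>l<d. (\<Sum>h\<in>H. \<rho> h $$ (i, l)) / of_nat (card H) * M $$ (l, j))"
    using ij by (simp add: mm M average_def)
  also have "\<dots> = (\<Sum>h\<in>H. \<Sum>l<d. \<rho> h $$ (i, l) * M $$ (l, j)) / of_nat (card H)"
    unfolding times_divide_eq_left sum_distrib_right sum_divide_distrib[symmetric] by (subst sum.swap) (rule refl)
  also have "(\<Sum>h\<in>H. \<Sum>l<d. \<rho> h $$ (i, l) * M $$ (l, j)) = (\<Sum>h\<in>H. (\<rho> h * M) $$ (i, j))"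
    using mm[OF _ M] subgroup_rep_carrier[OF H] by (intro sum.cong refl) simp
  finally show "(average d \<rho> H * M) $$ (i, j) = (\<Sum>h\<in>H. (\<rho> h * M) $$ (i, j)) / of_nat (card H)" .
qed

lemma card_subgroup_neq_0: "subgroup H G \<Longrightarrow> (of_nat (card H) :: complex) \<noteq> 0"
  using subgroup.subset[of H G] subgroup.one_closed[of H G] finite_subset[OF _ finite_carrier, of H]
  by (auto simp: card_eq_0_iff)

lemma average_absorb:
  assumes H: "subgroup H G" and M: "M \<in> carrier_mat d d"
  shows "(\<And>h. h \<in> H \<Longrightarrow> \<rho> h * M = M) \<Longrightarrow> average d \<rho> H * M = M"
    "(\<And>h. h \<in> H \<Longrightarrow> M * \<rho> h = M) \<Longrightarrow> M * average d \<rho> H = M"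
proof -
  have dim: "dim_row M = d" "dim_col M = d" using M by auto
  show "average d \<rho> H * M = M" if h: "\<And>h. h \<in> H \<Longrightarrow> \<rho> h * M = M"
  proof (rule eq_matI)
    fix i j assume "i < dim_row M" "j < dim_col M"
    then have "(average d \<rho> H * M) $$ (i, j) = (\<Sum>h\<in>H. (\<rho> h * M) $$ (i, j)) / of_nat (card H)"
      unfolding dim by (rule mult_average_index(2)[OF H M])
    then show "(average d \<rho> H * M) $$ (i, j) = M $$ (i, j)" using h card_subgroup_neq_0[OF H] by simp
  qed (simp_all add: dim average_def)
  show "M * average d \<rho> H = M" if h: "\<And>h. h \<in> H \<Longrightarrow> M * \<rho> h = M"
  proof (rule eq_matI)
    fix i j assume "i < dim_row M" "j < dim_col M"
    then have "(M * average d \<rho> H) $$ (i, j) = (\<Sum>h\<in>H. (M * \<rho> h) $$ (i, j)) / of_nat (card H)"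
      unfolding dim by (rule mult_average_index(1)[OF H M])
    then show "(M * average d \<rho> H) $$ (i, j) = M $$ (i, j)" using h card_subgroup_neq_0[OF H] by simp
  qed (simp_all add: dim average_def)
qed

lemma average_invariant:
  assumes K: "subgroup K G" and k: "k \<in> K"
  shows "\<rho> k * average d \<rho> K = average d \<rho> K" "average d \<rho> K * \<rho> k = average d \<rho> K"
proof -
  note M = subgroup_rep_carrier[OF K k]
  have c: "\<And>h. h \<in> K \<Longrightarrow> h \<in> carrier G" using subgroup.subset[OF K] by blast
  have e: "(\<Sum>h\<in>K. (\<rho> k * \<rho> h) $$ (i, j)) = (\<Sum>h\<in>K. \<rho> h $$ (i, j))"
    "(\<Sum>h\<in>K. (\<rho> h * \<rho> k) $$ (i, j)) = (\<Sum>h\<in>K. \<rho> h $$ (i, j))" for i j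
  proof -
    have "(\<Sum>h\<in>K. (\<rho> k * \<rho> h) $$ (i, j)) = (\<Sum>h\<in>K. \<rho> (k \<otimes> h) $$ (i, j))"
      using representationD(2)[OF r] c k by (intro sum.cong refl) simp
    then show "(\<Sum>h\<in>K. (\<rho> k * \<rho> h) $$ (i, j)) = (\<Sum>h\<in>K. \<rho> h $$ (i, j))"
      using sum_subgroup_translate(1)[OF K k, of "\<lambda>h. \<rho> h $$ (i, j)"] by simp
    have "(\<Sum>h\<in>K. (\<rho> h * \<rho> k) $$ (i, j)) = (\<Sum>h\<in>K. \<rho> (h \<otimes> k) $$ (i, j))"
      using representationD(2)[OF r] c k by (intro sum.cong refl) simp
    then show "(\<Sum>h\<in>K. (\<rho> h * \<rho> k) $$ (i, j)) = (\<Sum>h\<in>K. \<rho> h $$ (i, j))"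
      using sum_subgroup_translate(2)[OF K k, of "\<lambda>h. \<rho> h $$ (i, j)"] by simp
  qed
  show "\<rho> k * average d \<rho> K = average d \<rho> K" "average d \<rho> K * \<rho> k = average d \<rho> K"
  proof -
    have d: "dim_row (\<rho> k) = d" "dim_col (\<rho> k) = d" using M by auto
    have "(\<rho> k * average d \<rho> K) $$ (i, j) = average d \<rho> K $$ (i, j)" if "i < d" "j < d" for i j
      unfolding mult_average_index(1)[OF K M that] e using that by (simp add: average_def)
    then show "\<rho> k * average d \<rho> K = average d \<rho> K" using d by (intro eq_matI) (auto simp: average_def)
    have "(average d \<rho> K * \<rho> k) $$ (i, j) = average d \<rho> K $$ (i, j)" if "i < d" "j < d" for i j
      unfolding mult_average_index(2)[OF K M that] e using that by (simp add: average_def)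
    then show "average d \<rho> K * \<rho> k = average d \<rho> K" using d by (intro eq_matI) (auto simp: average_def)
  qed
qed

lemma average_mult:
  assumes H: "subgroup H G" and K: "subgroup K G" and HK: "H \<subseteq> K"
  shows "average d \<rho> H * average d \<rho> K = average d \<rho> K" "average d \<rho> K * average d \<rho> H = average d \<rho> K"
  using average_absorb[OF H average_carrier] average_invariant[OF K] HK by blast+

lemma average_fixes:
  assumes H: "subgroup H G" and v: "v \<in> carrier_vec d"
  shows "average d \<rho> H *\<^sub>v v = v \<longleftrightarrow> (\<forall>h\<in>H. \<rho> h *\<^sub>v v = v)"
proof
  assume e: "average d \<rho> H *\<^sub>v v = v"
  show "\<forall>h\<in>H. \<rho> h *\<^sub>v v = v"
  proof
    fix h assume h: "h \<in> H"
    have "\<rho> h *\<^sub>v v = \<rho> h *\<^sub>v (average d \<rho> H *\<^sub>v v)" unfolding e ..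
    also have "\<dots> = (\<rho> h * average d \<rho> H) *\<^sub>v v"
      using assoc_mult_mat_vec[OF subgroup_rep_carrier[OF H h] average_carrier v] by simp
    also have "\<dots> = v" unfolding average_invariant(1)[OF H h] e ..
    finally show "\<rho> h *\<^sub>v v = v" .
  qed
next
  assume f: "\<forall>h\<in>H. \<rho> h *\<^sub>v v = v"
  have vi: "(A *\<^sub>v v) $ i = (\<Sum>l<d. A $$ (i, l) * v $ l)" if "A \<in> carrier_mat d d" "i < d" for A i
    using that v by (simp add: scalar_prod_def atLeast0LessThan)
  have "(average d \<rho> H *\<^sub>v v) $ i = v $ i" if i: "i < d" for i
  proof -
    have "(average d \<rho> H *\<^sub>v v) $ i = (\<Sum>l<d. (\<Sum>h\<in>H. \<rho> h $$ (i, l)) / of_nat (card H) * v $ l)"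
      unfolding vi[OF average_carrier i] using i by (simp add: average_def)
    also have "\<dots> = (\<Sum>h\<in>H. \<Sum>l<d. \<rho> h $$ (i, l) * v $ l) / of_nat (card H)"
      unfolding times_divide_eq_left sum_distrib_right sum_divide_distrib[symmetric] by (subst sum.swap) (rule refl)
    also have "(\<Sum>h\<in>H. \<Sum>l<d. \<rho> h $$ (i, l) * v $ l) = (\<Sum>h\<in>H. v $ i)"
      using vi[OF subgroup_rep_carrier[OF H] i] f by (intro sum.cong refl) metis
    finally show ?thesis using card_subgroup_neq_0[OF H] by simp
  qed
  then show "average d \<rho> H *\<^sub>v v = v" using v by (intro eq_vecI) (auto simp: average_def)
qed

text \<open>The vectors fixed by \<open>K\<close> are among those fixed by \<open>H\<close>, so the
  difference of the two projections is again idempotent, and \<open>k\<close> is the difference of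
  the dimensions of the fixed spaces.\<close>

lemma average_diff_factor:
  assumes H: "subgroup H G" and K: "subgroup K G" and HK: "H \<subseteq> K"
  obtains k C U where "C \<in> carrier_mat d k" "U \<in> carrier_mat k d" "average d \<rho> H - average d \<rho> K = C * U"
    "(\<Sum>h\<in>H. trace_mat (\<rho> h)) / of_nat (card H) - (\<Sum>h\<in>K. trace_mat (\<rho> h)) / of_nat (card K) = of_nat k"
proof -
  let ?A = "average d \<rho> H" and ?B = "average d \<rho> K"
  have Q: "?A - ?B \<in> carrier_mat d d" by (rule minus_carrier_mat) simp
  have "(?A - ?B) * (?A - ?B) = (?A * ?A - ?A * ?B) - (?B * ?A - ?B * ?B)"
    using minus_mult_distrib_mat[OF average_carrier average_carrier Q, of \<rho> H \<rho> K]
      mult_minus_distrib_mat[OF average_carrier average_carrier average_carrier, of d \<rho> H \<rho> H \<rho> K]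
      mult_minus_distrib_mat[OF average_carrier average_carrier average_carrier, of d \<rho> K \<rho> H \<rho> K] by simp
  also have "\<dots> = (?A - ?B) - (?B - ?B)"
    by (simp only: average_mult[OF H K HK] average_mult[OF H H subset_refl] average_mult[OF K K subset_refl])
  also have "\<dots> = ?A - ?B" by (intro eq_matI) (auto simp: average_def)
  finally obtain k C U where f: "C \<in> carrier_mat d k" "U \<in> carrier_mat k d" "?A - ?B = C * U" "trace_mat (?A - ?B) = of_nat k"
    using idempotent_factor[OF Q] by metis
  moreover have "trace_mat (?A - ?B) = trace_mat ?A - trace_mat ?B" by (rule trace_mat_minus[OF average_carrier average_carrier])
  ultimately show thesis using trace_average[OF H] trace_average[OF K] by (intro that[of C k U]) simp_all
qed

lemma subgroup_trivial: "subgroup {\<one>} G"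
  by (rule subgroupI) auto

lemma average_trivial: "average d \<rho> {\<one>} = 1\<^sub>m d"
  by (intro eq_matI) (auto simp: average_def representationD(3)[OF r])

text \<open>Comparison with the trivial subgroup: \<open>1 - average d \<rho> K\<close> factors
  through as many coordinates as the fixed space has codimension, and these coordinates are the
  functionals.\<close>

lemma fixed_functionals:
  assumes K: "subgroup K G"
  obtains us where "set us \<subseteq> carrier_vec d"
    "of_nat d - (\<Sum>h\<in>K. trace_mat (\<rho> h)) / of_nat (card K) = of_nat (length us)"
    "\<forall>v\<in>carrier_vec d. (\<forall>u\<in>set us. u \<bullet> v = 0) \<longrightarrow> (\<forall>h\<in>K. \<rho> h *\<^sub>v v = v)"
proof -
  have "{\<one>} \<subseteq> K" using subgroup.one_closed[OF K] by simp
  then obtain k C U where f: "C \<in> carrier_mat d k" "U \<in> carrier_mat k d"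
    "average d \<rho> {\<one>} - average d \<rho> K = C * U"
    "(\<Sum>h\<in>{\<one>}. trace_mat (\<rho> h)) / of_nat (card {\<one>}) - (\<Sum>h\<in>K. trace_mat (\<rho> h)) / of_nat (card K) = of_nat k"
    by (rule average_diff_factor[OF subgroup_trivial K])
  let ?E = "average d \<rho> K"
  show thesis
  proof (rule that[of "rows U"])
    show "set (rows U) \<subseteq> carrier_vec d" using f(2) by (auto simp: rows_def)
    show "of_nat d - (\<Sum>h\<in>K. trace_mat (\<rho> h)) / of_nat (card K) = of_nat (length (rows U))"
      using f(2,4) representationD(3)[OF r] by simp
    show "\<forall>v\<in>carrier_vec d. (\<forall>u\<in>set (rows U). u \<bullet> v = 0) \<longrightarrow> (\<forall>h\<in>K. \<rho> h *\<^sub>v v = v)"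
    proof (intro ballI impI)
      fix v h assume v: "v \<in> carrier_vec d" and z: "\<forall>u\<in>set (rows U). u \<bullet> v = 0" and h: "h \<in> K"
      have "U *\<^sub>v v = 0\<^sub>v k" using f(2) z by (intro eq_vecI) (auto simp: rows_def)
      then have "(C * U) *\<^sub>v v = C *\<^sub>v 0\<^sub>v k" using assoc_mult_mat_vec[OF f(1,2) v] by simp
      also have "\<dots> = 0\<^sub>v d" using f(1) by (intro eq_vecI) (auto simp: scalar_prod_def)
      finally have "(C * U) *\<^sub>v v = 0\<^sub>v d" .
      moreover have "(C * U) *\<^sub>v v = v - ?E *\<^sub>v v"
        unfolding f(3)[symmetric] average_trivial using minus_mult_distrib_mat_vec[of "1\<^sub>m d" d d ?E v] v by simp
      ultimately have z: "v - ?E *\<^sub>v v = 0\<^sub>v d" by simp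
      have "(?E *\<^sub>v v) $ i = v $ i" if "i < d" for i
        using arg_cong[OF z, of "\<lambda>w. w $ i"] that v by (simp add: average_def)
      then have "?E *\<^sub>v v = v" using v by (intro eq_vecI) (auto simp: average_def)
      then show "\<rho> h *\<^sub>v v = v" using average_fixes[OF K v] h by blast
    qed
  qed
qed

text \<open>Up to the order of \<open>K\<close> the sum is the trace, hence the rank, of the
  projection onto the fixed vectors; rank 0 would make the projection kill \<open>v\<close>.\<close>

lemma fixed_vector_sum_neq_0:
  assumes K: "subgroup K G" and v: "v \<in> carrier_vec d" "v \<noteq> 0\<^sub>v d" and fix': "\<And>h. h \<in> K \<Longrightarrow> \<rho> h *\<^sub>v v = v"
  shows "(\<Sum>h\<in>K. trace_mat (\<rho> h)) \<noteq> 0"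
proof
  assume z: "(\<Sum>h\<in>K. trace_mat (\<rho> h)) = 0"
  let ?E = "average d \<rho> K"
  obtain k C U where f: "C \<in> carrier_mat d k" "U \<in> carrier_mat k d" "?E = C * U" "trace_mat ?E = of_nat k"
    using idempotent_factor[OF average_carrier average_mult(1)[OF K K subset_refl]] by metis
  have "k = 0" using f(4) trace_average[OF K] z by simp
  have "?E *\<^sub>v v = C *\<^sub>v (U *\<^sub>v v)" unfolding f(3) using assoc_mult_mat_vec[OF f(1,2) v(1)] .
  also have "\<dots> = 0\<^sub>v d" using f(1,2) \<open>k = 0\<close> by (intro eq_vecI) (auto simp: scalar_prod_def)
  finally show False using average_fixes[OF K v(1)] fix' v(2) by auto
qed

end

text \<open>Burnside's count for a single orbit: each point stabilizer has as many elements as the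
  set of group elements carrying \<open>x0\<close> to any given point.\<close>

lemma transitive_fixed_points:
  assumes X: "finite X" and closed: "\<And>g x. g \<in> carrier G \<Longrightarrow> x \<in> X \<Longrightarrow> act g x \<in> X"
    and mult: "\<And>g h x. g \<in> carrier G \<Longrightarrow> h \<in> carrier G \<Longrightarrow> x \<in> X \<Longrightarrow> act (g \<otimes> h) x = act g (act h x)"
    and one: "\<And>x. x \<in> X \<Longrightarrow> act \<one> x = x"
    and x0: "x0 \<in> X" and trans: "\<And>y. y \<in> X \<Longrightarrow> \<exists>g\<in>carrier G. act g x0 = y"
  shows "(\<Sum>g\<in>carrier G. card {x \<in> X. act g x = x}) = Coset.order G"
proof -
  let ?N = "card {g \<in> carrier G. act g x0 = x0}"
  have inv_act: "act (inv a) (act a x) = x" if "a \<in> carrier G" "x \<in> X" for a x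
    using mult[of "inv a" a x] one that by simp
  have to: "card {g \<in> carrier G. act g x0 = y} = ?N" if y: "y \<in> X" for y
  proof -
    obtain a where a: "a \<in> carrier G" "act a x0 = y" using trans[OF y] by blast
    have ia: "act (inv a) y = x0" using inv_act[OF a(1) x0] a(2) by simp
    have "bij_betw (\<lambda>g. inv a \<otimes> g) {g \<in> carrier G. act g x0 = y} {g \<in> carrier G. act g x0 = x0}"
      by (rule bij_betw_byWitness[of _ "\<lambda>g. a \<otimes> g"])
        (use a ia x0 in \<open>auto simp: mult m_assoc[symmetric]\<close>)
    then show ?thesis by (rule bij_betw_same_card)
  qed
  have st: "card {g \<in> carrier G. act g y = y} = ?N" if y: "y \<in> X" for y
  proof -
    obtain a where a: "a \<in> carrier G" "act a x0 = y" using trans[OF y] by blast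
    have ia: "act (inv a) y = x0" using inv_act[OF a(1) x0] a(2) by simp
    have "bij_betw (\<lambda>g. g \<otimes> a) {g \<in> carrier G. act g y = y} {g \<in> carrier G. act g x0 = y}"
      by (rule bij_betw_byWitness[of _ "\<lambda>g. g \<otimes> inv a"])
        (use a ia x0 y in \<open>auto simp: mult m_assoc\<close>)
    then have "card {g \<in> carrier G. act g y = y} = card {g \<in> carrier G. act g x0 = y}" by (rule bij_betw_same_card)
    then show ?thesis using to[OF y] by simp
  qed
  have "(\<Sum>g\<in>carrier G. card {x \<in> X. act g x = x}) = (\<Sum>x\<in>X. card {g \<in> carrier G. act g x = x})"
    using X by (intro sum_multicount_gen) auto
  also have "\<dots> = (\<Sum>x\<in>X. card {g \<in> carrier G. act g x0 = x})" using st to by simp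
  also have "\<dots> = card (carrier G)"
    unfolding card_eq_sum using X closed[OF _ x0] by (intro sum.group) auto
  finally show ?thesis by (simp add: Coset.order_def)
qed

end

section \<open>The natural character of the alternating group\<close>

lemma alt_apply_mem: "g \<in> carrier (alt_group n) \<Longrightarrow> g x \<in> {1..n} \<longleftrightarrow> x \<in> {1..n}"
  by (rule permutes_in_image) (simp only: alt_group_carrier)

lemma evenperm_comp_transpose:
  assumes "permutation h" "a \<noteq> b"
  shows "evenperm (h \<circ> transpose a b) \<longleftrightarrow> \<not> evenperm h"
  using assms by (simp add: evenperm_comp permutation_swap_id evenperm_swap)

text \<open>A permutation with the required values exists in S_n; if it is odd, precomposition with
  the transposition of 3 and 4 makes it even and does not affect the arguments 1 and 2.\<close>

lemma alt_two_transitive: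
  assumes n: "n \<ge> 4" and xy: "x \<in> {1..n}" "y \<in> {1..n}" "x \<noteq> y"
  shows "\<exists>g\<in>carrier (alt_group n). g 1 = x \<and> g 2 = y"
proof -
  \<comment> \<open>The preimage of \<open>y\<close> under the transposition that is applied
    last.\<close>
  define z where "z = transpose 1 x y"
  define h where "h = transpose 1 x \<circ> transpose 2 z"
  have z: "z \<in> {1..n}" "z \<noteq> 1" using xy n by (auto simp: z_def transpose_def)
  have hp: "h permutes {1..n}" unfolding h_def
    using z xy n by (intro permutes_compose permutes_swap_id) auto
  have h: "h 1 = x" "h 2 = y" using z(2) by (simp_all add: h_def z_def)
  show ?thesis
  proof (cases "evenperm h")
    case True
    then show ?thesis using hp h by (auto simp: alt_group_carrier)
  next
    case False
    have "(h \<circ> transpose 3 4) permutes {1..n}" using n hp by (intro permutes_compose permutes_swap_id) auto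
    moreover have "evenperm (h \<circ> transpose 3 4)"
      using False evenperm_comp_transpose[OF permutation_if_permutes[OF hp], of 3 4] by simp
    moreover have "(h \<circ> transpose 3 4) 1 = x" "(h \<circ> transpose 3 4) 2 = y" using h by simp_all
    ultimately show ?thesis by (auto simp: alt_group_carrier intro!: bexI[of _ "h \<circ> transpose 3 4"])
  qed
qed

lemma sum_fixes_count:
  assumes n: "n \<ge> 4"
  shows "(\<Sum>g\<in>carrier (alt_group n). fixes_count n g) = Coset.order (alt_group n)"
  unfolding fixes_count_def
proof (rule A.transitive_fixed_points[of "{1..n}" n "\<lambda>g. g" 1])
  fix y assume y: "y \<in> {1..n}"
  obtain z where "z \<in> {1..n}" "y \<noteq> z"
  proof (cases "y = 1")
    case True then show thesis using n that[of 2] by simp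
  next
    case False then show thesis using n that[of 1] by simp
  qed
  then show "\<exists>g\<in>carrier (alt_group n). g 1 = y" using alt_two_transitive[OF n y] by blast
qed (use n alt_apply_mem in \<open>auto simp: alt_group_one\<close>)

text \<open>The square counts fixed ordered pairs. These pairs form two orbits, the diagonal and, by
  double transitivity, its complement.\<close>

lemma sum_fixes_count_square:
  assumes n: "n \<ge> 4"
  shows "(\<Sum>g\<in>carrier (alt_group n). fixes_count n g * fixes_count n g) = 2 * Coset.order (alt_group n)"
proof -
  let ?P = "{p \<in> {1..n} \<times> {1..n}. fst p \<noteq> snd p}"
  have "(\<Sum>g\<in>carrier (alt_group n). card {p \<in> ?P. map_prod g g p = p}) = Coset.order (alt_group n)"
  proof (rule A.transitive_fixed_points[of ?P n "\<lambda>g. map_prod g g" "(1, 2)"])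
    show "finite ?P" by (rule finite_subset[OF Collect_restrict]) simp
    fix g p assume g: "g \<in> carrier (alt_group n)" and p: "p \<in> ?P"
    have "inj g" using g permutes_inj by (auto simp: alt_group_carrier)
    then show "map_prod g g p \<in> ?P" using p alt_apply_mem[OF g] by (cases p) (auto simp: inj_eq)
  next
    fix p assume p: "p \<in> ?P"
    then show "\<exists>g\<in>carrier (alt_group n). map_prod g g (1, 2) = p"
      using alt_two_transitive[OF n, of "fst p" "snd p"] by (cases p) auto
  qed (use n in \<open>auto simp: alt_group_one map_prod_def split: prod.splits\<close>)
  moreover have "card {p \<in> ?P. map_prod g g p = p} + fixes_count n g = fixes_count n g * fixes_count n g" for g
  proof -
    let ?F = "{x \<in> {1..n}. g x = x}"
    have "?F \<times> ?F = {p \<in> ?P. map_prod g g p = p} \<union> (\<lambda>x. (x, x)) ` ?F" by auto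
    then have "card (?F \<times> ?F) = card {p \<in> ?P. map_prod g g p = p} + card ((\<lambda>x. (x, x)) ` ?F)"
    proof (simp only:, intro card_Un_disjoint)
      show "finite {p \<in> ?P. map_prod g g p = p}"
        by (rule finite_subset[OF subset_trans[OF Collect_restrict Collect_restrict]]) simp
      show "finite ((\<lambda>x. (x, x)) ` ?F)" by (intro finite_imageI finite_subset[OF Collect_restrict]) simp
      show "{p \<in> ?P. map_prod g g p = p} \<inter> (\<lambda>x. (x, x)) ` ?F = {}" by fastforce
    qed
    moreover have "card ((\<lambda>x. (x, x)) ` ?F) = card ?F" by (rule card_image) (simp add: inj_on_def)
    ultimately show ?thesis by (simp add: fixes_count_def card_cartesian_product)
  qed
  then have "(\<Sum>g\<in>carrier (alt_group n). fixes_count n g * fixes_count n g) =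
    (\<Sum>g\<in>carrier (alt_group n). card {p \<in> ?P. map_prod g g p = p}) + (\<Sum>g\<in>carrier (alt_group n). fixes_count n g)"
    unfolding sum.distrib[symmetric] by (intro sum.cong refl) simp
  ultimately show ?thesis using sum_fixes_count[OF n] by simp
qed

definition natural_char :: "nat \<Rightarrow> (nat \<Rightarrow> nat) \<Rightarrow> complex" where
  "natural_char n = restrict (\<lambda>g. of_nat (fixes_count n g) - 1) (carrier (alt_group n))"

lemma fixes_representation:
  obtains d \<rho> where "representation (alt_group n) d \<rho>"
    "\<And>g. g \<in> carrier (alt_group n) \<Longrightarrow> trace_mat (\<rho> g) = of_nat (fixes_count n g)"
  unfolding fixes_count_def
  by (rule A.permutation_representation[of "{1..n}" n "\<lambda>g. g"]) (use alt_apply_mem in \<open>auto simp: alt_group_one\<close>)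

lemma trivial_alt_char: "restrict (\<lambda>_. 1) (carrier (alt_group n)) \<in> irr_chars (alt_group n)"
  by (rule A.linear_character) auto

lemma char_inner_fixes_trivial:
  assumes n: "n \<ge> 4"
  shows "char_inner (alt_group n) (\<lambda>g. of_nat (fixes_count n g)) (\<lambda>_. 1) = 1"
proof -
  have "(\<Sum>g\<in>carrier (alt_group n). of_nat (fixes_count n g)) = (of_nat (Coset.order (alt_group n)) :: complex)"
    unfolding of_nat_sum[symmetric] sum_fixes_count[OF n] ..
  then show ?thesis using A.order_pos[of n] by (simp add: char_inner_def)
qed

text \<open>The two orbit counts give the norm 2 - 2 + 1; the multiplicities stay natural numbers
  because the subtracted trivial character occurs exactly once in the permutation character.\<close>

lemma natural_char_irr:
  assumes n: "n \<ge> 4"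
  shows "natural_char n \<in> irr_chars (alt_group n)"
proof -
  let ?G = "alt_group n" and ?f = "\<lambda>g. of_nat (fixes_count n g) :: complex" and ?triv = "restrict (\<lambda>_. 1 :: complex) (carrier (alt_group n))"
  obtain d \<rho> where r: "representation ?G d \<rho>" and t: "\<And>g. g \<in> carrier ?G \<Longrightarrow> trace_mat (\<rho> g) = ?f g"
    using fixes_representation by metis
  have cf: "A.class_function n (\<lambda>g. ?f g - 1)"
    using A.class_function_rep[OF r] t unfolding A.class_function_def by (metis A.m_closed A.inv_closed)
  have o: "(of_nat (Coset.order ?G) :: complex) \<noteq> 0" using A.order_pos[of n] by simp
  have one: "char_inner ?G (\<lambda>_. 1) \<chi> = (if \<chi> = ?triv then 1 else 0)" if "\<chi> \<in> irr_chars ?G" for \<chi>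
  proof -
    have "char_inner ?G (\<lambda>_. 1) \<chi> = char_inner ?G ?triv \<chi>" by (rule A.char_inner_cong) auto
    then show ?thesis using A.irr_chars_orthonormal[OF trivial_alt_char that] by auto
  qed
  show ?thesis unfolding natural_char_def
  proof (rule A.norm_1_class_function[OF cf])
    fix \<chi> assume chi: "\<chi> \<in> irr_chars ?G"
    have "char_inner ?G (\<lambda>g. trace_mat (\<rho> g)) \<chi> = char_inner ?G ?f \<chi>" by (rule A.char_inner_cong) (auto simp: t)
    then have nat: "char_inner ?G ?f \<chi> \<in> \<nat>" using A.rep_multiplicity[OF r chi] by simp
    have e: "char_inner ?G (\<lambda>g. ?f g - 1) \<chi> = char_inner ?G ?f \<chi> - (if \<chi> = ?triv then 1 else 0)"
      unfolding A.char_inner_diff one[OF chi] ..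
    have "char_inner ?G ?f ?triv = char_inner ?G ?f (\<lambda>_. 1)" by (rule A.char_inner_cong) auto
    then have "char_inner ?G ?f ?triv = 1" using char_inner_fixes_trivial[OF n] by simp
    then show "char_inner ?G (\<lambda>g. ?f g - 1) \<chi> \<in> \<nat>" using nat unfolding e by auto
  next
    have s: "(\<Sum>g\<in>carrier ?G. ?f g) = of_nat (Coset.order ?G)"
      unfolding of_nat_sum[symmetric] sum_fixes_count[OF n] ..
    have s2: "(\<Sum>g\<in>carrier ?G. ?f g * ?f g) = of_nat (2 * Coset.order ?G)"
      unfolding sum_fixes_count_square[OF n, symmetric] by simp
    have "(\<Sum>g\<in>carrier ?G. (?f g - 1) * cnj (?f g - 1))
      = (\<Sum>g\<in>carrier ?G. ?f g * ?f g) - 2 * (\<Sum>g\<in>carrier ?G. ?f g) + (\<Sum>g\<in>carrier ?G. 1)"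
      unfolding sum_distrib_left sum_subtractf[symmetric] sum.distrib[symmetric]
      by (intro sum.cong refl) (simp add: algebra_simps)
    also have "\<dots> = of_nat (Coset.order ?G)" unfolding s s2 by (simp add: Coset.order_def)
    finally show "char_inner ?G (\<lambda>g. ?f g - 1) (\<lambda>g. ?f g - 1) = 1" using o unfolding char_inner_def by simp
  qed
qed

lemma natural_char_eq: "g \<in> carrier (alt_group n) \<Longrightarrow> natural_char n g = of_nat (fixes_count n g) - 1"
  by (simp add: natural_char_def)

lemma fixes_count_id [simp]: "fixes_count n id = n"
  unfolding fixes_count_def id_apply simp_thms Collect_mem_eq by simp

lemma fixes_count_three_cycle:
  assumes "three_cycle n t"
  shows "fixes_count n t = n - 3" "n \<ge> 3"
proof -
  obtain a b c where abc: "{a, b, c} \<subseteq> {1..n}" "a \<noteq> b" "b \<noteq> c" "a \<noteq> c" "t = tri a b c"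
    using assms unfolding three_cycle_def by blast
  have c3: "card {a, b, c} = 3" using abc by simp
  have "{x \<in> {1..n}. t x = x} = {1..n} - {a, b, c}"
  proof (intro equalityI subsetI)
    fix x assume "x \<in> {x \<in> {1..n}. t x = x}"
    then show "x \<in> {1..n} - {a, b, c}" using tri_apply(1-3)[OF abc(2-4)] abc(2-5) by auto
  next
    fix x assume "x \<in> {1..n} - {a, b, c}"
    then show "x \<in> {x \<in> {1..n}. t x = x}" using tri_apply(4)[OF abc(2-4), of x] abc(5) by simp
  qed
  then show "fixes_count n t = n - 3" unfolding fixes_count_def using abc(1) c3 by (simp add: card_Diff_subset)
  show "n \<ge> 3" using card_mono[OF _ abc(1)] c3 by simp
qed

section \<open>Generation by 3-cycles\<close>

lemma tri_inverse:
  assumes "a \<noteq> b" "b \<noteq> c" "a \<noteq> c"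
  shows "tri a c b = tri a b c \<circ> tri a b c" "tri a b c \<circ> tri a c b = id"
proof -
  note d = assms assms[symmetric]
  have "tri a c b x = tri a b c (tri a b c x)" "tri a b c (tri a c b x) = x" for x
    by (cases "x = a"; cases "x = b"; cases "x = c"; simp add: tri_apply d)+
  then show "tri a c b = tri a b c \<circ> tri a b c" "tri a b c \<circ> tri a c b = id" by (simp_all add: fun_eq_iff)
qed

lemma tri_quotient:
  assumes "u \<noteq> w" "u \<noteq> p" "u \<noteq> q" "w \<noteq> p" "w \<noteq> q" "p \<noteq> q"
  shows "tri u p q \<circ> tri w q p = tri w u p" "tri u q p \<circ> tri w p q = tri w u q"
proof -
  note d = assms assms[symmetric]
  have "tri u p q (tri w q p x) = tri w u p x" "tri u q p (tri w p q x) = tri w u q x" for x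
    by (cases "x = u"; cases "x = w"; cases "x = p"; cases "x = q"; simp add: tri_apply d)+
  then show "tri u p q \<circ> tri w q p = tri w u p" "tri u q p \<circ> tri w p q = tri w u q" by (simp_all add: fun_eq_iff)
qed

lemma tri_conj:
  assumes "h permutes S"
  shows "h \<circ> tri a b c \<circ> inv' h = tri (h a) (h b) (h c)"
proof -
  have "h \<circ> transpose x y = transpose (h x) (h y) \<circ> h" for x y
    using permutes_inj[OF assms] by (auto simp: transpose_def fun_eq_iff inj_eq)
  then have "h \<circ> tri a b c = tri (h a) (h b) (h c) \<circ> h" unfolding tri_def by (metis comp_assoc)
  then have "h \<circ> tri a b c \<circ> inv' h = tri (h a) (h b) (h c) \<circ> (h \<circ> inv' h)" by (simp only: comp_assoc)
  then show ?thesis using permutes_inv_o(1)[OF assms] by simp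
qed

lemma tri_in_alt:
  "{a, b, c} \<subseteq> {1..n} \<Longrightarrow> a \<noteq> b \<Longrightarrow> b \<noteq> c \<Longrightarrow> a \<noteq> c \<Longrightarrow> tri a b c \<in> carrier (alt_group n)"
  by (rule three_cycle_carrier) (auto simp: three_cycle_def)

lemma alt_mono: "k \<le> n \<Longrightarrow> carrier (alt_group k) \<subseteq> carrier (alt_group n)"
  using permutes_subset[of _ "{1..k}" "{1..n}"] by (auto simp: alt_group_carrier)

lemma alt_subset_if_three_cycles:
  assumes H: "subgroup H (alt_group n)" and kn: "k \<le> n" and t: "\<And>t. three_cycle k t \<Longrightarrow> t \<in> H"
  shows "carrier (alt_group k) \<subseteq> H"
proof
  fix g assume "g \<in> carrier (alt_group k)"
  then have "g \<in> generate (alt_group k) (three_cycles k)" unfolding alt_group_carrier_as_three_cycles .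
  then show "g \<in> H"
  proof (induction rule: generate.induct)
    case one
    then show ?case using subgroup.one_closed[OF H] unfolding alt_group_one .
  next
    case (incl h)
    then show ?case using t three_cycle_iff by blast
  next
    case (inv h)
    then have h: "h \<in> H" and hk: "h \<in> carrier (alt_group k)" using t three_cycle_iff three_cycle_carrier by blast+
    then have "h \<in> carrier (alt_group n)" using alt_mono[OF kn] by blast
    then have "inv\<^bsub>alt_group n\<^esub> h = inv\<^bsub>alt_group k\<^esub> h" using hk by (simp add: alt_group_inv_equality)
    then show ?case using subgroup.m_inv_closed[OF H h] by simp
  next
    case (eng h1 h2)
    show ?case using subgroup.m_closed[OF H eng.IH] unfolding alt_mult .
  qed
qed

text \<open>With \<open>p = k + 1\<close> and \<open>q = k + 2\<close>, conjugation by \<open>A\<^sub>k\<close> yields all \<open>(u p q)\<close>, and quotients of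
  these yield all \<open>(w u p)\<close> and \<open>(w u q)\<close>.\<close>

lemma alt_generation_step:
  assumes H: "subgroup H (alt_group n)" and k: "k \<ge> 3" "k + 2 \<le> n"
    and A: "carrier (alt_group k) \<subseteq> H" and t: "tri k (k + 1) (k + 2) \<in> H"
  shows "carrier (alt_group (k + 2)) \<subseteq> H"
proof (rule alt_subset_if_three_cycles[OF H k(2)])
  let ?p = "k + 1" and ?q = "k + 2"
  have mult: "x \<circ> y \<in> H" if "x \<in> H" "y \<in> H" for x y using subgroup.m_closed[OF H that] by simp
  have inv: "inv' x \<in> H" if "x \<in> H" for x
  proof -
    have "x \<in> carrier (alt_group n)" using subgroup.subset[OF H] that by blast
    then show ?thesis using subgroup.m_inv_closed[OF H that] by (simp add: alt_group_inv_equality)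
  qed
  have upq: "tri u ?p ?q \<in> H" if u: "u \<in> {1..k}" for u
  proof (cases "u = k")
    case False
    \<comment> \<open>A third point of \<open>{1..k}\<close>, available as \<open>k \<ge> 3\<close>,
      lets the conjugator that carries \<open>k\<close> to \<open>u\<close> be an even
      permutation.\<close>
    obtain x where x: "x \<in> {1..k}" "x \<noteq> u" "x \<noteq> k"
    proof (cases "u = 1")
      case True then show thesis using k that[of 2] by simp
    next
      case False then show thesis using k that[of 1] by simp
    qed
    define s where "s = tri k u x"
    have d: "k \<noteq> u" "u \<noteq> x" "k \<noteq> x" using x False by auto
    have sA: "s \<in> carrier (alt_group k)" unfolding s_def using u x k d by (intro tri_in_alt) auto
    then have sp: "s permutes {1..k}" by (simp add: alt_group_carrier)
    have "s \<circ> tri k ?p ?q \<circ> inv' s \<in> H" using sA A t by (intro mult inv) auto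
    moreover have "s k = u" "s ?p = ?p" "s ?q = ?q"
      using tri_apply(1)[OF d] permutes_not_in[OF sp, of ?p] permutes_not_in[OF sp, of ?q] by (auto simp: s_def)
    ultimately show ?thesis unfolding tri_conj[OF sp] by simp
  qed (use t in simp)
  have uqp: "tri u ?q ?p \<in> H" if u: "u \<in> {1..k}" for u
    using tri_inverse(1)[of u ?p ?q] mult[OF upq[OF u] upq[OF u]] u by simp
  have wu: "tri w u ?p \<in> H" "tri w u ?q \<in> H" if "u \<in> {1..k}" "w \<in> {1..k}" "u \<noteq> w" for u w
    using tri_quotient[of u w ?p ?q] mult[OF upq[of u] uqp[of w]] mult[OF uqp[of u] upq[of w]] that by auto
  have uu: "tri a b c \<in> H" if "{a, b, c} \<subseteq> {1..k}" "a \<noteq> b" "b \<noteq> c" "a \<noteq> c" for a b c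
    using tri_in_alt[OF that] A by blast
  have last: "tri a b c \<in> H"
    if ab: "a \<in> {1..k}" "b \<in> {1..k + 2}" "c \<in> {1..k + 2}" and d: "a \<noteq> b" "b \<noteq> c" "a \<noteq> c" for a b c
  proof -
    have split: "x \<in> {1..k} \<or> x = ?p \<or> x = ?q" if "x \<in> {1..k + 2}" for x using that by auto
    have rot: "tri a b c = tri c a b" using tri_rotate[of c a b] d by simp
    from split[OF ab(2)] split[OF ab(3)] show ?thesis
    proof (elim disjE)
      assume "b \<in> {1..k}" "c \<in> {1..k}" then show ?thesis using uu ab d by simp
    next
      assume "b \<in> {1..k}" "c = ?p" then show ?thesis using wu(1)[of b a] ab d by simp
    next
      assume "b \<in> {1..k}" "c = ?q" then show ?thesis using wu(2)[of b a] ab d by simp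
    next
      assume "b = ?p" "c \<in> {1..k}" then show ?thesis unfolding rot using wu(1)[of a c] ab d by simp
    next
      assume "b = ?q" "c \<in> {1..k}" then show ?thesis unfolding rot using wu(2)[of a c] ab d by simp
    next
      assume "b = ?p" "c = ?q" then show ?thesis using upq ab by simp
    next
      assume "b = ?q" "c = ?p" then show ?thesis using uqp ab by simp
    qed (use d in auto)
  qed
  fix t assume "three_cycle (k + 2) t"
  then obtain a b c where abc: "{a, b, c} \<subseteq> {1..k + 2}" "a \<noteq> b" "b \<noteq> c" "a \<noteq> c" "t = tri a b c"
    unfolding three_cycle_def by blast
  have "a \<in> {1..k} \<or> b \<in> {1..k} \<or> c \<in> {1..k}" using abc(1-4) by auto
  then show "t \<in> H"
  proof (elim disjE)
    assume "a \<in> {1..k}" then show ?thesis unfolding abc(5) using last abc(1-4) by simp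
  next
    assume "b \<in> {1..k}"
    then have "tri b c a \<in> H" using last[of b c a] abc(1-4) by simp
    then show ?thesis unfolding abc(5) using tri_rotate[OF abc(2-4)] by simp
  next
    assume "c \<in> {1..k}"
    then have "tri c a b \<in> H" using last[of c a b] abc(1-4) by simp
    then show ?thesis unfolding abc(5) using tri_rotate[of c a b] abc(2-4) by simp
  qed
qed

section \<open>A vector fixed by a point stabilizer\<close>

lemma alt_subgroup: "k \<le> n \<Longrightarrow> subgroup (carrier (alt_group k)) (alt_group n)"
proof (rule A.subgroupI)
  assume kn: "k \<le> n"
  show "carrier (alt_group k) \<subseteq> carrier (alt_group n)" by (rule alt_mono[OF kn])
  show "carrier (alt_group k) \<noteq> {}" using A.one_closed[of k] by blast
  fix a b assume a: "a \<in> carrier (alt_group k)"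
  show "inv\<^bsub>alt_group n\<^esub> a \<in> carrier (alt_group k)"
    using a alt_mono[OF kn] alt_group_inv_closed[OF a] by (simp add: alt_group_inv_equality subset_iff)
  assume b: "b \<in> carrier (alt_group k)"
  show "a \<otimes>\<^bsub>alt_group n\<^esub> b \<in> carrier (alt_group k)" using A.m_closed[OF a b] by simp
qed

lemma cyclic_3_subgroup:
  assumes t: "tri a b c \<in> carrier (alt_group n)" and d: "a \<noteq> b" "b \<noteq> c" "a \<noteq> c"
  shows "subgroup {id, tri a b c, tri a c b} (alt_group n)" "card {id, tri a b c, tri a c b} = 3"
proof -
  let ?t = "tri a b c" and ?s = "tri a c b"
  have ts: "?t \<circ> ?t = ?s" "?s \<circ> ?s = ?t" "?t \<circ> ?s = id" "?s \<circ> ?t = id"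
    using tri_inverse[of a b c] tri_inverse[of a c b] d by auto
  have s: "?s \<in> carrier (alt_group n)" using A.m_closed[OF t t] ts(1) by simp
  have inv: "inv\<^bsub>alt_group n\<^esub> ?t = ?s" "inv\<^bsub>alt_group n\<^esub> ?s = ?t"
    by (rule A.inv_equality; simp add: s t ts alt_group_one)+
  show "subgroup {id, ?t, ?s} (alt_group n)"
  proof (rule A.subgroupI)
    show "{id, ?t, ?s} \<subseteq> carrier (alt_group n)" using s t A.one_closed[of n] by (simp add: alt_group_one)
    fix x assume "x \<in> {id, ?t, ?s}"
    then show "inv\<^bsub>alt_group n\<^esub> x \<in> {id, ?t, ?s}" using inv A.inv_one[of n] by (auto simp: alt_group_one)
    fix y assume "y \<in> {id, ?t, ?s}"
    then show "x \<otimes>\<^bsub>alt_group n\<^esub> y \<in> {id, ?t, ?s}" using \<open>x \<in> {id, ?t, ?s}\<close> ts by auto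
  qed simp
  have "distinct (map (\<lambda>g. g a) [id, ?t, ?s])"
    using tri_apply(1)[OF d] tri_apply(1)[of a c b] d by simp
  then have "distinct [id, ?t, ?s]" by (simp only: distinct_map)
  then show "card {id, ?t, ?s} = 3" using distinct_card[of "[id, ?t, ?s]"] by (simp only: list.set list.size)
qed

lemma alt_group_3: "carrier (alt_group 3) = {id, tri 1 2 3, tri 1 3 2}"
proof (rule sym, rule card_subset_eq)
  have "tri 1 2 3 \<in> carrier (alt_group 3)" by (rule tri_in_alt) auto
  then have s: "subgroup {id, tri 1 2 3, tri 1 3 2} (alt_group 3)" and c: "card {id, tri 1 2 3, tri 1 3 2} = 3"
    using cyclic_3_subgroup[of 1 2 3 3] by simp_all
  show "{id, tri 1 2 3, tri 1 3 2} \<subseteq> carrier (alt_group 3)" by (rule subgroup.subset[OF s])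
  have "2 * card (carrier (alt_group 3)) = fact 3" by (rule alt_group_card_carrier) simp
  then show "card {id, tri 1 2 3, tri 1 3 2} = card (carrier (alt_group 3))" unfolding c by (simp add: fact_numeral)
qed simp

text \<open>The Klein four-group; \<open>four_cosets\<close> lists the other elements of A_4, the
  eight 3-cycles. Lists make the cardinalities follow from distinctness.\<close>

definition four_group :: "(nat \<Rightarrow> nat) list" where
  "four_group = [id, transpose 1 2 \<circ> transpose 3 4, transpose 1 3 \<circ> transpose 2 4, transpose 1 4 \<circ> transpose 2 3]"

definition four_cosets :: "(nat \<Rightarrow> nat) list" where
  "four_cosets = [tri 1 2 3, tri 1 3 2, tri 1 2 4, tri 1 4 2, tri 1 3 4, tri 1 4 3, tri 2 3 4, tri 2 4 3]"

lemma distinct_four: "distinct (four_group @ four_cosets)"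
proof -
  \<comment> \<open>An even permutation of four points is determined by its values at 1 and
    2.\<close>
  have "distinct (map (\<lambda>g. (g 1, g 2)) (four_group @ four_cosets))"
    by (simp add: four_group_def four_cosets_def tri_def transpose_def)
  then show ?thesis by (simp only: distinct_map)
qed

lemma four_group_even: "set four_group \<subseteq> carrier (alt_group 4)"
proof -
  have "transpose a b \<circ> transpose c d \<in> carrier (alt_group 4)"
    if "{a, b, c, d} \<subseteq> {1..4}" "a \<noteq> b" "c \<noteq> d" for a b c d
  proof -
    have "(transpose a b \<circ> transpose c d) permutes {1..4}"
      using that by (intro permutes_compose permutes_swap_id) auto
    moreover have "evenperm (transpose a b \<circ> transpose c d)"
      using that evenperm_comp_transpose[OF permutation_swap_id, of c d a b] by (simp add: evenperm_swap)
    ultimately show ?thesis by (simp add: alt_group_carrier)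
  qed
  then show ?thesis using A.one_closed[of 4] by (simp add: four_group_def alt_group_one)
qed

lemma alt_group_4: "carrier (alt_group 4) = set (four_group @ four_cosets)"
proof (rule sym, rule card_subset_eq)
  show "set (four_group @ four_cosets) \<subseteq> carrier (alt_group 4)"
    using four_group_even unfolding set_append four_cosets_def by (auto intro!: tri_in_alt)
  have "2 * card (carrier (alt_group 4)) = fact 4" by (rule alt_group_card_carrier) simp
  moreover have "card (set (four_group @ four_cosets)) = 12"
    unfolding distinct_card[OF distinct_four] by (simp add: four_group_def four_cosets_def)
  ultimately show "card (set (four_group @ four_cosets)) = card (carrier (alt_group 4))" by (simp add: fact_numeral)
qed simp

lemma four_group_subgroup:
  assumes n: "n \<ge> 4"
  shows "subgroup (set four_group) (alt_group n)"
proof (rule A.subgroupI)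
  show sub: "set four_group \<subseteq> carrier (alt_group n)" using four_group_even alt_mono[OF n] by blast
  define s1 s2 s3 :: "nat \<Rightarrow> nat" where "s1 = transpose 1 2 \<circ> transpose 3 4"
    and "s2 = transpose 1 3 \<circ> transpose 2 4" and "s3 = transpose 1 4 \<circ> transpose 2 3"
  note s = s1_def s2_def s3_def
  have F: "set four_group = {id, s1, s2, s3}" by (simp add: four_group_def s)
  have p: "s1 \<circ> s1 = id" "s2 \<circ> s2 = id" "s3 \<circ> s3 = id" "s1 \<circ> s2 = s3" "s2 \<circ> s1 = s3"
    "s1 \<circ> s3 = s2" "s3 \<circ> s1 = s2" "s2 \<circ> s3 = s1" "s3 \<circ> s2 = s1"
    by (auto simp: s transpose_def fun_eq_iff)
  have m: "x \<circ> y \<in> set four_group" if "x \<in> set four_group" "y \<in> set four_group" for x y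
    using that p unfolding F by (elim insertE emptyE) simp_all
  have sq: "x \<circ> x = id" if "x \<in> set four_group" for x
    using that p unfolding F by (elim insertE emptyE) simp_all
  fix x assume x: "x \<in> set four_group"
  have "inv\<^bsub>alt_group n\<^esub> x = x"
    by (rule A.inv_equality) (use sub x sq[OF x] in \<open>auto simp: alt_group_one\<close>)
  then show "inv\<^bsub>alt_group n\<^esub> x \<in> set four_group" using x by simp
  fix y assume "y \<in> set four_group"
  then show "x \<otimes>\<^bsub>alt_group n\<^esub> y \<in> set four_group" using m x by simp
qed (simp add: four_group_def)

context
  fixes n d :: nat and \<rho> :: "(nat \<Rightarrow> nat) \<Rightarrow> complex mat"
  assumes n: "n \<ge> 4" and r: "representation (alt_group n) d \<rho>"
    and t: "\<And>t. three_cycle n t \<Longrightarrow> trace_mat (\<rho> t) = of_nat d - 3"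
begin

lemma trace_id: "trace_mat (\<rho> id) = of_nat d"
  using A.representationD(3)[OF r] by (simp add: alt_group_one)

text \<open>The group generated by a 3-cycle has a fixed space of dimension
  \<open>(d + 2 * (d - 3)) / 3 = d - 2\<close>.\<close>

lemma cyclic_3_functionals:
  assumes abc: "{a, b, c} \<subseteq> {1..n}" "a \<noteq> b" "b \<noteq> c" "a \<noteq> c"
  obtains us where "set us \<subseteq> carrier_vec d" "length us = 2"
    "\<forall>v\<in>carrier_vec d. (\<forall>u\<in>set us. u \<bullet> v = 0) \<longrightarrow> (\<forall>h\<in>{id, tri a b c, tri a c b}. \<rho> h *\<^sub>v v = v)"
proof -
  let ?K = "{id, tri a b c, tri a c b}"
  have tc: "three_cycle n (tri a b c)" "three_cycle n (tri a c b)"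
    unfolding three_cycle_def using abc by blast+
  note K = cyclic_3_subgroup[OF three_cycle_carrier[OF tc(1)] abc(2-4)]
  have "(\<Sum>h\<in>?K. trace_mat (\<rho> h)) = 3 * of_nat d - 6"
  proof -
    have "id \<noteq> tri a b c" "id \<noteq> tri a c b" "tri a b c \<noteq> tri a c b"
      using K(2) by (auto simp: card_insert_if split: if_splits)
    then have "(\<Sum>h\<in>?K. trace_mat (\<rho> h)) = trace_mat (\<rho> id) + (trace_mat (\<rho> (tri a b c)) + trace_mat (\<rho> (tri a c b)))"
      by simp
    then show ?thesis by (simp add: trace_id t tc)
  qed
  then have s: "of_nat d - (\<Sum>h\<in>?K. trace_mat (\<rho> h)) / of_nat (card ?K) = 2" unfolding K(2) by (simp add: field_simps)
  obtain us where us: "set us \<subseteq> carrier_vec d"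
    "of_nat d - (\<Sum>h\<in>?K. trace_mat (\<rho> h)) / of_nat (card ?K) = of_nat (length us)"
    "\<forall>v\<in>carrier_vec d. (\<forall>u\<in>set us. u \<bullet> v = 0) \<longrightarrow> (\<forall>h\<in>?K. \<rho> h *\<^sub>v v = v)"
    by (rule A.fixed_functionals[OF r K(1)]) (rule that)
  have "of_nat (length us) = (of_nat 2 :: complex)" using us(2) unfolding s by simp
  then have "length us = 2" by (simp only: of_nat_eq_iff)
  then show thesis using us(1,3) by (intro that[of us])
qed

text \<open>The character sum \<open>S\<close> over the four-group is unknown. It cancels when the
  codimension of the space fixed by A_4, \<open>length us\<close>, is combined with the dimension
  \<open>k\<close> by which the space fixed by the four-group is larger:
  \<open>2 * length us + k = 6\<close>. Since \<open>k\<close> is a natural number, three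
  functionals suffice.\<close>

lemma alt_4_functionals:
  obtains us where "set us \<subseteq> carrier_vec d" "length us \<le> 3"
    "\<forall>v\<in>carrier_vec d. (\<forall>u\<in>set us. u \<bullet> v = 0) \<longrightarrow> (\<forall>h\<in>carrier (alt_group 4). \<rho> h *\<^sub>v v = v)"
proof -
  let ?H = "set four_group" and ?K = "carrier (alt_group 4)"
  define S where "S = (\<Sum>h\<in>?H. trace_mat (\<rho> h))"
  have cH: "card ?H = 4" and cC: "card (set four_cosets) = 8"
    using distinct_four distinct_card[of four_group] distinct_card[of four_cosets]
    by (simp_all add: four_group_def four_cosets_def)
  have disj: "?H \<inter> set four_cosets = {}" using distinct_four by (simp only: distinct_append)
  have cK: "card ?K = 12" unfolding alt_group_4 set_append using cH cC disj by (subst card_Un_disjoint) simp_all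
  have "three_cycle n h" if "h \<in> set four_cosets" for h
  proof -
    have "three_cycle n (tri a b c)" if "a \<le> 4" "b \<le> 4" "c \<le> 4" "a > 0" "b > 0" "c > 0" "a \<noteq> b" "b \<noteq> c" "a \<noteq> c" for a b c
      unfolding three_cycle_def using that n by (intro exI[of _ a] exI[of _ b] exI[of _ c]) auto
    then show ?thesis using that by (auto simp: four_cosets_def)
  qed
  then have "(\<Sum>h\<in>set four_cosets. trace_mat (\<rho> h)) = (\<Sum>h\<in>set four_cosets. of_nat d - 3)"
    by (intro sum.cong refl t)
  then have C: "(\<Sum>h\<in>set four_cosets. trace_mat (\<rho> h)) = 8 * (of_nat d - 3)" by (simp add: cC)
  have sK: "(\<Sum>h\<in>?K. trace_mat (\<rho> h)) = S + 8 * (of_nat d - 3)"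
    unfolding alt_group_4 set_append S_def C[symmetric] by (rule sum.union_disjoint[OF _ _ disj]) simp_all
  have HK: "?H \<subseteq> ?K" unfolding alt_group_4 by simp
  obtain k C' U where "of_nat k = S / of_nat (card ?H) - (\<Sum>h\<in>?K. trace_mat (\<rho> h)) / of_nat (card ?K)"
    using A.average_diff_factor[OF r four_group_subgroup[OF n] alt_subgroup[OF n] HK] unfolding S_def by metis
  then have k: "of_nat k = S / 4 - (S + 8 * (of_nat d - 3)) / 12" unfolding sK cH cK by simp
  obtain us where us: "set us \<subseteq> carrier_vec d"
    "of_nat d - (\<Sum>h\<in>?K. trace_mat (\<rho> h)) / of_nat (card ?K) = of_nat (length us)"
    "\<forall>v\<in>carrier_vec d. (\<forall>u\<in>set us. u \<bullet> v = 0) \<longrightarrow> (\<forall>h\<in>?K. \<rho> h *\<^sub>v v = v)"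
    by (rule A.fixed_functionals[OF r alt_subgroup[OF n]]) (rule that)
  have "of_nat (length us) = of_nat d - (S + 8 * (of_nat d - 3)) / 12" using us(2) unfolding sK cK by simp
  then have e: "S + 12 * of_nat (length us) = 24 + 4 * of_nat d" by (simp add: field_simps)
  have "2 * of_nat (length us) + of_nat k = (6 :: complex)"
    unfolding k using arg_cong[OF e, of "\<lambda>x. 2 * x"] by (simp add: field_simps)
  then have "of_nat (2 * length us + k) = (of_nat 6 :: complex)" by simp
  then have "2 * length us + k = 6" by (simp only: of_nat_eq_iff)
  then show thesis using us(1,3) by (intro that[of us]) simp_all
qed

text \<open>\<open>A\<^sub>k\<close> is generated by \<open>A\<^sub>3\<close> or \<open>A\<^sub>4\<close> and further 3-cycles that bring in two points each,
  at the cost of two functionals.\<close>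

lemma alt_functionals:
  "3 \<le> k \<Longrightarrow> k \<le> n \<Longrightarrow> \<exists>us. set us \<subseteq> carrier_vec d \<and> length us < k \<and>
    (\<forall>v\<in>carrier_vec d. (\<forall>u\<in>set us. u \<bullet> v = 0) \<longrightarrow> (\<forall>h\<in>carrier (alt_group k). \<rho> h *\<^sub>v v = v))"
proof (induction k rule: less_induct)
  case (less k)
  consider "k = 3" | "k = 4" | "k \<ge> 5" using less.prems by linarith
  then show ?case
  proof cases
    case 1
    have "{1, 2, 3} \<subseteq> {1..n}" using n by simp
    then obtain us where "set us \<subseteq> carrier_vec d" "length us = 2"
      "\<forall>v\<in>carrier_vec d. (\<forall>u\<in>set us. u \<bullet> v = 0) \<longrightarrow> (\<forall>h\<in>{id, tri 1 2 3, tri 1 3 2}. \<rho> h *\<^sub>v v = v)"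
      by (rule cyclic_3_functionals) simp_all
    then show ?thesis unfolding 1 alt_group_3 by (intro exI[of _ us] conjI) simp_all
  next
    case 2
    obtain us where "set us \<subseteq> carrier_vec d" "length us \<le> 3"
      "\<forall>v\<in>carrier_vec d. (\<forall>u\<in>set us. u \<bullet> v = 0) \<longrightarrow> (\<forall>h\<in>carrier (alt_group 4). \<rho> h *\<^sub>v v = v)"
      by (rule alt_4_functionals)
    then show ?thesis unfolding 2 by (intro exI[of _ us] conjI) simp_all
  next
    case 3
    define j where "j = k - 2"
    have j: "j < k" "3 \<le> j" "j + 2 \<le> n" "k = j + 2" using 3 less.prems by (auto simp: j_def)
    obtain us where us: "set us \<subseteq> carrier_vec d" "length us < j"
      "\<forall>v\<in>carrier_vec d. (\<forall>u\<in>set us. u \<bullet> v = 0) \<longrightarrow> (\<forall>h\<in>carrier (alt_group j). \<rho> h *\<^sub>v v = v)"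
      using less.IH[OF j(1,2)] j(3) by auto
    have "{j, j + 1, j + 2} \<subseteq> {1..n}" using j by simp
    then obtain ws where ws: "set ws \<subseteq> carrier_vec d" "length ws = 2"
      "\<forall>v\<in>carrier_vec d. (\<forall>u\<in>set ws. u \<bullet> v = 0) \<longrightarrow> (\<forall>h\<in>{id, tri j (j + 1) (j + 2), tri j (j + 2) (j + 1)}. \<rho> h *\<^sub>v v = v)"
      by (rule cyclic_3_functionals) simp_all
    show ?thesis
    proof (intro exI[of _ "us @ ws"] conjI ballI impI)
      show "set (us @ ws) \<subseteq> carrier_vec d" "length (us @ ws) < k" using us(1,2) ws(1,2) j(4) by simp_all
      fix v h assume v: "v \<in> carrier_vec d" and z: "\<forall>u\<in>set (us @ ws). u \<bullet> v = 0" and h: "h \<in> carrier (alt_group k)"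
      \<comment> \<open>The permutations fixing \<open>v\<close> form a subgroup; it contains A_j
        and a 3-cycle that meets \<open>{1..j}\<close> in the single point \<open>j\<close>, hence
        A_(j+2).\<close>
      let ?F = "{h \<in> carrier (alt_group n). \<rho> h *\<^sub>v v = v}"
      have Fc: "?F \<subseteq> carrier (alt_group n)" by (rule Collect_restrict)
      have F: "subgroup ?F (alt_group n)"
      proof (rule A.subgroupI[OF Fc])
        have "\<rho> \<one>\<^bsub>alt_group n\<^esub> *\<^sub>v v = v" unfolding A.representationD(3)[OF r] using v by (rule one_mult_mat_vec)
        then have "\<one>\<^bsub>alt_group n\<^esub> \<in> ?F" using A.one_closed[of n] by simp
        then show "?F \<noteq> {}" by blast
        fix a assume a: "a \<in> ?F"
        then have ac: "a \<in> carrier (alt_group n)" and av: "\<rho> a *\<^sub>v v = v" by auto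
        have ic: "inv\<^bsub>alt_group n\<^esub> a \<in> carrier (alt_group n)" using ac by (rule A.inv_closed)
        have "\<rho> (inv\<^bsub>alt_group n\<^esub> a) *\<^sub>v v = \<rho> (inv\<^bsub>alt_group n\<^esub> a) *\<^sub>v (\<rho> a *\<^sub>v v)" unfolding av ..
        also have "\<dots> = (\<rho> (inv\<^bsub>alt_group n\<^esub> a) * \<rho> a) *\<^sub>v v"
          using assoc_mult_mat_vec[OF A.representationD(1)[OF r ic] A.representationD(1)[OF r ac] v] by simp
        also have "\<rho> (inv\<^bsub>alt_group n\<^esub> a) * \<rho> a = 1\<^sub>m d"
          unfolding A.representationD(2)[OF r ic ac, symmetric] A.l_inv[OF ac] A.representationD(3)[OF r] ..
        also have "1\<^sub>m d *\<^sub>v v = v" using v by (rule one_mult_mat_vec)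
        finally show "inv\<^bsub>alt_group n\<^esub> a \<in> ?F" using ic by simp
        fix b assume b: "b \<in> ?F"
        then have bc: "b \<in> carrier (alt_group n)" and bv: "\<rho> b *\<^sub>v v = v" by auto
        have "\<rho> (a \<otimes>\<^bsub>alt_group n\<^esub> b) *\<^sub>v v = \<rho> a *\<^sub>v (\<rho> b *\<^sub>v v)"
          unfolding A.representationD(2)[OF r ac bc]
          using assoc_mult_mat_vec[OF A.representationD(1)[OF r ac] A.representationD(1)[OF r bc] v] .
        then show "a \<otimes>\<^bsub>alt_group n\<^esub> b \<in> ?F" using A.m_closed[OF ac bc] av bv by simp
      qed
      have "carrier (alt_group j) \<subseteq> ?F"
        using us(3) v z alt_mono[of j n] j(3) by fastforce
      moreover have "tri j (j + 1) (j + 2) \<in> ?F"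
        using ws(3) v z j by (auto intro: tri_in_alt)
      ultimately have "carrier (alt_group (j + 2)) \<subseteq> ?F" by (rule alt_generation_step[OF F j(2,3)])
      then show "\<rho> h *\<^sub>v v = v" using h j(4) by blast
    qed
  qed
qed

text \<open>At most n - 2 linear conditions in dimension n - 1 have a nonzero common solution, and
  this vector is fixed by A_(n-1).\<close>

lemma stabilizer_sum_neq_0:
  assumes d: "d = n - 1"
  shows "(\<Sum>h\<in>carrier (alt_group (n - 1)). trace_mat (\<rho> h)) \<noteq> 0"
proof -
  obtain us where us: "set us \<subseteq> carrier_vec d" "length us < n - 1"
    "\<forall>v\<in>carrier_vec d. (\<forall>u\<in>set us. u \<bullet> v = 0) \<longrightarrow> (\<forall>h\<in>carrier (alt_group (n - 1)). \<rho> h *\<^sub>v v = v)"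
  proof -
    have "3 \<le> n - 1" "n - 1 \<le> n" using n by linarith+
    then show thesis using alt_functionals[of "n - 1"] that by blast
  qed
  have "mat_of_rows d us \<in> carrier_mat (length us) d" by simp
  then obtain v where v: "v \<in> carrier_vec d" "v \<noteq> 0\<^sub>v d" "mat_of_rows d us *\<^sub>v v = 0\<^sub>v (length us)"
    using wide_matrix_kernel us(2) d by blast
  have "u \<bullet> v = 0" if u: "u \<in> set us" for u
  proof -
    obtain i where i: "i < length us" "u = us ! i" using u by (metis in_set_conv_nth)
    have "(mat_of_rows d us *\<^sub>v v) $ i = u \<bullet> v" using i us(1) by (simp add: subset_iff)
    then show ?thesis unfolding v(3) using i(1) by simp
  qed
  then have "\<rho> h *\<^sub>v v = v" if "h \<in> carrier (alt_group (n - 1))" for h using us(3) v(1) that by blast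
  then show ?thesis by (rule A.fixed_vector_sum_neq_0[OF r alt_subgroup[OF diff_le_self] v(1,2)])
qed

text \<open>Distributed over the points, the sum consists of character sums over point stabilizers.
  Each is a natural number, being a multiplicity times a group order, so the nonzero contribution of
  the point \<open>n\<close> cannot cancel.\<close>

lemma sum_fixes_neq_0:
  assumes d: "d = n - 1"
  shows "(\<Sum>g\<in>carrier (alt_group n). trace_mat (\<rho> g) * of_nat (fixes_count n g)) \<noteq> 0"
proof -
  let ?S = "\<lambda>x. {g \<in> carrier (alt_group n). g x = x}"
  have sub: "subgroup (?S x) (alt_group n)" for x
  proof (rule A.subgroupI)
    show "?S x \<noteq> {}" using A.one_closed[of n] by (auto simp: alt_group_one)
    fix a assume a: "a \<in> ?S x"
    then have "inv' a x = x" using permutes_inverses(2)[of a "{1..n}" x] by (simp add: alt_group_carrier)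
    then show "inv\<^bsub>alt_group n\<^esub> a \<in> ?S x" using a alt_group_inv_closed[of a n] by (simp add: alt_group_inv_equality)
    fix b assume "b \<in> ?S x"
    then show "a \<otimes>\<^bsub>alt_group n\<^esub> b \<in> ?S x" using a A.m_closed[of a n b] by simp
  qed (rule Collect_restrict)
  have "\<exists>m. (\<Sum>g\<in>?S x. trace_mat (\<rho> g)) = of_nat m" for x
  proof -
    have "(\<Sum>g\<in>?S x. trace_mat (\<rho> g) * cnj 1) / of_nat (card (?S x)) \<in> \<nat>"
      by (rule A.subgroup_multiplicity[OF sub r]) simp_all
    then obtain q where q: "(\<Sum>g\<in>?S x. trace_mat (\<rho> g)) / of_nat (card (?S x)) = of_nat q" by (auto elim: Nats_cases)
    have "(\<Sum>g\<in>?S x. trace_mat (\<rho> g)) = of_nat (q * card (?S x))"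
      using q A.card_subgroup_neq_0[OF r sub[of x]] by (simp add: field_simps)
    then show ?thesis by blast
  qed
  then obtain m where m: "\<And>x. (\<Sum>g\<in>?S x. trace_mat (\<rho> g)) = of_nat (m x)" by metis
  have st: "?S n = carrier (alt_group (n - 1))"
  proof (intro equalityI subsetI)
    fix g assume g: "g \<in> ?S n"
    then have p: "g permutes {1..n}" by (simp add: alt_group_carrier)
    have "g permutes {1..n - 1}"
    proof (rule permutes_superset[OF p])
      fix x assume "x \<in> {1..n} - {1..n - 1}"
      then have "x = n" by auto
      then show "g x = x" using g by simp
    qed
    then show "g \<in> carrier (alt_group (n - 1))" using g by (simp add: alt_group_carrier)
  next
    fix g assume g: "g \<in> carrier (alt_group (n - 1))"
    then have "g n = n" using permutes_not_in[of g "{1..n - 1}" n] n by (simp add: alt_group_carrier)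
    then show "g \<in> ?S n" using g alt_mono[of "n - 1" n] by auto
  qed
  have "m n \<noteq> 0" using stabilizer_sum_neq_0[OF d] m[of n] unfolding st by auto
  then have pos: "(\<Sum>x\<in>{1..n}. m x) \<noteq> 0" using n by auto
  have "(\<Sum>g\<in>carrier (alt_group n). trace_mat (\<rho> g) * of_nat (fixes_count n g))
    = (\<Sum>g\<in>carrier (alt_group n). \<Sum>x\<in>{1..n}. if g x = x then trace_mat (\<rho> g) else 0)"
    unfolding fixes_count_def by (intro sum.cong refl) (simp add: sum.If_cases Int_def mult.commute)
  also have "\<dots> = (\<Sum>x\<in>{1..n}. \<Sum>g\<in>carrier (alt_group n). if g x = x then trace_mat (\<rho> g) else 0)"
    by (rule sum.swap)
  also have "\<dots> = (\<Sum>x\<in>{1..n}. of_nat (m x))"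
    unfolding m[symmetric] by (intro sum.cong refl sum.inter_filter[symmetric]) simp
  also have "\<dots> = of_nat (\<Sum>x\<in>{1..n}. m x)" by simp
  finally have e: "(\<Sum>g\<in>carrier (alt_group n). trace_mat (\<rho> g) * of_nat (fixes_count n g)) = of_nat (\<Sum>x\<in>{1..n}. m x)" .
  show ?thesis unfolding e of_nat_eq_0_iff by (rule pos)
qed

end

text \<open>Otherwise \<open>\<psi>\<close> is orthogonal to the trivial and to the natural
  character, hence to the permutation character, contrary to \<open>sum_fixes_neq_0\<close>.\<close>

lemma natural_char_unique:
  assumes n: "n \<ge> 4" and psi: "\<psi> \<in> irr_chars (alt_group n)" and deg: "\<psi> id = of_nat (n - 1)"
    and t: "\<And>t. three_cycle n t \<Longrightarrow> \<psi> t = of_nat (n - 1) - 3"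
  shows "\<psi> = natural_char n"
proof (rule ccontr)
  assume ne: "\<psi> \<noteq> natural_char n"
  let ?G = "alt_group n" and ?triv = "restrict (\<lambda>_. 1 :: complex) (carrier (alt_group n))"
  obtain d \<rho> where r: "representation ?G d \<rho>" and tr: "\<And>g. g \<in> carrier ?G \<Longrightarrow> \<psi> g = trace_mat (\<rho> g)"
    by (rule A.irr_charE[OF psi]) (rule that)
  have idc: "id \<in> carrier ?G" using A.one_closed[of n] by (simp only: alt_group_one)
  have "of_nat d = (of_nat (n - 1) :: complex)" using tr[OF idc] deg A.representationD(3)[OF r] by (simp add: alt_group_one)
  then have d: "d = n - 1" by (simp only: of_nat_eq_iff)
  have "\<psi> \<noteq> ?triv"
  proof
    assume "\<psi> = ?triv"
    then have "of_nat (n - 1) = (of_nat 1 :: complex)" using deg idc by simp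
    then have "n - 1 = 1" by (simp only: of_nat_eq_iff)
    then show False using n by simp
  qed
  then have "char_inner ?G \<psi> ?triv = 0" using A.irr_chars_orthonormal[OF psi trivial_alt_char] by simp
  then have 1: "(\<Sum>g\<in>carrier ?G. \<psi> g * cnj (?triv g)) = 0" using A.order_pos[of n] by (simp add: char_inner_def)
  have "char_inner ?G \<psi> (natural_char n) = 0"
    using A.irr_chars_orthonormal[OF psi natural_char_irr[OF n]] ne by simp
  then have 2: "(\<Sum>g\<in>carrier ?G. \<psi> g * cnj (natural_char n g)) = 0" using A.order_pos[of n] by (simp add: char_inner_def)
  have "(\<Sum>g\<in>carrier ?G. trace_mat (\<rho> g) * of_nat (fixes_count n g))
      = (\<Sum>g\<in>carrier ?G. \<psi> g * cnj (natural_char n g)) + (\<Sum>g\<in>carrier ?G. \<psi> g * cnj (?triv g))"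
    unfolding sum.distrib[symmetric] by (intro sum.cong refl) (simp add: natural_char_eq tr algebra_simps)
  then have "(\<Sum>g\<in>carrier ?G. trace_mat (\<rho> g) * of_nat (fixes_count n g)) = 0" using 1 2 by simp
  moreover have "(\<Sum>g\<in>carrier ?G. trace_mat (\<rho> g) * of_nat (fixes_count n g)) \<noteq> 0"
    using t tr three_cycle_carrier d by (intro sum_fixes_neq_0[OF n r]) auto
  ultimately show False by simp
qed

section \<open>3-cycles and fixed points are determined by the table\<close>

lemma card_moved: "card {x \<in> {1..n}. g x \<noteq> x} + fixes_count n g = n"
proof -
  have "card ({x \<in> {1..n}. g x \<noteq> x} \<union> {x \<in> {1..n}. g x = x}) =
      card {x \<in> {1..n}. g x \<noteq> x} + card {x \<in> {1..n}. g x = x}"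
    by (intro card_Un_disjoint) auto
  moreover have "{x \<in> {1..n}. g x \<noteq> x} \<union> {x \<in> {1..n}. g x = x} = {1..n}" by blast
  ultimately show ?thesis by (simp add: fixes_count_def)
qed

lemma three_cycle_if_moved_3:
  assumes g: "g permutes {1..n}" and m: "card {x \<in> {1..n}. g x \<noteq> x} = 3"
  shows "three_cycle n g"
proof -
  let ?M = "{x \<in> {1..n}. g x \<noteq> x}"
  obtain a b c where M: "?M = {a, b, c}" and d: "a \<noteq> b" "b \<noteq> c" "a \<noteq> c"
    using m unfolding card_3_iff by metis
  have inj: "g x = g y \<longleftrightarrow> x = y" for x y using permutes_inj[OF g] by (simp add: inj_eq)
  have to: "g x \<in> {a, b, c}" "g x \<noteq> x" if "x \<in> {a, b, c}" for x
  proof -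
    have x: "x \<in> ?M" using that M by simp
    then show "g x \<noteq> x" by simp
    have "g x \<in> {1..n}" using x permutes_in_image[OF g] by blast
    moreover have "g (g x) \<noteq> g x" using x inj by simp
    ultimately have "g x \<in> ?M" by simp
    then show "g x \<in> {a, b, c}" unfolding M .
  qed
  have out: "g x = x" if "x \<notin> {a, b, c}" for x
  proof (cases "x \<in> {1..n}")
    case True
    then show ?thesis using that M by blast
  qed (rule permutes_not_in[OF g])
  have sub: "{a, b, c} \<subseteq> {1..n}" unfolding M[symmetric] by (rule Collect_restrict)
  have three: "three_cycle n g" if d: "a \<noteq> b" "b \<noteq> c" "a \<noteq> c" and sub: "{a, b, c} \<subseteq> {1..n}"
    and e: "g a = b" "g b = c" "g c = a" and out: "\<And>x. x \<notin> {a, b, c} \<Longrightarrow> g x = x" for a b c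
  proof -
    have "g x = tri a b c x" for x
    proof (cases "x \<in> {a, b, c}")
      case True
      then show ?thesis using e tri_apply(1-3)[OF d] by auto
    next
      case False
      then show ?thesis using out tri_apply(4)[OF d, of x] by simp
    qed
    then have "g = tri a b c" by (rule ext)
    then show ?thesis using d sub unfolding three_cycle_def by blast
  qed
  have ga: "g a = b \<or> g a = c" and gb: "g b = a \<or> g b = c" and gc: "g c = a \<or> g c = b"
    using to[of a] to[of b] to[of c] by auto
  show ?thesis
  proof (cases "g a = b")
    case True
    then have "g c = a" "g b = c" using ga gb gc inj d by metis+
    then show ?thesis using three[OF d sub True] out by blast
  next
    case False
    then have e: "g a = c" "g c = b" "g b = a" using ga gb gc inj d by metis+
    have d': "a \<noteq> c" "c \<noteq> b" "a \<noteq> b" using d by auto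
    have s': "{a, c, b} \<subseteq> {1..n}" using sub by blast
    show ?thesis using three[OF d' s' e] out by blast
  qed
qed

context alt_table
begin

lemma natural_index:
  assumes "n \<ge> 4"
  obtains i where "i \<in> I" "r i = natural_char n"
proof -
  have "natural_char n \<in> r ` I" using bij_betw_imp_surj_on[OF r] natural_char_irr[OF assms] by simp
  then show thesis by (rule imageE) (rule that, simp_all)
qed

lemma alt_swap: "alt_table n I J r' r c' c"
  by (rule alt_table.intro) (rule swap)

lemma id_carrier: "id \<in> carrier (alt_group n)"
  using one_closed by (simp only: alt_group_one)

lemma rel_id_iff:
  assumes "rel x y"
  shows "x = id \<longleftrightarrow> y = id"
proof
  show "y = id" if "x = id" using rel_one[of y] assms that unfolding alt_group_one by simp
  show "x = id" if "y = id"
    using table_symmetry.rel_one[OF swap, of x] assms that rel_swap unfolding alt_group_one by simp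
qed

lemma rel_three_cycle_imp:
  assumes n: "n \<ge> 4" "n \<noteq> 6" and rel: "rel t t'" and t: "three_cycle n t"
  shows "three_cycle n t'"
proof -
  let ?G = "alt_group n" and ?f = "fixes_count n t'" and ?m = "card {x \<in> {1..n}. t' x \<noteq> x}"
  have tc: "t \<in> carrier ?G" and t'c: "t' \<in> carrier ?G" using rel_carrier[OF rel] by auto
  have p': "t' permutes {1..n}" using t'c by (simp add: alt_group_carrier)
  have mf: "?m + ?f = n" by (rule card_moved)
  obtain a b e where abc: "{a, b, e} \<subseteq> {1..n}" "a \<noteq> b" "b \<noteq> e" "a \<noteq> e" "t = tri a b e"
    using t unfolding three_cycle_def by blast
  \<comment> \<open>The trivial character has multiplicity \<open>(n - 1 + 2 * (?f - 1)) / 3\<close>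
    in the restriction of \<open>r i\<close> to the group generated by \<open>t\<close>. So 3
    divides \<open>n + 2 * ?f\<close>, which is congruent to \<open>?m = n - ?f\<close>.\<close>
  have dvd: "3 dvd ?m"
  proof -
    obtain i where i: "i \<in> I" "r' i = natural_char n" using alt_table.natural_index[OF alt_swap n(1)] by blast
    have chi: "r i \<in> irr_chars ?G" using i(1) bij_betwE[OF r] by blast
    obtain d \<rho> where rho: "representation ?G d \<rho>" and tr: "\<And>g. g \<in> carrier ?G \<Longrightarrow> r i g = trace_mat (\<rho> g)"
      by (rule irr_charE[OF chi]) (rule that)
    let ?s = "tri a e b"
    note K = cyclic_3_subgroup[OF tc[unfolded abc(5)] abc(2-4)]
    have inv: "inv\<^bsub>?G\<^esub> t = ?s"
      unfolding abc(5) by (rule inv_equality)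
        (use tri_inverse(2)[of a e b] abc(2-4) subgroup.subset[OF K(1)] in \<open>auto simp: alt_group_one\<close>)
    have vt: "r i t = of_nat ?f - 1" using rel_value[OF rel i(1)] t'c unfolding i(2) by (simp add: natural_char_eq)
    have vs: "r i ?s = of_nat ?f - 1" using irr_char_inv[OF chi tc] unfolding inv vt by simp
    have v1: "r i id = of_nat n - 1"
      using degree_eq[OF i(1)] id_carrier unfolding i(2) alt_group_one by (simp add: natural_char_eq)
    have sc: "?s \<in> carrier ?G" using subgroup.subset[OF K(1)] by blast
    have ne: "id \<noteq> t" "id \<noteq> ?s" "t \<noteq> ?s"
      using K(2) unfolding abc(5) by (auto simp: card_insert_if split: if_splits)
    have "(\<Sum>h\<in>{id, t, ?s}. trace_mat (\<rho> h) * cnj 1) / of_nat (card {id, t, ?s}) \<in> \<nat>"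
      unfolding abc(5) by (rule subgroup_multiplicity[OF K(1) rho]) simp_all
    moreover have "(\<Sum>h\<in>{id, t, ?s}. trace_mat (\<rho> h) * cnj 1) = r i id + r i t + r i ?s"
      using ne tr id_carrier tc sc by simp
    moreover have "card {id, t, ?s} = 3" unfolding abc(5) by (rule K(2))
    ultimately have "(r i id + r i t + r i ?s) / 3 \<in> \<nat>" by simp
    then have "(of_nat n - 1 + (of_nat ?f - 1) + (of_nat ?f - 1)) / (3 :: complex) \<in> \<nat>" unfolding v1 vt vs .
    then obtain q where "(of_nat n - 1 + (of_nat ?f - 1) + (of_nat ?f - 1)) / (3 :: complex) = of_nat q"
      by (auto elim: Nats_cases)
    then have "of_nat (n + 2 * ?f) = (of_nat (3 * q + 3) :: complex)" by (simp add: field_simps)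
    then have "n + 2 * ?f = 3 * q + 3" by (simp only: of_nat_eq_iff)
    then show ?thesis using mf by presburger
  qed
  have "?m \<noteq> 0"
  proof
    assume "?m = 0"
    then have "{x \<in> {1..n}. t' x \<noteq> x} = {}" by simp
    then have "t' x = x" for x using permutes_not_in[OF p', of x] by blast
    then have "t' = id" by auto
    then have "t = id" using rel_id_iff[OF rel] by simp
    then show False using tri_apply(1)[OF abc(2-4)] abc by simp
  qed
  moreover have False if "?m \<ge> 6"
  proof -
    have n7: "n \<ge> 7" using that mf n(2) by linarith
    have m: "?m = 6 \<or> ?m \<ge> 9" using that dvd by presburger
    \<comment> \<open>Without a cycle of length at least 3, \<open>t'\<close> would be an
      involution, and the trivial character would have multiplicity \<open>(2 * n - 5) / 2\<close>
      in the restriction of \<open>r' i\<close> to the group generated by \<open>t'\<close>, where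
      \<open>r i\<close> is the natural character.\<close>
    obtain x where x: "x \<in> {1..n}" "least_power t' x \<ge> 3"
    proof (rule ccontr)
      assume no: "\<not> thesis"
      note p = permutation_if_permutes[OF p']
      have "t' (t' x) = x" for x
      proof (cases "x \<in> {1..n}")
        case True
        then have "\<not> least_power t' x \<ge> 3" using no that by blast
        then have "least_power t' x = 1 \<or> least_power t' x = 2" using least_power_pos[OF p, of x] by linarith
        then have "least_power t' x dvd 2" by auto
        then have "(t' ^^ 2) x = x" unfolding least_power_dvd[OF p] .
        then show ?thesis by (simp add: numeral_2_eq_2)
      qed (simp add: permutes_not_in[OF p'])
      then have sq: "t' \<circ> t' = id" by auto
      obtain i where i: "i \<in> I" "r i = natural_char n" using natural_index[OF n(1)] by blast
      have chi: "r' i \<in> irr_chars ?G" using i(1) bij_betwE[OF r'] by blast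
      obtain d \<rho> where rho: "representation ?G d \<rho>" and tr: "\<And>g. g \<in> carrier ?G \<Longrightarrow> r' i g = trace_mat (\<rho> g)"
        by (rule irr_charE[OF chi]) (rule that)
      have v1: "r' i id = of_nat n - 1"
        using degree_eq[OF i(1)] id_carrier unfolding i(2) alt_group_one by (simp add: natural_char_eq)
      have vt: "r' i t' = of_nat (n - 3) - 1"
        using rel_value[OF rel i(1)] tc fixes_count_three_cycle(1)[OF t] unfolding i(2) by (simp add: natural_char_eq)
      have ne: "t' \<noteq> id" using \<open>?m \<noteq> 0\<close> by auto
      have inv: "inv\<^bsub>?G\<^esub> t' = t'" by (rule inv_equality) (use sq t'c in \<open>auto simp: alt_group_one\<close>)
      have K: "subgroup {id, t'} ?G"
      proof (rule subgroupI)
        show "{id, t'} \<subseteq> carrier ?G" using id_carrier t'c by simp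
        fix u assume u: "u \<in> {id, t'}"
        then show "inv\<^bsub>?G\<^esub> u \<in> {id, t'}" using inv inv_one by (auto simp: alt_group_one)
        fix w assume "w \<in> {id, t'}"
        then show "u \<otimes>\<^bsub>?G\<^esub> w \<in> {id, t'}" using u sq by auto
      qed simp
      have "(\<Sum>h\<in>{id, t'}. trace_mat (\<rho> h) * cnj 1) / of_nat (card {id, t'}) \<in> \<nat>"
        by (rule subgroup_multiplicity[OF K rho]) simp_all
      moreover have "(\<Sum>h\<in>{id, t'}. trace_mat (\<rho> h) * cnj 1) = r' i id + r' i t'"
        using ne tr id_carrier t'c by simp
      moreover have "card {id, t'} = 2" using ne by simp
      ultimately have "(of_nat n - 1 + (of_nat (n - 3) - 1)) / (2 :: complex) \<in> \<nat>"
        unfolding v1 vt by simp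
      then obtain q where "(of_nat n - 1 + (of_nat (n - 3) - 1)) / (2 :: complex) = of_nat q" by (auto elim: Nats_cases)
      then have "of_nat (n + (n - 3)) = (of_nat (2 * q + 2) :: complex)" by (simp add: field_simps)
      then have "n + (n - 3) = 2 * q + 2" by (simp only: of_nat_eq_iff)
      then show False using n by presburger
    qed
    let ?C = "centralizing_perms {1..n} t'"
    have C: "card ?C \<le> fact (n - ?m) * (?m * double_fact (?m - 3))"
    proof -
      have f: "n - ?m = ?f" using mf by simp
      show ?thesis unfolding f fixes_count_def by (rule card_centralizing_perms_bound_3[OF _ p' x]) simp
    qed
    have sub: "conj_class t \<subseteq> {t. three_cycle n t}"
    proof
      fix y assume "y \<in> conj_class t"
      then obtain h where h: "h \<in> carrier ?G" "y = h \<otimes>\<^bsub>?G\<^esub> t \<otimes>\<^bsub>?G\<^esub> inv\<^bsub>?G\<^esub> h" unfolding conj_class_def by blast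
      have "three_cycle n (h \<circ> t \<circ> inv' h)" using h(1) by (intro three_cycle_conj[OF t]) (simp add: alt_group_carrier)
      then show "y \<in> {t. three_cycle n t}" using h by (simp add: alt_group_inv_equality)
    qed
    have "finite {t. three_cycle n t}"
      by (rule finite_subset[OF _ finite_carrier]) (use three_cycle_carrier in blast)
    then have "card (conj_class t') \<le> card {t. three_cycle n t}"
      using rel_card_class[OF rel] card_mono[OF _ sub] by simp
    then have le: "3 * card (conj_class t') \<le> n * (n - 1) * (n - 2)" using card_three_cycles[of n] by linarith
    \<comment> \<open>Orbit counting for \<open>t'\<close> in A_n, of order
      \<open>fact n / 2\<close>, meets the bound on the number of 3-cycles, which also bounds the
      class of \<open>t'\<close> because related classes have equal size.\<close>
    have "fact n = 2 * card (carrier ?G)" using alt_group_card_carrier[of n] n by simp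
    moreover have "card (carrier ?G) \<le> card (conj_class t') * card ?C" by (rule card_alt_le[OF t'c])
    ultimately have "3 * fact n \<le> 2 * (3 * card (conj_class t') * card ?C)" by simp
    also have "\<dots> \<le> 2 * (n * (n - 1) * (n - 2) * (fact (n - ?m) * (?m * double_fact (?m - 3))))"
      by (rule mult_le_mono2[OF mult_le_mono[OF le C]])
    also have "\<dots> = n * (n - 1) * (n - 2) * (2 * (fact (n - ?m) * (?m * double_fact (?m - 3))))"
      by (simp only: mult.left_commute)
    also have "\<dots> < n * (n - 1) * (n - 2) * (3 * fact (n - 3))"
      using centralizer_order_bound[OF _ n7 m] mf n7 by (intro mult_less_mono2) auto
    also have "\<dots> = 3 * fact n"
    proof -
      obtain k where "n = 3 + k" using n7 le_Suc_ex[of 3 n] by auto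
      then have "n = Suc (Suc (Suc k))" by simp
      then show ?thesis by (simp add: algebra_simps)
    qed
    finally show False by simp
  qed
  ultimately have "?m = 3" using dvd by presburger
  then show ?thesis by (rule three_cycle_if_moved_3[OF p'])
qed

lemma rel_three_cycle:
  assumes n: "n \<ge> 4" "n \<noteq> 6" and rel: "rel g h"
  shows "three_cycle n g \<longleftrightarrow> three_cycle n h"
  using rel_three_cycle_imp[OF n rel] alt_table.rel_three_cycle_imp[OF alt_swap n, of h g] rel rel_swap by blast

text \<open>\<open>natural_char_unique\<close> identifies the partner of the natural character; its
  value at every 3-cycle is known because each 3-cycle is related to a 3-cycle.\<close>

lemma rel_fixes_count:
  assumes n: "n \<ge> 4" "n \<noteq> 6" and rel: "rel g h"
  shows "fixes_count n g = fixes_count n h"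
proof -
  obtain i where i: "i \<in> I" "r i = natural_char n" using natural_index[OF n(1)] by blast
  have "r' i = natural_char n"
  proof (rule natural_char_unique[OF n(1)])
    show "r' i \<in> irr_chars (alt_group n)" using i(1) bij_betwE[OF r'] by blast
    show "r' i id = of_nat (n - 1)"
      using degree_eq[OF i(1)] id_carrier n unfolding i(2) alt_group_one by (simp add: natural_char_eq of_nat_diff)
    fix t assume t: "three_cycle n t"
    obtain s where "table_symmetry.rel J c' c t s" by (rule table_symmetry.rel_total[OF swap three_cycle_carrier[OF t]])
    then have s: "rel s t" using rel_swap by blast
    then have "three_cycle n s" using rel_three_cycle[OF n s] t by blast
    then have "natural_char n s = of_nat (n - 1) - 3"
      using fixes_count_three_cycle[of n s] three_cycle_carrier[of n s] n by (simp add: natural_char_eq of_nat_diff)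
    then show "r' i t = of_nat (n - 1) - 3" using rel_value[OF s i(1)] unfolding i(2) by simp
  qed
  then have "natural_char n g = natural_char n h" using rel_value[OF rel i(1)] unfolding i(2) by simp
  then show ?thesis using rel_carrier[OF rel] by (simp add: natural_char_eq)
qed

theorem rel_imp_cycle_type:
  assumes n: "n \<noteq> 6" and rel: "rel g h"
  shows "cycle_type n g = cycle_type n h"
proof (cases "n \<ge> 4")
  case True
  then show ?thesis
    by (intro rel_cycle_type[OF _ _ rel] rel_three_cycle rel_fixes_count n)
next
  case False
  \<comment> \<open>For \<open>n < 4\<close> every element of A_n other than the identity is a
    3-cycle, so it suffices that the identity corresponds to itself.\<close>
  have moved: "card {x \<in> {1..n}. u x \<noteq> x} = 3" if u: "u \<in> carrier (alt_group n)" "u \<noteq> id" for u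
  proof -
    have p: "u permutes {1..n}" and e: "evenperm u" using u by (auto simp: alt_group_carrier)
    let ?M = "{x \<in> {1..n}. u x \<noteq> x}"
    have le: "card ?M \<le> 3" using card_mono[OF _ Collect_restrict[of "{1..n}" "\<lambda>x. u x \<noteq> x"]] False by simp
    have "card ?M \<noteq> 0"
    proof
      assume "card ?M = 0"
      then have "{x \<in> {1..n}. u x \<noteq> x} = {}" by simp
      then have "u x = x" for x using permutes_not_in[OF p, of x] by blast
      then show False using u(2) by auto
    qed
    moreover have "card ?M \<noteq> 1"
    proof
      assume "card ?M = 1"
      then obtain a where a: "?M = {a}" by (rule card_1_singletonE)
      then have "a \<in> ?M" by simp
      then have "u a \<in> ?M" using permutes_in_image[OF p, of a] permutes_inj[OF p] by (simp add: inj_eq)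
      then show False using a \<open>a \<in> ?M\<close> by auto
    qed
    moreover have "card ?M \<noteq> 2"
    proof
      assume "card ?M = 2"
      then obtain a b where ab: "?M = {a, b}" "a \<noteq> b" unfolding card_2_iff by metis
      have to: "u x \<in> {a, b}" "u x \<noteq> x" if "x \<in> {a, b}" for x
      proof -
        have x: "x \<in> ?M" using that ab by simp
        then show "u x \<noteq> x" by simp
        have "u x \<in> ?M" using x permutes_in_image[OF p, of x] permutes_inj[OF p] by (simp add: inj_eq)
        then show "u x \<in> {a, b}" unfolding ab(1) .
      qed
      have "u x = transpose a b x" for x
      proof (cases "x \<in> {a, b}")
        case True
        then show ?thesis using to[of a] to[of b] by auto
      next
        case False
        then have "x \<notin> ?M" unfolding ab(1) .
        then have "u x = x" using permutes_not_in[OF p, of x] by blast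
        then show ?thesis using False by (simp add: transpose_apply_other)
      qed
      then have "u = transpose a b" by (rule ext)
      then show False using e ab(2) by (simp add: evenperm_swap)
    qed
    ultimately show ?thesis using le by linarith
  qed
  have tc: "three_cycle n u \<longleftrightarrow> u \<noteq> id" if u: "u \<in> carrier (alt_group n)" for u
  proof
    assume "three_cycle n u"
    then show "u \<noteq> id" using fixes_count_three_cycle[of n u] by auto
  next
    assume "u \<noteq> id"
    then show "three_cycle n u" using three_cycle_if_moved_3 moved u by (auto simp: alt_group_carrier)
  qed
  show ?thesis
  proof (rule rel_cycle_type[OF _ _ rel])
    fix x y assume xy: "rel x y"
    then have c: "x \<in> carrier (alt_group n)" "y \<in> carrier (alt_group n)" using rel_carrier by auto
    show "three_cycle n x \<longleftrightarrow> three_cycle n y" unfolding tc[OF c(1)] tc[OF c(2)] rel_id_iff[OF xy] ..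
    show "fixes_count n x = fixes_count n y"
    proof (cases "y = id")
      case True
      then show ?thesis using rel_id_iff[OF xy] by simp
    next
      case False
      then show ?thesis
        using rel_id_iff[OF xy] tc[OF c(1)] tc[OF c(2)] fixes_count_three_cycle(1)[of n x] fixes_count_three_cycle(1)[of n y] by simp
    qed
  qed
qed

end

section \<open>Uniqueness of the labels\<close>

lemma sym_char_alt_cycle_type:
  assumes p: "p \<in> partitions_of n" and g: "g \<in> carrier (alt_group n)" and h: "h \<in> carrier (alt_group n)"
    and ct: "cycle_type n g = cycle_type n h"
  shows "sym_char_alt n p g = sym_char_alt n p h"
proof -
  have "h \<in> S.conj_class n g" using conj_class_sym_iff alt_in_sym[OF g] alt_in_sym[OF h] ct by simp
  then have "sym_char n p h = sym_char n p g"
    by (rule S.irr_char_class[OF sym_char_irr[OF p] alt_in_sym[OF g]])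
  then show ?thesis using sym_char_alt_eq g h by simp
qed

context alt_labels
begin

lemma class_label_eq_or_pair:
  assumes L: "L \<in> class_labels n" and L': "L' \<in> class_labels n" and t: "label_type L = label_type L'"
  shows "L = L' \<or> (\<exists>v\<in>partitions_of n. odd_distinct v \<and> {L, L'} = {Split_Class v Plus, Split_Class v Minus})"
proof (cases L)
  case (Nonsplit_Class v)
  then have "\<not> odd_distinct v" using L by (auto simp: class_labels_def)
  then have "L' = Nonsplit_Class v"
    using L' t Nonsplit_Class by (auto simp: class_labels_def label_type_def)
  then show ?thesis using Nonsplit_Class by simp
next
  case (Split_Class v s)
  then have v: "v \<in> partitions_of n" "odd_distinct v" using L by (auto simp: class_labels_def)
  then obtain s' where s': "L' = Split_Class v s'"
    using L' t Split_Class by (auto simp: class_labels_def label_type_def)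
  show ?thesis
  proof (cases "s = s'")
    case False
    then have "{L, L'} = {Split_Class v Plus, Split_Class v Minus}"
      using Split_Class s' by (cases s; cases s') auto
    then show ?thesis using v by blast
  qed (use Split_Class s' in simp)
qed

lemma labelling_unique:
  assumes n6: "n \<noteq> 6" and L: "labelling n sc cc X \<alpha> \<beta>" and L': "labelling n sc cc X \<alpha>' \<beta>'"
  shows "\<And>i. i < dim_row X \<Longrightarrow> \<alpha> i = \<alpha>' i \<or>
      (\<exists>p\<in>partitions_of n. conj_partition p = p \<and> {\<alpha> i, \<alpha>' i} = {Split_Char p Plus, Split_Char p Minus})"
    and "\<And>j. j < dim_col X \<Longrightarrow> \<beta> j = \<beta>' j \<or>
      (\<exists>v\<in>partitions_of n. odd_distinct v \<and> {\<beta> j, \<beta>' j} = {Split_Class v Plus, Split_Class v Minus})"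
proof -
  let ?I = "{..<dim_row X}" and ?J = "{..<dim_col X}" and ?G = "alt_group n"
  define r where "r = label_char \<circ> \<alpha>"
  define r' where "r' = label_char \<circ> \<alpha>'"
  define c where "c = class_labelled n cc \<circ> \<beta>"
  define c' where "c' = class_labelled n cc \<circ> \<beta>'"
  have a: "bij_betw \<alpha> ?I (char_labels n)" "bij_betw \<alpha>' ?I (char_labels n)"
    and b: "bij_betw \<beta> ?J (class_labels n)" "bij_betw \<beta>' ?J (class_labels n)"
    using L L' by (auto simp: labelling_def)
  have aI: "\<alpha> i \<in> char_labels n" "\<alpha>' i \<in> char_labels n" if "i \<in> ?I" for i
    using that bij_betwE[OF a(1)] bij_betwE[OF a(2)] by auto
  have bJ: "\<beta> j \<in> class_labels n" "\<beta>' j \<in> class_labels n" if "j \<in> ?J" for j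
    using that bij_betwE[OF b(1)] bij_betwE[OF b(2)] by auto
  have X: "X $$ (i, j) = r i g" "X $$ (i, j) = r' i h" if "i \<in> ?I" "j \<in> ?J" "g \<in> c j" "h \<in> c' j" for i j g h
  proof -
    have "r i \<in> chars_labelled n sc (\<alpha> i)" "r' i \<in> chars_labelled n sc (\<alpha>' i)"
      using chars_labelled_eq aI[OF that(1)] by (simp_all add: r_def r'_def)
    then show "X $$ (i, j) = r i g" "X $$ (i, j) = r' i h"
      using L L' that unfolding labelling_def c_def c'_def o_apply lessThan_iff by blast+
  qed
  interpret T: alt_table n ?I ?J r r' c c'
  proof
    show "bij_betw r ?I (irr_chars ?G)" "bij_betw r' ?I (irr_chars ?G)"
      unfolding r_def r'_def using bij_betw_trans[OF _ label_char_bij] a by blast+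
    show "bij_betw c ?J (conj_classes ?G)" "bij_betw c' ?J (conj_classes ?G)"
      unfolding c_def c'_def using bij_betw_trans[OF _ class_labelled_bij] b by blast+
    fix i j g h assume "i \<in> ?I" "j \<in> ?J" "g \<in> c j" "h \<in> c' j"
    from X[OF this] show "r i g = r' i h" by simp
  qed
  have inv: "sym_char_alt n p g = sym_char_alt n p h" if "p \<in> partitions_of n" "T.rel g h" for p g h
    using sym_char_alt_cycle_type[OF that(1)] T.rel_carrier[OF that(2)] T.rel_imp_cycle_type[OF n6 that(2)] by blast
  have rel_to: "\<exists>g. T.rel g h" if h: "h \<in> carrier ?G" for h
  proof -
    obtain g where "table_symmetry.rel ?J c' c h g" by (rule table_symmetry.rel_total[OF T.swap h])
    then show ?thesis using T.rel_swap by blast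
  qed
  have inj: "\<alpha>' i = M" if "i \<in> ?I" "M \<in> char_labels n" "r' i = label_char M" for i M
    using bij_betw_imp_inj_on[OF label_char_bij] aI(2)[OF that(1)] that(2,3)
    by (simp add: r'_def inj_on_eq_iff)
  show "\<alpha> i = \<alpha>' i \<or>
      (\<exists>p\<in>partitions_of n. conj_partition p = p \<and> {\<alpha> i, \<alpha>' i} = {Split_Char p Plus, Split_Char p Minus})"
    if "i < dim_row X" for i
  proof -
    have i: "i \<in> ?I" using that by simp
    have irr: "r i \<in> irr_chars ?G" "r' i \<in> irr_chars ?G" using bij_betwE[OF T.r] bij_betwE[OF T.r'] i by blast+
    consider p where "p \<in> partitions_of n" "conj_partition p \<noteq> p" "\<alpha> i = Nonsplit_Char {p, conj_partition p}"
      | p s where "p \<in> partitions_of n" "conj_partition p = p" "\<alpha> i = Split_Char p s"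
      using aI(1)[OF i] unfolding char_labels_def by blast
    then show ?thesis
    proof cases
      case (1 p)
      \<comment> \<open>A restriction from S_n depends only on the cycle type, so both readings give
        row \<open>i\<close> the same character.\<close>
      have rp: "r i = sym_char_alt n p" using label_char_nonsplit[OF 1(1)] by (simp add: r_def 1(3))
      have "r' i = r i"
      proof (rule A.irr_char_eqI[OF irr(2,1)])
        fix h assume h: "h \<in> carrier ?G"
        obtain g where g: "T.rel g h" using rel_to[OF h] by blast
        then show "r' i h = r i h" using T.rel_value[OF g i] inv[OF 1(1) g] by (simp add: rp)
      qed
      then show ?thesis using inj[OF i aI(1)[OF i]] by (simp add: r_def)
    next
      case (2 p s)
      \<comment> \<open>The opposite sign, carried by row \<open>k\<close> under
        \<open>\<alpha>\<close>. A single half may change within a cycle type, but the sum of both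
        halves is a restriction from S_n and cannot.\<close>
      define s' where "s' = (case s of Plus \<Rightarrow> Minus | Minus \<Rightarrow> Plus)"
      have lab: "Split_Char p u \<in> char_labels n" for u using 2(1,2) by (auto simp: char_labels_def)
      then obtain k where k: "k \<in> ?I" "\<alpha> k = Split_Char p s'"
        using bij_betw_imp_surj_on[OF a(1)] by (metis imageE)
      have ss: "s' \<noteq> s" by (cases s) (simp_all add: s'_def)
      have ki: "k \<noteq> i" using k(2) 2(3) ss by auto
      have "r' k \<noteq> r' i" using bij_betw_imp_inj_on[OF T.r'] k(1) i ki by (simp add: inj_on_eq_iff)
      moreover have "r' k \<in> irr_chars ?G" using bij_betwE[OF T.r'] k(1) by blast
      \<comment> \<open>The sum of the distinct characters \<open>r' i\<close> and
        \<open>r' k\<close> has inner product 1 with \<open>r' i\<close>; as this sum is the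
        restriction for \<open>p\<close>, row \<open>i\<close> carries one of its two halves in the
        second reading too.\<close>
      ultimately have "char_inner ?G (\<lambda>h. r' i h + r' k h) (r' i) = 1"
        unfolding A.char_inner_add by (simp add: A.irr_chars_orthonormal irr(2))
      moreover have "char_inner ?G (\<lambda>h. r' i h + r' k h) (r' i) = char_inner ?G (sym_char_alt n p) (r' i)"
      proof (rule A.char_inner_cong[OF _ refl])
        fix h assume h: "h \<in> carrier ?G"
        obtain g where g: "T.rel g h" using rel_to[OF h] by blast
        have gc: "g \<in> carrier ?G" using T.rel_carrier[OF g] by blast
        have "r' i h + r' k h = r i g + r k g" using T.rel_value[OF g] i k(1) by simp
        also have "\<dots> = sc p Plus g + sc p Minus g"
          by (cases s) (simp_all add: r_def 2(3) k(2) label_char_split s'_def)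
        also have "\<dots> = sym_char_alt n p g" using split_char(3)[OF 2(1,2) gc] by simp
        finally show "r' i h + r' k h = sym_char_alt n p h" using inv[OF 2(1) g] by simp
      qed
      ultimately have "char_inner ?G (r' i) (sym_char_alt n p) = 1"
        by (subst A.char_inner_commute) simp
      then have "r' i = sc p Plus \<or> r' i = sc p Minus"
        unfolding char_inner_self_conj[OF 2(1,2) irr(2)] by (auto split: if_splits)
      then obtain u where "r' i = label_char (Split_Char p u)" unfolding label_char_split by blast
      then have u: "\<alpha>' i = Split_Char p u" by (rule inj[OF i lab])
      show ?thesis
      proof (cases "u = s")
        case False
        then have "{\<alpha> i, \<alpha>' i} = {Split_Char p Plus, Split_Char p Minus}"
          using 2(3) u by (cases s; cases u) auto
        then show ?thesis using 2(1,2) by blast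
      qed (use 2(3) u in simp)
    qed
  qed
  show "\<beta> j = \<beta>' j \<or>
      (\<exists>v\<in>partitions_of n. odd_distinct v \<and> {\<beta> j, \<beta>' j} = {Split_Class v Plus, Split_Class v Minus})"
    if "j < dim_col X" for j
  proof (rule class_label_eq_or_pair)
    have j: "j \<in> ?J" using that by simp
    show "\<beta> j \<in> class_labels n" "\<beta>' j \<in> class_labels n" using bJ[OF j] by auto
    have ne: "K \<noteq> {}" if "K \<in> conj_classes ?G" for K
      using that A.conj_class_self unfolding A.conj_classes_eq by blast
    have "c j \<noteq> {}" "c' j \<noteq> {}"
      using bij_betwE[OF T.c] bij_betwE[OF T.c'] j by (auto intro!: ne simp del: lessThan_iff)
    then obtain g h where gh: "g \<in> c j" "h \<in> c' j" by blast
    then have "T.rel g h" unfolding T.rel_def using j by blast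
    then have "cycle_type n g = cycle_type n h" by (rule T.rel_imp_cycle_type[OF n6])
    moreover have "cycle_type n g = label_type (\<beta> j)" "cycle_type n h = label_type (\<beta>' j)"
      using class_labelled_type(2)[OF bJ(1)[OF j]] class_labelled_type(2)[OF bJ(2)[OF j]] gh
      by (auto simp: c_def c'_def even_perms_of_type_def)
    ultimately show "label_type (\<beta> j) = label_type (\<beta>' j)" by simp
  qed
qed

end

theorem theorem3p1:
  fixes n :: nat and X :: "complex mat"
    and sc :: "nat multiset \<Rightarrow> pm \<Rightarrow> (nat \<Rightarrow> nat) \<Rightarrow> complex"
    and cc :: "nat multiset \<Rightarrow> pm \<Rightarrow> (nat \<Rightarrow> nat) set"
  assumes "n \<ge> 2" and "n \<noteq> 6"
    and "character_table (alt_group n) X"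
    and "split_char_choice n sc"
    and "split_class_choice n cc"
  shows "(\<exists>\<alpha> \<beta>. labelling n sc cc X \<alpha> \<beta>) \<and>
    (\<forall>\<alpha> \<beta> \<alpha>' \<beta>'. labelling n sc cc X \<alpha> \<beta> \<longrightarrow> labelling n sc cc X \<alpha>' \<beta>' \<longrightarrow>
       (\<forall>i<dim_row X. \<alpha> i = \<alpha>' i \<or>
          (\<exists>p\<in>partitions_of n. conj_partition p = p \<and>
             {\<alpha> i, \<alpha>' i} = {Split_Char p Plus, Split_Char p Minus})) \<and>
       (\<forall>j<dim_col X. \<beta> j = \<beta>' j \<or>
          (\<exists>v\<in>partitions_of n. odd_distinct v \<and>
             {\<beta> j, \<beta>' j} = {Split_Class v Plus, Split_Class v Minus})))"
proof -
  interpret alt_labels n sc cc using assms(1,4,5) by unfold_locales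
  show ?thesis
    by (intro conjI allI impI labelling_exists[OF assms(3)] labelling_unique[OF assms(2)])
qed

end
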